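(* For every $\varepsilon>0$, there is a randomized algorithm that, given a directed graph with $n$ nodes, $m$ edges and positive integer edge weights, runs in $\tilde{O}(mn^{\sqrt{2}-1}/\varepsilon)$ time and computes a $(4+\varepsilon)$-approximation of its girth with high probability.
   Context: The girth of a directed weighted graph is the minimum total edge weight of a directed cycle; cycles contain at least two distinct vertices (no self-loops). For $c\ge 1$, a $c$-approximation of the girth $g$ is a value $\hat g$ with $g\le \hat g\le c\cdot g$. The notation $\tilde O(\cdot)$ hides factors polylogarithmic in $n$. "With high probability" (whp) means with probability at least $1-1/n^{c}$ for a constant $c>0$ that can be chosen arbitrarily large. Arithmetic operations and comparisons on edge weights take unit time. *)

theory Defs
  imports "HOL-Probability.SPMF" "HOL-Library.Extended_Real" "Graph_Theory.Graph_Theory"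
begin

section \<open>Girth\<close>

text \<open>
  Weights are positive in all uses, so it makes no difference that \<^const>\<open>pre_digraph.cycle\<close> admits
  vertex-simple cycles only. The digraphs are loop-free, hence every cycle visits at least two
  distinct vertices. The girth of an acyclic digraph is \<open>\<infinity>\<close>; otherwise the infimum ranges over a
  finite nonempty set and is a minimum.
\<close>

definition girth :: "'a pair_pre_digraph \<Rightarrow> ('a \<times> 'a \<Rightarrow> nat) \<Rightarrow> ereal" where
  "girth G w =
    (INF p \<in> {p. pre_digraph.cycle (with_proj G) p}. ereal (wf_digraph.awalk_cost (\<lambda>a. real (w a)) p))"

definition approximates :: "real \<Rightarrow> ereal \<Rightarrow> ereal \<Rightarrow> bool" where
  "approximates c g g' \<longleftrightarrow> g \<le> g' \<and> g' \<le> ereal c * g"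

section \<open>Randomized word RAM\<close>

text \<open>
  Algorithms are programs of a small imperative language over an integer-addressed memory whose cells
  hold integers. Every executed operation takes unit time. As usual for a word RAM, words have bounded
  size, so that unit-cost arithmetic cannot be misused on huge numbers: a computation is aborted as soon
  as an operation yields a number of absolute value above the bound \<open>B\<close>.
\<close>

datatype binop = Add | Sub | Mul | Div | Less

datatype expr = Lit int | Cell expr | Op binop expr expr

datatype com =
    Skip
  | Store expr expr
  | Rand expr expr
  | Seq com com
  | If expr com com
  | While expr com

type_synonym memory = "int \<Rightarrow> int"

fun apply_op :: "binop \<Rightarrow> int \<Rightarrow> int \<Rightarrow> int" where
  "apply_op Add x y = x + y"
| "apply_op Sub x y = x - y"
| "apply_op Mul x y = x * y"
| "apply_op Div x y = x div y"
| "apply_op Less x y = (if x < y then 1 else 0)"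

definition word :: "real \<Rightarrow> int \<Rightarrow> int option" where
  "word B x = (if \<bar>real_of_int x\<bar> \<le> B then Some x else None)"

primrec eval_expr :: "real \<Rightarrow> memory \<Rightarrow> expr \<Rightarrow> int option" where
  "eval_expr B s (Lit k) = word B k"
| "eval_expr B s (Cell e) = Option.bind (eval_expr B s e) (\<lambda>i. word B (s i))"
| "eval_expr B s (Op f e1 e2) =
     Option.bind (eval_expr B s e1) (\<lambda>x. Option.bind (eval_expr B s e2) (\<lambda>y. word B (apply_op f x y)))"

primrec expr_cost :: "expr \<Rightarrow> nat" where
  "expr_cost (Lit k) = 1"
| "expr_cost (Cell e) = expr_cost e + 1"
| "expr_cost (Op f e1 e2) = expr_cost e1 + expr_cost e2 + 1"

partial_function (spmf) loop_spmf ::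
    "('s \<Rightarrow> (bool \<times> 's) spmf) \<Rightarrow> ('s \<Rightarrow> 's spmf) \<Rightarrow> 's \<Rightarrow> 's spmf" where
  "loop_spmf test body s =
     bind_spmf (test s) (\<lambda>(b, s'). if b then bind_spmf (body s') (loop_spmf test body) else return_spmf s')"

text \<open>
  A configuration consists of the memory and the time used so far. The mass missing from the
  sub-probability distribution of final configurations is the probability of divergence or abortion.
  An option value \<open>x\<close> is lifted to the (possibly aborting) computation \<^term>\<open>return_pmf x\<close>.
  \<open>Rand a e\<close> stores a uniformly random element of \<open>{0..<v}\<close>, where \<open>v\<close> is the value of \<open>e\<close>; it aborts
  if this range is empty. In tests, nonzero means true.
\<close>

primrec run :: "real \<Rightarrow> com \<Rightarrow> memory \<times> nat \<Rightarrow> (memory \<times> nat) spmf" where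
  "run B Skip = (\<lambda>(s, t). return_spmf (s, t + 1))"
| "run B (Store a e) = (\<lambda>(s, t).
     bind_spmf (return_pmf (eval_expr B s a)) (\<lambda>i.
     bind_spmf (return_pmf (eval_expr B s e)) (\<lambda>v.
     return_spmf (s(i := v), t + expr_cost a + expr_cost e + 1))))"
| "run B (Rand a e) = (\<lambda>(s, t).
     bind_spmf (return_pmf (eval_expr B s a)) (\<lambda>i.
     bind_spmf (return_pmf (eval_expr B s e)) (\<lambda>v.
     bind_spmf (spmf_of_set {0..<v}) (\<lambda>r.
     return_spmf (s(i := r), t + expr_cost a + expr_cost e + 1)))))"
| "run B (Seq c1 c2) = (\<lambda>st. bind_spmf (run B c1 st) (run B c2))"
| "run B (If e c1 c2) = (\<lambda>(s, t).
     bind_spmf (return_pmf (eval_expr B s e)) (\<lambda>v.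
     (if v \<noteq> 0 then run B c1 else run B c2) (s, t + expr_cost e + 1)))"
| "run B (While e c) =
     loop_spmf
       (\<lambda>(s, t). bind_spmf (return_pmf (eval_expr B s e)) (\<lambda>v. return_spmf (v \<noteq> 0, (s, t + expr_cost e + 1))))
       (run B c)"

section \<open>Input and output conventions\<close>

text \<open>
  The vertices are \<open>0, \<dots>, n - 1\<close>, and \<open>es\<close> lists the edges in arbitrary order. Initially the memory holds
  \<open>n\<close>, the number \<open>m\<close> of edges, and then tail, head and weight of each edge; all other cells are \<open>0\<close>.
  The result is read off cell \<open>0\<close>, a negative number standing for \<open>\<infinity>\<close>. As the girth is an integer or
  \<open>\<infinity>\<close>, integer outputs are no restriction: rounding down preserves being a \<open>c\<close>-approximation.
\<close>

definition weighted_digraph_input ::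
    "nat \<Rightarrow> nat pair_pre_digraph \<Rightarrow> (nat \<times> nat \<Rightarrow> nat) \<Rightarrow> (nat \<times> nat) list \<Rightarrow> bool" where
  "weighted_digraph_input n G w es \<longleftrightarrow>
     n \<ge> 1 \<and> pair_digraph G \<and> pverts G = {0..<n} \<and> (\<forall>a \<in> parcs G. w a > 0) \<and>
     distinct es \<and> set es = parcs G"

definition input_words :: "nat \<Rightarrow> (nat \<times> nat \<Rightarrow> nat) \<Rightarrow> (nat \<times> nat) list \<Rightarrow> nat list" where
  "input_words n w es = n # length es # concat (map (\<lambda>(u, v). [u, v, w (u, v)]) es)"

definition initial_memory :: "nat list \<Rightarrow> memory" where
  "initial_memory xs i = (if 0 \<le> i \<and> i < int (length xs) then int (xs ! nat i) else 0)"

definition result_of :: "memory \<Rightarrow> ereal" where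
  "result_of s = (if s 0 < 0 then \<infinity> else ereal (real_of_int (s 0)))"

text \<open>The value \<open>1\<close> is inserted only to cover the edgeless digraph.\<close>

definition max_weight :: "nat pair_pre_digraph \<Rightarrow> (nat \<times> nat \<Rightarrow> nat) \<Rightarrow> nat" where
  "max_weight G w = Max (insert 1 (w ` parcs G))"

text \<open>
  On the given input, \<open>P\<close> always terminates within time \<open>T\<close> (for all random choices), and with
  probability at least \<open>q\<close> it outputs a \<open>c\<close>-approximation of the girth.
\<close>

definition approximates_girth_within ::
    "real \<Rightarrow> com \<Rightarrow> nat \<Rightarrow> nat pair_pre_digraph \<Rightarrow> (nat \<times> nat \<Rightarrow> nat) \<Rightarrow> (nat \<times> nat) list
     \<Rightarrow> real \<Rightarrow> real \<Rightarrow> real \<Rightarrow> bool" where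
  "approximates_girth_within B P n G w es c T q \<longleftrightarrow>
    (let R = run B P (initial_memory (input_words n w es), 0) in
      lossless_spmf R \<and>
      (\<forall>(s, t) \<in> set_spmf R. real t \<le> T) \<and>
      measure (measure_spmf R) {(s, t). approximates c (girth G w) (result_of s)} \<ge> q)"

end

theory Submission
 imports Defs "HOL-Library.Discrete_Functions"
begin

text \<open>
 The algorithm runs three stages of truncated Dijkstra searches in alternating directions, from the
 ends of about \<open>k\<close> random edges, of about \<open>k * k\<close> random edges and of all edges, where \<open>k ^ 3\<close> is about
 \<open>min n m\<close>. A search may relax about \<open>m\<close>, \<open>m / k\<close> and \<open>m / k ^ 2\<close> edges, respectively, so every stage costs
 about \<open>m * k\<close>, which is below \<open>m * n powr (sqrt 2 - 1)\<close>.

 Let \<open>c(s)\<close> be the length of the shortest cycle found through an earlier root \<open>s\<close>. A later search that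
 concerns \<open>r\<close> visits a vertex \<open>x\<close> only if \<open>2 (d(s,x) + d(x,r)) < 2 d(s,r) + c(s)\<close> for all \<open>s\<close> on a short list
 kept for \<open>r\<close>. If \<open>x\<close> and \<open>r\<close> lie on a closed walk of length \<open>g\<close>, then \<open>d(s,x) + d(x,r) \<le> d(s,r) + g\<close>, so no
 vertex of a cycle is lost as long as \<open>4 g\<close> is below the current estimate. On the other hand, if two vertices
 both pass the test of the other one, then they lie on a closed walk that is too short. So "\<open>s\<close> excludes
 \<open>x\<close>" is a total relation, a random survivor excludes half of the survivors in expectation, and after
 logarithmically many additions to the list the survivors have so few edges that, with high
 probability, the truncation has no effect.
\<close>

section \<open>Random sampling with pruning\<close>

text \<open>The factor 4 comes from nested tests. Distances from a listed root are known only where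
  the search from it got, and in stage 2 that search was itself pruned. So a vertex \<open>x\<close>
  of a short cycle through \<open>r\<close> must pass the stage 2 test of a root \<open>z\<close> on
  the list of \<open>r\<close>. This is derived from the test that \<open>z\<close> passed when it
  was listed, plus one tour of the cycle. Listing grants only the slack \<open>gm\<close>, searching
  grants \<open>2 * cm\<close>, in inequalities scaled by 4; the difference pays for a tour of
  length \<open>t\<close> as long as \<open>4 * t\<close> is below the estimate. Directions
  alternate because drawing an edge by its end \<open>dst d e\<close> weighs a vertex by the number
  of edges that a search in direction \<open>1 - d\<close> relaxes there. Roots of earlier stages
  are never entered again: a short cycle through them is already known, and they would not count as
  survivors. The program does not depend on \<epsilon>. For good random choices its output is within
  the factor 4, and its time is governed by the cube root \<open>k\<close>, where 1/3 is below
  \<open>sqrt 2 - 1\<close>.\<close>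

definition onl :: "(int => bool) => (int => int => bool) => nat => int list => int list" where
 "onl A kl K xs = foldl (\<lambda>R x. if A x \<and> (\<forall>s\<in>set R. \<not> kl s x) \<and> length R < K then R @ [x] else R) [] xs"

lemma onl_Nil [simp]: "onl A kl K [] = []"
 by (simp add: onl_def)

lemma onl_snoc: "onl A kl K (xs @ [x]) =
  (let R = onl A kl K xs in if A x \<and> (\<forall>s\<in>set R. \<not> kl s x) \<and> length R < K then R @ [x] else R)"
 by (simp add: onl_def Let_def)

lemma onl_set: "set (onl A kl K xs) \<subseteq> set xs \<inter> Collect A"
 by (induction xs rule: rev_induct) (auto simp: onl_snoc Let_def)

text \<open>Probabilities are counted: \<open>LS m N\<close> carries the uniform distribution of
  \<open>N\<close> independent draws, and bounds on expectations become bounds on sums over it, to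
  be compared with \<open>m ^ N\<close>.\<close>

definition LS :: "int => nat => int list set" where
 "LS m N = {es. length es = N \<and> set es \<subseteq> {0..<m}}"

lemma LS_0 [simp]: "LS m 0 = {[]}"
 by (auto simp: LS_def)

lemma finite_LS: "finite (LS m N)"
 unfolding LS_def using finite_lists_length_eq[of "{0..<m}" N] by (simp add: conj_commute)

lemma card_LS: "0 \<le> m ==> real (card (LS m N)) = real_of_int m ^ N"
 unfolding LS_def using card_lists_length_eq[of "{0..<m}" N] by (simp add: conj_commute)

lemma LS_Suc: "LS m (Suc N) = (\<lambda>(es, e). es @ [e]) ` (LS m N \<times> {0..<m})"
proof
 show "LS m (Suc N) \<subseteq> (\<lambda>(es, e). es @ [e]) ` (LS m N \<times> {0..<m})"
 proof
  fix es assume es: "es \<in> LS m (Suc N)"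
  then obtain ys y where "es = ys @ [y]" by (cases es rule: rev_exhaust) (auto simp: LS_def)
  thus "es \<in> (\<lambda>(es, e). es @ [e]) ` (LS m N \<times> {0..<m})" using es by (force simp: LS_def)
 qed
qed (auto simp: LS_def)

lemma sum_LS_Suc: "(\<Sum>es\<in>LS m (Suc N). F es) = (\<Sum>es\<in>LS m N. \<Sum>e\<in>{0..<m}. F (es @ [e]))"
proof -
 have "inj_on (\<lambda>(es, e). es @ [e]) (LS m N \<times> {0..<m})" by (auto simp: inj_on_def)
 thus ?thesis unfolding LS_Suc by (subst sum.reindex) (auto simp: sum.cartesian_product split_def)
qed

text \<open>A draw \<open>e\<close> proposes the element \<open>f e\<close>, and
  \<open>kl x y\<close> means that \<open>x\<close> excludes \<open>y\<close>. The case
  \<open>x = y\<close> of \<open>total\<close> makes every admissible element exclude itself, so an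
  element that has been added no longer survives.\<close>

locale sampling =
 fixes m :: int and f :: "int => int" and A :: "int => bool" and kl :: "int => int => bool" and K :: nat
 assumes m1: "1 \<le> m" and total: "\<And>x y. A x ==> A y ==> kl x y \<or> kl y x" and K1: "1 \<le> K"
begin

text \<open>Survivors are draws rather than elements: an element counts once for each draw that
  proposes it. Later this makes the number of survivors a number of edges.\<close>

definition surv :: "int list => int set" where
 "surv R = {e. 0 \<le> e \<and> e < m \<and> A (f e) \<and> (\<forall>s\<in>set R. \<not> kl s (f e))}"

abbreviation R :: "int list => int list" where "R es \<equiv> onl A kl K (map f es)"

lemma finite_surv: "finite (surv L)"
 by (rule finite_subset[of _ "{0..<m}"]) (auto simp: surv_def)

lemma surv_le: "card (surv L) \<le> nat m"
proof -
 have "card (surv L) \<le> card {0..<m}" by (intro card_mono) (auto simp: surv_def)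
 thus ?thesis by simp
qed

lemma R_in: "e \<in> surv (R es) ==> length (R es) < K ==> R (es @ [e]) = R es @ [f e]"
 by (auto simp: onl_snoc Let_def surv_def)

lemma R_out: "e \<in> {0..<m} ==> e \<notin> surv (R es) \<or> \<not> length (R es) < K ==> R (es @ [e]) = R es"
 by (auto simp: onl_snoc Let_def surv_def)

lemma surv_mono: "card (surv (R (es @ [e]))) \<le> card (surv (R es))"
 by (intro card_mono finite_surv) (auto simp: onl_snoc Let_def surv_def)

text \<open>By totality the pairs of survivors in which the first fails to exclude the second form a
  relation \<open>S\<close> disjoint from its converse, so \<open>S\<close> contains at most half of
  all pairs. Averaged over the first component, a random survivor leaves at most half of the
  survivors.\<close>

lemma halving: "2 * (\<Sum>e\<in>surv L. card (surv (L @ [f e]))) \<le> card (surv L) * card (surv L)"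
proof -
 define U where "U = surv L"
 define S where "S = {(e, e'). e \<in> U \<and> e' \<in> U \<and> \<not> kl (f e) (f e')}"
 have fU: "finite U" by (simp add: U_def finite_surv)
 have SU: "S \<subseteq> U \<times> U" by (auto simp: S_def)
 have fS: "finite S" using SU fU finite_subset by blast
 have "S = Sigma U (\<lambda>e. surv (L @ [f e]))" by (auto simp: S_def U_def surv_def)
 hence cS: "(\<Sum>e\<in>U. card (surv (L @ [f e]))) = card S" using fU by (simp add: finite_surv)
 have cS': "card (S\<inverse>) = card S" by (simp add: card_inverse)
 have "kl (f e) (f e') \<or> kl (f e') (f e)" if "e \<in> U" "e' \<in> U" for e e'
  using that total by (auto simp: U_def surv_def)
 hence disj: "S \<inter> S\<inverse> = {}" by (auto simp: S_def)
 have "card S + card (S\<inverse>) = card (S \<union> S\<inverse>)" using disj fS by (simp add: card_Un_disjoint)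
 also have "\<dots> \<le> card (U \<times> U)" using SU fU by (intro card_mono) auto
 also have "\<dots> = card U * card U" by (simp add: card_cartesian_product)
 finally show ?thesis using cS cS' by (simp add: U_def)
qed

text \<open>The product of \<open>2 ^ length\<close> and the number of survivors is a
  supermartingale. A draw outside the survivors changes nothing. A draw inside doubles the first
  factor and, by \<open>halving\<close>, at least halves the second one on average. Initially the
  product is at most \<open>m\<close>.\<close>

lemma potential1: "(\<Sum>es\<in>LS m N. 2 ^ length (R es) * real (card (surv (R es)))) \<le> real_of_int m ^ (N + 1)"
proof (induction N)
 case 0
 have "real (card (surv [])) \<le> real_of_int m" using surv_le[of "[]"] m1 by linarith
 thus ?case by simp
next
 case (Suc N)
 have step: "(\<Sum>e\<in>{0..<m}. 2 ^ length (R (es @ [e])) * real (card (surv (R (es @ [e]))))) \<le>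
   real_of_int m * (2 ^ length (R es) * real (card (surv (R es))))" for es
 proof (cases "length (R es) < K")
  case False
  thus ?thesis using R_out[of _ es] m1 by simp
 next
  case True
  define U where "U = surv (R es)"
  have U: "U \<subseteq> {0..<m}" "finite U" by (auto simp: U_def surv_def finite_surv[unfolded surv_def])
  have cm: "card U \<le> nat m" unfolding U_def by (rule surv_le)
  define G where "G e = 2 ^ length (R (es @ [e])) * real (card (surv (R (es @ [e]))))" for e
  have e1: "sum G {0..<m} = sum G ({0..<m} - U) + sum G U" using U by (intro sum.subset_diff) auto
  have "sum G ({0..<m} - U) = (\<Sum>e\<in>{0..<m} - U. 2 ^ length (R es) * real (card U))"
   using R_out[of _ es] by (intro sum.cong) (auto simp: U_def G_def)
  hence e2: "sum G ({0..<m} - U) = real (card ({0..<m} - U)) * (2 ^ length (R es) * real (card U))" by simp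
  have e3: "real (card ({0..<m} - U)) = real_of_int m - real (card U)"
   using U cm m1 by (simp add: card_Diff_subset of_nat_diff)
  have "sum G U = (\<Sum>e\<in>U. 2 ^ length (R es) * (2 * real (card (surv (R es @ [f e])))))"
   using R_in[OF _ True] by (intro sum.cong) (auto simp: U_def G_def)
  also have "\<dots> = 2 ^ length (R es) * real (2 * (\<Sum>e\<in>U. card (surv (R es @ [f e]))))"
   by (simp add: sum_distrib_left)
  also have "\<dots> \<le> 2 ^ length (R es) * real (card U * card U)"
   using halving[of "R es"] unfolding U_def by (intro mult_left_mono of_nat_mono) simp_all
  finally have e4: "sum G U \<le> 2 ^ length (R es) * real (card U * card U)" .
  have "sum G {0..<m} \<le> (real_of_int m - real (card U)) * (2 ^ length (R es) * real (card U)) + 2 ^ length (R es) * real (card U * card U)"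
   using e1 e2 e3 e4 by simp
  \<comment> \<open>Both cases balance exactly: \<open>(m - u) * u + u * u = m * u\<close> for
    \<open>u = card U\<close>.\<close>
  also have "\<dots> = real_of_int m * (2 ^ length (R es) * real (card (surv (R es))))" by (simp add: U_def algebra_simps)
  finally show ?thesis by (simp add: G_def)
 qed
 have "(\<Sum>es\<in>LS m (Suc N). 2 ^ length (R es) * real (card (surv (R es)))) \<le>
   (\<Sum>es\<in>LS m N. real_of_int m * (2 ^ length (R es) * real (card (surv (R es)))))"
  unfolding sum_LS_Suc by (intro sum_mono step)
 also have "\<dots> \<le> real_of_int m * real_of_int m ^ (N + 1)"
  unfolding sum_distrib_left[symmetric] using Suc m1 by (intro mult_left_mono) auto
 finally show ?case by simp
qed

text \<open>A list gets its \<open>K\<close>-th entry only when a survivor is drawn while it has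
  \<open>K - 1\<close> entries. At that moment \<open>2 ^ length / 2 ^ (K - 1)\<close> equals 1, so
  the number of such draws is bounded by \<open>potential1\<close> divided by
  \<open>2 ^ (K - 1)\<close>. The factor \<open>N\<close> adds up the steps at which this can
  happen.\<close>

lemma long_count: "real (card {es \<in> LS m N. K \<le> length (R es)}) \<le> real N * real_of_int m ^ N / 2 ^ (K - 1)"
proof (induction N)
 case 0
 have "{es \<in> LS m 0. K \<le> length (R es)} = {}" using K1 by auto
 thus ?case by simp
next
 case (Suc N)
 let ?h = "\<lambda>es. if K \<le> length (R es) then 1 else 0 :: real"
 have cnt: "real (card {es \<in> LS m N. P es}) = (\<Sum>es\<in>LS m N. if P es then 1 else 0)" for N P
  by (simp add: finite_LS sum.If_cases Int_def conj_commute)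
 have step: "(\<Sum>e\<in>{0..<m}. ?h (es @ [e])) \<le>
   real_of_int m * ?h es + 2 ^ length (R es) * real (card (surv (R es))) / 2 ^ (K - 1)" for es
 proof (cases "K \<le> length (R es)")
  case True
  have "(\<Sum>e\<in>{0..<m}. ?h (es @ [e])) \<le> (\<Sum>e\<in>{0..<m}. 1)" by (intro sum_mono) auto
  also have "\<dots> = real_of_int m" using m1 by simp
  finally show ?thesis using True by (simp add: add_increasing2)
 next
  case False
  have "(\<Sum>e\<in>{0..<m}. ?h (es @ [e])) = (\<Sum>e\<in>surv (R es). ?h (es @ [e]))"
   by (rule sum.mono_neutral_right) (use R_out[of _ es] False in \<open>auto simp: surv_def\<close>)
  also have "\<dots> \<le> (\<Sum>e\<in>surv (R es). 2 ^ length (R es) / 2 ^ (K - 1))"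
  proof (rule sum_mono)
   fix e assume e: "e \<in> surv (R es)"
   have "length (R (es @ [e])) = Suc (length (R es))" using R_in[OF e] False by simp
   moreover have "(2 :: real) ^ length (R es) / 2 ^ (K - 1) = 1" if "K \<le> Suc (length (R es))"
   proof -
    have "length (R es) = K - 1" using that False by simp
    thus ?thesis by simp
   qed
   ultimately show "?h (es @ [e]) \<le> 2 ^ length (R es) / 2 ^ (K - 1)" by auto
  qed
  finally show ?thesis using False by (simp add: mult.commute)
 qed
 have "real (card {es \<in> LS m (Suc N). K \<le> length (R es)}) = (\<Sum>es\<in>LS m N. \<Sum>e\<in>{0..<m}. ?h (es @ [e]))"
  unfolding cnt sum_LS_Suc ..
 also have "\<dots> \<le> (\<Sum>es\<in>LS m N. real_of_int m * ?h es + 2 ^ length (R es) * real (card (surv (R es))) / 2 ^ (K - 1))"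
  by (intro sum_mono step)
 also have "\<dots> = real_of_int m * real (card {es \<in> LS m N. K \<le> length (R es)}) +
   (\<Sum>es\<in>LS m N. 2 ^ length (R es) * real (card (surv (R es)))) / 2 ^ (K - 1)"
  unfolding cnt by (simp add: sum.distrib sum_distrib_left sum_divide_distrib)
 also have "\<dots> \<le> real_of_int m * (real N * real_of_int m ^ N / 2 ^ (K - 1)) + real_of_int m ^ (N + 1) / 2 ^ (K - 1)"
  using Suc potential1[of N] m1 by (intro add_mono mult_left_mono divide_right_mono) auto
 finally show ?case by (simp add: field_simps)
qed

text \<open>Weigh an outcome by \<open>(1 / 2) ^ length\<close> as long as the list is not full and
  at least \<open>X\<close> draws survive. Each further draw hits a survivor with probability at
  least \<open>X / m\<close> and then halves the weight, so the mean weight shrinks by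
  \<open>1 - X / (2 * m)\<close>. The factor \<open>2 ^ K\<close> turns weights back into
  counts.\<close>

lemma large_count:
 assumes "0 \<le> X" "X \<le> 2 * real_of_int m"
 shows "real (card {es \<in> LS m N. length (R es) < K \<and> X \<le> real (card (surv (R es)))}) \<le> 2 ^ K * (real_of_int m - X / 2) ^ N"
proof -
 define F where "F es = (if length (R es) < K \<and> X \<le> real (card (surv (R es))) then (1 / 2) ^ length (R es) else 0 :: real)" for es
 have step: "(\<Sum>e\<in>{0..<m}. F (es @ [e])) \<le> (real_of_int m - X / 2) * F es" for es
 proof (cases "length (R es) < K \<and> X \<le> real (card (surv (R es)))")
  case False
  \<comment> \<open>The number of survivors and the free space in the list never grow, so an outcome
    that has lost its weight never regains it.\<close>
  have "F (es @ [e]) = 0" if "e \<in> {0..<m}" for e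
  proof (cases "length (R es) < K")
   case True
   thus ?thesis using False surv_mono[of es e] by (auto simp: F_def)
  next
   case F: False
   thus ?thesis using R_out[OF that, of es] by (simp add: F_def)
  qed
  hence "(\<Sum>e\<in>{0..<m}. F (es @ [e])) = 0" by (intro sum.neutral) blast
  moreover have "F es = 0" using False by (simp add: F_def)
  ultimately show ?thesis by simp
 next
  case True
  define U where "U = surv (R es)"
  have U: "U \<subseteq> {0..<m}" "finite U" by (auto simp: U_def surv_def finite_surv[unfolded surv_def])
  have cm: "card U \<le> nat m" unfolding U_def by (rule surv_le)
  have Fe: "F es = (1 / 2) ^ length (R es)" using True by (simp add: F_def)
  define G where "G e = F (es @ [e])" for e
  have e1: "sum G {0..<m} = sum G ({0..<m} - U) + sum G U" using U by (intro sum.subset_diff) auto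
  have "sum G ({0..<m} - U) = (\<Sum>e\<in>{0..<m} - U. F es)"
   using R_out[of _ es] by (intro sum.cong) (auto simp: U_def G_def F_def)
  hence e2: "sum G ({0..<m} - U) = real (card ({0..<m} - U)) * F es" by simp
  have e3: "real (card ({0..<m} - U)) = real_of_int m - real (card U)"
   using U cm m1 by (simp add: card_Diff_subset of_nat_diff)
  have "sum G U \<le> (\<Sum>e\<in>U. F es / 2)"
   using R_in[of _ es] True by (intro sum_mono) (auto simp: U_def F_def G_def)
  hence e4: "sum G U \<le> real (card U) * F es / 2" by simp
  have "sum G {0..<m} \<le> (real_of_int m - real (card U)) * F es + real (card U) * F es / 2"
   using e1 e2 e3 e4 by simp
  hence "(\<Sum>e\<in>{0..<m}. F (es @ [e])) \<le> (real_of_int m - real (card U) / 2) * F es" by (simp add: G_def algebra_simps)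
  also have "\<dots> \<le> (real_of_int m - X / 2) * F es"
   using True by (intro mult_right_mono) (auto simp: U_def Fe)
  finally show ?thesis .
 qed
 have "(\<Sum>es\<in>LS m N. F es) \<le> (real_of_int m - X / 2) ^ N"
 proof (induction N)
  case (Suc N)
  have "(\<Sum>es\<in>LS m (Suc N). F es) \<le> (\<Sum>es\<in>LS m N. (real_of_int m - X / 2) * F es)"
   unfolding sum_LS_Suc by (intro sum_mono step)
  also have "\<dots> \<le> (real_of_int m - X / 2) * (real_of_int m - X / 2) ^ N"
   unfolding sum_distrib_left[symmetric] using Suc assms by (intro mult_left_mono) auto
  finally show ?case by simp
 qed (simp add: F_def)
 moreover have "real (card {es \<in> LS m N. length (R es) < K \<and> X \<le> real (card (surv (R es)))}) \<le> (\<Sum>es\<in>LS m N. 2 ^ K * F es)"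
 proof -
  have "real (card {es \<in> LS m N. length (R es) < K \<and> X \<le> real (card (surv (R es)))}) =
   (\<Sum>es\<in>LS m N. if length (R es) < K \<and> X \<le> real (card (surv (R es))) then 1 else 0)"
   by (simp add: finite_LS sum.If_cases Int_def conj_commute)
  also have "\<dots> \<le> (\<Sum>es\<in>LS m N. 2 ^ K * F es)"
  proof (rule sum_mono)
   fix es
   have "(1 :: real) \<le> 2 ^ K * (1 / 2) ^ length (R es)" if "length (R es) < K"
   proof -
    have "(2 :: real) ^ length (R es) \<le> 2 ^ K" using that by (intro power_increasing) auto
    thus ?thesis by (simp add: power_divide field_simps)
   qed
   thus "(if length (R es) < K \<and> X \<le> real (card (surv (R es))) then 1 else 0) \<le> 2 ^ K * F es" by (simp add: F_def)
  qed
  finally show ?thesis .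
 qed
 ultimately show ?thesis
  unfolding sum_distrib_left[symmetric] by (meson mult_left_mono order_trans zero_le_numeral zero_le_power)
qed

text \<open>With \<open>4 * K * \<kappa>\<close> draws the factor
  \<open>(1 - 1 / (2 * \<kappa>)) ^ N\<close> from \<open>large_count\<close> is at most
  \<open>exp (- 2 * K)\<close>, hence at most \<open>(1 / 4) ^ K\<close>, and outweighs the loss of
  \<open>2 ^ K\<close>. Together with the full lists from \<open>long_count\<close>, a failure
  probability of order \<open>N / 2 ^ K\<close> remains.\<close>

lemma bad_count:
 assumes "1 \<le> \<kappa>" "real_of_int m \<le> real \<kappa> * real X" "int X \<le> 2 * m" "N = \<kappa> * (4 * K)"
 shows "real (card {es \<in> LS m N. X \<le> card (surv (R es))}) \<le> (2 * real N + 1) / 2 ^ K * real_of_int m ^ N"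
proof -
 have sub: "{es \<in> LS m N. X \<le> card (surv (R es))} \<subseteq> {es \<in> LS m N. K \<le> length (R es)} \<union>
   {es \<in> LS m N. length (R es) < K \<and> real X \<le> real (card (surv (R es)))}" by auto
 have "card {es \<in> LS m N. X \<le> card (surv (R es))} \<le> card {es \<in> LS m N. K \<le> length (R es)} +
   card {es \<in> LS m N. length (R es) < K \<and> real X \<le> real (card (surv (R es)))}"
  by (rule order_trans[OF card_mono[OF _ sub] card_Un_le]) (simp add: finite_LS)
 hence "real (card {es \<in> LS m N. X \<le> card (surv (R es))}) \<le> real (card {es \<in> LS m N. K \<le> length (R es)}) +
   real (card {es \<in> LS m N. length (R es) < K \<and> real X \<le> real (card (surv (R es)))})"
  by linarith
 also have "\<dots> \<le> real N * real_of_int m ^ N / 2 ^ (K - 1) + 2 ^ K * (real_of_int m - real X / 2) ^ N"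
  using assms by (intro add_mono long_count large_count) auto
 also have "2 ^ K * (real_of_int m - real X / 2) ^ N \<le> real_of_int m ^ N / 2 ^ K"
 proof -
  have mp: "0 < real_of_int m" using m1 by simp
  have "real_of_int m - real X / 2 \<le> real_of_int m * (1 - 1 / (2 * real \<kappa>))"
   using assms(1,2) by (simp add: field_simps)
  also have "\<dots> \<le> real_of_int m * exp (- 1 / (2 * real \<kappa>))"
   using exp_ge_add_one_self[of "- 1 / (2 * real \<kappa>)"] mp by (intro mult_left_mono) auto
  finally have "(real_of_int m - real X / 2) ^ N \<le> (real_of_int m * exp (- 1 / (2 * real \<kappa>))) ^ N"
   using assms(3) by (intro power_mono) auto
  also have "\<dots> = real_of_int m ^ N * exp (- 2 * real K)"
   using assms(1,4) by (simp add: power_mult_distrib exp_of_nat_mult[symmetric] field_simps)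
  also have "exp (- 2 * real K) \<le> (1 / 4 :: real) ^ K"
  proof -
   have "exp (- 2 :: real) \<le> 1 / 4"
   proof -
    have "(2 :: real) \<le> exp 1" using exp_ge_add_one_self[of 1] by simp
    hence "2 * 2 \<le> exp 1 * exp (1 :: real)" by (intro mult_mono) auto
    hence "4 \<le> exp (2 :: real)" by (simp add: exp_add[symmetric])
    thus ?thesis by (simp add: exp_minus field_simps)
   qed
   hence "exp (- 2) ^ K \<le> (1 / 4 :: real) ^ K" by (intro power_mono) auto
   thus ?thesis by (simp add: exp_of_nat_mult[symmetric] mult.commute)
  qed
  finally have "(real_of_int m - real X / 2) ^ N \<le> real_of_int m ^ N * (1 / 4) ^ K" using mp by simp
  hence "2 ^ K * (real_of_int m - real X / 2) ^ N \<le> 2 ^ K * (real_of_int m ^ N * (1 / 4) ^ K)" by (intro mult_left_mono) auto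
  also have "\<dots> = real_of_int m ^ N / 2 ^ K"
   by (simp add: power_divide field_simps power_mult_distrib[symmetric])
  finally show ?thesis .
 qed
 also have "real N * real_of_int m ^ N / 2 ^ (K - 1) = 2 * real N / 2 ^ K * real_of_int m ^ N"
  using K1 by (cases K) auto
 finally show ?thesis by (simp add: field_simps)
qed

end

section \<open>A verification layer for the word RAM\<close>

text \<open>
 Memory is divided into 64 arrays: cell \<open>i\<close> of array \<open>r\<close> has the address \<open>- 1 - r - 64 * i\<close>, and a scalar is
 cell \<open>0\<close> of its array. Negative indices thus reach the input and output area at nonnegative addresses.
\<close>

type_synonym st = "nat => int => int"

datatype ex = N int | V nat | A nat ex | I ex | Bi binop ex ex

definition reg_of :: "int => nat" where "reg_of a = nat ((- 1 - a) mod 64)"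
definition idx_of :: "int => int" where "idx_of a = (- 1 - a) div 64"
definition addr :: "nat => int => int" where "addr r i = - 1 - int r - 64 * i"
definition enc :: "st => memory" where "enc s a = s (reg_of a) (idx_of a)"
definition dec :: "memory => st" where "dec f r i = f (addr r i)"

definition upd :: "st => nat => int => int => st" where
 "upd s r i v = (\<lambda>r' i'. if r' = r \<and> i' = i then v else s r' i')"

lemma upd_apply [simp]: "upd s r i v r' i' = (if r' = r \<and> i' = i then v else s r' i')"
 by (simp add: upd_def)

lemma reg_of_addr [simp]: "r < 64 ==> reg_of (addr r i) = r"
 unfolding reg_of_def addr_def by (simp add: algebra_simps)

lemma idx_of_addr [simp]: "r < 64 ==> idx_of (addr r i) = i"
 unfolding idx_of_def addr_def by (simp add: algebra_simps)

lemma addr_of [simp]: "addr (reg_of a) (idx_of a) = a"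
proof -
 have "(- 1 - a) mod 64 \<ge> 0" by simp
 hence "int (reg_of a) = (- 1 - a) mod 64" unfolding reg_of_def by simp
 thus ?thesis unfolding addr_def idx_of_def
  using div_mult_mod_eq[of "- 1 - a" 64] by linarith
qed

lemma enc_dec [simp]: "enc (dec f) = f"
 by (rule ext) (simp add: enc_def dec_def)

lemma enc_upd: "r < 64 ==> enc (upd s r i v) = (enc s)(addr r i := v)"
proof (rule ext)
 fix a assume "r < 64"
 thus "enc (upd s r i v) a = ((enc s)(addr r i := v)) a"
  using addr_of[of a] reg_of_addr[of r i] idx_of_addr[of r i] by (auto simp: enc_def)
qed

lemma enc_addr: "r < 64 ==> enc s (addr r i) = s r i"
 by (simp add: enc_def)

primrec comp :: "ex => expr" where
 "comp (N k) = Lit k"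
| "comp (V x) = Cell (Lit (- 1 - int x))"
| "comp (A r e) = Cell (Op Sub (Lit (- 1 - int r)) (Op Mul (Lit 64) (comp e)))"
| "comp (I e) = Cell (comp e)"
| "comp (Bi f e1 e2) = Op f (comp e1) (comp e2)"

primrec ev :: "st => ex => int" where
 "ev s (N k) = k"
| "ev s (V x) = s x 0"
| "ev s (A r e) = s r (ev s e)"
| "ev s (I e) = enc s (ev s e)"
| "ev s (Bi f e1 e2) = apply_op f (ev s e1) (ev s e2)"

primrec cost :: "ex => nat" where
 "cost (N k) = 1"
| "cost (V x) = 2"
| "cost (A r e) = cost e + 5"
| "cost (I e) = cost e + 1"
| "cost (Bi f e1 e2) = cost e1 + cost e2 + 1"

text \<open>Every intermediate value of an expression is bounded by a power of the bound
  \<open>M\<close> on the cells, and \<open>sz\<close> is a sufficient exponent. An array access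
  adds 2, for the multiplication by 64 and the subtraction in the address.\<close>

primrec sz :: "ex => nat" where
 "sz (N k) = 1"
| "sz (V x) = 1"
| "sz (A r e) = sz e + 2"
| "sz (I e) = sz e"
| "sz (Bi f e1 e2) = sz e1 + sz e2"

primrec regs_ok :: "int => ex => bool" where
 "regs_ok M (N k) = (\<bar>k\<bar> \<le> M)"
| "regs_ok M (V x) = (x < 64)"
| "regs_ok M (A r e) = (r < 64 \<and> regs_ok M e)"
| "regs_ok M (I e) = regs_ok M e"
| "regs_ok M (Bi f e1 e2) = (regs_ok M e1 \<and> regs_ok M e2)"

text \<open>The limit 30 leaves room below the power \<open>M ^ 40\<close> that a word is assumed to
  hold, in particular for the 2 added by the address of an array cell.\<close>

definition ok_ex :: "int => ex => bool" where "ok_ex M e \<longleftrightarrow> regs_ok M e \<and> sz e \<le> 30"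

definition bnd :: "int => st => bool" where "bnd M s \<longleftrightarrow> (\<forall>r i. \<bar>s r i\<bar> \<le> M)"

lemma expr_cost_comp [simp]: "expr_cost (comp e) = cost e"
 by (induction e) auto

lemma sz_pos: "1 \<le> sz e"
 by (induction e) auto

text \<open>The delicate case is a negative dividend, which is rounded away from zero: for
  \<open>y > 0\<close> the quotient still exceeds \<open>x - 1\<close>. Division by zero yields
  0.\<close>

lemma div_abs_le: "\<bar>x div y\<bar> \<le> \<bar>x :: int\<bar>"
proof (cases "y = 0")
 case False
 have *: "\<bar>x div y\<bar> \<le> \<bar>x\<bar>" if "y > 0" for x y :: int
 proof (cases "x \<ge> 0")
  case True
  thus ?thesis using that
   by (metis abs_of_nonneg div_by_1 int_one_le_iff_zero_less pos_imp_zdiv_nonneg_iff zdiv_mono2 zero_less_one)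
 next
  case False
  have "y * (x div y) + x mod y = x" by simp
  moreover have "x mod y < y" using that by simp
  ultimately have "y * (x div y) > x - y" by linarith
  moreover have "x div y < 0" using False that by (simp add: div_neg_pos_less0)
  moreover have "y * (x - 1) \<le> x - y" using that False mult_left_mono_neg[of 1 y x] by (simp add: algebra_simps)
  ultimately have "y * (x div y) > y * (x - 1)" by linarith
  hence "x div y > x - 1" using that by simp
  thus ?thesis using False \<open>x div y < 0\<close> by linarith
 qed
 show ?thesis
 proof (cases "y > 0")
  case True thus ?thesis by (rule *)
 next
  case F: False
  have "x div y = (- x) div (- y)" by simp
  thus ?thesis using *[of "- y" "- x"] F False by simp
 qed
qed simp

text \<open>The point is addition: as both bounds are at least 2,
  \<open>(M ^ a - 1) * (M ^ b - 1) \<ge> 1\<close>, so the sum of the bounds is at most their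
  product.\<close>

lemma apply_op_bound:
 assumes "2 \<le> M" "1 \<le> a" "1 \<le> b" "\<bar>x\<bar> \<le> M ^ a" "\<bar>y\<bar> \<le> M ^ b"
 shows "\<bar>apply_op f x y\<bar> \<le> (M :: int) ^ (a + b)"
proof -
 have a: "M ^ 1 \<le> M ^ a" using assms by (intro power_increasing) auto
 have b: "M ^ 1 \<le> M ^ b" using assms by (intro power_increasing) auto
 have a2: "2 \<le> M ^ a" using a assms(1) by simp
 have b2: "2 \<le> M ^ b" using b assms(1) by simp
 have s: "M ^ a + M ^ b \<le> M ^ (a + b)"
 proof -
  have "(M ^ a - 1) * (M ^ b - 1) \<ge> 1 * 1" using a2 b2 by (intro mult_mono) auto
  thus ?thesis by (simp add: power_add algebra_simps)
 qed
 have p: "\<bar>x * y\<bar> \<le> M ^ (a + b)" unfolding power_add abs_mult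
  using assms by (intro mult_mono) auto
 have q: "\<bar>x\<bar> \<le> M ^ (a + b)" using s assms b2 by linarith
 have r: "\<bar>y\<bar> \<le> M ^ (a + b)" using s assms a2 by linarith
 show ?thesis
 proof (cases f)
  case Div thus ?thesis using q div_abs_le[of x y] by auto
 qed (use s p assms a2 b2 in auto)
qed

lemma eval_comp:
 assumes "64 \<le> M" "bnd M s" "regs_ok M e" "real_of_int (M ^ sz e) \<le> B"
 shows "eval_expr B (enc s) (comp e) = Some (ev s e) \<and> \<bar>ev s e\<bar> \<le> M ^ sz e"
proof -
 have w: "word B x = Some x" if "\<bar>x\<bar> \<le> M ^ k" "real_of_int (M ^ k) \<le> B" for x k
 proof -
  have "real_of_int \<bar>x\<bar> \<le> B" using that of_int_le_iff[of "\<bar>x\<bar>" "M ^ k", where ?'a = real] by linarith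
  thus ?thesis by (simp add: word_def)
 qed
 have mono: "real_of_int (M ^ k) \<le> B" if "real_of_int (M ^ l) \<le> B" "k \<le> l" for k l
 proof -
  have "M ^ k \<le> M ^ l" using that assms(1) by (intro power_increasing) auto
  hence "real_of_int (M ^ k) \<le> real_of_int (M ^ l)" by (simp only: of_int_le_iff)
  thus ?thesis using that by linarith
 qed
 have cell: "\<bar>s r i\<bar> \<le> M ^ k" if "1 \<le> k" for r i k
 proof -
  have "M ^ 1 \<le> M ^ k" using that assms(1) by (intro power_increasing) auto
  thus ?thesis using assms(2) unfolding bnd_def by (metis order_trans power_one_right)
 qed
 show ?thesis using assms(3,4)
 proof (induction e)
  case (N k)
  thus ?case using w[of k 1] by simp
 next
  case (V x)
  have c: "enc s (- 1 - int x) = s x 0" using enc_addr[of x s 0] V by (simp add: addr_def)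
  have "\<bar>- 1 - int x\<bar> \<le> M ^ 1" using V assms(1) by simp
  thus ?case using c w[of "- 1 - int x" 1] w[of "s x 0" 1] V cell[of 1 x 0] by simp
 next
  case (A r e)
  have B: "real_of_int (M ^ sz e) \<le> B" "real_of_int (M ^ (sz e + 1)) \<le> B"
   by (rule mono[OF A.prems(2)]; simp)+
  have B1: "real_of_int (M ^ 1) \<le> B" by (rule mono[OF A.prems(2)]) simp
  have IH: "eval_expr B (enc s) (comp e) = Some (ev s e)" "\<bar>ev s e\<bar> \<le> M ^ sz e"
   using A B by auto
  have m: "\<bar>64 * ev s e\<bar> \<le> M ^ (sz e + 1)"
   using apply_op_bound[of M 1 "sz e" 64 "ev s e" Mul] IH assms(1) sz_pos by (simp add: add.commute)
  have r: "\<bar>- 1 - int r\<bar> \<le> M ^ 1" using A assms(1) by simp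
  have a: "\<bar>- 1 - int r - 64 * ev s e\<bar> \<le> M ^ (sz e + 2)"
   using apply_op_bound[of M 1 "sz e + 1" "- 1 - int r" "64 * ev s e" Sub] m r assms(1)
   by (simp add: add.commute del: power_Suc power_one_right)
  have c: "enc s (- 1 - int r - 64 * ev s e) = s r (ev s e)"
   using enc_addr[of r s "ev s e"] A by (simp add: addr_def)
  have 64: "\<bar>64\<bar> \<le> M ^ 1" using assms(1) by simp
  show ?case
   using IH c w[OF r B1] w[OF 64 B1] w[OF m B(2)] w[OF a] A.prems(2) cell[of "sz e + 2" r "ev s e"]
    w[OF cell[of "sz e + 2" r "ev s e"]]
   by (simp del: power_Suc)
 next
  case (I e)
  have c: "\<bar>enc s (ev s e)\<bar> \<le> M ^ sz e" unfolding enc_def by (rule cell) (rule sz_pos)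
  thus ?case using I w[OF c] by simp
 next
  case (Bi f e1 e2)
  have 1: "real_of_int (M ^ sz e1) \<le> B" "real_of_int (M ^ sz e2) \<le> B"
   by (rule mono[OF Bi.prems(2)]; simp)+
  have "\<bar>apply_op f (ev s e1) (ev s e2)\<bar> \<le> M ^ (sz e1 + sz e2)"
   using Bi 1 assms(1) by (intro apply_op_bound sz_pos) auto
  thus ?case using Bi 1 w[of "apply_op f (ev s e1) (ev s e2)" "sz e1 + sz e2"] by simp
 qed
qed

lemma ok_ex_eval:
 assumes "64 \<le> M" "bnd M s" "ok_ex M e" "real_of_int (M ^ 40) \<le> B"
 shows "eval_expr B (enc s) (comp e) = Some (ev s e)"
  and "r < 64 ==> eval_expr B (enc s) (Op Sub (Lit (- 1 - int r)) (Op Mul (Lit 64) (comp e))) = Some (addr r (ev s e))"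
proof -
 have mono: "real_of_int (M ^ k) \<le> B" if "k \<le> 40" for k
 proof -
  have "M ^ k \<le> M ^ 40" using that assms(1) by (intro power_increasing) auto
  hence "real_of_int (M ^ k) \<le> real_of_int (M ^ 40)" by (simp only: of_int_le_iff)
  thus ?thesis using assms(4) by linarith
 qed
 show "eval_expr B (enc s) (comp e) = Some (ev s e)"
  using eval_comp[of M s e B] assms mono[of "sz e"] by (simp add: ok_ex_def)
 assume "r < 64"
 hence "eval_expr B (enc s) (comp (A r e)) = Some (s r (ev s e))"
  using eval_comp[of M s "A r e" B] assms mono[of "sz e + 2"] by (simp add: ok_ex_def)
 moreover have "eval_expr B (enc s) (comp e) = Some (ev s e)"
  using eval_comp[of M s e B] assms mono[of "sz e"] by (simp add: ok_ex_def)
 ultimately show "eval_expr B (enc s) (Op Sub (Lit (- 1 - int r)) (Op Mul (Lit 64) (comp e))) = Some (addr r (ev s e))"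
  by (auto simp: bind_eq_Some_conv word_def addr_def split: if_splits)
qed

section \<open>Deterministic commands: exact running time and weakest preconditions\<close>

datatype cmd = Nop | Asg nat ex | Put nat ex ex | Sq cmd cmd | Cnd ex cmd cmd | Whl ex cmd

primrec co :: "cmd => com" where
 "co Nop = Skip"
| "co (Asg x e) = Store (Lit (- 1 - int x)) (comp e)"
| "co (Put r i e) = Store (Op Sub (Lit (- 1 - int r)) (Op Mul (Lit 64) (comp i))) (comp e)"
| "co (Sq c d) = Seq (co c) (co d)"
| "co (Cnd e c d) = If (comp e) (co c) (co d)"
| "co (Whl e c) = While (comp e) (co c)"

primrec ok :: "int => cmd => bool" where
 "ok M Nop = True"
| "ok M (Asg x e) = (x < 64 \<and> ok_ex M e)"
| "ok M (Put r i e) = (r < 64 \<and> ok_ex M i \<and> ok_ex M e)"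
| "ok M (Sq c d) = (ok M c \<and> ok M d)"
| "ok M (Cnd e c d) = (ok_ex M e \<and> ok M c \<and> ok M d)"
| "ok M (Whl e c) = (ok_ex M e \<and> ok M c)"

text \<open>The word bound is replaced by the condition that every stored value is at most
  \<open>M\<close>. This keeps \<open>bnd M\<close> invariant, and for commands that are
  \<open>ok\<close> it follows in \<open>bs_run\<close> that no word overflows, intermediate values
  and addresses included.\<close>

inductive bs :: "int => cmd => st => st => nat => bool" for M where
 bs_Nop: "bs M Nop s s 1"
| bs_Asg: "\<bar>ev s e\<bar> \<le> M ==> bs M (Asg x e) s (upd s x 0 (ev s e)) (cost e + 2)"
| bs_Put: "\<bar>ev s e\<bar> \<le> M ==> bs M (Put r i e) s (upd s r (ev s i) (ev s e)) (cost i + cost e + 5)"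
| bs_Sq: "bs M c s s1 k1 ==> bs M d s1 s2 k2 ==> bs M (Sq c d) s s2 (k1 + k2)"
| bs_Cnd: "bs M (if ev s e \<noteq> 0 then c else d) s s1 k1 ==> bs M (Cnd e c d) s s1 (k1 + cost e + 1)"
| bs_WhlF: "ev s e = 0 ==> bs M (Whl e c) s s (cost e + 1)"
| bs_WhlT: "ev s e \<noteq> 0 ==> bs M c s s1 k1 ==> bs M (Whl e c) s1 s2 k2 ==>
  bs M (Whl e c) s s2 (k1 + k2 + cost e + 1)"

inductive_cases bs_NopE: "bs M Nop s s' k"
inductive_cases bs_AsgE: "bs M (Asg x e) s s' k"
inductive_cases bs_PutE: "bs M (Put r i e) s s' k"
inductive_cases bs_SqE: "bs M (Sq c d) s s' k"
inductive_cases bs_CndE: "bs M (Cnd e c d) s s' k"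

lemma bnd_upd: "bnd M s ==> \<bar>v\<bar> \<le> M ==> bnd M (upd s r i v)"
 by (simp add: bnd_def)

text \<open>A derivation pins the run down to a point mass with its exact time, so termination,
  absence of aborts and the time bound can all be read off from \<open>bs\<close>.\<close>

lemma bs_run:
 assumes "bs M c s s' k" "64 \<le> M" "real_of_int (M ^ 40) \<le> B" "bnd M s" "ok M c"
 shows "bnd M s' \<and> (\<forall>t. run B (co c) (enc s, t) = return_spmf (enc s', t + k))"
 using assms(1,4,5)
proof (induction rule: bs.induct)
 case (bs_Asg s e x)
 have 1: "ok_ex M (N 0)" using assms(2) by (simp add: ok_ex_def)
 have e: "eval_expr B (enc s) (comp e) = Some (ev s e)"
  using bs_Asg ok_ex_eval(1)[of M s e B] assms(2,3) by auto
 have a: "eval_expr B (enc s) (Lit (- 1 - int x)) = Some (addr x 0)"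
  using ok_ex_eval(2)[OF assms(2) bs_Asg.prems(1) 1 assms(3), of x] bs_Asg.prems
  by (auto simp: bind_eq_Some_conv word_def addr_def split: if_splits)
 have "bnd M (upd s x 0 (ev s e))" using bs_Asg bnd_upd by blast
 thus ?case using a e enc_upd[of x s 0 "ev s e"] bs_Asg.prems by (simp add: fun_upd_def del: upd_apply)
next
 case (bs_Put s e r i)
 have "eval_expr B (enc s) (comp e) = Some (ev s e)"
  using bs_Put ok_ex_eval(1)[of M s e B] assms(2,3) by auto
 moreover have "bnd M (upd s r (ev s i) (ev s e))" using bs_Put bnd_upd by blast
 ultimately show ?case using bs_Put.prems ok_ex_eval(2)[of M s i B r] assms(2,3) enc_upd[of r s "ev s i" "ev s e"]
  by (simp add: fun_upd_def del: upd_apply)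
next
 case (bs_Cnd s e c d s1 k1)
 have "eval_expr B (enc s) (comp e) = Some (ev s e)"
  using bs_Cnd ok_ex_eval(1)[of M s e B] assms(2,3) by auto
 thus ?case using bs_Cnd by (auto split: if_splits)
next
 case (bs_WhlF s e c)
 have "eval_expr B (enc s) (comp e) = Some (ev s e)"
  using bs_WhlF ok_ex_eval(1)[of M s e B] assms(2,3) by auto
 thus ?case using bs_WhlF by (simp add: loop_spmf.simps)
next
 case (bs_WhlT s e c s1 k1 s2 k2)
 have "eval_expr B (enc s) (comp e) = Some (ev s e)"
  using bs_WhlT ok_ex_eval(1)[of M s e B] assms(2,3) by auto
 thus ?case using bs_WhlT by (subst co.simps, subst run.simps, subst loop_spmf.simps) (simp add: ac_simps)
qed auto

definition wp :: "int => cmd => (st => nat => bool) => st => bool" where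
 "wp M c Q s \<longleftrightarrow> (\<exists>s' k. bs M c s s' k \<and> Q s' k)"

lemma wp_Nop [simp]: "wp M Nop Q s = Q s 1"
 unfolding wp_def by (rule iffI, (elim exE conjE bs_NopE, simp), use bs_Nop in blast)

lemma wp_Asg [simp]: "wp M (Asg x e) Q s = (\<bar>ev s e\<bar> \<le> M \<and> Q (upd s x 0 (ev s e)) (cost e + 2))"
 unfolding wp_def by (rule iffI, (elim exE conjE bs_AsgE, simp), use bs_Asg in blast)

lemma wp_Put [simp]: "wp M (Put r i e) Q s = (\<bar>ev s e\<bar> \<le> M \<and> Q (upd s r (ev s i) (ev s e)) (cost i + cost e + 5))"
 unfolding wp_def by (rule iffI, (elim exE conjE bs_PutE, simp), use bs_Put in blast)

lemma wp_Sq [simp]: "wp M (Sq c d) Q s = wp M c (\<lambda>s1 k1. wp M d (\<lambda>s2 k2. Q s2 (k1 + k2)) s1) s"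
 unfolding wp_def by (rule iffI, (elim exE conjE bs_SqE, blast), use bs_Sq in blast)

lemma wp_Cnd [simp]: "wp M (Cnd e c d) Q s =
  (if ev s e \<noteq> 0 then wp M c (\<lambda>s' k. Q s' (k + cost e + 1)) s else wp M d (\<lambda>s' k. Q s' (k + cost e + 1)) s)"
 (is "_ = ?R")
proof
 assume "wp M (Cnd e c d) Q s"
 then obtain s' k where "bs M (Cnd e c d) s s' k" "Q s' k" unfolding wp_def by blast
 thus ?R unfolding wp_def by (elim bs_CndE) (auto split: if_splits)
next
 assume ?R
 then obtain s' k where "bs M (if ev s e \<noteq> 0 then c else d) s s' k" "Q s' (k + cost e + 1)"
  unfolding wp_def by (auto split: if_splits)
 thus "wp M (Cnd e c d) Q s" unfolding wp_def using bs_Cnd by blast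
qed

lemma wp_mono: "wp M c Q s ==> (\<And>s' k. Q s' k ==> Q' s' k) ==> wp M c Q' s"
 unfolding wp_def by blast

text \<open>\<open>\<Phi>\<close> is termination measure and time budget in one: a round must lower
  it by at least its own cost, which is positive because of the test. The last, failing test
  accounts for the extra \<open>cost e + 1\<close>.\<close>

lemma wp_Whl:
 assumes inv: "Inv s"
  and step: "\<And>s. Inv s ==> ev s e \<noteq> 0 ==> wp M c (\<lambda>s' k. Inv s' \<and> \<Phi> s' + k + cost e + 1 \<le> \<Phi> s) s"
  and post: "\<And>s' k. Inv s' ==> ev s' e = 0 ==> \<Phi> s' + k \<le> \<Phi> s + cost e + 1 ==> Q s' k"
 shows "wp M (Whl e c) Q s"
proof -
 have "wp M (Whl e c) (\<lambda>s' k. Inv s' \<and> ev s' e = 0 \<and> \<Phi> s' + k \<le> (\<Phi> s :: nat) + cost e + 1) s"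
  using inv
 proof (induction "\<Phi> s" arbitrary: s rule: less_induct)
  case less
  show ?case
  proof (cases "ev s e = 0")
   case True
   thus ?thesis unfolding wp_def using less.prems bs_WhlF[of s e M c] by fastforce
  next
   case False
   from step[OF less.prems False] obtain s1 k1 where
    1: "bs M c s s1 k1" "Inv s1" "\<Phi> s1 + k1 + cost e + 1 \<le> \<Phi> s" unfolding wp_def by blast
   from less.hyps[of s1] 1 obtain s2 k2 where
    2: "bs M (Whl e c) s1 s2 k2" "Inv s2" "ev s2 e = 0" "\<Phi> s2 + k2 \<le> \<Phi> s1 + cost e + 1"
    unfolding wp_def by fastforce
   from bs_WhlT[OF False 1(1) 2(1)] show ?thesis unfolding wp_def using 1 2 by fastforce
  qed
 qed
 thus ?thesis by (rule wp_mono) (use post in blast)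
qed

section \<open>The program\<close>

lemma bs_bnd: "bs M c s s' k ==> bnd M s ==> bnd M s'"
 by (induction rule: bs.induct) (auto intro: bnd_upd simp del: upd_apply)

lemma wp_bnd: "wp M c (\<lambda>s' k. bnd M s' --> Q s' k) s ==> bnd M s ==> wp M c Q s"
 unfolding wp_def using bs_bnd by blast

lemma wp_While:
 assumes inv: "Inv s" and bnd: "bnd M s"
  and step: "\<And>s. Inv s ==> bnd M s ==> ev s e \<noteq> 0 ==> wp M c (\<lambda>s' k. Inv s' \<and> \<Phi> s' + k + cost e + 1 \<le> \<Phi> s) s"
  and post: "\<And>s' k. Inv s' ==> bnd M s' ==> ev s' e = 0 ==> \<Phi> s' + k \<le> \<Phi> s + cost e + 1 ==> Q s' k"
 shows "wp M (Whl e c) Q s"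
proof (rule wp_Whl[where Inv = "\<lambda>s. Inv s \<and> bnd M s" and \<Phi> = \<Phi>])
 fix s assume s: "Inv s \<and> bnd M s" "ev s e \<noteq> 0"
 show "wp M c (\<lambda>s' k. (Inv s' \<and> bnd M s') \<and> \<Phi> s' + k + cost e + 1 \<le> \<Phi> s) s"
  by (rule wp_bnd, rule wp_mono[OF step]) (use s in auto)
qed (use inv bnd post in auto)

abbreviation (input) plus_ex (infixl ".+" 65) where "a .+ b \<equiv> Bi Add a b"
abbreviation (input) minus_ex (infixl ".-" 65) where "a .- b \<equiv> Bi Sub a b"
abbreviation (input) mult_ex (infixl ".*" 70) where "a .* b \<equiv> Bi Mul a b"
abbreviation (input) div_ex (infixl ".div" 70) where "a .div b \<equiv> Bi Div a b"
abbreviation (input) less_ex (infix ".<" 50) where "a .< b \<equiv> Bi Less a b"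
notation (input) Asg (infix "::=" 61)
notation (input) Sq (infixr ";;" 60)

text \<open>Scalars. \<open>rWM\<close> is the largest weight, \<open>rLG\<close> a binary logarithm
  of about \<open>2 * n\<close>, \<open>rKK\<close> the cube root \<open>k\<close>,
  \<open>rK\<close> the capacity of a list, \<open>rBIG\<close> stands for an infinite length,
  \<open>rBC\<close> is the offset of the queue keys. Stage 1 has the rows below \<open>rN1\<close>,
  stage 2 those up to \<open>rNR\<close>. \<open>rST\<close>, \<open>rD\<close>, \<open>rX\<close>
  are stage, direction and truncation bound, \<open>rJ\<close> and \<open>rJE\<close> the current
  row and the end of the stage, \<open>rR\<close> the root. \<open>rBEST\<close> is the estimate,
  \<open>rCNT\<close> counts visited vertices, \<open>rCTR\<close> relaxed edges, and
  \<open>rFND\<close> is the cycle length found by the current search.\<close>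

abbreviation (input) "rN \<equiv> 2 :: nat"
abbreviation (input) "rM \<equiv> 3 :: nat"
abbreviation (input) "rWM \<equiv> 4 :: nat"
abbreviation (input) "rLG \<equiv> 5 :: nat"
abbreviation (input) "rKK \<equiv> 6 :: nat"
abbreviation (input) "rK \<equiv> 7 :: nat"
abbreviation (input) "rBIG \<equiv> 8 :: nat"
abbreviation (input) "rBC \<equiv> 9 :: nat"
abbreviation (input) "rNR \<equiv> 10 :: nat"
abbreviation (input) "rN1 \<equiv> 11 :: nat"
abbreviation (input) "rST \<equiv> 12 :: nat"
abbreviation (input) "rD \<equiv> 13 :: nat"
abbreviation (input) "rX \<equiv> 14 :: nat"
abbreviation (input) "rJE \<equiv> 15 :: nat"
abbreviation (input) "rJ \<equiv> 16 :: nat"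
abbreviation (input) "rR \<equiv> 17 :: nat"
abbreviation (input) "rBEST \<equiv> 18 :: nat"
abbreviation (input) "rCNT \<equiv> 19 :: nat"
abbreviation (input) "rCTR \<equiv> 20 :: nat"
abbreviation (input) "rFND \<equiv> 21 :: nat"
abbreviation (input) "rTT \<equiv> 22 :: nat"
abbreviation (input) "rVV \<equiv> 23 :: nat"
abbreviation (input) "rE \<equiv> 24 :: nat"
abbreviation (input) "rH \<equiv> 25 :: nat"
abbreviation (input) "rT2 \<equiv> 26 :: nat"
abbreviation (input) "rOK \<equiv> 27 :: nat"
abbreviation (input) "rA \<equiv> 28 :: nat"
abbreviation (input) "rP \<equiv> 29 :: nat"
abbreviation (input) "rI \<equiv> 30 :: nat"
abbreviation (input) "rU \<equiv> 31 :: nat"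
abbreviation (input) "rI2 \<equiv> 32 :: nat"
text \<open>
 In direction \<open>d\<close>, the edge \<open>e\<close> leads to \<open>rDST (d * m + e)\<close>; \<open>rFST\<close> and \<open>rNXT\<close> link the edges leaving a vertex,
 shifted by one since \<open>0\<close> ends a list. Row \<open>j\<close> is the search from an end of edge \<open>rSQ j\<close>: \<open>rT (j * n + v)\<close> is the
 distance of \<open>v\<close> plus one, or \<open>0\<close>, and \<open>rC2 j\<close> is twice the cycle length found, capped by the estimate. The
 heap \<open>rSEG\<close> is a tournament tree, \<open>rMK\<close> holds the stage in which a vertex was a root, \<open>rG\<close> the estimate
 after each stage, and \<open>rLC\<close>, \<open>rLI\<close> the sizes and entries of the lists of rows kept for each stage and vertex.
\<close>

abbreviation (input) "rDST \<equiv> 40 :: nat"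
abbreviation (input) "rWT \<equiv> 41 :: nat"
abbreviation (input) "rFST \<equiv> 42 :: nat"
abbreviation (input) "rNXT \<equiv> 43 :: nat"
abbreviation (input) "rSQ \<equiv> 44 :: nat"
abbreviation (input) "rT \<equiv> 45 :: nat"
abbreviation (input) "rSEG \<equiv> 46 :: nat"
abbreviation (input) "rVIS \<equiv> 47 :: nat"
abbreviation (input) "rMK \<equiv> 48 :: nat"
abbreviation (input) "rLC \<equiv> 49 :: nat"
abbreviation (input) "rLI \<equiv> 50 :: nat"
abbreviation (input) "rC2 \<equiv> 51 :: nat"
abbreviation (input) "rG \<equiv> 52 :: nat"

text \<open>Node \<open>i\<close> has the children \<open>2 * i\<close> and
  \<open>2 * i + 1\<close>, and vertex \<open>v\<close> sits at leaf \<open>n + v\<close>. Nodes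
  hold maxima, so the next vertex to be settled must have the largest key, and the key 0 marks a
  vertex that is not queued.\<close>

definition segu :: "ex => ex => cmd" where
 "segu v c = rI ::= V rN .+ v;; Put rSEG (V rI) c;;
   Whl (N 1 .< V rI) (
    rI ::= V rI .div N 2;;
    Cnd (A rSEG (N 2 .* V rI) .< A rSEG (N 2 .* V rI .+ N 1))
     (Put rSEG (V rI) (A rSEG (N 2 .* V rI .+ N 1)))
     (Put rSEG (V rI) (A rSEG (N 2 .* V rI))))"

text \<open>Distances in \<open>rT\<close> are shifted by one on both sides of the comparison, so
  the shifts cancel; only the first factor looks at the shift, to see that \<open>x\<close> was
  reached. The scaling by 4 keeps all thresholds integral, whether half or a quarter of a length is
  meant.\<close>

definition chk :: "ex => ex => ex => ex => ex => cmd" where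
 "chk L x y t th = rA ::= N 0;;
   Whl (V rA .< A rLC L) (
    rP ::= A rLI (L .* V rK .+ V rA);;
    Cnd ((N 0 .< A rT (V rP .* V rN .+ x)) .*
      (N 4 .* (A rT (V rP .* V rN .+ x) .+ t) .< N 4 .* A rT (V rP .* V rN .+ y) .+ th))
     Nop (rOK ::= N 0);;
    rA ::= V rA .+ N 1)"

text \<open>The first check uses the list of the root, the second one the list that the vertex
  \<open>rH\<close> had one stage earlier. Only in stage 3 can the latter be nonempty. There it
  grants every visited vertex the condition of \<open>A2\<close>, so that visited vertices are among
  the survivors that the sampling argument counts.\<close>

definition tests :: cmd where
 "tests = rOK ::= N 1;;
   chk (V rST .* V rN .+ V rR) (V rH) (V rR) (V rT2) (A rC2 (V rP));;
   chk ((V rST .- N 1) .* V rN .+ V rH) (V rR) (V rH) (V rT2) (A rG (V rST .- N 2))"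

definition label :: cmd where
 "label =
   Cnd (A rT (V rJ .* V rN .+ V rH)) Nop
    (Put rVIS (V rCNT) (V rH);; rCNT ::= V rCNT .+ N 1);;
   Put rT (V rJ .* V rN .+ V rH) (V rT2 .+ N 1);;
   segu (V rH) (V rBC .- (V rT2 .* V rN .+ V rH))"

text \<open>An edge into the root closes a cycle and only updates \<open>rFND\<close>. Roots of
  earlier stages are never entered. Labels are shifted by one, so a label below
  \<open>rT2 + 2\<close> stands for a distance of at most \<open>rT2\<close>, and the edge brings no
  improvement.\<close>

definition relax :: cmd where
 "relax =
  Cnd (V rH .- V rR)
   (Cnd ((N 0 .< A rMK (V rH)) .* (A rMK (V rH) .< V rST)) Nop
    (Cnd ((N 0 .< A rT (V rJ .* V rN .+ V rH)) .* (A rT (V rJ .* V rN .+ V rH) .< V rT2 .+ N 2)) Nop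
     (tests;; Cnd (V rOK) label Nop)))
   (Cnd (V rT2 .< V rFND) (rFND ::= V rT2) Nop)"

definition expand_edge :: cmd where
 "expand_edge =
   rCTR ::= V rCTR .+ N 1;;
   rH ::= A rDST (V rD .* V rM .+ (V rE .- N 1));;
   rT2 ::= V rTT .+ A rWT (V rE .- N 1);;
   relax;;
   rE ::= A rNXT (V rD .* V rM .+ (V rE .- N 1))"

definition expand :: cmd where
 "expand =
   rE ::= A rFST (V rD .* V rN .+ V rVV);;
   Whl ((N 0 .< V rE) .* (V rCTR .< V rX)) expand_edge"

text \<open>The key at the root of the tree is \<open>BC - (t * n + v)\<close>, so quotient and
  remainder by \<open>n\<close> of its difference to \<open>BC\<close> give distance and vertex; the
  key 0 then removes the vertex.\<close>

abbreviation (input) extract_min :: cmd where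
 "extract_min \<equiv>
   rTT ::= (V rBC .- A rSEG (N 1)) .div V rN;;
   rVV ::= (V rBC .- A rSEG (N 1)) .- V rTT .* V rN;;
   segu (V rVV) (N 0);;
   expand"

definition search :: cmd where
 "search =
   rCNT ::= N 1;; rCTR ::= N 0;; rFND ::= V rBIG;;
   Put rT (V rJ .* V rN .+ V rR) (N 1);; Put rVIS (N 0) (V rR);;
   segu (V rR) (V rBC .- V rR);;
   Whl (N 0 .< A rSEG (N 1)) (
    extract_min)"

abbreviation (input) lidx :: ex where
 "lidx \<equiv> (V rST .+ N 1) .* V rN .+ V rU"

text \<open>The first check is the admission test for the visited vertex \<open>rU\<close>. Its
  threshold is the single estimate \<open>rG\<close>, not the doubled cycle length used while
  searching; \<open>four_approx\<close> lives on the difference. The second check asks whether an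
  entry of the list of \<open>rU\<close> already excludes the new root.\<close>

definition append_tests :: cmd where
 "append_tests = rOK ::= N 1;;
   chk (V rST .* V rN .+ V rR) (V rU) (V rR) (V rTT) (A rG (V rST .- N 1));;
   chk lidx (V rR) (V rU) (V rTT) (A rC2 (V rP))"

abbreviation (input) append_vertex :: cmd where
 "append_vertex \<equiv>
   rU ::= A rVIS (V rI2);;
   rTT ::= A rT (V rJ .* V rN .+ V rU) .- N 1;;
   append_tests;;
   Cnd (V rOK .* (A rLC lidx .< V rK))
   (Put rLI (lidx .* V rK .+ A rLC lidx) (V rJ);;
   Put rLC lidx (A rLC lidx .+ N 1))
   Nop;;
   rI2 ::= V rI2 .+ N 1"

definition append_row :: cmd where
 "append_row =
   rI2 ::= N 0;;
   Whl (V rI2 .< V rCNT) (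
    append_vertex)"

text \<open>Without the cap the recorded length would depend on which long cycles a pruned search
  happens to find. With it, the entry of an untruncated stage 2 search is a function of the graph
  and the first sample, namely \<open>min (2 * cm r) (gm ys)\<close>, as \<open>kl2\<close>
  demands.\<close>

abbreviation (input) clip_C2 :: cmd where
 "clip_C2 \<equiv> Cnd (A rG (V rST .- N 1) .< A rC2 (V rJ)) (Put rC2 (V rJ) (A rG (V rST .- N 1))) Nop"

abbreviation (input) store_C2 :: cmd where
 "store_C2 \<equiv> Put rC2 (V rJ) (N 2 .* V rFND)"

abbreviation (input) note_best :: cmd where
 "note_best \<equiv> Cnd (V rFND .< V rBEST) (rBEST ::= V rFND) Nop"

definition row :: cmd where
 "row =
   rR ::= A rDST (V rD .* V rM .+ A rSQ (V rJ));;
   Cnd (A rMK (V rR)) Nop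
    (Put rMK (V rR) (V rST);;
    search;;
    store_C2;;
    clip_C2;;
    note_best;;
    append_row);;
   rJ ::= V rJ .+ N 1"

definition stage :: cmd where
 "stage = Whl (V rJ .< V rJE) row;; Put rG (V rST) (V rBEST)"

text \<open>No search of stage 1 can be cut off by the bound \<open>m + 1\<close>, and the initial
  cap \<open>2 * BIG\<close> changes nothing. Cell \<open>- 1\<close> of array 63 has address 0, the
  output cell; an estimate that never fell below \<open>BIG\<close> is reported as infinity.\<close>

definition main :: cmd where
 "main =
   rBEST ::= V rBIG;; Put rG (N 0) (N 2 .* V rBIG);; rJ ::= N 0;;
   rST ::= N 1;; rD ::= N 0;; rX ::= V rM .+ N 1;; rJE ::= V rN1;; stage;;
   rST ::= N 2;; rD ::= N 1;; rX ::= V rM .div V rKK .+ N 1;; rJE ::= V rNR;; stage;;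
   rST ::= N 3;; rD ::= N 0;; rX ::= V rM .div (V rKK .* V rKK) .+ N 1;; rJE ::= V rNR .+ V rM;; stage;;
   Cnd (V rBEST .< V rBIG) (Put 63 (N (- 1)) (V rBEST)) (Put 63 (N (- 1)) (N (- 1)))"

definition agree :: "nat set => st => st => bool" where
 "agree X s s' \<longleftrightarrow> (\<forall>r. r \<notin> X --> s' r = s r)"

lemma agreeD: "agree X s s' ==> r \<notin> X ==> s' r = s r"
 by (simp add: agree_def)

lemma agree_refl [simp]: "agree X s s"
 by (simp add: agree_def)

lemma agree_trans: "agree X s s' ==> agree Y s' s'' ==> X \<subseteq> Z ==> Y \<subseteq> Z ==> agree Z s s''"
 unfolding agree_def by (metis subsetD)

lemma agree_upd: "agree X s s' ==> r \<in> X ==> agree X s (upd s' r i v)"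
 by (auto simp: agree_def fun_eq_iff)

section \<open>The tournament tree\<close>

definition seg_node :: "(int => int) => int => bool" where
 "seg_node f i \<longleftrightarrow> f i = max (f (2 * i)) (f (2 * i + 1))"

definition seg_tree :: "int => (int => int) => bool" where
 "seg_tree n f \<longleftrightarrow> (\<forall>i. 1 \<le> i \<and> i < n --> seg_node f i)"

lemma seg_node_cong: "f i = g i ==> f (2 * i) = g (2 * i) ==> f (2 * i + 1) = g (2 * i + 1) ==> seg_node f i \<longleftrightarrow> seg_node g i"
 by (simp add: seg_node_def)

lemma wp_segu:
 assumes n: "s rN 0 = n" "2 \<le> n" "2 * n \<le> 2 ^ b" "2 * n \<le> M" and bnd: "bnd M s"
  and tree: "seg_tree n (s rSEG)"
  and v: "ev s v = x" "0 \<le> x" "x < n" and c: "\<And>s'. agree {rI} s s' ==> ev s' c = y" and y: "\<bar>y\<bar> \<le> M"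
  and cost: "cost v \<le> 20" "cost c \<le> 20"
  and Q: "\<And>s' k. agree {rI, rSEG} s s' ==> seg_tree n (s' rSEG) ==>
    (\<And>i. n \<le> i ==> s' rSEG i = (if i = n + x then y else s rSEG i)) ==> k \<le> 100 * b + 100 ==> bnd M s' ==> Q s' k"
 shows "wp M (segu v c) Q s"
proof -
 define s1 where "s1 = upd (upd s rI 0 (n + x)) rSEG (n + x) y"
 have c1: "ev (upd s rI 0 (n + x)) c = y" by (rule c) (simp add: agree_upd del: upd_apply)
 define e where "e = Bi Less (N 1) (V rI)"
 define body where "body = rI ::= V rI .div N 2;;
    Cnd (A rSEG (N 2 .* V rI) .< A rSEG (N 2 .* V rI .+ N 1))
     (Put rSEG (V rI) (A rSEG (N 2 .* V rI .+ N 1)))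
     (Put rSEG (V rI) (A rSEG (N 2 .* V rI)))"
 \<comment> \<open>Only the parent of the node written last may be wrong. At the end that node is 1,
   its would-be parent \<open>1 div 2 = 0\<close> is no node, and the whole tree is right
   again.\<close>
 define Inv where "Inv s' \<longleftrightarrow> agree {rI, rSEG} s s' \<and> 1 \<le> s' rI 0 \<and> s' rI 0 < 2 * n \<and>
  (\<forall>i. 1 \<le> i \<and> i < n \<and> i \<noteq> s' rI 0 div 2 --> seg_node (s' rSEG) i) \<and>
  (\<forall>i. n \<le> i --> s' rSEG i = (if i = n + x then y else s rSEG i))" for s'
 have bnd1: "bnd M s1" unfolding s1_def using bnd y v n by (intro bnd_upd) auto
 have inv1: "Inv s1"
  unfolding Inv_def
 proof (intro conjI allI impI)
  fix i assume i: "1 \<le> i \<and> i < n \<and> i \<noteq> s1 rI 0 div 2"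
  hence "seg_node (s rSEG) i" using tree by (simp add: seg_tree_def)
  moreover have "i \<noteq> n + x" "2 * i \<noteq> n + x" "2 * i + 1 \<noteq> n + x" using i v by (auto simp: s1_def)
  ultimately show "seg_node (s1 rSEG) i" unfolding s1_def by (subst seg_node_cong[of _ _ "s rSEG"]) auto
 qed (use v n in \<open>auto simp: agree_def s1_def\<close>)
 have loop: "wp M (Whl e body) (\<lambda>s' k. Q s' (12 + cost v + cost c + k)) s1"
 proof (rule wp_While[where Inv = Inv and \<Phi> = "\<lambda>s. 90 * floor_log (nat (s rI 0))"])
  fix s' assume I: "Inv s'" "bnd M s'" "ev s' e \<noteq> 0"
  define i where "i = s' rI 0"
  have i: "1 < i" "i < 2 * n" using I by (auto simp: e_def Inv_def i_def split: if_splits)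
  have fl: "floor_log (nat i) = Suc (floor_log (nat (i div 2)))"
   using floor_log_rec[of "nat i"] i by (simp add: nat_div_distrib)
  have i2: "1 \<le> i div 2" "i div 2 < n" "2 * (i div 2) = i \<or> 2 * (i div 2) + 1 = i" using i by auto
  have d: "i div 2 \<noteq> i div 2 div 2" using i by auto
  have bnd': "\<bar>s' rSEG a\<bar> \<le> M" for a using I(2) by (simp add: bnd_def)
  define z where "z = (if s' rSEG (2 * (i div 2)) < s' rSEG (2 * (i div 2) + 1) then s' rSEG (2 * (i div 2) + 1) else s' rSEG (2 * (i div 2)))"
  have inv': "Inv (upd (upd s' rI 0 (i div 2)) rSEG (i div 2) z)"
   unfolding Inv_def
  proof (intro conjI allI impI)
   show "agree {rI, rSEG} s (upd (upd s' rI 0 (i div 2)) rSEG (i div 2) z)"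
    using I by (auto simp: Inv_def intro!: agree_upd simp del: upd_apply)
   fix j assume j: "1 \<le> j \<and> j < n \<and> j \<noteq> upd (upd s' rI 0 (i div 2)) rSEG (i div 2) z rI 0 div 2"
   show "seg_node (upd (upd s' rI 0 (i div 2)) rSEG (i div 2) z rSEG) j"
   proof (cases "j = i div 2")
    case True
    thus ?thesis using i2 by (auto simp: z_def max_def seg_node_def)
   next
    case False
    moreover have "2 * j \<noteq> i div 2" "2 * j + 1 \<noteq> i div 2" using j by auto
    moreover have "j \<noteq> i div 2 div 2" using j by simp
    ultimately show ?thesis using I(1) j unfolding Inv_def i_def
     by (subst seg_node_cong[of _ _ "s' rSEG"]) auto
   qed
  next
   fix j assume "n \<le> j"
   thus "upd (upd s' rI 0 (i div 2)) rSEG (i div 2) z rSEG j = (if j = n + x then y else s rSEG j)"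
    using I i2 by (simp add: Inv_def)
  qed (use i2 in auto)
  have iM: "\<bar>i div 2\<bar> \<le> M" using i2 n by linarith
  show "wp M body (\<lambda>s'' k. Inv s'' \<and> 90 * floor_log (nat (s'' rI 0)) + k + cost e + 1 \<le> 90 * floor_log (nat (s' rI 0))) s'"
   unfolding body_def using inv' i bnd' iM fl unfolding z_def i_def[symmetric]
   by (simp add: i_def[symmetric] e_def split: if_splits)
 next
  fix s' k assume I: "Inv s'" "bnd M s'" "ev s' e = 0"
   "90 * floor_log (nat (s' rI 0)) + k \<le> 90 * floor_log (nat (s1 rI 0)) + cost e + 1"
  have i: "s' rI 0 = 1" using I by (auto simp: e_def Inv_def split: if_splits)
  have "nat (n + x) < 2 ^ b"
   using n(3) v by (simp add: nat_less_iff)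
  hence "floor_log (nat (n + x)) \<le> b"
   using monoD[OF floor_log_mono, of "nat (n + x)" "2 ^ b"] by simp
  hence k: "k \<le> 90 * b + 10" using I(4) i by (simp add: s1_def e_def)
  show "Q s' (12 + cost v + cost c + k)"
  proof (rule Q)
   show "agree {rI, rSEG} s s'" using I by (simp add: Inv_def)
   show "seg_tree n (s' rSEG)" using I i by (simp add: Inv_def seg_tree_def)
   show "12 + cost v + cost c + k \<le> 100 * b + 100" using k cost by simp
   show "\<And>i. n \<le> i ==> s' rSEG i = (if i = n + x then y else s rSEG i)" using I by (simp add: Inv_def)
  qed (rule I)
 qed (use inv1 bnd1 in auto)
 show ?thesis
  unfolding segu_def e_def[symmetric] body_def[symmetric]
  using n v c1 y loop unfolding s1_def by (simp add: ac_simps)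
qed

definition passes :: "st => int => int => int => int => (int => int) => bool" where
 "passes s L X Y t th \<longleftrightarrow> (\<forall>a. 0 \<le> a \<and> a < s rLC L -->
   (let p = s rLI (L * s rK 0 + a) in
    0 < s rT (p * s rN 0 + X) \<and> 4 * (s rT (p * s rN 0 + X) + t) < 4 * s rT (p * s rN 0 + Y) + th p))"

lemma wp_chk:
 assumes bnd: "bnd M s" and M: "2 \<le> M"
  and ev: "\<And>s'. agree {rA, rP, rOK} s s' ==> ev s' l = L \<and> ev s' x = X \<and> ev s' y = Y \<and> ev s' t = t' \<and> ev s' te = th (s' rP 0)"
  and cnt: "0 \<le> s rLC L" "s rLC L \<le> int Kb" "int Kb + 1 \<le> M"
  and cost: "cost l \<le> 30" "cost x \<le> 30" "cost y \<le> 30" "cost t \<le> 30" "cost te \<le> 30"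
  and Q: "\<And>s' k. agree {rA, rP, rOK} s s' ==> s' rOK 0 = (if passes s L X Y t' th then s rOK 0 else 0) ==>
    k \<le> 400 * Kb + 100 ==> bnd M s' ==> Q s' k"
 shows "wp M (chk l x y t te) Q s"
proof -
 define pa where "pa a \<longleftrightarrow> (let p = s rLI (L * s rK 0 + a) in
    0 < s rT (p * s rN 0 + X) \<and> 4 * (s rT (p * s rN 0 + X) + t') < 4 * s rT (p * s rN 0 + Y) + th p)" for a
 define s1 where "s1 = upd s rA 0 0"
 have bnd1: "bnd M s1" unfolding s1_def using bnd M by (intro bnd_upd) auto
 define e where "e = Bi Less (V rA) (A rLC l)"
 define body where "body = rP ::= A rLI (l .* V rK .+ V rA);;
    Cnd ((N 0 .< A rT (V rP .* V rN .+ x)) .*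
      (N 4 .* (A rT (V rP .* V rN .+ x) .+ t) .< N 4 .* A rT (V rP .* V rN .+ y) .+ te))
     Nop (rOK ::= N 0);;
    rA ::= V rA .+ N 1"
 define Inv where "Inv s' \<longleftrightarrow> agree {rA, rP, rOK} s s' \<and> 0 \<le> s' rA 0 \<and> s' rA 0 \<le> s rLC L \<and>
   s' rOK 0 = (if \<forall>a. 0 \<le> a \<and> a < s' rA 0 --> pa a then s rOK 0 else 0)" for s'
 have "wp M (Whl e body) (\<lambda>s' k. Q s' (k + 3)) s1"
 proof (rule wp_While[where Inv = Inv and \<Phi> = "\<lambda>s'. 400 * nat (s rLC L - s' rA 0)"])
  show "Inv s1" using cnt by (auto simp: Inv_def s1_def agree_def)
  show "bnd M s1" by (rule bnd1)
 next
  fix s' assume I: "Inv s'" "bnd M s'" "ev s' e \<noteq> 0"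
  have ag: "agree {rA, rP, rOK} s s'" using I by (simp add: Inv_def)
  define a where "a = s' rA 0"
  define p where "p = s rLI (L * s rK 0 + a)"
  define s2 where "s2 = upd s' rP 0 p"
  have eq: "s' rLC = s rLC" "s' rLI = s rLI" "s' rT = s rT" "s' rN = s rN" "s' rK = s rK"
   using ag by (auto simp: agree_def)
  have ag2: "agree {rA, rP, rOK} s s2" unfolding s2_def by (rule agree_upd[OF ag]) simp
  have ev1: "ev s' l = L" using ev[OF ag] by simp
  have ev2: "ev s2 l = L" "ev s2 x = X" "ev s2 y = Y" "ev s2 t = t'" "ev s2 te = th p"
   using ev[OF ag2] by (auto simp: s2_def)
  have pM: "\<bar>p\<bar> \<le> M" using bnd by (simp add: bnd_def p_def)
  have a: "0 \<le> a" "a < s rLC L" using I ev1 by (auto simp: Inv_def e_def eq a_def split: if_splits)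
  have aM: "\<bar>a + 1\<bar> \<le> M" using a cnt by linarith
  define s3 where "s3 = (if pa a then s2 else upd s2 rOK 0 0)"
  define s4 where "s4 = upd s3 rA 0 (a + 1)"
  have split: "(\<forall>b. 0 \<le> b \<and> b < a + 1 --> pa b) \<longleftrightarrow> (\<forall>b. 0 \<le> b \<and> b < a --> pa b) \<and> pa a"
   using a by (metis add1_zle_eq linorder_not_less zless_add1_eq order_less_le)
  have "agree {rA, rP, rOK} s s4" unfolding s4_def s3_def using ag2 by (auto intro!: agree_upd simp del: upd_apply)
  moreover have "s4 rOK 0 = (if \<forall>b. 0 \<le> b \<and> b < a + 1 --> pa b then s rOK 0 else 0)"
   unfolding split using I(1) by (auto simp: s4_def s3_def s2_def Inv_def a_def)
  ultimately have inv4: "Inv s4" using a by (simp add: Inv_def s4_def)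
  have fuel: "nat (s rLC L - a) = Suc (nat (s rLC L - (a + 1)))" using a by simp
  have pa_eq: "pa a \<longleftrightarrow> 0 < s rT (p * s rN 0 + X) \<and> 4 * (s rT (p * s rN 0 + X) + t') < 4 * s rT (p * s rN 0 + Y) + th p"
   by (simp add: pa_def p_def Let_def)
  have a2: "s2 rA 0 = a" by (simp add: s2_def a_def)
  have eq2: "s2 rLC = s rLC" "s2 rLI = s rLI" "s2 rT = s rT" "s2 rN = s rN" "s2 rK = s rK" "s2 rP 0 = p"
   using ag2 by (auto simp: agree_def s2_def)
  have A: "wp M (rP ::= A rLI (l .* V rK .+ V rA)) (\<lambda>s k. s = s2 \<and> k \<le> 50) s'"
   using pM cost by (simp add: ev1 eq a_def[symmetric] p_def[symmetric] s2_def[symmetric])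
  have B: "wp M (Cnd ((N 0 .< A rT (V rP .* V rN .+ x)) .*
      (N 4 .* (A rT (V rP .* V rN .+ x) .+ t) .< N 4 .* A rT (V rP .* V rN .+ y) .+ te))
     Nop (rOK ::= N 0)) (\<lambda>s k. s = s3 \<and> k \<le> 250) s2"
   using cost M pa_eq by (auto simp: ev2 eq2 s3_def)
  have C: "wp M (rA ::= V rA .+ N 1) (\<lambda>s k. s = s4 \<and> k \<le> 10) s3"
   using aM a2 by (auto simp: s4_def s3_def)
  show "wp M body (\<lambda>s'' k. Inv s'' \<and> 400 * nat (s rLC L - s'' rA 0) + k + cost e + 1 \<le> 400 * nat (s rLC L - s' rA 0)) s'"
   unfolding body_def wp_Sq
   apply (rule wp_mono[OF A], elim conjE, hypsubst)
   apply (rule wp_mono[OF B], elim conjE, hypsubst)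
   apply (rule wp_mono[OF C], elim conjE, hypsubst)
   using inv4 fuel cost by (auto simp: a_def[symmetric] e_def s4_def)
 next
  fix s' k assume I: "Inv s'" "bnd M s'" "ev s' e = 0"
   "400 * nat (s rLC L - s' rA 0) + k \<le> 400 * nat (s rLC L - s1 rA 0) + cost e + 1"
  have ag: "agree {rA, rP, rOK} s s'" using I by (simp add: Inv_def)
  have "\<not> s' rA 0 < s rLC L" using I ev[OF ag] ag by (auto simp: e_def agree_def split: if_splits)
  hence a: "s' rA 0 = s rLC L" using I by (simp add: Inv_def)
  show "Q s' (k + 3)"
  proof (rule Q)
   show "k + 3 \<le> 400 * Kb + 100" using I(4) a cost cnt by (simp add: e_def s1_def)
   show "s' rOK 0 = (if passes s L X Y t' th then s rOK 0 else 0)"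
    using I(1) a by (simp add: Inv_def passes_def pa_def)
  qed (use I ag in auto)
 qed
 thus ?thesis unfolding chk_def e_def[symmetric] body_def[symmetric]
  using M by (simp add: s1_def ac_simps numeral_3_eq_3)
qed

section \<open>Walks and the truncated search\<close>

locale wgraph =
 fixes n m W :: int and tlv hdv wt :: "int => int"
 assumes n2: "2 \<le> n" and m1: "1 \<le> m"
  and tlv: "\<And>e. 0 \<le> e ==> e < m ==> 0 \<le> tlv e \<and> tlv e < n"
  and hdv: "\<And>e. 0 \<le> e ==> e < m ==> 0 \<le> hdv e \<and> hdv e < n"
  and wt: "\<And>e. 0 \<le> e ==> e < m ==> 1 \<le> wt e \<and> wt e \<le> W"
begin

abbreviation (input) vtx :: "int => bool" where "vtx v \<equiv> 0 \<le> v \<and> v < n"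

definition dst :: "int => int => int" where "dst d e = (if d = 0 then hdv e else tlv e)"
definition src :: "int => int => int" where "src d e = dst (1 - d) e"

lemma dst_range: "0 \<le> e ==> e < m ==> 0 \<le> dst d e \<and> dst d e < n"
 using tlv hdv by (simp add: dst_def)

lemma src_range: "0 \<le> e ==> e < m ==> 0 \<le> src d e \<and> src d e < n"
 using dst_range by (simp add: src_def)

lemma src_flip: "src (1 - d) e = dst d e"
 by (simp add: src_def)

lemma dst_flip: "dst (1 - d) e = src d e"
 by (simp add: src_def)

text \<open>\<open>Z\<close> is forbidden for every vertex but the first, so a walk may start in
  \<open>Z\<close>; this is why reversal asks for \<open>u \<notin> Z\<close>. A walk may also pass
  through its start again.\<close>

inductive wk :: "int => int set => int => int => int => bool" for d Z u where
 wk_refl: "wk d Z u u 0"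
| wk_step: "wk d Z u v t ==> 0 \<le> e ==> e < m ==> src d e = v ==> dst d e \<notin> Z ==> wk d Z u (dst d e) (t + wt e)"

lemma wk_nonneg: "wk d Z u v t ==> 0 \<le> t"
 by (induction rule: wk.induct) (use wt in fastforce)+

lemma wk_trans: "wk d Z v x t' ==> wk d Z u v t ==> wk d Z u x (t + t')"
 by (induction rule: wk.induct) (auto simp: add.assoc[symmetric] intro: wk.intros)

lemma wk_mono: "wk d Z u v t ==> Z' \<subseteq> Z ==> wk d Z' u v t"
 by (induction rule: wk.induct) (auto intro: wk.intros)

lemma wk_end: "wk d Z u v t ==> v = u \<or> v \<notin> Z"
 by (induction rule: wk.induct) auto

lemma wk_range: "wk d Z u v t ==> 0 \<le> u \<and> u < n ==> vtx v"
 by (induction rule: wk.induct) (use dst_range in auto)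

lemma wk_rev: "wk d Z u v t ==> u \<notin> Z ==> wk (1 - d) Z v u t"
proof (induction rule: wk.induct)
 case (wk_step v t e)
 have v: "v \<notin> Z" using wk_end[OF wk_step.hyps(1)] wk_step.prems by auto
 have "wk (1 - d) Z (dst d e) (dst (1 - d) e) (0 + wt e)"
  by (rule wk.wk_step[OF wk_refl]) (use wk_step v in \<open>auto simp: src_flip dst_flip\<close>)
 from wk_trans[OF wk_step.IH[OF wk_step.prems], of "dst d e" "wt e"] this
 show ?case using wk_step.hyps(4) by (simp add: dst_flip add.commute)
qed (rule wk.wk_refl)

lemma wk_pos: "wk d Z u v t ==> u \<noteq> v ==> 0 < t"
proof (induction rule: wk.induct)
 case (wk_step v t e)
 thus ?case using wk_nonneg[OF wk_step.hyps(1)] wt[of e] by auto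
qed auto

text \<open>Distance is a relation: an unreachable vertex has none, which spares an infinite value
  among the integers.\<close>

definition isd :: "int => int set => int => int => int => bool" where
 "isd d Z u v t \<longleftrightarrow> wk d Z u v t \<and> (\<forall>t'. wk d Z u v t' --> t \<le> t')"

lemma isd_ex:
 assumes "wk d Z u v t"
 shows "\<exists>t'. isd d Z u v t' \<and> t' \<le> t"
proof -
 define k where "k = (LEAST k. wk d Z u v (int k))"
 have nn: "wk d Z u v (int (nat t))" using wk_nonneg[OF assms] assms by simp
 have k: "wk d Z u v (int k)" unfolding k_def by (rule LeastI[where P = "\<lambda>k. wk d Z u v (int k)", OF nn])
 have "isd d Z u v (int k)"
  unfolding isd_def
 proof (intro conjI allI impI k)
  fix t' assume t': "wk d Z u v t'"
  have "wk d Z u v (int (nat t'))" using wk_nonneg[OF t'] t' by simp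
  hence "k \<le> nat t'" unfolding k_def by (rule Least_le)
  thus "int k \<le> t'" using wk_nonneg[OF t'] by simp
 qed
 moreover have "int k \<le> t" using calculation assms by (simp add: isd_def)
 ultimately show ?thesis by blast
qed

lemma isd_unique: "isd d Z u v t ==> isd d Z u v t' ==> t = t'"
 unfolding isd_def by (meson order_antisym)

lemma isd_wk: "isd d Z u v t ==> wk d Z u v t"
 by (simp add: isd_def)

lemma isd_le: "isd d Z u v t ==> wk d Z u v t' ==> t \<le> t'"
 by (simp add: isd_def)

lemma isd_rev: "isd d Z u v t ==> u \<notin> Z ==> v \<notin> Z ==> isd (1 - d) Z v u t"
proof -
 assume a: "isd d Z u v t" "u \<notin> Z" "v \<notin> Z"
 have "t \<le> t'" if "wk (1 - d) Z v u t'" for t'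
  using wk_rev[OF that a(3)] a(1) by (simp add: isd_def)
 thus ?thesis using wk_rev[OF isd_wk[OF a(1)] a(2)] by (simp add: isd_def)
qed

text \<open>\<open>p - 1\<close> is the last edge before \<open>b\<close> that leaves
  \<open>v\<close>, or \<open>p = 0\<close> if there is none. Following such links lists the edges
  at \<open>v\<close> in decreasing order.\<close>

definition isnx :: "int => int => int => int => bool" where
 "isnx d v b p \<longleftrightarrow> 0 \<le> p \<and> p \<le> b \<and> (0 < p --> src d (p - 1) = v) \<and> (\<forall>e. p \<le> e \<and> e < b --> src d e \<noteq> v)"

text \<open>This is the value of the relaxation counter after an untruncated search that settles
  exactly \<open>S\<close>.\<close>

definition vol :: "int => int set => nat" where
 "vol d S = card {e. 0 \<le> e \<and> e < m \<and> src d e \<in> S}"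

lemma finite_edges: "finite {e. 0 \<le> e \<and> e < m \<and> P e}"
 by (rule finite_subset[of _ "{0..<m}"]) auto

lemma vol_mono: "(\<And>v. v \<in> S ==> 0 \<le> v ==> v < n ==> v \<in> S') ==> vol d S \<le> vol d S'"
 unfolding vol_def using src_range by (intro card_mono finite_edges) blast

lemma vol_le: "vol d S \<le> nat m"
proof -
 have "vol d S \<le> card {0..<m}" unfolding vol_def by (intro card_mono) auto
 thus ?thesis by simp
qed

end

section \<open>Invariants of the truncated Dijkstra search\<close>

locale searching = wgraph +
 fixes d r X BC BIG :: int and Z :: "int set" and tst :: "int => int => bool"
 assumes d01: "d = 0 \<or> d = 1" and r: "0 \<le> r" "r < n" "r \<notin> Z" and X1: "1 \<le> X" "X \<le> m + 1"
  and BC: "((m + 2) * W + 2) * n \<le> BC" and BIG: "(m + 2) * W < BIG"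
begin

text \<open>Keys are reversed for a maximum tree, with the vertex as the last digit in base
  \<open>n\<close> of the subtracted number. The bound on \<open>BC\<close> keeps them positive,
  since 0 means absence from the queue.\<close>

definition code :: "int => int => int" where "code t v = BC - (t * n + v)"

text \<open>
 \<open>\<tau> v\<close> is \<open>0\<close> for an unreached vertex and the tentative distance plus one otherwise, \<open>q\<close> describes the
 leaves of the queue, \<open>R\<close> is the set of relaxed edges.
\<close>

definition relaxed :: "(int => int) => int => int => bool" where
 "relaxed \<tau> fnd e \<longleftrightarrow>
  (if dst d e = r then fnd \<le> \<tau> (src d e) - 1 + wt e
   else dst d e \<in> Z \<or> \<not> tst (dst d e) (\<tau> (src d e) - 1 + wt e) \<or>
    (0 < \<tau> (dst d e) \<and> \<tau> (dst d e) \<le> \<tau> (src d e) + wt e))"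

text \<open>The bound \<open>ctr * W\<close> holds because a relaxation exceeds the label it starts
  from by at most \<open>W\<close>. It keeps the keys positive, however the test prunes the
  search.\<close>

definition label_ok :: "(int => int) => int => bool" where
 "label_ok \<tau> ctr \<longleftrightarrow> \<tau> r = 1 \<and> (\<forall>v. vtx v --> 0 \<le> \<tau> v \<and>
   (0 < \<tau> v --> wk d Z r v (\<tau> v - 1) \<and> \<tau> v - 1 \<le> ctr * W \<and> (v \<noteq> r --> v \<notin> Z \<and> tst v (\<tau> v - 1))))"

definition queue_ok :: "(int => int) => (int => int) => bool" where
 "queue_ok \<tau> q \<longleftrightarrow> (\<forall>v. vtx v --> q v = 0 \<or> (0 < \<tau> v \<and> q v = code (\<tau> v - 1) v))"

definition order_ok :: "(int => int) => (int => int) => int => bool" where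
 "order_ok \<tau> q t \<longleftrightarrow> (\<forall>v. vtx v --> (q v \<noteq> 0 --> t \<le> \<tau> v) \<and> (q v = 0 \<and> 0 < \<tau> v --> \<tau> v \<le> t))"

definition vis_ok :: "(int => int) => (int => int) => int => bool" where
 "vis_ok \<tau> vis cnt \<longleftrightarrow> (\<forall>i. 0 \<le> i \<and> i < cnt --> 0 \<le> vis i \<and> vis i < n \<and> 0 < \<tau> (vis i)) \<and>
   (\<forall>v. 0 \<le> v \<and> v < n \<and> 0 < \<tau> v --> (\<exists>i. 0 \<le> i \<and> i < cnt \<and> vis i = v)) \<and> inj_on vis {0..<cnt}"

definition found_ok :: "int => bool" where
 "found_ok fnd \<longleftrightarrow> 0 < fnd \<and> fnd \<le> BIG \<and> (fnd < BIG --> wk d Z r r fnd)"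

text \<open>\<open>cnt \<le> ctr + 1\<close> since every visited vertex except the root was first
  labelled by a relaxation of its own. It bounds the work of recording a search by the truncation
  parameter.\<close>

definition sinv :: "(int => int) => (int => int) => (int => int) => int => int => int => int set => int => bool" where
 "sinv \<tau> q vis cnt ctr fnd R t \<longleftrightarrow> label_ok \<tau> ctr \<and> queue_ok \<tau> q \<and> order_ok \<tau> q t \<and> vis_ok \<tau> vis cnt \<and> found_ok fnd \<and>
   0 < t \<and> 1 \<le> cnt \<and> cnt \<le> ctr + 1 \<and> ctr \<le> X \<and> R \<subseteq> {0..<m} \<and> ctr = int (card R) \<and>
   (\<forall>e\<in>R. 0 < \<tau> (src d e) \<and> q (src d e) = 0 \<and> relaxed \<tau> fnd e)"

text \<open>The exception \<open>S\<close> is there for the vertex that is being expanded.\<close>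

definition full :: "(int => int) => (int => int) => int set => int set => bool" where
 "full \<tau> q R S \<longleftrightarrow> (\<forall>e. 0 \<le> e \<and> e < m \<and> 0 < \<tau> (src d e) \<and> q (src d e) = 0 \<and> src d e \<notin> S --> e \<in> R)"

lemma W1: "1 \<le> W"
 using wt[of 0] m1 by auto

lemma code_pos:
 assumes "label_ok \<tau> ctr" "ctr \<le> X" "0 \<le> v" "v < n" "0 < \<tau> v"
 shows "0 < code (\<tau> v - 1) v" "\<tau> v \<le> (m + 1) * W + 1"
proof -
 have "ctr * W \<le> (m + 1) * W" using assms(2) X1 W1 by (intro mult_right_mono) auto
 moreover have "\<tau> v - 1 \<le> ctr * W" using assms by (auto simp: label_ok_def)
 ultimately show a: "\<tau> v \<le> (m + 1) * W + 1" by linarith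
 have "\<tau> v * n \<le> ((m + 1) * W + 1) * n" using a n2 by (intro mult_right_mono) auto
 also have "\<dots> < ((m + 2) * W + 2) * n" using n2 W1 by (intro mult_strict_right_mono) (auto simp: algebra_simps)
 finally have "\<tau> v * n < BC" using BC by linarith
 thus "0 < code (\<tau> v - 1) v" using assms(3,4) by (simp add: code_def algebra_simps)
qed

lemma sinv_init:
 assumes "\<tau> r = 1" "\<And>v. 0 \<le> v ==> v < n ==> v \<noteq> r ==> \<tau> v = 0"
  "q r = code 0 r" "\<And>v. 0 \<le> v ==> v < n ==> v \<noteq> r ==> q v = 0" "vis 0 = r"
 shows "sinv \<tau> q vis 1 0 BIG {} 1" "full \<tau> q {} {}"
proof -
 have l: "label_ok \<tau> 0"
  unfolding label_ok_def
 proof (intro conjI allI impI)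
  fix v assume v: "vtx v"
  show "0 \<le> \<tau> v" using v assms(1,2) by (cases "v = r") auto
  assume "0 < \<tau> v"
  hence "v = r" using v assms(2)[of v] by force
  thus "wk d Z r v (\<tau> v - 1)" "\<tau> v - 1 \<le> 0 * W" "v \<noteq> r ==> v \<notin> Z" "v \<noteq> r ==> tst v (\<tau> v - 1)"
   using assms(1) wk_refl by auto
 qed (rule assms(1))
 have "1 * 1 \<le> (m + 2) * W" using W1 m1 by (intro mult_mono) auto
 hence b: "0 < BIG" using BIG by linarith
 have c: "0 < code 0 r" using code_pos(1)[OF l, of r] X1 r assms(1) by simp
 have o: "order_ok \<tau> q 1" unfolding order_ok_def
 proof (intro allI impI conjI)
  fix v assume "vtx v" "q v \<noteq> 0"
  thus "1 \<le> \<tau> v" using assms by (cases "v = r") auto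
 next
  fix v assume "vtx v" "q v = 0 \<and> 0 < \<tau> v"
  thus "\<tau> v \<le> 1" using assms by (cases "v = r") auto
 qed
 have qq: "queue_ok \<tau> q" unfolding queue_ok_def
 proof (intro allI impI)
  fix v assume "vtx v"
  thus "q v = 0 \<or> (0 < \<tau> v \<and> q v = code (\<tau> v - 1) v)" using assms by (cases "v = r") auto
 qed
 have v: "vis_ok \<tau> vis 1" unfolding vis_ok_def
 proof (intro conjI allI impI)
  fix i assume "0 \<le> i \<and> i < (1 :: int)"
  hence "i = 0" by auto
  thus "0 \<le> vis i" "vis i < n" "0 < \<tau> (vis i)" using assms r by auto
 next
  fix v assume "0 \<le> v \<and> v < n \<and> 0 < \<tau> v"
  hence "v = r" using assms(2)[of v] by force
  thus "\<exists>i. 0 \<le> i \<and> i < 1 \<and> vis i = v" using assms by (intro exI[of _ 0]) auto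
 qed (auto simp: inj_on_def)
 show "sinv \<tau> q vis 1 0 BIG {} 1"
  unfolding sinv_def found_ok_def using l o qq v b X1 by auto
 show "full \<tau> q {} {}" unfolding full_def
 proof (intro allI impI)
  fix e assume e: "0 \<le> e \<and> e < m \<and> 0 < \<tau> (src d e) \<and> q (src d e) = 0 \<and> src d e \<notin> {}"
  hence "src d e = r" using assms(2)[of "src d e"] src_range[of e d] by force
  thus "e \<in> {}" using e c assms by auto
 qed
qed

lemma sinv_extract:
 assumes s: "sinv \<tau> q vis cnt ctr fnd R t" and f: "ctr < X ==> full \<tau> q R {}"
  and v: "0 \<le> v" "v < n" "q v \<noteq> 0" and max: "\<And>x. 0 \<le> x ==> x < n ==> q x \<le> q v"
 shows "sinv \<tau> (q(v := 0)) vis cnt ctr fnd R (\<tau> v)" "ctr < X ==> full \<tau> (q(v := 0)) R {v}"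
  "0 < \<tau> v" "q v = code (\<tau> v - 1) v" "\<tau> v \<le> (m + 1) * W + 1"
  "\<And>e. e \<in> R ==> src d e \<noteq> v"
proof -
 have lab: "label_ok \<tau> ctr" "ctr \<le> X" using s by (auto simp: sinv_def)
 have qv: "0 < \<tau> v" "q v = code (\<tau> v - 1) v" using s v by (auto simp: sinv_def queue_ok_def)
 show "0 < \<tau> v" "q v = code (\<tau> v - 1) v" by (rule qv)+
 show "\<tau> v \<le> (m + 1) * W + 1" using code_pos[OF lab v(1,2) qv(1)] by simp
 have least: "\<tau> v \<le> \<tau> x" if x: "0 \<le> x" "x < n" "q x \<noteq> 0" for x
 proof -
  have qx: "0 < \<tau> x" "q x = code (\<tau> x - 1) x" using s x by (auto simp: sinv_def queue_ok_def)
  have "(\<tau> v - 1) * n + v \<le> (\<tau> x - 1) * n + x" using max[OF x(1,2)] qv qx by (simp add: code_def)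
  \<comment> \<open>The digits \<open>v\<close> and \<open>x\<close> are below \<open>n\<close>, so
    the order of the keys decides the order of the distances.\<close>
  hence "\<tau> v * n < (\<tau> x + 1) * n" using v x by (simp add: algebra_simps)
  thus ?thesis using n2 by (simp add: mult_less_cancel_right)
 qed
 have o: "order_ok \<tau> q t" using s by (simp add: sinv_def)
 hence tv: "t \<le> \<tau> v" using v by (simp add: order_ok_def)
 have "order_ok \<tau> (q(v := 0)) (\<tau> v)" unfolding order_ok_def
 proof (intro allI impI conjI)
  fix x assume "vtx x" "(q(v := 0)) x \<noteq> 0"
  thus "\<tau> v \<le> \<tau> x" using least[of x] by (auto split: if_splits)
 next
  fix x assume x: "vtx x" "(q(v := 0)) x = 0 \<and> 0 < \<tau> x"
  show "\<tau> x \<le> \<tau> v"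
  proof (cases "x = v")
   case False
   hence "\<tau> x \<le> t" using x o by (auto simp: order_ok_def)
   thus ?thesis using tv by linarith
  qed simp
 qed
 moreover have "queue_ok \<tau> (q(v := 0))" using s by (auto simp: sinv_def queue_ok_def)
 ultimately show "sinv \<tau> (q(v := 0)) vis cnt ctr fnd R (\<tau> v)" using s qv by (auto simp: sinv_def)
 show "ctr < X ==> full \<tau> (q(v := 0)) R {v}" using f by (auto simp: full_def split: if_splits)
 show "src d e \<noteq> v" if "e \<in> R" for e using s that v by (auto simp: sinv_def)
qed

context
 fixes \<tau> q vis :: "int => int" and cnt ctr fnd :: int and R :: "int set" and v e :: int
 assumes s: "sinv \<tau> q vis cnt ctr fnd R (\<tau> v)" and v: "0 \<le> v" "v < n" "q v = 0" "0 < \<tau> v"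
  and e: "0 \<le> e" "e < m" "src d e = v" "e \<notin> R" and X: "ctr < X"
begin

lemma relax_ctr: "int (card (insert e R)) = ctr + 1" "ctr + 1 \<le> X" "insert e R \<subseteq> {0..<m}"
proof -
 have "R \<subseteq> {0..<m}" "ctr = int (card R)" using s by (auto simp: sinv_def)
 moreover have "finite R" using calculation finite_subset by blast
 ultimately show "int (card (insert e R)) = ctr + 1" using e by simp
 show "ctr + 1 \<le> X" using X by simp
 show "insert e R \<subseteq> {0..<m}" using s e by (auto simp: sinv_def)
qed

lemma label_ok_Suc: "label_ok \<tau> (ctr + 1)"
proof -
 have *: "x \<le> (ctr + 1) * W" if "x \<le> ctr * W" for x using W1 that by (simp add: algebra_simps)
 have "label_ok \<tau> ctr" using s unfolding sinv_def by (elim conjE)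
 thus ?thesis using * unfolding label_ok_def by blast
qed

lemma relax_bound: "\<tau> v - 1 + wt e \<le> (ctr + 1) * W" "0 < \<tau> v - 1 + wt e" "\<tau> v - 1 + wt e \<le> (m + 1) * W"
proof -
 have "\<tau> v - 1 \<le> ctr * W" using s v by (auto simp: sinv_def label_ok_def)
 thus a: "\<tau> v - 1 + wt e \<le> (ctr + 1) * W" using wt[OF e(1,2)] by (simp add: algebra_simps)
 show "0 < \<tau> v - 1 + wt e" using wt[OF e(1,2)] v by simp
 have "(ctr + 1) * W \<le> (m + 1) * W" using X X1 W1 by (intro mult_right_mono) auto
 thus "\<tau> v - 1 + wt e \<le> (m + 1) * W" using a by linarith
qed

lemma relax_same:
 assumes "dst d e \<noteq> r" "dst d e \<in> Z \<or> \<not> tst (dst d e) (\<tau> v - 1 + wt e) \<or>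
   (0 < \<tau> (dst d e) \<and> \<tau> (dst d e) \<le> \<tau> v + wt e)"
 shows "sinv \<tau> q vis cnt (ctr + 1) fnd (insert e R) (\<tau> v)"
proof -
 have "relaxed \<tau> fnd e" using assms e by (simp add: relaxed_def)
 thus ?thesis using s relax_ctr label_ok_Suc e v unfolding sinv_def by auto
qed

lemma relax_root:
 assumes "dst d e = r"
 shows "sinv \<tau> q vis cnt (ctr + 1) (min fnd (\<tau> v - 1 + wt e)) (insert e R) (\<tau> v)"
proof -
 have w: "wk d Z r v (\<tau> v - 1)" using s v by (auto simp: sinv_def label_ok_def)
 have "wk d Z r (dst d e) (\<tau> v - 1 + wt e)" by (rule wk_step[OF w]) (use e r assms in auto)
 hence w2: "wk d Z r r (\<tau> v - 1 + wt e)" using assms by simp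
 have fo: "found_ok fnd" using s by (simp add: sinv_def)
 have f: "found_ok (min fnd (\<tau> v - 1 + wt e))"
  using w2 fo relax_bound(2) unfolding found_ok_def by (auto simp: min_def)
 have "relaxed \<tau> (min fnd (\<tau> v - 1 + wt e)) a" if "a \<in> insert e R" for a
 proof (cases "a = e")
  case True
  thus ?thesis using assms e by (simp add: relaxed_def)
 next
  case False
  hence "relaxed \<tau> fnd a" using that s by (auto simp: sinv_def)
  thus ?thesis by (auto simp: relaxed_def split: if_splits)
 qed
 thus ?thesis using s relax_ctr label_ok_Suc e v f unfolding sinv_def by auto
qed

lemma relax_insert:
 assumes h: "h = dst d e" "h \<noteq> r" "h \<notin> Z" and tst: "tst h (\<tau> v - 1 + wt e)" and imp: "\<tau> h = 0 \<or> \<tau> v + wt e < \<tau> h"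
  and c: "(cnt' = cnt \<and> vis' = vis \<and> \<tau> h \<noteq> 0) \<or> (cnt' = cnt + 1 \<and> vis' = vis(cnt := h) \<and> \<tau> h = 0)"
 shows "sinv (\<tau>(h := \<tau> v + wt e)) (q(h := code (\<tau> v - 1 + wt e) h)) vis' cnt' (ctr + 1) fnd (insert e R) (\<tau> v)"
  "h \<noteq> v" "0 \<le> h" "h < n" "\<tau> h = 0 \<or> q h \<noteq> 0" "code (\<tau> v - 1 + wt e) h \<noteq> 0"
proof -
 have hr: "0 \<le> h" "h < n" using dst_range[OF e(1,2)] h by auto
 have o: "order_ok \<tau> q (\<tau> v)" using s by (simp add: sinv_def)
 have t0: "0 \<le> \<tau> h" using s hr by (auto simp: sinv_def label_ok_def)
 \<comment> \<open>An improved vertex cannot be settled: settled labels are at most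
   \<open>\<tau> v\<close>, and the new label is larger.\<close>
 have qh: "\<tau> h = 0 \<or> q h \<noteq> 0"
 proof (rule ccontr)
  assume "\<not> (\<tau> h = 0 \<or> q h \<noteq> 0)"
  hence "\<tau> h \<le> \<tau> v" using o hr t0 by (auto simp: order_ok_def)
  thus False using imp wt[OF e(1,2)] \<open>\<not> (\<tau> h = 0 \<or> q h \<noteq> 0)\<close> by auto
 qed
 have hv: "h \<noteq> v" using qh v by auto
 show "h \<noteq> v" "0 \<le> h" "h < n" "\<tau> h = 0 \<or> q h \<noteq> 0" by (rule hv hr qh)+
 let ?\<tau> = "\<tau>(h := \<tau> v + wt e)" and ?q = "q(h := code (\<tau> v - 1 + wt e) h)"
 have w: "wk d Z r v (\<tau> v - 1)" using s v by (auto simp: sinv_def label_ok_def)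
 have "wk d Z r (dst d e) (\<tau> v - 1 + wt e)" by (rule wk_step[OF w]) (use e h in auto)
 hence w2: "wk d Z r h (\<tau> v + wt e - 1)" using h by (simp add: algebra_simps)
 have rb: "\<tau> v + wt e - 1 \<le> (ctr + 1) * W" using relax_bound(1) by simp
 have tst': "tst h (\<tau> v + wt e - 1)" using tst by (simp add: algebra_simps)
 have l: "label_ok ?\<tau> (ctr + 1)"
  using label_ok_Suc w2 rb relax_bound(2) tst' h unfolding label_ok_def by auto
 have cp: "0 < code (\<tau> v - 1 + wt e) h"
  using code_pos(1)[OF l _ hr] relax_bound(2) X by (simp add: algebra_simps)
 show "code (\<tau> v - 1 + wt e) h \<noteq> 0" using cp by simp
 have qo: "queue_ok ?\<tau> ?q"
  using s relax_bound(2) by (auto simp: sinv_def queue_ok_def algebra_simps)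
 have oo: "order_ok ?\<tau> ?q (\<tau> v)"
  using o wt[OF e(1,2)] cp by (auto simp: order_ok_def)
 have vo: "vis_ok \<tau> vis cnt" "1 \<le> cnt" "cnt \<le> ctr + 1" using s by (auto simp: sinv_def)
 have vn: "vis_ok ?\<tau> vis' cnt' \<and> 1 \<le> cnt' \<and> cnt' \<le> ctr + 1 + 1"
  using c
 proof (elim disjE conjE)
  assume a: "cnt' = cnt" "vis' = vis" "\<tau> h \<noteq> 0"
  hence "0 < \<tau> h" using t0 by simp
  hence "vis_ok ?\<tau> vis cnt" using vo(1) relax_bound(2) hr unfolding vis_ok_def by auto
  thus ?thesis using a vo by simp
 next
  assume a: "cnt' = cnt + 1" "vis' = vis(cnt := h)" "\<tau> h = 0"
  have nv: "vis i \<noteq> h" if "0 \<le> i" "i < cnt" for i using vo(1) a that by (force simp: vis_ok_def)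
  have "vis_ok ?\<tau> (vis(cnt := h)) (cnt + 1)" unfolding vis_ok_def
  proof (intro conjI allI impI)
   fix i assume i: "0 \<le> i \<and> i < cnt + 1"
   thus "0 \<le> (vis(cnt := h)) i" "(vis(cnt := h)) i < n" "0 < ?\<tau> ((vis(cnt := h)) i)"
    using vo(1) hr nv relax_bound(2) by (auto simp: vis_ok_def)
  next
   fix x assume x: "0 \<le> x \<and> x < n \<and> 0 < ?\<tau> x"
   show "\<exists>i. 0 \<le> i \<and> i < cnt + 1 \<and> (vis(cnt := h)) i = x"
   proof (cases "x = h")
    case True thus ?thesis using vo by (intro exI[of _ cnt]) auto
   next
    case False
    then obtain i where "0 \<le> i" "i < cnt" "vis i = x" using x vo(1) by (auto simp: vis_ok_def)
    thus ?thesis by (intro exI[of _ i]) auto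
   qed
  next
   have "inj_on vis {0..<cnt}" using vo(1) by (simp add: vis_ok_def)
   moreover have "inj_on (vis(cnt := h)) {0..<cnt}"
    using calculation inj_on_cong[of "{0..<cnt}" "vis(cnt := h)" vis] by auto
   moreover have "{0..<cnt + 1} = insert cnt {0..<cnt}" using vo(2) by auto
   moreover have "h \<notin> vis ` {0..<cnt}" using nv by force
   ultimately show "inj_on (vis(cnt := h)) {0..<cnt + 1}" by (simp add: image_iff)
  qed
  thus ?thesis using a vo by simp
 qed
 have "0 < ?\<tau> (src d a) \<and> ?q (src d a) = 0 \<and> relaxed ?\<tau> fnd a" if a: "a \<in> insert e R" for a
 proof (cases "a = e")
  case True
  thus ?thesis using e v hv h relax_bound(2) by (auto simp: relaxed_def)
 next
  case False
  hence aR: "0 < \<tau> (src d a)" "q (src d a) = 0" "relaxed \<tau> fnd a" "0 \<le> a" "a < m" using a s by (auto simp: sinv_def)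
  hence ne: "src d a \<noteq> h" using qh by auto
  \<comment> \<open>An edge into \<open>h\<close> stays relaxed: exclusion and test do not mention
    the label of \<open>h\<close>, and that label only drops. No relaxed edge starts at
    \<open>h\<close>, which is not settled.\<close>
  have "relaxed ?\<tau> fnd a"
  proof (cases "dst d a = h")
   case True
   thus ?thesis using aR(3) ne imp relax_bound(2) h by (auto simp: relaxed_def)
  next
   case False
   thus ?thesis using aR(3) ne by (auto simp: relaxed_def split: if_splits)
  qed
  thus ?thesis using aR ne by simp
 qed
 thus "sinv ?\<tau> ?q vis' cnt' (ctr + 1) fnd (insert e R) (\<tau> v)"
  using s relax_ctr l qo oo vn v unfolding sinv_def by auto
qed

end

end

section \<open>Verification of a single search\<close>

lemma upd_other [simp]: "r \<noteq> x ==> upd s x i v r = s r"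
 by (simp add: upd_def)

lemma upd_same [simp]: "upd s x i v x = (s x)(i := v)"
 by (auto simp: upd_def)

lemma wp_seqI: "wp M c P s ==> (\<And>s1 k1. P s1 k1 ==> wp M d (\<lambda>s2 k2. Q s2 (k1 + k2)) s1) ==> wp M (Sq c d) Q s"
 unfolding wp_Sq by (rule wp_mono)

lemma wp_chain: "wp M c (\<lambda>s' k. s' = t \<and> k \<le> a) s ==> (\<And>k1. k1 \<le> a ==> wp M d (\<lambda>s2 k2. Q s2 (k1 + k2)) t) ==> wp M (Sq c d) Q s"
 unfolding wp_Sq by (rule wp_mono, assumption) auto

locale prog = wgraph n m W tlv hdv wt for n m W tlv hdv wt +
 fixes K BIG BC M :: int and b :: nat
 assumes K1: "1 \<le> K" and KM: "K + 1 \<le> M" and BCl: "((m + 2) * W + 2) * n \<le> BC" and BCM: "BC \<le> M"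
  and BIGl: "(m + 2) * W < BIG" and BIGM: "2 * BIG \<le> M" and nb: "2 * n \<le> 2 ^ b" and nM: "2 * n \<le> M" and mM: "m + 2 \<le> M"
begin

lemma M64: "2 \<le> M" using nM n2 by linarith

definition cst :: "st => bool" where
 "cst s \<longleftrightarrow> s rN 0 = n \<and> s rM 0 = m \<and> s rK 0 = K \<and> s rBIG 0 = BIG \<and> s rBC 0 = BC \<and>
   (\<forall>d e. (d = 0 \<or> d = 1) \<and> 0 \<le> e \<and> e < m --> s rDST (d * m + e) = dst d e \<and> isnx d (src d e) e (s rNXT (d * m + e))) \<and>
   (\<forall>e. 0 \<le> e \<and> e < m --> s rWT e = wt e) \<and>
   (\<forall>d v. (d = 0 \<or> d = 1) \<and> vtx v --> isnx d v m (s rFST (d * n + v)))"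

definition lists_ok :: "st => int => bool" where
 "lists_ok s j \<longleftrightarrow> (\<forall>L. 0 \<le> s rLC L \<and> s rLC L \<le> K) \<and>
   (\<forall>L a. 0 \<le> a \<and> a < s rLC L --> 0 \<le> s rLI (L * K + a) \<and> s rLI (L * K + a) < j)"

definition tau :: "st => int => int => int" where "tau s j v = s rT (j * n + v)"
definition leaf :: "st => int => int" where "leaf s v = (if 0 \<le> v then s rSEG (n + v) else 0)"

definition tst_of :: "st => int => int => int => int => bool" where
 "tst_of s l r v t \<longleftrightarrow> passes s (l * n + r) v r t (s rC2) \<and> passes s ((l - 1) * n + v) r v t (\<lambda>_. s rG (l - 2))"

definition excl :: "st => int => int set" where "excl s l = {v. 0 < s rMK v \<and> s rMK v < l}"

lemma row_disjoint:
 assumes "p \<noteq> j" "0 \<le> x" "x < n" "0 \<le> v" "v < n" shows "p * n + x \<noteq> j * n + (v :: int)"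
proof
 assume "p * n + x = j * n + v"
 hence "(p * n + x) div n = (j * n + v) div n" by simp
 thus False using assms n2 by simp
qed

end

abbreviation (input) "srch \<equiv> {rCNT, rCTR, rFND, rT, rVIS, rSEG, rTT, rVV, rE, rH, rT2, rOK, rA, rP, rI}"

locale prog_search = prog n m W tlv hdv wt K BIG BC M b +
  searching n m W tlv hdv wt d r X BC BIG "prog.excl s0 l" "prog.tst_of n s0 l r"
 for n m W tlv hdv wt K BIG BC M b d r X and s0 :: st and l :: int +
 fixes j :: int
 assumes cst0: "cst s0" and bnd0: "bnd M s0" and j0: "0 \<le> j" and regs0: "s0 rJ 0 = j" "s0 rR 0 = r" "s0 rST 0 = l" "s0 rD 0 = d" "s0 rX 0 = X"
  and l13: "1 \<le> l" and lists0: "lists_ok s0 j" and tree0: "seg_tree n (s0 rSEG)"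
  and leaf0: "\<And>v. 0 \<le> v ==> v < n ==> leaf s0 v = 0"
  and row0: "\<And>v. 0 \<le> v ==> v < n ==> tau s0 j v = 0"
begin

text \<open>Within the table the search writes to row \<open>j\<close> only, while the tests consult
  rows below \<open>j\<close>. Hence every test has the outcome it had in \<open>s0\<close>, and
  test and excluded set can be fixed parameters of the search.\<close>

definition frame :: "st => bool" where
 "frame s \<longleftrightarrow> agree srch s0 s \<and> seg_tree n (s rSEG) \<and> (\<forall>i. (\<forall>v. vtx v --> i \<noteq> j * n + v) --> s rT i = s0 rT i)"

lemma frame_regs:
 assumes "frame s"
 shows "s rJ 0 = j" "s rR 0 = r" "s rST 0 = l" "s rD 0 = d" "s rX 0 = X" "s rN 0 = n" "s rM 0 = m" "s rK 0 = K"
  "s rBIG 0 = BIG" "s rBC 0 = BC" "s rMK = s0 rMK" "s rLC = s0 rLC" "s rLI = s0 rLI" "s rC2 = s0 rC2" "s rG = s0 rG"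
  "s rDST = s0 rDST" "s rNXT = s0 rNXT" "s rFST = s0 rFST" "s rWT = s0 rWT"
 using assms regs0 cst0 by (auto simp: frame_def agree_def cst_def)

lemma frame_T:
 assumes "frame s" "0 \<le> p" "p < j" "0 \<le> x" "x < n"
 shows "s rT (p * n + x) = s0 rT (p * n + x)"
 using assms row_disjoint[of p j x] by (auto simp: frame_def)

lemma passes_frame:
 assumes "frame s" "0 \<le> x" "x < n" "0 \<le> y" "y < n" and th: "\<And>p. th p = th' p"
 shows "passes s L x y t th = passes s0 L x y t th'"
proof -
 have "(let p = s rLI (L * s rK 0 + a) in 0 < s rT (p * s rN 0 + x) \<and> 4 * (s rT (p * s rN 0 + x) + t) < 4 * s rT (p * s rN 0 + y) + th p) \<longleftrightarrow>
  (let p = s0 rLI (L * s0 rK 0 + a) in 0 < s0 rT (p * s0 rN 0 + x) \<and> 4 * (s0 rT (p * s0 rN 0 + x) + t) < 4 * s0 rT (p * s0 rN 0 + y) + th' p)"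
  if "0 \<le> a" "a < s0 rLC L" for a
 proof -
  have K: "s rK 0 = K" "s0 rK 0 = K" "s rN 0 = n" "s0 rN 0 = n" using frame_regs[OF assms(1)] cst0 by (auto simp: cst_def)
  define p where "p = s0 rLI (L * K + a)"
  have "0 \<le> p" "p < j" using lists0 that by (auto simp: lists_ok_def p_def)
  hence "s rT (p * n + x) = s0 rT (p * n + x)" "s rT (p * n + y) = s0 rT (p * n + y)" using frame_T assms by auto
  thus ?thesis unfolding Let_def K frame_regs(13)[OF assms(1)] p_def[symmetric] by (simp add: th)
 qed
 thus ?thesis unfolding passes_def frame_regs(12)[OF assms(1)] by (metis (no_types, lifting))
qed

lemma frame_upd: "frame s ==> x \<in> srch - {rT, rSEG} ==> frame (upd s x i y)"
 unfolding frame_def by (auto intro!: agree_upd simp del: upd_apply)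

lemma frame_agree:
 assumes "frame s" "agree {rCNT, rCTR, rFND, rVIS, rTT, rVV, rE, rH, rT2, rOK, rA, rP, rI} s s'"
 shows "frame s'"
proof -
 have "agree srch s0 s'" using assms by (intro agree_trans[of _ s0 s _ s']) (auto simp: frame_def)
 thus ?thesis using assms by (auto simp: frame_def agree_def)
qed

lemma frame_segu:
 assumes "frame s" "agree {rI, rSEG} s s'" "seg_tree n (s' rSEG)"
 shows "frame s'"
proof -
 have "agree srch s0 s'" using assms by (intro agree_trans[of _ s0 s _ s']) (auto simp: frame_def)
 thus ?thesis using assms by (auto simp: frame_def agree_def)
qed

abbreviation tst :: "int => int => bool" where "tst \<equiv> tst_of s0 l r"

lemma wp_tests:
 assumes s: "frame s" "bnd M s" "s rH 0 = h" "0 \<le> h" "h < n" "s rT2 0 = t"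
  and Q: "\<And>s' k. agree {rA, rP, rOK} s s' ==> s' rOK 0 \<noteq> 0 \<longleftrightarrow> tst h t ==> k \<le> 800 * nat K + 210 ==> bnd M s' ==> frame s' ==> Q s' k"
 shows "wp M tests Q s"
proof -
 define s1 where "s1 = upd s rOK 0 1"
 have f1: "frame s1" unfolding s1_def using s(1) by (intro frame_upd) auto
 have b1: "bnd M s1" unfolding s1_def using s(2) M64 by (intro bnd_upd) auto
 have a1: "agree {rA, rP, rOK} s s1" unfolding s1_def by (auto intro: agree_upd)
 note fr = frame_regs[OF f1]
 have lc: "0 \<le> s1 rLC L" "s1 rLC L \<le> int (nat K)" for L using lists0 K1 fr by (auto simp: lists_ok_def)
 have h1: "s1 rH 0 = h" "s1 rT2 0 = t" using s by (auto simp: s1_def)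
 have "wp M (rOK ::= N 1) (\<lambda>s' k. s' = s1 \<and> k = 3) s"
  using M64 by (simp add: s1_def)
 thus ?thesis unfolding tests_def
 proof (rule wp_seqI, elim conjE, hypsubst)
  show "wp M (chk (V rST .* V rN .+ V rR) (V rH) (V rR) (V rT2) (A rC2 (V rP));;
    chk ((V rST .- N 1) .* V rN .+ V rH) (V rR) (V rH) (V rT2) (A rG (V rST .- N 2)))
   (\<lambda>s2 k2. Q s2 (3 + k2)) s1" unfolding wp_Sq
  proof (rule wp_chk[where L = "l * n + r" and X = h and Y = r and t' = t and th = "s0 rC2" and Kb = "nat K"])
   fix s' assume "agree {rA, rP, rOK} s1 s'"
   thus "ev s' (V rST .* V rN .+ V rR) = l * n + r \<and> ev s' (V rH) = h \<and> ev s' (V rR) = r \<and> ev s' (V rT2) = t \<and> ev s' (A rC2 (V rP)) = s0 rC2 (s' rP 0)"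
    using fr h1 by (simp add: agree_def)
  next
   fix s2 k2 assume A2: "agree {rA, rP, rOK} s1 s2" "s2 rOK 0 = (if passes s1 (l * n + r) h r t (s0 rC2) then s1 rOK 0 else 0)" "k2 \<le> 400 * nat K + 100" "bnd M s2"
   have f2: "frame s2" by (rule frame_agree[OF f1]) (use A2 in \<open>auto simp: agree_def\<close>)
   note fr2 = frame_regs[OF f2]
   have h2: "s2 rH 0 = h" "s2 rT2 0 = t" using A2 h1 by (auto simp: agree_def)
   have lc2: "0 \<le> s2 rLC L" "s2 rLC L \<le> int (nat K)" for L using lists0 K1 fr2 by (auto simp: lists_ok_def)
   show "wp M (chk ((V rST .- N 1) .* V rN .+ V rH) (V rR) (V rH) (V rT2) (A rG (V rST .- N 2)))
    (\<lambda>s3 k3. Q s3 (3 + (k2 + k3))) s2"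
   proof (rule wp_chk[where L = "(l - 1) * n + h" and X = r and Y = h and t' = t and th = "\<lambda>_. s0 rG (l - 2)" and Kb = "nat K"])
    fix s' assume "agree {rA, rP, rOK} s2 s'"
    thus "ev s' ((V rST .- N 1) .* V rN .+ V rH) = (l - 1) * n + h \<and> ev s' (V rR) = r \<and> ev s' (V rH) = h \<and> ev s' (V rT2) = t \<and> ev s' (A rG (V rST .- N 2)) = s0 rG (l - 2)"
     using fr2 h2 by (simp add: agree_def)
   next
    fix s3 k3 assume A3: "agree {rA, rP, rOK} s2 s3" "s3 rOK 0 = (if passes s2 ((l - 1) * n + h) r h t (\<lambda>_. s0 rG (l - 2)) then s2 rOK 0 else 0)" "k3 \<le> 400 * nat K + 100" "bnd M s3"
    have f3: "frame s3" by (rule frame_agree[OF f2]) (use A3 in \<open>auto simp: agree_def\<close>)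
    have p1: "passes s1 (l * n + r) h r t (s0 rC2) = passes s0 (l * n + r) h r t (s0 rC2)"
     by (rule passes_frame[OF f1]) (use s r in auto)
    have p2: "passes s2 ((l - 1) * n + h) r h t (\<lambda>_. s0 rG (l - 2)) = passes s0 ((l - 1) * n + h) r h t (\<lambda>_. s0 rG (l - 2))"
     by (rule passes_frame[OF f2]) (use s r in auto)
    show "Q s3 (3 + (k2 + k3))"
    proof (rule Q)
     show "agree {rA, rP, rOK} s s3" using a1 A2 A3 by (auto simp: agree_def)
     show "s3 rOK 0 \<noteq> 0 \<longleftrightarrow> tst h t" using A2 A3 p1 p2 by (simp add: tst_of_def s1_def)
    qed (use A2 A3 f3 in auto)
   qed (use A2 lc2 M64 KM K1 in auto)
  qed (use b1 lc M64 KM K1 in auto)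
 qed
qed

lemma wp_label:
 assumes s: "frame s" "bnd M s" "s rH 0 = h" "0 \<le> h" "h < n" "s rT2 0 = t" "0 \<le> t" "t \<le> (m + 1) * W"
  and cnt: "s rCNT 0 = cnt" "0 \<le> cnt" "cnt \<le> m + 1"
  and Q: "\<And>s' k. frame s' ==> bnd M s' ==> agree {rVIS, rCNT, rT, rSEG, rI} s s' ==> tau s' j = (tau s j)(h := t + 1) ==>
    leaf s' = (leaf s)(h := code t h) ==>
    (tau s j h \<noteq> 0 \<and> s' rCNT 0 = s rCNT 0 \<and> s' rVIS = s rVIS) \<or> (tau s j h = 0 \<and> s' rCNT 0 = s rCNT 0 + 1 \<and> s' rVIS = (s rVIS)(s rCNT 0 := h)) ==>
    k \<le> 100 * b + 200 ==> Q s' k"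
 shows "wp M label Q s"
proof -
 note fr = frame_regs[OF s(1)]
 define c where "c = (if tau s j h = 0 then upd (upd s rVIS cnt h) rCNT 0 (cnt + 1) else s)"
 define s1 where "s1 = upd c rT (j * n + h) (t + 1)"
 have tM: "\<bar>t + 1\<bar> \<le> M"
 proof -
  have "(m + 1) * W + 1 \<le> ((m + 2) * W + 2) * 1" using W1 by (simp add: algebra_simps)
  also have "\<dots> \<le> ((m + 2) * W + 2) * n" using n2 W1 m1 by (intro mult_left_mono) auto
  finally show ?thesis using s BCl BCM by linarith
 qed
 have co: "0 \<le> code t h" "code t h \<le> BC"
 proof -
  have "t * n + h \<le> (t + 1) * n" using s by (simp add: algebra_simps)
  also have "\<dots> \<le> ((m + 2) * W + 2) * n" using s n2 W1 by (intro mult_right_mono) (auto simp: algebra_simps)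
  finally show "0 \<le> code t h" using BCl by (simp add: code_def)
  have "0 \<le> t * n" using s(7) n2 by (intro mult_nonneg_nonneg) auto
  thus "code t h \<le> BC" unfolding code_def using s(4) by linarith
 qed
 have bc: "bnd M c" unfolding c_def using s cnt mM nM n2 by (auto intro!: bnd_upd simp del: upd_apply)
 have b1: "bnd M s1" unfolding s1_def using bc tM by (rule bnd_upd)
 have fc: "frame c" unfolding c_def using s(1) by (auto intro!: frame_upd simp del: upd_apply)
 have ac: "agree {rVIS, rCNT} s c" unfolding c_def by (auto intro!: agree_upd simp del: upd_apply)
 have f1: "frame s1"
 proof -
  have "agree srch s0 s1" unfolding s1_def using fc by (intro agree_upd) (auto simp: frame_def)
  thus ?thesis using fc s by (auto simp: frame_def s1_def)
 qed
 note fr1 = frame_regs[OF f1] and frc = frame_regs[OF fc]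
 have cr: "c rH 0 = h" "c rT2 0 = t" "c rT = s rT" "c rSEG = s rSEG" using ac s by (auto simp: agree_def)
 have s1r: "s1 rH 0 = h" "s1 rT2 0 = t" using cr by (auto simp: s1_def)
 have inner: "wp M (segu (V rH) (V rBC .- (V rT2 .* V rN .+ V rH))) (\<lambda>s' k. Q s' (k0 + (17 + k))) s1"
  if k0: "k0 \<le> 30" for k0
 proof (rule wp_segu[where n = n and b = b and x = h and y = "code t h"])
  fix s' assume "agree {rI} s1 s'"
  thus "ev s' (V rBC .- (V rT2 .* V rN .+ V rH)) = code t h"
   using fr1 s1r by (simp add: agree_def code_def)
 next
  fix s' k assume A: "agree {rI, rSEG} s1 s'" "seg_tree n (s' rSEG)"
   "\<And>i. n \<le> i ==> s' rSEG i = (if i = n + h then code t h else s1 rSEG i)" "k \<le> 100 * b + 100" "bnd M s'"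
  have s1s: "s1 rSEG = s rSEG" by (simp add: s1_def cr)
  have T: "s' rT = s1 rT" "s' rVIS = s1 rVIS" "s' rCNT = s1 rCNT" using A(1) by (auto simp: agree_def)
  show "Q s' (k0 + (17 + k))"
  proof (rule Q)
   show "frame s'" by (rule frame_segu[OF f1 A(1,2)])
   show "agree {rVIS, rCNT, rT, rSEG, rI} s s'" using A(1) ac by (auto simp: agree_def s1_def)
   show "tau s' j = (tau s j)(h := t + 1)" by (rule ext) (simp add: tau_def T s1_def cr)
   show "leaf s' = (leaf s)(h := code t h)"
    using A(3) s by (auto simp: leaf_def s1s fun_eq_iff)
   show "(tau s j h \<noteq> 0 \<and> s' rCNT 0 = s rCNT 0 \<and> s' rVIS = s rVIS) \<or> (tau s j h = 0 \<and> s' rCNT 0 = s rCNT 0 + 1 \<and> s' rVIS = (s rVIS)(s rCNT 0 := h))"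
    by (auto simp: T s1_def c_def cnt fun_eq_iff)
  qed (use A k0 in auto)
 qed (use fr1 n2 nb nM b1 f1 s1r s co BCM in \<open>auto simp: frame_def\<close>)
 have hM: "\<bar>h\<bar> \<le> M" "\<bar>cnt + 1\<bar> \<le> M" using s nM n2 cnt mM by linarith+
 have step: "wp M (Put rT (V rJ .* V rN .+ V rH) (V rT2 .+ N 1);; segu (V rH) (V rBC .- (V rT2 .* V rN .+ V rH))) (\<lambda>s' k. Q s' (k0 + k)) c"
  if "k0 \<le> 30" for k0
  using inner[OF that] tM by (simp add: frc cr s1_def[symmetric])
 have tau: "s rT (j * n + h) = tau s j h" by (simp add: tau_def)
 show ?thesis
 proof (cases "tau s j h = 0")
  case True
  hence cc: "c = upd (upd s rVIS cnt h) rCNT 0 (cnt + 1)" by (simp add: c_def)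
  show ?thesis unfolding label_def wp_Sq[of M "Cnd _ _ _"] wp_Cnd
   using step[of 29, unfolded cc] True hM by (simp add: fr s cnt tau del: wp_Sq) (simp add: cnt s)
 next
  case False
  hence cc: "c = s" by (simp add: c_def)
  show ?thesis unfolding label_def wp_Sq[of M "Cnd _ _ _"] wp_Cnd
   using step[of 15, unfolded cc] False hM by (simp add: fr s cnt tau del: wp_Sq)
 qed
qed

lemma excl_iff: "frame s ==> h \<in> excl s0 l \<longleftrightarrow> 0 < s rMK h \<and> s rMK h < s rST 0"
 using frame_regs[of s] by (simp add: excl_def)

lemma wp_relax:
 assumes s: "frame s" "bnd M s" "s rH 0 = h" "0 \<le> h" "h < n" "s rT2 0 = t" "0 \<le> t" "t \<le> (m + 1) * W"
  and cnt: "0 \<le> s rCNT 0" "s rCNT 0 \<le> m + 1"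
  and Q: "\<And>s' k. frame s' ==> bnd M s' ==> agree (srch - {rE, rTT, rVV, rCTR, rT2, rH}) s s' ==> k \<le> 800 * nat K + 100 * b + 1000 ==>
    (h = r \<and> s' rFND 0 = min (s rFND 0) t \<and> tau s' j = tau s j \<and> leaf s' = leaf s \<and> s' rCNT 0 = s rCNT 0 \<and> s' rVIS = s rVIS) \<or>
    (h \<noteq> r \<and> (h \<in> excl s0 l \<or> \<not> tst h t \<or> (0 < tau s j h \<and> tau s j h \<le> t + 1)) \<and>
     s' rFND 0 = s rFND 0 \<and> tau s' j = tau s j \<and> leaf s' = leaf s \<and> s' rCNT 0 = s rCNT 0 \<and> s' rVIS = s rVIS) \<or>
    (h \<noteq> r \<and> h \<notin> excl s0 l \<and> tst h t \<and> \<not> (0 < tau s j h \<and> tau s j h \<le> t + 1) \<and>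
     s' rFND 0 = s rFND 0 \<and> tau s' j = (tau s j)(h := t + 1) \<and> leaf s' = (leaf s)(h := code t h) \<and>
     ((s' rCNT 0 = s rCNT 0 \<and> s' rVIS = s rVIS \<and> tau s j h \<noteq> 0) \<or> (s' rCNT 0 = s rCNT 0 + 1 \<and> s' rVIS = (s rVIS)(s rCNT 0 := h) \<and> tau s j h = 0))) ==>
    Q s' k"
 shows "wp M relax Q s"
proof -
 note fr = frame_regs[OF s(1)]
 have tau: "s rT (j * n + h) = tau s j h" by (simp add: tau_def)
 have tM: "t \<le> M" "0 \<le> t"
 proof -
  have "(m + 1) * W \<le> (m + 2) * W" using W1 by (simp add: algebra_simps)
  thus "t \<le> M" using s BIGl BIGM by linarith
 qed (rule s)
 have same: "Q s k" if "h \<noteq> r" "h \<in> excl s0 l \<or> \<not> tst h t \<or> (0 < tau s j h \<and> tau s j h \<le> t + 1)" "k \<le> 800 * nat K + 100 * b + 1000" for k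
  by (rule Q) (use s that in auto)
 consider (root) "h = r" | (ex) "h \<noteq> r" "h \<in> excl s0 l" | (old) "h \<noteq> r" "h \<notin> excl s0 l" "0 < tau s j h" "tau s j h \<le> t + 1"
  | (new) "h \<noteq> r" "h \<notin> excl s0 l" "\<not> (0 < tau s j h \<and> tau s j h \<le> t + 1)" by blast
 thus ?thesis
 proof cases
  case root
  define s1 where "s1 = (if t < s rFND 0 then upd s rFND 0 t else s)"
  have "Q s1 k" if "k \<le> 30" for k
  proof (rule Q)
   show "frame s1" unfolding s1_def using s(1) by (auto intro!: frame_upd simp del: upd_apply)
   show "bnd M s1" unfolding s1_def using s(2) tM by (auto intro!: bnd_upd simp del: upd_apply)
   show "agree (srch - {rE, rTT, rVV, rCTR, rT2, rH}) s s1" unfolding s1_def by (auto intro!: agree_upd simp del: upd_apply)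
   show "(h = r \<and> s1 rFND 0 = min (s rFND 0) t \<and> tau s1 j = tau s j \<and> leaf s1 = leaf s \<and> s1 rCNT 0 = s rCNT 0 \<and> s1 rVIS = s rVIS) \<or> R" for R
    using root by (auto simp: s1_def tau_def leaf_def fun_eq_iff)
  qed (use that in auto)
  from this[of 16] this[of 13] show ?thesis using root tM by (simp add: relax_def fr s s1_def split: if_splits)
 next
  case ex
  thus ?thesis using same by (simp add: relax_def fr s excl_iff[OF s(1)])
 next
  case old
  thus ?thesis using same by (auto simp: relax_def fr s excl_iff[OF s(1)] tau)
 next
  case new
  have ex: "\<not> (0 < s rMK h \<and> s rMK h < l)" using new(2) by (simp add: excl_iff[OF s(1)] fr)
  have "wp M (tests;; Cnd (V rOK) label Nop) (\<lambda>s' k. Q s' (k0 + k)) s" if k0: "k0 \<le> 200" for k0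
   unfolding wp_Sq
  proof (rule wp_tests[OF s(1-6)])
   fix s1 k1 assume A1: "agree {rA, rP, rOK} s s1" "s1 rOK 0 \<noteq> 0 \<longleftrightarrow> tst h t" "k1 \<le> 800 * nat K + 210" "bnd M s1" "frame s1"
   have e1: "tau s1 j = tau s j" "leaf s1 = leaf s" "s1 rCNT = s rCNT" "s1 rVIS = s rVIS" "s1 rFND = s rFND" "s1 rH = s rH" "s1 rT2 = s rT2"
    using A1(1) by (auto simp: agree_def tau_def leaf_def fun_eq_iff)
   show "wp M (Cnd (V rOK) label Nop) (\<lambda>s2 k2. Q s2 (k0 + (k1 + k2))) s1"
   proof (cases "tst h t")
    case False
    have "Q s1 (k0 + (k1 + 4))"
    proof (rule Q)
     show "agree (srch - {rE, rTT, rVV, rCTR, rT2, rH}) s s1" using A1(1) by (auto simp: agree_def)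
    qed (use A1 e1 k0 new False in auto)
    thus ?thesis using False A1(2) by (simp add: eval_nat_numeral)
   next
    case True
    hence ok: "s1 rOK 0 \<noteq> 0" using A1(2) by simp
    have "wp M label (\<lambda>s2 k2. Q s2 (k0 + (k1 + (k2 + 3)))) s1"
    proof (rule wp_label[where h = h and t = t and cnt = "s rCNT 0"])
     fix s2 k2 assume A2: "frame s2" "bnd M s2" "agree {rVIS, rCNT, rT, rSEG, rI} s1 s2" "tau s2 j = (tau s1 j)(h := t + 1)"
      "leaf s2 = (leaf s1)(h := code t h)"
      "(tau s1 j h \<noteq> 0 \<and> s2 rCNT 0 = s1 rCNT 0 \<and> s2 rVIS = s1 rVIS) \<or> (tau s1 j h = 0 \<and> s2 rCNT 0 = s1 rCNT 0 + 1 \<and> s2 rVIS = (s1 rVIS)(s1 rCNT 0 := h))"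
      "k2 \<le> 100 * b + 200"
     have f2: "s2 rFND = s rFND" using A2(3) e1 by (auto simp: agree_def)
     show "Q s2 (k0 + (k1 + (k2 + 3)))"
     proof (rule Q)
      show "agree (srch - {rE, rTT, rVV, rCTR, rT2, rH}) s s2" using A1(1) A2(3) by (auto simp: agree_def)
      show "k0 + (k1 + (k2 + 3)) \<le> 800 * nat K + 100 * b + 1000" using A1(3) A2(7) k0 by simp
     qed (use A2 f2 e1 new True in auto)
    qed (use A1 e1 s cnt in auto)
    thus ?thesis using ok by (simp add: eval_nat_numeral)
   qed
  qed
  note w = this[of 62]
  have old: "\<not> (0 < s rT (j * n + h) \<and> s rT (j * n + h) < t + 2)" using new(3) by (auto simp: tau)
  show ?thesis using new(1) ex old w unfolding relax_def wp_Cnd by (auto simp: fr s simp del: wp_Sq)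
 qed
qed

lemma cst_frame: "frame s ==> cst s"
 using cst0 frame_regs[of s] by (simp add: cst_def)

definition outer :: "int set => int => st => bool" where
 "outer R t s \<longleftrightarrow> frame s \<and> sinv (tau s j) (leaf s) (s rVIS) (s rCNT 0) (s rCTR 0) (s rFND 0) R t"

text \<open>The links lead downwards, so the edges at \<open>v\<close> that are already relaxed are
  exactly those from \<open>rE\<close> on. Here \<open>rE\<close> is shifted by one: the next edge
  is \<open>rE - 1\<close>.\<close>

definition inner :: "int => int set => st => bool" where
 "inner v R s \<longleftrightarrow> outer R (tau s j v) s \<and> s rTT 0 = tau s j v - 1 \<and> s rVV 0 = v \<and> 0 < tau s j v \<and> leaf s v = 0 \<and>
   0 \<le> s rE 0 \<and> s rE 0 \<le> m \<and> (0 < s rE 0 --> src d (s rE 0 - 1) = v) \<and>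
   (\<forall>e\<in>R. src d e = v --> s rE 0 \<le> e) \<and> (\<forall>e. s rE 0 \<le> e \<and> e < m \<and> src d e = v --> e \<in> R) \<and>
   (s rCTR 0 < X --> full (tau s j) (leaf s) R {v})"

definition cR :: nat where "cR = 800 * nat K + 100 * b + 1100"
definition cE :: nat where "cE = 100 * b + 300"
definition qcard :: "st => nat" where "qcard s = card {v. 0 \<le> v \<and> v < n \<and> leaf s v \<noteq> 0}"
text \<open>Amortized time: each relaxation still permitted is charged for itself and for the
  extraction of the vertex that it may put into the queue; queued vertices carry the charge of their
  own extraction.\<close>

definition pot :: "st => nat" where "pot s = (cR + cE) * nat (X - s rCTR 0) + cE * qcard s"

lemma finite_q: "finite {v. 0 \<le> v \<and> v < n \<and> P v}"
 by (rule finite_subset[of _ "{0..<n}"]) auto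

lemma qcard_ins: "leaf s' = (leaf s)(h := c) ==> qcard s' \<le> qcard s + 1"
proof -
 assume l: "leaf s' = (leaf s)(h := c)"
 have "qcard s' \<le> card (insert h {v. 0 \<le> v \<and> v < n \<and> leaf s v \<noteq> 0})"
  unfolding qcard_def l by (intro card_mono) (auto simp: finite_q)
 also have "\<dots> \<le> qcard s + 1" unfolding qcard_def by (simp add: card_insert_if finite_q)
 finally show ?thesis .
qed

lemma wp_expand_step:
 assumes I: "inner v R s" "bnd M s" "0 \<le> v" "v < n" and g: "0 < s rE 0" "s rCTR 0 < X"
 shows "wp M expand_edge (\<lambda>s' k. (\<exists>R. inner v R s') \<and> pot s' + k + 12 \<le> pot s) s"
proof -
 have f: "frame s" and sv: "sinv (tau s j) (leaf s) (s rVIS) (s rCNT 0) (s rCTR 0) (s rFND 0) R (tau s j v)"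
  using I by (auto simp: inner_def outer_def)
 note fr = frame_regs[OF f]
 note cs = cst_frame[OF f]
 define p where "p = s rE 0"
 define e where "e = p - 1"
 define ctr where "ctr = s rCTR 0"
 have e: "0 \<le> e" "e < m" "src d e = v" using I g by (auto simp: inner_def p_def e_def)
 have eR: "e \<notin> R" using I e by (auto simp: inner_def e_def p_def)
 define h where "h = dst d e"
 define t where "t = tau s j v - 1 + wt e"
 have h: "0 \<le> h" "h < n" using dst_range[OF e(1,2)] by (auto simp: h_def)
 have vq: "leaf s v = 0" "0 < tau s j v" using I by (auto simp: inner_def)
 have X: "ctr < X" using g by (simp add: ctr_def)
 note P = sv[folded ctr_def] I(3,4) vq e eR X
 have D: "s rDST (d * m + e) = h" "s rNXT (d * m + e) = s rNXT (d * m + e)" "isnx d v e (s rNXT (d * m + e))" "s rWT e = wt e"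
  using cs d01 e by (auto simp: cst_def h_def)
 have tb: "t \<le> (m + 1) * W" "0 < t" using relax_bound[OF P] by (auto simp: t_def)
 have cnt: "1 \<le> s rCNT 0" "s rCNT 0 \<le> ctr + 1" "ctr \<le> X" "0 \<le> ctr" using sv by (auto simp: sinv_def ctr_def)
 have TT: "s rTT 0 = tau s j v - 1" and VV: "s rVV 0 = v" using I(1) by (simp_all add: inner_def)
 define s1 where "s1 = upd (upd (upd s rCTR 0 (ctr + 1)) rH 0 h) rT2 0 t"
 have tM: "t \<le> M"
 proof -
  have "(m + 1) * W \<le> (m + 2) * W" using W1 by (simp add: algebra_simps)
  thus "t \<le> M" using tb BIGl BIGM by linarith
 qed
 have M: "\<bar>ctr + 1\<bar> \<le> M" "\<bar>h\<bar> \<le> M" "\<bar>t\<bar> \<le> M" using cnt X X1 mM h nM tM tb by linarith+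
 have b1: "bnd M s1" unfolding s1_def by (intro bnd_upd I M)
 have f1: "frame s1" unfolding s1_def using f by (auto intro!: frame_upd simp del: upd_apply)
 have same1: "tau s1 j = tau s j" "leaf s1 = leaf s" "s1 rCNT = s rCNT" "s1 rVIS = s rVIS" "s1 rFND = s rFND"
  "s1 rE = s rE" "s1 rTT = s rTT" "s1 rVV = s rVV" "s1 rH 0 = h" "s1 rT2 0 = t" "s1 rCTR 0 = ctr + 1"
  by (auto simp: s1_def tau_def leaf_def fun_eq_iff)
 have A: "wp M relax (\<lambda>s2 k2. wp M (rE ::= A rNXT (V rD .* V rM .+ (V rE .- N 1)))
   (\<lambda>s' k. (\<exists>R. inner v R s') \<and> pot s' + (41 + (k2 + k)) + 12 \<le> pot s) s2) s1"
 proof (rule wp_relax[OF f1 b1 same1(9) h same1(10)])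
  fix s2 k2 assume A2: "frame s2" "bnd M s2" "agree (srch - {rE, rTT, rVV, rCTR, rT2, rH}) s1 s2" "k2 \<le> 800 * nat K + 100 * b + 1000"
   "(h = r \<and> s2 rFND 0 = min (s1 rFND 0) t \<and> tau s2 j = tau s1 j \<and> leaf s2 = leaf s1 \<and> s2 rCNT 0 = s1 rCNT 0 \<and> s2 rVIS = s1 rVIS) \<or>
    (h \<noteq> r \<and> (h \<in> excl s0 l \<or> \<not> tst h t \<or> (0 < tau s1 j h \<and> tau s1 j h \<le> t + 1)) \<and>
     s2 rFND 0 = s1 rFND 0 \<and> tau s2 j = tau s1 j \<and> leaf s2 = leaf s1 \<and> s2 rCNT 0 = s1 rCNT 0 \<and> s2 rVIS = s1 rVIS) \<or>
    (h \<noteq> r \<and> h \<notin> excl s0 l \<and> tst h t \<and> \<not> (0 < tau s1 j h \<and> tau s1 j h \<le> t + 1) \<and>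
     s2 rFND 0 = s1 rFND 0 \<and> tau s2 j = (tau s1 j)(h := t + 1) \<and> leaf s2 = (leaf s1)(h := code t h) \<and>
     ((s2 rCNT 0 = s1 rCNT 0 \<and> s2 rVIS = s1 rVIS \<and> tau s1 j h \<noteq> 0) \<or> (s2 rCNT 0 = s1 rCNT 0 + 1 \<and> s2 rVIS = (s1 rVIS)(s1 rCNT 0 := h) \<and> tau s1 j h = 0)))"
  have r2: "s2 rE 0 = p" "s2 rTT 0 = tau s j v - 1" "s2 rVV 0 = v" "s2 rCTR 0 = ctr + 1"
   using agreeD[OF A2(3), of rE] agreeD[OF A2(3), of rTT] agreeD[OF A2(3), of rVV] agreeD[OF A2(3), of rCTR]
    same1(6,7,8,11) TT VV by (simp_all add: p_def)
  define p' where "p' = s rNXT (d * m + e)"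
  have p': "0 \<le> p'" "p' \<le> e" "0 < p' --> src d (p' - 1) = v" "\<And>x. p' \<le> x ==> x < e ==> src d x \<noteq> v"
   using D(3) by (auto simp: isnx_def p'_def)
  define s3 where "s3 = upd s2 rE 0 p'"
  have same3: "tau s3 j = tau s2 j" "leaf s3 = leaf s2" "s3 rCNT = s2 rCNT" "s3 rVIS = s2 rVIS" "s3 rFND = s2 rFND"
   "s3 rE 0 = p'" "s3 rTT = s2 rTT" "s3 rVV = s2 rVV" "s3 rCTR 0 = ctr + 1"
   by (auto simp: s3_def tau_def leaf_def fun_eq_iff r2)
  have t0: "0 \<le> tau s j h" using sv h by (auto simp: sinv_def label_ok_def)
  \<comment> \<open>The three outcomes of \<open>relax\<close> match \<open>relax_root\<close>,
    \<open>relax_same\<close> and \<open>relax_insert\<close>. In none of them does a vertex become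
    settled, so \<open>full\<close> can only gain from the new edge.\<close>
  have key: "sinv (tau s2 j) (leaf s2) (s2 rVIS) (s2 rCNT 0) (ctr + 1) (s2 rFND 0) (insert e R) (tau s j v) \<and>
    tau s2 j v = tau s j v \<and> leaf s2 v = 0 \<and> (\<forall>x. 0 < tau s2 j x \<and> leaf s2 x = 0 --> 0 < tau s j x \<and> leaf s x = 0) \<and> qcard s2 \<le> qcard s + 1"
   using A2(5)
  proof (elim disjE)
   assume c: "h = r \<and> s2 rFND 0 = min (s1 rFND 0) t \<and> tau s2 j = tau s1 j \<and> leaf s2 = leaf s1 \<and> s2 rCNT 0 = s1 rCNT 0 \<and> s2 rVIS = s1 rVIS"
   have "sinv (tau s j) (leaf s) (s rVIS) (s rCNT 0) (ctr + 1) (min (s rFND 0) (tau s j v - 1 + wt e)) (insert e R) (tau s j v)"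
    by (rule relax_root[OF P]) (use c in \<open>simp add: h_def\<close>)
   thus ?thesis using c vq by (simp add: same1 t_def qcard_def)
  next
   assume c: "h \<noteq> r \<and> (h \<in> excl s0 l \<or> \<not> tst h t \<or> (0 < tau s1 j h \<and> tau s1 j h \<le> t + 1)) \<and>
     s2 rFND 0 = s1 rFND 0 \<and> tau s2 j = tau s1 j \<and> leaf s2 = leaf s1 \<and> s2 rCNT 0 = s1 rCNT 0 \<and> s2 rVIS = s1 rVIS"
   have "sinv (tau s j) (leaf s) (s rVIS) (s rCNT 0) (ctr + 1) (s rFND 0) (insert e R) (tau s j v)"
    by (rule relax_same[OF P]) (use c[unfolded same1 h_def t_def] in auto)
   thus ?thesis using c vq by (simp add: same1 qcard_def)
  next
   assume c: "h \<noteq> r \<and> h \<notin> excl s0 l \<and> tst h t \<and> \<not> (0 < tau s1 j h \<and> tau s1 j h \<le> t + 1) \<and>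
     s2 rFND 0 = s1 rFND 0 \<and> tau s2 j = (tau s1 j)(h := t + 1) \<and> leaf s2 = (leaf s1)(h := code t h) \<and>
     ((s2 rCNT 0 = s1 rCNT 0 \<and> s2 rVIS = s1 rVIS \<and> tau s1 j h \<noteq> 0) \<or> (s2 rCNT 0 = s1 rCNT 0 + 1 \<and> s2 rVIS = (s1 rVIS)(s1 rCNT 0 := h) \<and> tau s1 j h = 0))"
   have teq: "t + 1 = tau s j v + wt e" by (simp add: t_def)
   have a1: "h = dst d e" "h \<noteq> r" "h \<notin> excl s0 l" "tst h (tau s j v - 1 + wt e)" "tau s j h = 0 \<or> tau s j v + wt e < tau s j h"
    using c[unfolded same1] t0 teq h_def[symmetric] unfolding t_def[symmetric] by auto
   have a2: "(s2 rCNT 0 = s rCNT 0 \<and> s2 rVIS = s rVIS \<and> tau s j h \<noteq> 0) \<or> (s2 rCNT 0 = s rCNT 0 + 1 \<and> s2 rVIS = (s rVIS)(s rCNT 0 := h) \<and> tau s j h = 0)"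
    using c by (simp add: same1)
   note ri = relax_insert[OF P a1 a2]
   have s2: "tau s2 j = (tau s j)(h := tau s j v + wt e)" "leaf s2 = (leaf s)(h := code (tau s j v - 1 + wt e) h)" "s2 rFND 0 = s rFND 0"
    using c unfolding same1 teq by (simp_all add: t_def)
   have l0: "leaf s2 h \<noteq> 0" using ri(6) by (simp add: s2)
   have qc: "qcard s2 \<le> qcard s + 1" by (rule qcard_ins[OF s2(2)])
   have im: "0 < tau s j x \<and> leaf s x = 0" if "0 < tau s2 j x \<and> leaf s2 x = 0" for x
   proof -
    have "x \<noteq> h" using that l0 by blast
    thus ?thesis using that unfolding s2 by simp
   qed
   have sv': "sinv (tau s2 j) (leaf s2) (s2 rVIS) (s2 rCNT 0) (ctr + 1) (s2 rFND 0) (insert e R) (tau s j v)"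
    unfolding s2 by (rule ri(1))
   have tv: "tau s2 j v = tau s j v" "leaf s2 v = 0" unfolding s2 using ri(2) vq by simp_all
   show ?thesis using sv' tv im qc by blast
  qed
  have in3: "inner v (insert e R) s3" unfolding inner_def outer_def
  proof (intro conjI ballI allI impI)
   show "frame s3" unfolding s3_def using A2(1) by (intro frame_upd) auto
   show "sinv (tau s3 j) (leaf s3) (s3 rVIS) (s3 rCNT 0) (s3 rCTR 0) (s3 rFND 0) (insert e R) (tau s3 j v)"
    using key by (simp add: same3)
   show "s3 rTT 0 = tau s3 j v - 1" "s3 rVV 0 = v" "0 < tau s3 j v" "leaf s3 v = 0" "0 \<le> s3 rE 0" "s3 rE 0 \<le> m"
    "0 < s3 rE 0 ==> src d (s3 rE 0 - 1) = v"
    using key r2 vq p' e by (auto simp: same3)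
  next
   fix x assume "x \<in> insert e R" "src d x = v"
   moreover have "p \<le> x" if "x \<in> R" using I(1) that calculation by (auto simp: inner_def p_def)
   ultimately show "s3 rE 0 \<le> x" using p' by (auto simp: same3 e_def)
  next
   fix x assume x: "s3 rE 0 \<le> x \<and> x < m \<and> src d x = v"
   show "x \<in> insert e R"
   proof (cases "x < e")
    case True thus ?thesis using p'(4)[of x] x by (simp add: same3)
   next
    case False
    hence "x = e \<or> p \<le> x" by (auto simp: e_def)
    thus ?thesis using x I(1) by (auto simp: inner_def p_def)
   qed
  next
   assume "s3 rCTR 0 < X"
   hence "full (tau s j) (leaf s) R {v}" using I(1) X by (simp add: inner_def ctr_def)
   thus "full (tau s3 j) (leaf s3) (insert e R) {v}" using key by (simp add: full_def same3)
  qed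
  have pot3: "pot s3 + (41 + (k2 + 17)) + 12 \<le> pot s"
  proof -
   have "nat (X - ctr) = Suc (nat (X - (ctr + 1)))" using X by simp
   moreover have "qcard s3 \<le> qcard s + 1" using key by (simp add: qcard_def same3)
   hence "cE * qcard s3 \<le> cE * (qcard s + 1)" by (rule mult_le_mono2)
   moreover have "k2 + 70 \<le> cR" using A2(4) by (simp add: cR_def)
   ultimately show ?thesis unfolding pot_def same3 ctr_def[symmetric] by simp
  qed
  have p'M: "\<bar>p'\<bar> \<le> M" using p' e mM by linarith
  have ev2: "ev s2 (A rNXT (V rD .* V rM .+ (V rE .- N 1))) = p'"
   using frame_regs[OF A2(1)] r2 fr by (simp add: e_def p'_def)
  have c2: "cost (A rNXT (V rD .* V rM .+ (V rE .- N 1))) + 2 = 17" by simp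
  show "wp M (rE ::= A rNXT (V rD .* V rM .+ (V rE .- N 1)))
   (\<lambda>s' k. (\<exists>R. inner v R s') \<and> pot s' + (41 + (k2 + k)) + 12 \<le> pot s) s2"
   unfolding wp_Asg ev2 c2 s3_def[symmetric] using p'M pot3 in3 by blast
 next
  show "0 \<le> t" "t \<le> (m + 1) * W" using tb by auto
  show "0 \<le> s1 rCNT 0" "s1 rCNT 0 \<le> m + 1" using cnt X X1 by (simp_all add: same1)
 qed
 let ?Q = "\<lambda>s' k. (\<exists>R. inner v R s') \<and> pot s' + k + 12 \<le> pot s"
 have S1: "wp M (rCTR ::= V rCTR .+ N 1) (\<lambda>s' k. s' = upd s rCTR 0 (ctr + 1) \<and> k \<le> 10) s"
  using M by (simp add: ctr_def)
 have S2: "wp M (rH ::= A rDST (V rD .* V rM .+ (V rE .- N 1))) (\<lambda>s' k. s' = upd (upd s rCTR 0 (ctr + 1)) rH 0 h \<and> k \<le> 17) (upd s rCTR 0 (ctr + 1))"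
  using M D(1) fr by (simp add: p_def e_def)
 have S3: "wp M (rT2 ::= V rTT .+ A rWT (V rE .- N 1)) (\<lambda>s' k. s' = s1 \<and> k \<le> 14) (upd (upd s rCTR 0 (ctr + 1)) rH 0 h)"
  using M D(4) TT fr by (simp add: p_def e_def t_def s1_def)
 have S4: "wp M (relax;; rE ::= A rNXT (V rD .* V rM .+ (V rE .- N 1))) (\<lambda>s' k. ?Q s' (41 + k)) s1"
  unfolding wp_Sq by (rule A)
 have ar: "a + (41 + k) + 12 \<le> (P :: nat) ==> k1 \<le> 10 ==> k2 \<le> 17 ==> k3 \<le> 14 ==> a + (k1 + (k2 + (k3 + k))) + 12 \<le> P"
  for a k P k1 k2 k3 by simp
 have S5: "wp M (relax;; rE ::= A rNXT (V rD .* V rM .+ (V rE .- N 1))) (\<lambda>s' k. ?Q s' (k1 + (k2 + (k3 + k)))) s1"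
  if "k1 \<le> 10" "k2 \<le> 17" "k3 \<le> 14" for k1 k2 k3
 proof (rule wp_mono[OF S4])
  fix s' k assume q: "?Q s' (41 + k)"
  show "?Q s' (k1 + (k2 + (k3 + k)))"
   by (rule conjI[OF conjunct1[OF q] ar[OF conjunct2[OF q] that]])
 qed
 show ?thesis unfolding expand_edge_def
  by (rule wp_chain[OF S1], rule wp_chain[OF S2], rule wp_chain[OF S3], rule S5)
qed

end

context searching begin

text \<open>If fewer than \<open>X\<close> edges leave the labelled vertices, the counter cannot
  have reached \<open>X\<close>. Then the truncation had no effect, and the queue ran empty with all
  these edges relaxed.\<close>

definition search_done :: "(int => int) => (int => int) => int => int => bool" where
 "search_done \<tau> vis cnt fnd \<longleftrightarrow> label_ok \<tau> (m + 1) \<and> vis_ok \<tau> vis cnt \<and> 1 \<le> cnt \<and> cnt \<le> X + 1 \<and> found_ok fnd \<and>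
   (vol d {v. 0 < \<tau> v} < nat X --> (\<forall>e. 0 \<le> e \<and> e < m \<and> 0 < \<tau> (src d e) --> relaxed \<tau> fnd e))"

lemma search_doneI:
 assumes s: "sinv \<tau> q vis cnt ctr fnd R t" and f: "ctr < X ==> full \<tau> q R {}" and q: "\<And>v. 0 \<le> v ==> v < n ==> q v = 0"
 shows "search_done \<tau> vis cnt fnd"
 unfolding search_done_def
proof (intro conjI impI allI)
 have R: "R \<subseteq> {0..<m}" "ctr = int (card R)" "ctr \<le> X" and r: "\<And>e. e \<in> R ==> 0 < \<tau> (src d e) \<and> relaxed \<tau> fnd e"
  using s unfolding sinv_def by blast+
 have l: "label_ok \<tau> ctr" using s unfolding sinv_def by blast
 have *: "x \<le> ctr * W ==> x \<le> (m + 1) * W" for x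
  using mult_right_mono[of ctr "m + 1" W] R X1 W1 by linarith
 show "label_ok \<tau> (m + 1)" using l * unfolding label_ok_def by blast
 show "vis_ok \<tau> vis cnt" "1 \<le> cnt" "cnt \<le> X + 1" "found_ok fnd" using s unfolding sinv_def by auto
 fix e assume v: "vol d {v. 0 < \<tau> v} < nat X" and e: "0 \<le> e \<and> e < m \<and> 0 < \<tau> (src d e)"
 have "card R \<le> vol d {v. 0 < \<tau> v}"
  unfolding vol_def using R r by (intro card_mono finite_edges) fastforce
 hence "ctr < X" using v R by linarith
 from f[OF this] have "e \<in> R" using e q[of "src d e"] src_range[of e d] by (auto simp: full_def)
 thus "relaxed \<tau> fnd e" using r by simp
qed

end

context prog_search begin

lemma wp_expand:
 assumes o: "outer R (tau s j v) s" and B: "bnd M s" and v: "0 \<le> v" "v < n" "0 < tau s j v" "leaf s v = 0"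
  and regs: "s rTT 0 = tau s j v - 1" "s rVV 0 = v"
  and f: "s rCTR 0 < X ==> full (tau s j) (leaf s) R {v}" and nR: "\<And>e. e \<in> R ==> src d e \<noteq> v"
  and Q: "\<And>s' k R t. outer R t s' ==> bnd M s' ==> (s' rCTR 0 < X ==> full (tau s' j) (leaf s') R {}) ==> pot s' + k \<le> pot s + 30 ==> Q s' k"
 shows "wp M expand Q s"
proof -
 have fr0: "frame s" using o by (simp add: outer_def)
 note fr = frame_regs[OF fr0]
 define p where "p = s rFST (d * n + v)"
 define s1 where "s1 = upd s rE 0 p"
 have p: "isnx d v m p" using cst_frame[OF fr0] d01 v by (auto simp: cst_def p_def)
 have pM: "\<bar>p\<bar> \<le> M" using p mM by (simp add: isnx_def)
 have same: "tau s1 j = tau s j" "leaf s1 = leaf s" "s1 rCNT = s rCNT" "s1 rVIS = s rVIS" "s1 rFND = s rFND"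
  "s1 rCTR = s rCTR" "s1 rTT = s rTT" "s1 rVV = s rVV" "s1 rE 0 = p"
  by (auto simp: s1_def tau_def leaf_def fun_eq_iff)
 have b1: "bnd M s1" unfolding s1_def using B pM by (rule bnd_upd)
 have f1: "frame s1" unfolding s1_def using fr0 by (intro frame_upd) auto
 have I1: "inner v R s1"
  unfolding inner_def outer_def same
  using o p v regs nR f by (auto simp: f1 outer_def isnx_def)
 have pot1: "pot s1 = pot s" by (simp add: pot_def same qcard_def)
 let ?e = "(N 0 .< V rE) .* (V rCTR .< V rX)"
 have loop: "wp M (Whl ?e expand_edge) (\<lambda>s' k. Q s' (15 + k)) s1"
 proof (rule wp_While[where Inv = "\<lambda>s. \<exists>R. inner v R s" and \<Phi> = pot])
  show "\<exists>R. inner v R s1" using I1 by blast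
  show "bnd M s1" by (rule b1)
 next
  fix s' assume I: "\<exists>R. inner v R s'" "bnd M s'" "ev s' ?e \<noteq> 0"
  then obtain R where R: "inner v R s'" by blast
  have "frame s'" using R by (simp add: inner_def outer_def)
  hence g: "0 < s' rE 0" "s' rCTR 0 < X" using I(3) frame_regs(5)[of s'] by (auto split: if_splits)
  have c: "cost ?e + 1 = 11" by simp
  show "wp M expand_edge (\<lambda>s'' k. (\<exists>R. inner v R s'') \<and> pot s'' + k + cost ?e + 1 \<le> pot s') s'"
   unfolding add.assoc c by (rule wp_mono[OF wp_expand_step[OF R I(2) v(1,2) g]]) simp
 next
  fix s' k assume I: "\<exists>R. inner v R s'" "bnd M s'" "ev s' ?e = 0" "pot s' + k \<le> pot s1 + cost ?e + 1"
  then obtain R where R: "inner v R s'" by blast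
  have fr': "frame s'" using R by (simp add: inner_def outer_def)
  have g: "s' rE 0 \<le> 0 \<or> X \<le> s' rCTR 0" using I(3) frame_regs(5)[OF fr'] by (auto split: if_splits)
  show "Q s' (15 + k)"
  proof (rule Q)
   show "outer R (tau s' j v) s'" using R by (simp add: inner_def)
   show "pot s' + (15 + k) \<le> pot s + 30" using I(4) pot1 by simp
   assume "s' rCTR 0 < X"
   hence "s' rE 0 \<le> 0" and fu: "full (tau s' j) (leaf s') R {v}" using g R by (auto simp: inner_def)
   hence "e \<in> R" if "0 \<le> e" "e < m" "src d e = v" for e using R that by (auto simp: inner_def)
   thus "full (tau s' j) (leaf s') R {}" using fu unfolding full_def by blast
  qed (rule I)
 qed
 have S1: "wp M (rE ::= A rFST (V rD .* V rN .+ V rVV)) (\<lambda>s' k. s' = s1 \<and> k = 15) s"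
  using pM regs by (simp add: fr(4,6) p_def s1_def)
 show ?thesis unfolding expand_def
  by (rule wp_seqI[OF S1]) (use loop in simp)
qed

lemma seg_tree_root_ge:
 assumes "seg_tree n f" "1 \<le> i" "i < 2 * n"
 shows "f i \<le> f 1"
 using assms(2,3)
proof (induction "nat i" arbitrary: i rule: less_induct)
 case less
 show ?case
 proof (cases "i = 1")
  case False
  hence i: "1 \<le> i div 2" "i div 2 < n" "nat (i div 2) < nat i" using less.prems by auto
  have "f i \<le> f (i div 2)"
   using assms(1) i unfolding seg_tree_def seg_node_def
   by (metis (no_types, opaque_lifting) div_mult_mod_eq max.cobounded1 max.cobounded2 mult.commute not_mod_2_eq_1_eq_0 add.right_neutral)
  also have "\<dots> \<le> f 1" using less.hyps[of "i div 2"] i less.prems by auto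
  finally show ?thesis .
 qed simp
qed

lemma seg_tree_root_ex:
 assumes "seg_tree n f" shows "\<exists>v. 0 \<le> v \<and> v < n \<and> f (n + v) = f 1"
proof -
 have "\<exists>v. 0 \<le> v \<and> v < n \<and> f (n + v) = f i" if "1 \<le> i" "i < 2 * n" for i
  using that
 proof (induction "nat (2 * n - i)" arbitrary: i rule: less_induct)
  case less
  show ?case
  proof (cases "i < n")
   case False
   thus ?thesis using less.prems by (intro exI[of _ "i - n"]) auto
  next
   case True
   hence "f i = f (2 * i) \<or> f i = f (2 * i + 1)"
    using assms less.prems unfolding seg_tree_def seg_node_def by (auto simp: max_def)
   moreover have "\<exists>v. 0 \<le> v \<and> v < n \<and> f (n + v) = f (2 * i)" using less.hyps[of "2 * i"] less.prems True by auto
   moreover have "\<exists>v. 0 \<le> v \<and> v < n \<and> f (n + v) = f (2 * i + 1)" using less.hyps[of "2 * i + 1"] less.prems True by auto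
   ultimately show ?thesis by metis
  qed
 qed
 from this[of 1] show ?thesis using n2 by auto
qed

lemma wp_extract:
 assumes I: "outer R t s" "bnd M s" "s rCTR 0 < X ==> full (tau s j) (leaf s) R {}" and g: "0 < s rSEG 1"
  and Q: "\<And>s' k R t. outer R t s' ==> bnd M s' ==> (s' rCTR 0 < X ==> full (tau s' j) (leaf s') R {}) ==> pot s' + k + 10 \<le> pot s ==> Q s' k"
 shows "wp M extract_min Q s"
proof -
 have f: "frame s" and sv: "sinv (tau s j) (leaf s) (s rVIS) (s rCNT 0) (s rCTR 0) (s rFND 0) R t"
  using I(1) unfolding outer_def by blast+
 have tree: "seg_tree n (s rSEG)" using f by (simp add: frame_def)
 note fr = frame_regs[OF f]
 obtain v where v: "0 \<le> v" "v < n" "s rSEG (n + v) = s rSEG 1" using seg_tree_root_ex[OF tree] by blast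
 have lv: "leaf s v = s rSEG 1" "leaf s v \<noteq> 0" using v g by (auto simp: leaf_def)
 have mx: "leaf s x \<le> leaf s v" if "0 \<le> x" "x < n" for x
  using seg_tree_root_ge[OF tree, of "n + x"] that n2 by (simp add: leaf_def lv(1)[unfolded leaf_def] v)
 note ex = sinv_extract[OF sv I(3) v(1,2) lv(2) mx]
 have root: "BC - s rSEG 1 = (tau s j v - 1) * n + v" using ex(4) lv by (simp add: code_def)
 have tt: "(BC - s rSEG 1) div n = tau s j v - 1" unfolding root using v n2 by simp
 have vv: "BC - s rSEG 1 - (tau s j v - 1) * n = v" using root by simp
 define s1 where "s1 = upd (upd s rTT 0 (tau s j v - 1)) rVV 0 v"
 have tM: "\<bar>tau s j v - 1\<bar> \<le> M"
 proof -
  have "(m + 1) * W \<le> (m + 2) * W" using W1 by (simp add: algebra_simps)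
  thus ?thesis using ex(3,5) BIGl BIGM by linarith
 qed
 have vM: "\<bar>v\<bar> \<le> M" using v nM by linarith
 have b1: "bnd M s1" unfolding s1_def by (intro bnd_upd I tM vM)
 have f1: "frame s1" unfolding s1_def using f by (auto intro!: frame_upd simp del: upd_apply)
 have S1: "wp M (rTT ::= (V rBC .- A rSEG (N 1)) .div V rN) (\<lambda>s' k. s' = upd s rTT 0 (tau s j v - 1) \<and> k \<le> 20) s"
  using tM by (simp add: fr(6,10) tt)
 have S2: "wp M (rVV ::= (V rBC .- A rSEG (N 1)) .- V rTT .* V rN) (\<lambda>s' k. s' = s1 \<and> k \<le> 20) (upd s rTT 0 (tau s j v - 1))"
  using vM by (simp add: fr(6,10) vv s1_def)
 have S3: "wp M (segu (V rVV) (N 0)) (\<lambda>s' k. frame s' \<and> agree {rI, rSEG} s1 s' \<and> leaf s' = (leaf s)(v := 0) \<and> k \<le> 100 * b + 100 \<and> bnd M s') s1"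
 proof (rule wp_segu[where n = n and b = b and x = v and y = 0])
  fix s' k assume A: "agree {rI, rSEG} s1 s'" "seg_tree n (s' rSEG)"
   "\<And>i. n \<le> i ==> s' rSEG i = (if i = n + v then 0 else s1 rSEG i)" "k \<le> 100 * b + 100" "bnd M s'"
  have "s1 rSEG = s rSEG" by (simp add: s1_def)
  hence "leaf s' = (leaf s)(v := 0)" using A(3) v by (auto simp: leaf_def fun_eq_iff)
  thus "frame s' \<and> agree {rI, rSEG} s1 s' \<and> leaf s' = (leaf s)(v := 0) \<and> k \<le> 100 * b + 100 \<and> bnd M s'"
   using A frame_segu[OF f1 A(1,2)] by blast
 qed (use frame_regs[OF f1] n2 nb nM b1 f1 v M64 in \<open>auto simp: frame_def s1_def\<close>)
 have main: "wp M expand (\<lambda>s' k. Q s' (k1 + (k2 + (k3 + k)))) s2"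
  if s2: "frame s2" "agree {rI, rSEG} s1 s2" "leaf s2 = (leaf s)(v := 0)" "k3 \<le> 100 * b + 100" "bnd M s2" and k: "k1 \<le> 20" "k2 \<le> 20" for s2 k1 k2 k3
 proof -
  have same: "tau s2 j = tau s j" "s2 rCNT = s rCNT" "s2 rVIS = s rVIS" "s2 rFND = s rFND" "s2 rCTR = s rCTR"
   using s2(2) by (auto simp: agree_def s1_def tau_def fun_eq_iff)
  have rg: "s2 rTT 0 = tau s j v - 1" "s2 rVV 0 = v" using s2(2) by (auto simp: agree_def s1_def)
  have "{x. 0 \<le> x \<and> x < n \<and> leaf s2 x \<noteq> 0} = {x. 0 \<le> x \<and> x < n \<and> leaf s x \<noteq> 0} - {v}"
   using v lv by (auto simp: s2(3))
  hence qc: "qcard s = qcard s2 + 1" unfolding qcard_def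
   using v lv card.remove[of "{x. 0 \<le> x \<and> x < n \<and> leaf s x \<noteq> 0}" v] by (simp add: finite_q)
  have pot: "pot s = pot s2 + cE" unfolding pot_def same qc by simp
  show ?thesis
  proof (rule wp_expand[where R = R and v = v])
   show "outer R (tau s2 j v) s2" unfolding outer_def same s2(3) using ex(1) s2(1) by blast
   show "s2 rCTR 0 < X ==> full (tau s2 j) (leaf s2) R {v}" unfolding same s2(3) by (rule ex(2))
  next
   fix s' k R t assume A: "outer R t s'" "bnd M s'" "s' rCTR 0 < X ==> full (tau s' j) (leaf s') R {}" "pot s' + k \<le> pot s2 + 30"
   show "Q s' (k1 + (k2 + (k3 + k)))"
    by (rule Q[OF A(1-3)]) (use A(4) pot k s2(4) in \<open>auto simp: cE_def\<close>)
  qed (use s2 v ex rg same in auto)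
 qed
 show ?thesis
  apply (rule wp_chain[OF S1], rule wp_chain[OF S2], rule wp_seqI[OF S3], elim conjE)
  apply (rule main; assumption)
  done
qed

definition search_cost :: nat where "search_cost = (cR + cE) * (nat X + 3)"

lemma wp_search:
 assumes Q: "\<And>s' k. frame s' ==> bnd M s' ==> (\<And>v. 0 \<le> v ==> v < n ==> leaf s' v = 0) ==>
   search_done (tau s' j) (s' rVIS) (s' rCNT 0) (s' rFND 0) ==> k \<le> search_cost ==> Q s' k"
 shows "wp M search Q s0"
proof -
 have f0: "frame s0" by (simp add: frame_def tree0)
 define s1 where "s1 = upd (upd (upd (upd (upd s0 rCNT 0 1) rCTR 0 0) rFND 0 BIG) rT (j * n + r) 1) rVIS 0 r"
 have fa: "frame (upd (upd (upd s0 rCNT 0 1) rCTR 0 0) rFND 0 BIG)" using f0 by (intro frame_upd) auto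
 have "agree srch s0 (upd (upd (upd (upd s0 rCNT 0 1) rCTR 0 0) rFND 0 BIG) rT (j * n + r) 1)"
  by (rule agree_upd) (use fa in \<open>simp_all add: frame_def\<close>)
 hence "frame (upd (upd (upd (upd s0 rCNT 0 1) rCTR 0 0) rFND 0 BIG) rT (j * n + r) 1)"
  using fa r by (auto simp: frame_def)
 hence f1: "frame s1" unfolding s1_def by (rule frame_upd) auto
 have "1 * 1 \<le> (m + 2) * W" using W1 m1 by (intro mult_mono) auto
 hence B: "0 < BIG" "\<bar>BIG\<bar> \<le> M" "\<bar>r\<bar> \<le> M" using BIGl BIGM r nM by linarith+
 have b1: "bnd M s1" unfolding s1_def using M64 B by (intro bnd_upd bnd0) auto
 have "r \<le> n" "0 * 1 \<le> ((m + 2) * W + 2) * n" using r W1 m1 n2 by (auto intro!: mult_mono)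
 moreover have "1 * n \<le> ((m + 2) * W + 2) * n" using W1 m1 n2 by (intro mult_right_mono) auto
 ultimately have "n \<le> BC" using BCl by linarith
 hence co: "0 \<le> code 0 r" "code 0 r \<le> BC" using r by (auto simp: code_def)
 note fr0 = frame_regs[OF f0] and fr1 = frame_regs[OF f1]
 have S1: "wp M (rCNT ::= N 1) (\<lambda>s' k. s' = upd s0 rCNT 0 1 \<and> k \<le> 3) s0" using M64 by simp
 have S2: "wp M (rCTR ::= N 0) (\<lambda>s' k. s' = upd (upd s0 rCNT 0 1) rCTR 0 0 \<and> k \<le> 3) (upd s0 rCNT 0 1)" using M64 by simp
 have S3: "wp M (rFND ::= V rBIG) (\<lambda>s' k. s' = upd (upd (upd s0 rCNT 0 1) rCTR 0 0) rFND 0 BIG \<and> k \<le> 5) (upd (upd s0 rCNT 0 1) rCTR 0 0)"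
  using B fr0 by simp
 have S4: "wp M (Put rT (V rJ .* V rN .+ V rR) (N 1)) (\<lambda>s' k. s' = upd (upd (upd (upd s0 rCNT 0 1) rCTR 0 0) rFND 0 BIG) rT (j * n + r) 1 \<and> k \<le> 20)
   (upd (upd (upd s0 rCNT 0 1) rCTR 0 0) rFND 0 BIG)" using M64 fr0(1,2,6) by simp
 have S5: "wp M (Put rVIS (N 0) (V rR)) (\<lambda>s' k. s' = s1 \<and> k \<le> 20) (upd (upd (upd (upd s0 rCNT 0 1) rCTR 0 0) rFND 0 BIG) rT (j * n + r) 1)"
  using B fr0(2) by (simp add: s1_def)
 have S6: "wp M (segu (V rR) (V rBC .- V rR)) (\<lambda>s' k. frame s' \<and> agree {rI, rSEG} s1 s' \<and> leaf s' = (leaf s0)(r := code 0 r) \<and> k \<le> 100 * b + 100 \<and> bnd M s') s1"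
 proof (rule wp_segu[where n = n and b = b and x = r and y = "code 0 r"])
  fix s' assume "agree {rI} s1 s'" thus "ev s' (V rBC .- V rR) = code 0 r" using fr1 by (simp add: agree_def code_def)
 next
  fix s' k assume A: "agree {rI, rSEG} s1 s'" "seg_tree n (s' rSEG)"
   "\<And>i. n \<le> i ==> s' rSEG i = (if i = n + r then code 0 r else s1 rSEG i)" "k \<le> 100 * b + 100" "bnd M s'"
  have "s1 rSEG = s0 rSEG" by (simp add: s1_def)
  hence "leaf s' = (leaf s0)(r := code 0 r)" using A(3) r by (auto simp: leaf_def fun_eq_iff)
  thus "frame s' \<and> agree {rI, rSEG} s1 s' \<and> leaf s' = (leaf s0)(r := code 0 r) \<and> k \<le> 100 * b + 100 \<and> bnd M s'"
   using A frame_segu[OF f1 A(1,2)] by blast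
 qed (use fr1 n2 nb nM b1 f1 r co BCM in \<open>auto simp: frame_def\<close>)
 let ?e = "N 0 .< A rSEG (N 1)"
 let ?Inv = "\<lambda>s. \<exists>R t. outer R t s \<and> (s rCTR 0 < X --> full (tau s j) (leaf s) R {})"
 have loop: "wp M (Whl ?e extract_min) (\<lambda>s' k. Q s' (k1 + (k2 + (k3 + (k4 + (k5 + (k6 + k))))))) s2"
  if s2: "frame s2" "agree {rI, rSEG} s1 s2" "leaf s2 = (leaf s0)(r := code 0 r)" "k6 \<le> 100 * b + 100" "bnd M s2"
   and k: "k1 \<le> 3" "k2 \<le> 3" "k3 \<le> 5" "k4 \<le> 20" "k5 \<le> 20" for s2 k1 k2 k3 k4 k5 k6
 proof (rule wp_While[where Inv = ?Inv and \<Phi> = pot])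
  have regs: "s2 rCNT 0 = 1" "s2 rCTR 0 = 0" "s2 rFND 0 = BIG" "s2 rVIS 0 = r"
   using s2(2) by (auto simp: agree_def s1_def)
  have T: "s2 rT = s1 rT" using s2(2) by (auto simp: agree_def)
  have t: "tau s2 j r = 1" "\<And>v. 0 \<le> v ==> v < n ==> v \<noteq> r ==> tau s2 j v = 0"
   using row0 by (auto simp: tau_def T s1_def)
  have l: "leaf s2 r = code 0 r" "\<And>v. 0 \<le> v ==> v < n ==> v \<noteq> r ==> leaf s2 v = 0"
   using leaf0 by (auto simp: s2(3))
  from sinv_init[where \<tau> = "tau s2 j" and q = "leaf s2" and vis = "s2 rVIS", OF t l regs(4)] s2(1) show "?Inv s2" unfolding outer_def regs by blast
  show "bnd M s2" by (rule s2)
  fix s' k assume I: "?Inv s'" "bnd M s'" "ev s' ?e = 0" "pot s' + k \<le> pot s2 + cost ?e + 1"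
  then obtain R t where R: "frame s'" "sinv (tau s' j) (leaf s') (s' rVIS) (s' rCNT 0) (s' rCTR 0) (s' rFND 0) R t"
   "s' rCTR 0 < X ==> full (tau s' j) (leaf s') R {}" unfolding outer_def by blast
  have lab: "label_ok (tau s' j) (s' rCTR 0)" "queue_ok (tau s' j) (leaf s')" "s' rCTR 0 \<le> X" using R(2) unfolding sinv_def by blast+
  \<comment> \<open>Keys are 0 or positive, so a root of the tree that is not positive forces every
    leaf to be 0.\<close>
  have z: "leaf s' v = 0" if v: "0 \<le> v" "v < n" for v
  proof (rule ccontr)
   assume nz: "leaf s' v \<noteq> 0"
   have "seg_tree n (s' rSEG)" using R(1) by (simp add: frame_def)
   from seg_tree_root_ge[OF this, of "n + v"] have "leaf s' v \<le> 0" using v n2 I(3) by (auto simp: leaf_def split: if_splits)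
   moreover have "0 < leaf s' v" using lab(2) nz v code_pos(1)[OF lab(1,3), of v] unfolding queue_ok_def by auto
   ultimately show False by simp
  qed
  have q2: "qcard s2 \<le> 1"
  proof -
   have "{v. 0 \<le> v \<and> v < n \<and> leaf s2 v \<noteq> 0} \<subseteq> {r}" using l by blast
   thus ?thesis unfolding qcard_def using card_mono[of "{r}"] by fastforce
  qed
  show "Q s' (k1 + (k2 + (k3 + (k4 + (k5 + (k6 + k))))))"
  proof (rule Q[OF R(1) I(2) z])
   show "search_done (tau s' j) (s' rVIS) (s' rCNT 0) (s' rFND 0)" by (rule search_doneI[OF R(2,3) z])
   have "pot s2 \<le> (cR + cE) * nat X + cE * 1" unfolding pot_def regs using q2 by (intro add_mono mult_le_mono2) auto
   moreover have "cost ?e + 1 = 9" by simp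
   ultimately have "k \<le> (cR + cE) * nat X + cE + 9" using I(4) by linarith
   thus "k1 + (k2 + (k3 + (k4 + (k5 + (k6 + k))))) \<le> search_cost"
    using k s2(4) by (simp add: search_cost_def cE_def cR_def algebra_simps)
  qed
 next
  fix s' assume I: "?Inv s'" "bnd M s'" "ev s' ?e \<noteq> 0"
  then obtain R t where R: "outer R t s'" "s' rCTR 0 < X ==> full (tau s' j) (leaf s') R {}" by blast
  have g: "0 < s' rSEG 1" using I(3) by (auto split: if_splits)
  have c: "cost ?e + 1 = 9" by simp
  show "wp M extract_min (\<lambda>s'' k. ?Inv s'' \<and> pot s'' + k + cost ?e + 1 \<le> pot s') s'"
  proof (rule wp_extract[OF R(1) I(2) R(2) g])
   fix s'' k R t assume A: "outer R t s''" "s'' rCTR 0 < X ==> full (tau s'' j) (leaf s'') R {}" "pot s'' + k + 10 \<le> pot s'"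
   have "pot s'' + k + cost ?e + 1 \<le> pot s'" unfolding add.assoc c using A(3) by linarith
   thus "?Inv s'' \<and> pot s'' + k + cost ?e + 1 \<le> pot s'" using A(1,2) by blast
  qed
 qed
 show ?thesis unfolding search_def
  apply (rule wp_chain[OF S1], rule wp_chain[OF S2], rule wp_chain[OF S3], rule wp_chain[OF S4], rule wp_chain[OF S5], rule wp_seqI[OF S6], elim conjE)
  apply (rule loop; assumption)
  done
qed

end

section \<open>Recording a search\<close>

lemma wp_chainQ: "wp M c (\<lambda>s' k. P s' \<and> k \<le> a) s ==> (\<And>s1 k1. P s1 ==> k1 \<le> a ==> wp M d (\<lambda>s2 k2. Q s2 (k1 + k2)) s1) ==> wp M (Sq c d) Q s"
 by (rule wp_seqI, assumption) blast

context prog begin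

definition lst :: "st => int => int list" where
 "lst s L = map (\<lambda>a. s rLI (L * K + int a)) [0..<nat (s rLC L)]"

definition okp :: "st => int => int => int => int => int => bool" where
 "okp s p x y t c \<longleftrightarrow> 0 < tau s p x \<and> 4 * (tau s p x + t) < 4 * tau s p y + c"

lemma passes_lst:
 assumes "s rN 0 = n" "s rK 0 = K"
 shows "passes s L x y t th \<longleftrightarrow> (\<forall>p\<in>set (lst s L). okp s p x y t (th p))"
proof -
 have "(\<forall>a. 0 \<le> a \<and> a < s rLC L --> P (s rLI (L * K + a))) \<longleftrightarrow> (\<forall>p\<in>set (lst s L). P p)" for P
 proof
  assume h: "\<forall>a. 0 \<le> a \<and> a < s rLC L --> P (s rLI (L * K + a))"
  show "\<forall>p\<in>set (lst s L). P p" using h by (auto simp: lst_def)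
 next
  assume h: "\<forall>p\<in>set (lst s L). P p"
  show "\<forall>a. 0 \<le> a \<and> a < s rLC L --> P (s rLI (L * K + a))"
  proof (intro allI impI)
   fix a assume a: "0 \<le> a \<and> a < s rLC L"
   hence "s rLI (L * K + a) \<in> set (lst s L)" unfolding lst_def by (auto intro!: image_eqI[of _ _ "nat a"])
   thus "P (s rLI (L * K + a))" using h by blast
  qed
 qed
 from this[of "\<lambda>p. okp s p x y t (th p)"] show ?thesis
  unfolding passes_def assms Let_def okp_def tau_def by simp
qed

lemma lst_cong:
 assumes "s' rLC L = s rLC L" "\<And>a. 0 \<le> a ==> a < s rLC L ==> s' rLI (L * K + a) = s rLI (L * K + a)"
 shows "lst s' L = lst s L"
 unfolding lst_def using assms by auto

lemma lst_append:
 assumes "\<And>L. 0 \<le> s rLC L \<and> s rLC L \<le> K" "s rLC L < K"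
 shows "lst (upd (upd s rLI (L * K + s rLC L) x) rLC L (s rLC L + 1)) L' = (if L' = L then lst s L @ [x] else lst s L')"
proof (cases "L' = L")
 case True
 have "nat (s rLC L + 1) = Suc (nat (s rLC L))" using assms(1)[of L] by (simp add: Suc_nat_eq_nat_zadd1 add.commute)
 thus ?thesis using True assms(1)[of L] by (auto simp: lst_def)
next
 case False
 \<comment> \<open>Lists are stored in blocks of \<open>K\<close> cells, and an index below
   \<open>K\<close> never leaves its block.\<close>
 have "L' * K + a \<noteq> L * K + s rLC L" if "0 \<le> a" "a < s rLC L'" for a
 proof
  assume "L' * K + a = L * K + s rLC L"
  hence "(L' * K + a) div K = (L * K + s rLC L) div K" by simp
  thus False using False that assms(1)[of L] assms(1)[of L'] assms(2) K1 by simp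
 qed
 hence "lst (upd (upd s rLI (L * K + s rLC L) x) rLC L (s rLC L + 1)) L' = lst s L'"
  using False by (intro lst_cong) auto
 thus ?thesis using False by simp
qed

definition appc :: "st => int => int => int => int => bool" where
 "appc s j l r u \<longleftrightarrow> 0 < tau s j u \<and>
   (\<forall>p\<in>set (lst s (l * n + r)). okp s p u r (tau s j u - 1) (s rG (l - 1))) \<and>
   (\<forall>p\<in>set (lst s ((l + 1) * n + u)). okp s p r u (tau s j u - 1) (s rC2 p)) \<and> length (lst s ((l + 1) * n + u)) < nat K"

abbreviation (input) "apr \<equiv> {rI2, rU, rTT, rOK, rA, rP, rLI, rLC}"

lemma length_lst: "length (lst s L) = nat (s rLC L)"
 by (simp add: lst_def)

lemma lst_set: "p \<in> set (lst s L) ==> lists_ok s j ==> 0 \<le> p \<and> p < j"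
 by (auto simp: lst_def lists_ok_def)

context
 fixes s0 :: st and j r l cnt :: int
 assumes B0: "bnd M s0" and regs: "s0 rJ 0 = j" "s0 rR 0 = r" "s0 rST 0 = l" "s0 rN 0 = n" "s0 rK 0 = K" "s0 rCNT 0 = cnt"
  and j: "0 \<le> j" "j \<le> M" and r: "0 \<le> r" "r < n" and lists: "lists_ok s0 j"
  and cnt: "0 \<le> cnt" "cnt \<le> M"
  and vis: "\<And>i. 0 \<le> i ==> i < cnt ==> 0 \<le> s0 rVIS i \<and> s0 rVIS i < n \<and> 0 < tau s0 j (s0 rVIS i)" "inj_on (s0 rVIS) {0..<cnt}"
begin

definition appinv :: "int => st => bool" where
 "appinv i s \<longleftrightarrow> agree apr s0 s \<and> s rI2 0 = i \<and> 0 \<le> i \<and> i \<le> cnt \<and> lists_ok s (j + 1) \<and>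
   (\<forall>L. lst s L = (if \<exists>u. u \<in> s0 rVIS ` {0..<i} \<and> L = (l + 1) * n + u \<and> appc s0 j l r u then lst s0 L @ [j] else lst s0 L))"

lemma wp_append_step:
 assumes I: "appinv i s" "bnd M s" "i < cnt"
 shows "wp M append_vertex (\<lambda>s' k. appinv (i + 1) s' \<and> k \<le> 800 * nat K + 500) s"
proof -
 have ag: "agree apr s0 s" and i: "s rI2 0 = i" "0 \<le> i" and lo: "lists_ok s (j + 1)"
  and ls: "\<And>L. lst s L = (if \<exists>u. u \<in> s0 rVIS ` {0..<i} \<and> L = (l + 1) * n + u \<and> appc s0 j l r u then lst s0 L @ [j] else lst s0 L)"
  using I(1) unfolding appinv_def by blast+
 define u where "u = s0 rVIS i"
 define t where "t = tau s0 j u - 1"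
 have u: "0 \<le> u" "u < n" "0 < tau s0 j u" using vis(1)[OF i(2) I(3)] by (auto simp: u_def)
 \<comment> \<open>\<open>rVIS\<close> lists each vertex once, so within this row the list of
   \<open>u\<close> is still the one of \<open>s0\<close>.\<close>
 have uni: "u \<notin> s0 rVIS ` {0..<i}"
 proof
  assume "u \<in> s0 rVIS ` {0..<i}"
  then obtain i' where "0 \<le> i'" "i' < i" "s0 rVIS i' = s0 rVIS i" by (auto simp: u_def)
  thus False using vis(2) I(3) i(2) unfolding inj_on_def by fastforce
 qed
 have sr: "s rJ = s0 rJ" "s rR = s0 rR" "s rST = s0 rST" "s rN = s0 rN" "s rK = s0 rK" "s rCNT = s0 rCNT" "s rVIS = s0 rVIS"
  "s rT = s0 rT" "s rG = s0 rG" "s rC2 = s0 rC2" using ag by (auto simp: agree_def)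
 have tq: "tau s = tau s0" by (simp add: tau_def sr fun_eq_iff)
 have uM: "\<bar>u\<bar> \<le> M" using u nM by linarith
 have tM: "\<bar>t\<bar> \<le> M"
 proof -
  have "\<bar>tau s0 j u\<bar> \<le> M" using B0 by (simp add: bnd_def tau_def)
  thus ?thesis using u by (simp add: t_def)
 qed
 define L where "L = (l + 1) * n + u"
 define s2 where "s2 = upd (upd s rU 0 u) rTT 0 t"
 define s3 where "s3 = upd s2 rOK 0 1"
 have ag3: "agree apr s0 s3" unfolding s3_def s2_def using ag by (auto intro!: agree_upd simp del: upd_apply)
 have b3: "bnd M s3" unfolding s3_def s2_def using I(2) uM tM M64 by (auto intro!: bnd_upd simp del: upd_apply)
 have ls3: "s3 rLC = s rLC" "s3 rLI = s rLI" by (simp_all add: s3_def s2_def)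
 have S1: "wp M (rU ::= A rVIS (V rI2)) (\<lambda>s' k. s' = upd s rU 0 u \<and> k \<le> 20) s"
  using uM by (simp add: i sr u_def)
 have S2: "wp M (rTT ::= A rT (V rJ .* V rN .+ V rU) .- N 1) (\<lambda>s' k. s' = s2 \<and> k \<le> 30) (upd s rU 0 u)"
  using tM by (simp add: sr regs s2_def t_def tau_def)
 have S3: "wp M (rOK ::= N 1) (\<lambda>s' k. s' = s3 \<and> k \<le> 3) s2" using M64 by (simp add: s3_def)
 have lcb: "0 \<le> s rLC L \<and> s rLC L \<le> int (nat K)" for L using lo K1 by (simp add: lists_ok_def)
 have r3: "s3 rU 0 = u" "s3 rTT 0 = t" "s3 rOK 0 = 1" by (simp_all add: s3_def s2_def)
 \<comment> \<open>Entries go to lists of level \<open>l + 1\<close>; the list of the root has level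
   \<open>l\<close>.\<close>
 have l1: "lst s (l * n + r) = lst s0 (l * n + r)"
 proof -
  have "l * n + r \<noteq> (l + 1) * n + u'" if "u' \<in> s0 rVIS ` {0..<i}" for u'
   using that vis(1) I(3) r by (fastforce simp: algebra_simps)
  thus ?thesis unfolding ls by auto
 qed
 have l2: "lst s L = lst s0 L" unfolding ls L_def using uni by auto
 have lst3: "lst s' = lst s" if "agree {rA, rP, rOK} s3 s'" for s'
  using that ls3 by (auto simp: lst_def fun_eq_iff agree_def)
 have tau3: "tau s' = tau s0" "s' rG = s0 rG" "s' rC2 = s0 rC2" if "agree {rA, rP, rOK} s3 s'" for s'
  using that sr by (auto simp: tau_def fun_eq_iff agree_def s3_def s2_def)
 have reg3: "s' rJ 0 = j" "s' rR 0 = r" "s' rST 0 = l" "s' rN 0 = n" "s' rK 0 = K" "s' rU 0 = u" "s' rTT 0 = t" "s' rI2 0 = i" "s' rLC = s rLC" "s' rLI = s rLI"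
  if "agree {rA, rP, rOK} s3 s'" for s'
  using that sr regs i by (auto simp: agree_def s3_def s2_def)
 note base = agree_refl[of "{rA, rP, rOK}" s3]
 define c1 where "c1 \<longleftrightarrow> (\<forall>p\<in>set (lst s0 (l * n + r)). okp s0 p u r t (s0 rG (l - 1)))"
 define c2 where "c2 \<longleftrightarrow> (\<forall>p\<in>set (lst s0 L). okp s0 p r u t (s0 rC2 p))"
 have okp3: "okp s' p x y a b = okp s0 p x y a b" if "agree {rA, rP, rOK} s3 s'" for s' p x y a b
  using tau3(1)[OF that] by (simp add: okp_def)
 have P1: "passes s' (l * n + r) u r t (\<lambda>_. s0 rG (l - 1)) = c1" if a: "agree {rA, rP, rOK} s3 s'" for s'
  unfolding passes_lst[where s = s', OF reg3(4,5)[OF a]] lst3[OF a] l1 c1_def by (simp add: okp3[OF a])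
 have P2: "passes s' L r u t (s0 rC2) = c2" if a: "agree {rA, rP, rOK} s3 s'" for s'
  unfolding passes_lst[where s = s', OF reg3(4,5)[OF a]] lst3[OF a] l2 c2_def by (simp add: okp3[OF a])
 have S4: "wp M (chk (V rST .* V rN .+ V rR) (V rU) (V rR) (V rTT) (A rG (V rST .- N 1)))
   (\<lambda>s' k. (agree {rA, rP, rOK} s3 s' \<and> bnd M s' \<and> (s' rOK 0 \<noteq> 0 \<longleftrightarrow> c1)) \<and> k \<le> 400 * nat K + 100) s3"
 proof (rule wp_chk[where L = "l * n + r" and X = u and Y = r and t' = t and th = "\<lambda>_. s0 rG (l - 1)" and Kb = "nat K"])
  fix s' assume a: "agree {rA, rP, rOK} s3 s'"
  show "ev s' (V rST .* V rN .+ V rR) = l * n + r \<and> ev s' (V rU) = u \<and> ev s' (V rR) = r \<and> ev s' (V rTT) = t \<and> ev s' (A rG (V rST .- N 1)) = s0 rG (l - 1)"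
   using reg3[OF a] tau3[OF a] by simp
 qed (use b3 M64 lcb[of "l * n + r"] KM K1 P1[OF base] r3 in \<open>auto simp: ls3\<close>)
 have S5: "wp M (chk lidx (V rR) (V rU) (V rTT) (A rC2 (V rP)))
   (\<lambda>s' k. (agree {rA, rP, rOK} s3 s' \<and> bnd M s' \<and> (s' rOK 0 \<noteq> 0 \<longleftrightarrow> c1 \<and> c2)) \<and> k \<le> 400 * nat K + 100) s4"
  if s4: "agree {rA, rP, rOK} s3 s4 \<and> bnd M s4 \<and> (s4 rOK 0 \<noteq> 0 \<longleftrightarrow> c1)" for s4
 proof (rule wp_chk[where L = L and X = r and Y = u and t' = t and th = "s0 rC2" and Kb = "nat K"])
  fix s' assume "agree {rA, rP, rOK} s4 s'"
  hence a: "agree {rA, rP, rOK} s3 s'" using s4 by (auto simp: agree_def)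
  show "ev s' lidx = L \<and> ev s' (V rR) = r \<and> ev s' (V rU) = u \<and> ev s' (V rTT) = t \<and> ev s' (A rC2 (V rP)) = s0 rC2 (s' rP 0)"
   using reg3[OF a] tau3[OF a] by (simp add: L_def)
 next
  fix s' k assume A: "agree {rA, rP, rOK} s4 s'" "s' rOK 0 = (if passes s4 L r u t (s0 rC2) then s4 rOK 0 else 0)" "k \<le> 400 * nat K + 100" "bnd M s'"
  have a: "agree {rA, rP, rOK} s3 s'" using s4 A(1) by (auto simp: agree_def)
  have "passes s4 L r u t (s0 rC2) = c2" using P2 s4 by blast
  thus "(agree {rA, rP, rOK} s3 s' \<and> bnd M s' \<and> (s' rOK 0 \<noteq> 0 \<longleftrightarrow> c1 \<and> c2)) \<and> k \<le> 400 * nat K + 100"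
   using A a s4 by auto
 qed (use s4 M64 lcb[of L] KM K1 reg3[of s4] in auto)
 have appc: "appc s0 j l r u \<longleftrightarrow> c1 \<and> c2 \<and> s rLC L < K"
 proof -
  have "length (lst s0 L) = nat (s rLC L)" using l2 length_lst[of s L] by simp
  thus ?thesis using u lcb[of L] K1 unfolding appc_def c1_def c2_def L_def[symmetric] t_def[symmetric] by auto
 qed
 have S6: "wp M (Cnd (V rOK .* (A rLC lidx .< V rK))
     (Put rLI (lidx .* V rK .+ A rLC lidx) (V rJ);;
     Put rLC lidx (A rLC lidx .+ N 1))
     Nop) (\<lambda>s' k. s' = (if appc s0 j l r u then upd (upd s5 rLI (L * K + s rLC L) j) rLC L (s rLC L + 1) else s5) \<and> k \<le> 150) s5"
  if s5: "agree {rA, rP, rOK} s3 s5 \<and> bnd M s5 \<and> (s5 rOK 0 \<noteq> 0 \<longleftrightarrow> c1 \<and> c2)" for s5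
 proof -
  have a5: "agree {rA, rP, rOK} s3 s5" and ok5: "s5 rOK 0 \<noteq> 0 \<longleftrightarrow> c1 \<and> c2" using s5 by auto
  note rg = reg3[OF a5]
  have L': "(l + 1) * n + u = L" by (simp add: L_def)
  show ?thesis
  proof (cases "appc s0 j l r u")
   case True
   have "\<bar>s rLC L + 1\<bar> \<le> M" using lcb[of L] KM K1 by auto
   thus ?thesis using True appc ok5 j by (simp add: rg L')
  next
   case False
   thus ?thesis using appc ok5 by (auto simp: rg L')
  qed
 qed
 have S7: "wp M (rI2 ::= V rI2 .+ N 1) (\<lambda>s' k. appinv (i + 1) s' \<and> k \<le> 6) s6"
  if s5: "agree {rA, rP, rOK} s3 s5 \<and> bnd M s5 \<and> (s5 rOK 0 \<noteq> 0 \<longleftrightarrow> c1 \<and> c2)"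
   and s6: "s6 = (if appc s0 j l r u then upd (upd s5 rLI (L * K + s rLC L) j) rLC L (s rLC L + 1) else s5)" for s5 s6
 proof -
  have a5: "agree {rA, rP, rOK} s3 s5" using s5 by auto
  note rg = reg3[OF a5]
  have i6: "s6 rI2 0 = i" using rg(8) by (simp add: s6)
  have l5: "lst s5 = lst s" by (rule lst3[OF a5])
  have lo5: "lists_ok s5 (j + 1)" using lo by (simp add: lists_ok_def rg)
  have l6: "lst s6 L' = (if L' = L \<and> appc s0 j l r u then lst s L @ [j] else lst s L')" for L'
  proof (cases "appc s0 j l r u")
   case True
   have "\<And>L. 0 \<le> s5 rLC L \<and> s5 rLC L \<le> K" "s5 rLC L < K" using lo5 True appc by (auto simp: lists_ok_def rg)
   from lst_append[where s = s5 and L = L and x = j and L' = L', OF this] show ?thesis using True by (simp add: s6 l5 rg)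
  qed (simp add: s6 l5)
  have l7: "lst (upd s6 rI2 0 (i + 1)) = lst s6" by (simp add: lst_def fun_eq_iff)
  have "lists_ok s6 (j + 1)"
  proof (cases "appc s0 j l r u")
   case True
   have lc: "\<And>L. 0 \<le> s5 rLC L \<and> s5 rLC L \<le> K" "s5 rLC L < K" using lo5 True appc by (auto simp: lists_ok_def rg)
   have e: "L' * K + a = L * K + s rLC L ==> L' = L \<and> a = s rLC L" if "0 \<le> a" "a < K" for L' a
   proof -
    assume "L' * K + a = L * K + s rLC L"
    moreover have "(L' * K + a) div K = L'" using that K1 by simp
    moreover have "(L * K + s rLC L) div K = L" using lc(1)[of L] lc(2) K1 by (simp add: rg)
    ultimately show ?thesis by auto
   qed
   show ?thesis unfolding lists_ok_def
   proof (intro conjI allI impI)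
    fix L' show "0 \<le> s6 rLC L'" "s6 rLC L' \<le> K" using lc(1)[of L'] lc(1)[of L] lc(2) True by (auto simp: s6 rg)
   next
    fix L' a assume a: "0 \<le> a \<and> a < s6 rLC L'"
    have aK: "a < K" using a lc(1)[of L'] lc(2) True by (auto simp: s6 rg split: if_splits)
    have "0 \<le> s6 rLI (L' * K + a) \<and> s6 rLI (L' * K + a) < j + 1"
    proof (cases "L' * K + a = L * K + s rLC L")
     case eq: True
     thus ?thesis using True j by (simp add: s6)
    next
     case ne: False
     have "a < s5 rLC L'" using a ne True by (auto simp: s6 rg split: if_splits)
     thus ?thesis using ne True a lo5 by (simp add: s6 rg lists_ok_def)
    qed
    thus "0 \<le> s6 rLI (L' * K + a)" "s6 rLI (L' * K + a) < j + 1" by auto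
   qed
  qed (use lo5 s6 in simp)
  hence lo7: "lists_ok (upd s6 rI2 0 (i + 1)) (j + 1)" by (simp add: lists_ok_def)
  have ag7: "agree apr s0 (upd s6 rI2 0 (i + 1))"
  proof -
   have "agree apr s0 s5" using ag3 a5 by (auto simp: agree_def)
   thus ?thesis unfolding s6 by (auto intro!: agree_upd simp del: upd_apply)
  qed
  have img: "s0 rVIS ` {0..<i + 1} = insert u (s0 rVIS ` {0..<i})"
  proof -
   have "{0..<i + 1} = insert i {0..<i}" using i by auto
   thus ?thesis by (simp add: u_def)
  qed
  have "lst s6 L' = (if \<exists>x. x \<in> s0 rVIS ` {0..<i + 1} \<and> L' = (l + 1) * n + x \<and> appc s0 j l r x then lst s0 L' @ [j] else lst s0 L')" for L'
  proof (cases "L' = L")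
   case True
   have "(\<exists>x. x \<in> s0 rVIS ` {0..<i + 1} \<and> L' = (l + 1) * n + x \<and> appc s0 j l r x) \<longleftrightarrow> appc s0 j l r u"
    unfolding img True L_def by auto
   thus ?thesis using l2 by (simp add: l6 True)
  next
   case False
   hence "(\<exists>x. x \<in> s0 rVIS ` {0..<i + 1} \<and> L' = (l + 1) * n + x \<and> appc s0 j l r x) \<longleftrightarrow>
    (\<exists>x. x \<in> s0 rVIS ` {0..<i} \<and> L' = (l + 1) * n + x \<and> appc s0 j l r x)" unfolding img L_def by auto
   thus ?thesis using False by (simp add: l6 ls)
  qed
  hence "appinv (i + 1) (upd s6 rI2 0 (i + 1))"
   unfolding appinv_def l7 using ag7 lo7 i I(3) by simp
  moreover have "\<bar>i + 1\<bar> \<le> M" using i I(3) cnt by linarith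
  ultimately show ?thesis using i6 by simp
 qed
 show ?thesis unfolding append_tests_def
  apply (rule wp_chain[OF S1], rule wp_chain[OF S2])
  apply (rule wp_chainQ[where P = "\<lambda>s5. agree {rA, rP, rOK} s3 s5 \<and> bnd M s5 \<and> (s5 rOK 0 \<noteq> 0 \<longleftrightarrow> c1 \<and> c2)" and a = "800 * nat K + 203"])
   apply (rule wp_chain[OF S3], rule wp_chainQ[OF S4])
   apply (rule wp_mono[OF S5], assumption, simp)
  apply (rule wp_chain[OF S6], assumption)
  apply (rule wp_mono[OF S7[OF _ refl]], assumption, simp)
  done
qed

lemma wp_append_row:
 assumes Q: "\<And>s k. agree apr s0 s ==> bnd M s ==> lists_ok s (j + 1) ==>
   (\<And>L. lst s L = (if \<exists>u. u \<in> s0 rVIS ` {0..<cnt} \<and> L = (l + 1) * n + u \<and> appc s0 j l r u then lst s0 L @ [j] else lst s0 L)) ==>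
   k \<le> (800 * nat K + 600) * nat cnt + 20 ==> Q s k"
 shows "wp M append_row Q s0"
proof -
 define s1 where "s1 = upd s0 rI2 0 0"
 have b1: "bnd M s1" unfolding s1_def using M64 by (intro bnd_upd B0) auto
 have l1: "lst s1 = lst s0" by (simp add: s1_def lst_def fun_eq_iff)
 have a1: "agree apr s0 s1" unfolding s1_def by (rule agree_upd) auto
 have lo1: "lists_ok s1 (j + 1)" using lists unfolding lists_ok_def s1_def by fastforce
 have I1: "appinv 0 s1" unfolding appinv_def l1 using a1 cnt lo1 by (auto simp: s1_def)
 have S1: "wp M (rI2 ::= N 0) (\<lambda>s' k. s' = s1 \<and> k \<le> 3) s0" using M64 by (simp add: s1_def)
 show ?thesis unfolding append_row_def
 proof (rule wp_chain[OF S1], rule wp_While[where Inv = "\<lambda>s. appinv (s rI2 0) s" and \<Phi> = "\<lambda>s. (800 * nat K + 550) * nat (cnt - s rI2 0)"])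
  show "appinv (s1 rI2 0) s1" using I1 by (simp add: s1_def)
  show "bnd M s1" by (rule b1)
 next
  fix s assume I: "appinv (s rI2 0) s" "bnd M s" "ev s (V rI2 .< V rCNT) \<noteq> 0"
  define i where "i = s rI2 0"
  have c: "s rCNT 0 = cnt" using I(1) regs by (auto simp: appinv_def agree_def)
  have i: "i < cnt" using I(3) c by (auto simp: i_def split: if_splits)
  have i0: "0 \<le> i" using I(1) by (simp add: appinv_def i_def)
  have cc: "cost (V rI2 .< V rCNT) + 1 = 6" by simp
  show "wp M append_vertex
   (\<lambda>s' k. appinv (s' rI2 0) s' \<and> (800 * nat K + 550) * nat (cnt - s' rI2 0) + k + cost (V rI2 .< V rCNT) + 1 \<le> (800 * nat K + 550) * nat (cnt - s rI2 0)) s"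
  proof (rule wp_mono[OF wp_append_step[OF I(1)[folded i_def] I(2) i]], elim conjE)
   fix s' k assume A: "appinv (i + 1) s'" "k \<le> 800 * nat K + 500"
   have i': "s' rI2 0 = i + 1" using A(1) by (simp add: appinv_def)
   have "nat (cnt - i) = Suc (nat (cnt - (i + 1)))" using i by simp
   hence "(800 * nat K + 550) * nat (cnt - (i + 1)) + k + 6 \<le> (800 * nat K + 550) * nat (cnt - i)" using A(2) by simp
   thus "appinv (s' rI2 0) s' \<and> (800 * nat K + 550) * nat (cnt - s' rI2 0) + k + cost (V rI2 .< V rCNT) + 1 \<le> (800 * nat K + 550) * nat (cnt - s rI2 0)"
    unfolding add.assoc cc i' i_def[symmetric] using A(1) by simp
  qed
 next
  fix k1 s k assume k1: "k1 \<le> (3::nat)" and I: "appinv (s rI2 0) s" "bnd M s" "ev s (V rI2 .< V rCNT) = 0"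
   "(800 * nat K + 550) * nat (cnt - s rI2 0) + k \<le> (800 * nat K + 550) * nat (cnt - s1 rI2 0) + cost (V rI2 .< V rCNT) + 1"
  have c: "s rCNT 0 = cnt" using I(1) regs by (auto simp: appinv_def agree_def)
  have i: "s rI2 0 = cnt" using I(1,3) c by (auto simp: appinv_def split: if_splits)
  show "Q s (k1 + k)"
  proof (rule Q)
   show "k1 + k \<le> (800 * nat K + 600) * nat cnt + 20" using I(4) k1 by (simp add: i s1_def add_mult_distrib)
  qed (use I(1,2) in \<open>auto simp: appinv_def i\<close>)
 qed
qed

end

end

section \<open>Stages\<close>

context prog begin

text \<open>What remains of \<open>search_done\<close> once queue and counter are forgotten. It
  mentions memory only through its parameters, so it can be carried to later states and finally to
  sets and tests described by distances.\<close>

definition rowfacts :: "int => int => int => int set => (int => int => bool) => (int => int) => int => bool" where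
 "rowfacts d r X Z tst \<tau> fnd \<longleftrightarrow> r \<notin> Z \<and> \<tau> r = 1 \<and>
   (\<forall>v. vtx v --> 0 \<le> \<tau> v \<and> (0 < \<tau> v --> wk d Z r v (\<tau> v - 1) \<and> (v \<noteq> r --> v \<notin> Z \<and> tst v (\<tau> v - 1)))) \<and>
   0 < fnd \<and> fnd \<le> BIG \<and> (fnd < BIG --> wk d Z r r fnd) \<and>
   (vol d {v. 0 < \<tau> v} < nat X --> (\<forall>e. 0 \<le> e \<and> e < m \<and> 0 < \<tau> (src d e) -->
    (if dst d e = r then fnd \<le> \<tau> (src d e) - 1 + wt e
     else dst d e \<in> Z \<or> \<not> tst (dst d e) (\<tau> (src d e) - 1 + wt e) \<or>
      (0 < \<tau> (dst d e) \<and> \<tau> (dst d e) \<le> \<tau> (src d e) + wt e))))"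

definition root :: "st => int => int => int" where "root s d p = dst d (s rSQ p)"

text \<open>A row is left empty when its root has been used before, by an earlier stage or by an
  earlier row \<open>p'\<close> of the same one. Otherwise it is the first use of its root, and this
  distinctness settles the clause \<open>s = x\<close> of the exclusion relations.\<close>

definition row_ok :: "st => int => int => int => int => int => bool" where
 "row_ok s l d X js p \<longleftrightarrow>
  (if 0 < tau s p (root s d p)
   then \<exists>fnd. rowfacts d (root s d p) X (excl s l) (tst_of s l (root s d p)) (tau s p) fnd \<and>
    s rC2 p = min (2 * fnd) (s rG (l - 1)) \<and> s rBEST 0 \<le> fnd \<and>
    (\<forall>p'. js \<le> p' \<and> p' < p --> \<not> (root s d p' = root s d p \<and> 0 < tau s p' (root s d p)))
   else (\<forall>v. vtx v --> tau s p v = 0) \<and>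
    (root s d p \<in> excl s l \<or> (\<exists>p'. js \<le> p' \<and> p' < p \<and> root s d p' = root s d p \<and> 0 < tau s p' (root s d p))))"

definition cond :: "st => int => int => int => int list => int => bool" where
 "cond s l d u R p \<longleftrightarrow> 0 < tau s p u \<and>
   (\<forall>q\<in>set (lst s (l * n + root s d p)). okp s q u (root s d p) (tau s p u - 1) (s rG (l - 1))) \<and>
   (\<forall>q\<in>set R. okp s q (root s d p) u (tau s p u - 1) (s rC2 q)) \<and> length R < nat K"

text \<open>The list of \<open>u\<close> is reconstructed from the finished table instead of being
  traced through time. This works because \<open>cond\<close> reads only rows, lists of lower level
  and estimates that do not change afterwards.\<close>

definition alist :: "st => int => int => int => int => int => int list" where
 "alist s l d u js j = foldl (\<lambda>R p. if cond s l d u R p then R @ [p] else R) [] [js..j - 1]"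

lemma alist_empty [simp]: "alist s l d u js js = []"
 by (simp add: alist_def)

lemma alist_step: "js \<le> j ==> alist s l d u js (j + 1) =
  (if cond s l d u (alist s l d u js j) j then alist s l d u js j @ [j] else alist s l d u js j)"
 unfolding alist_def by (simp add: upto_rec2)

lemma alist_set: "p \<in> set (alist s l d u js j) ==> js \<le> p \<and> p < j"
proof -
 have "set (foldl (\<lambda>R p. if P R p then R @ [p] else R) R xs) \<subseteq> set R \<union> set xs" for P R and xs :: "int list"
  by (induction xs arbitrary: R) (auto simp: subset_iff, fastforce+)
 from this[of "cond s l d u" "[]" "[js..j - 1]"] show "p \<in> set (alist s l d u js j) ==> js \<le> p \<and> p < j"
  unfolding alist_def by auto
qed

text \<open>Later computation steps preserve everything the rows below \<open>j\<close> of a stage up to \<open>l\<close> depend on.\<close>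

definition stable :: "st => st => int => int => bool" where
 "stable s s' l j \<longleftrightarrow> s' rSQ = s rSQ \<and> (\<forall>i. i < l --> s' rG i = s rG i) \<and>
   (\<forall>p v. p < j \<and> vtx v --> tau s' p v = tau s p v) \<and> (\<forall>p. p < j --> s' rC2 p = s rC2 p) \<and>
   (\<forall>L. L < (l + 1) * n --> lst s' L = lst s L) \<and> (\<forall>v. vtx v --> (v \<in> excl s' l \<longleftrightarrow> v \<in> excl s l)) \<and> s rN = s' rN \<and> s rK = s' rK"

lemma okp_stable: "stable s s' l j ==> p < j ==> 0 \<le> x ==> x < n ==> 0 \<le> y ==> y < n ==> okp s' p x y t c = okp s p x y t c"
 unfolding stable_def okp_def by simp

lemma tst_of_stable:
 assumes st: "stable s s' l j" and c: "s rN 0 = n" "s rK 0 = K" and lo: "lists_ok s j0" "j0 \<le> j" and r: "0 \<le> r" "r < n" and v: "0 \<le> v" "v < n"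
 shows "tst_of s' l r v t = tst_of s l r v t"
proof -
 have c': "s' rN 0 = n" "s' rK 0 = K" using st c by (auto simp: stable_def)
 have l1: "l * n + r < (l + 1) * n" using r by (simp add: algebra_simps)
 have l2: "(l - 1) * n + v < (l + 1) * n" using v by (simp add: algebra_simps)
 have L: "lst s' (l * n + r) = lst s (l * n + r)" "lst s' ((l - 1) * n + v) = lst s ((l - 1) * n + v)" "s' rG (l - 2) = s rG (l - 2)"
  using st l1 l2 by (auto simp: stable_def)
 have lt: "q < j" if "q \<in> set (lst s L)" for q L using lst_set[OF that lo(1)] lo(2) by auto
 have C: "s' rC2 q = s rC2 q" if "q < j" for q using st that by (simp add: stable_def)
 have P1: "passes s' (l * n + r) v r t (s' rC2) = passes s (l * n + r) v r t (s rC2)"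
  unfolding passes_lst[where s = s', OF c'] passes_lst[where s = s, OF c] L
  using lt okp_stable[OF st _ v r] C by simp
 have P2: "passes s' ((l - 1) * n + v) r v t (\<lambda>_. s' rG (l - 2)) = passes s ((l - 1) * n + v) r v t (\<lambda>_. s rG (l - 2))"
  unfolding passes_lst[where s = s', OF c'] passes_lst[where s = s, OF c] L
  using lt okp_stable[OF st _ r v] by simp
 show ?thesis unfolding tst_of_def P1 P2 ..
qed

lemma rowfacts_cong:
 assumes "rowfacts d r X Z tst \<tau> fnd" and r: "0 \<le> r" "r < n"
  and "\<And>v. 0 \<le> v ==> v < n ==> v \<in> Z' \<longleftrightarrow> v \<in> Z" "\<And>v t. 0 \<le> v ==> v < n ==> tst' v t = tst v t"
  and t: "\<And>v. 0 \<le> v ==> v < n ==> \<tau>' v = \<tau> v"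
 shows "rowfacts d r X Z' tst' \<tau>' fnd"
proof -
 have wk: "wk d Z' u v t" if "wk d Z u v t" for u v t
  using that
 proof induction
  case (wk_step v t e)
  thus ?case using assms(4)[of "dst d e"] dst_range[of e d] by (intro wk.wk_step) auto
 qed (rule wk_refl)
 have vol: "vol d {v. 0 < \<tau>' v} = vol d {v. 0 < \<tau> v}"
  using vol_mono[of "{v. 0 < \<tau>' v}" "{v. 0 < \<tau> v}" d] vol_mono[of "{v. 0 < \<tau> v}" "{v. 0 < \<tau>' v}" d] t by force
 show ?thesis
  unfolding rowfacts_def
 proof (intro conjI allI impI)
  show "r \<notin> Z'" "\<tau>' r = 1" "0 < fnd" "fnd \<le> BIG" using assms r by (auto simp: rowfacts_def)
  show "wk d Z' r r fnd" if "fnd < BIG" using that assms(1) wk by (simp add: rowfacts_def)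
  fix v assume v: "vtx v"
  show "0 \<le> \<tau>' v" using v t assms(1) by (simp add: rowfacts_def)
  assume "0 < \<tau>' v"
  hence p: "0 < \<tau> v" using v t by simp
  show "wk d Z' r v (\<tau>' v - 1)" using v t p assms(1) wk by (simp add: rowfacts_def)
  show "v \<notin> Z'" "tst' v (\<tau>' v - 1)" if "v \<noteq> r" using that v t p assms(1,4,5) by (simp_all add: rowfacts_def)
 next
  fix e assume v: "vol d {v. 0 < \<tau>' v} < nat X" and e: "0 \<le> e \<and> e < m \<and> 0 < \<tau>' (src d e)"
  have se: "\<tau>' (src d e) = \<tau> (src d e)" "\<tau>' (dst d e) = \<tau> (dst d e)" using t src_range[of e d] dst_range[of e d] e by auto
  have "if dst d e = r then fnd \<le> \<tau> (src d e) - 1 + wt e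
     else dst d e \<in> Z \<or> \<not> tst (dst d e) (\<tau> (src d e) - 1 + wt e) \<or>
      (0 < \<tau> (dst d e) \<and> \<tau> (dst d e) \<le> \<tau> (src d e) + wt e)"
   using assms(1) v[unfolded vol] e unfolding rowfacts_def se by blast
  thus "if dst d e = r then fnd \<le> \<tau>' (src d e) - 1 + wt e
     else dst d e \<in> Z' \<or> \<not> tst' (dst d e) (\<tau>' (src d e) - 1 + wt e) \<or>
      (0 < \<tau>' (dst d e) \<and> \<tau>' (dst d e) \<le> \<tau>' (src d e) + wt e)"
   using assms(4,5) dst_range[of e d] e unfolding se by auto
 qed
qed

lemma row_ok_stable:
 assumes st: "stable s s' l j" and c: "s rN 0 = n" "s rK 0 = K" and lo: "lists_ok s j0" "j0 \<le> j"
  and p: "p < j" "0 \<le> s rSQ p" "s rSQ p < m" and best: "s' rBEST 0 \<le> s rBEST 0"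
  and ok: "row_ok s l d X js p"
 shows "row_ok s' l d X js p"
proof -
 have root: "root s' d q = root s d q" for q using st by (simp add: root_def stable_def)
 define r where "r = root s d p"
 have r: "0 \<le> r" "r < n" using dst_range[OF p(2,3)] by (auto simp: r_def root_def)
 have t: "\<And>v q. q < j ==> 0 \<le> v ==> v < n ==> tau s' q v = tau s q v" using st by (simp add: stable_def)
 have ex: "\<And>v. 0 \<le> v ==> v < n ==> v \<in> excl s' l \<longleftrightarrow> v \<in> excl s l" using st by (simp add: stable_def)
 have C: "s' rC2 p = s rC2 p" "s' rG (l - 1) = s rG (l - 1)" using st p by (auto simp: stable_def)
 show ?thesis
 proof (cases "0 < tau s p r")
  case True
  then obtain fnd where f: "rowfacts d r X (excl s l) (tst_of s l r) (tau s p) fnd" "s rC2 p = min (2 * fnd) (s rG (l - 1))" "s rBEST 0 \<le> fnd"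
   "\<And>p'. js \<le> p' ==> p' < p ==> \<not> (root s d p' = r \<and> 0 < tau s p' r)"
   using ok unfolding row_ok_def r_def[symmetric] by auto
  have "rowfacts d r X (excl s' l) (tst_of s' l r) (tau s' p) fnd"
   by (rule rowfacts_cong[OF f(1) r ex tst_of_stable[OF st c lo r] t[OF p(1)]])
  moreover have "0 < tau s' p r" using True t[OF p(1) r] by simp
  moreover have "\<not> (root s d p' = r \<and> 0 < tau s' p' r)" if "js \<le> p'" "p' < p" for p'
   using f(4)[OF that] t[of p' r] r that p(1) by simp
  ultimately show ?thesis unfolding row_ok_def root r_def[symmetric] using f(2,3) best C by auto
 next
  case False
  hence F: "\<not> 0 < tau s' p r" using t[OF p(1) r] by simp
  have o: "(\<forall>v. vtx v --> tau s p v = 0)" "r \<in> excl s l \<or> (\<exists>p'. js \<le> p' \<and> p' < p \<and> root s d p' = r \<and> 0 < tau s p' r)"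
   using ok False unfolding row_ok_def r_def[symmetric] by auto
  have "r \<in> excl s' l \<or> (\<exists>p'. js \<le> p' \<and> p' < p \<and> root s d p' = r \<and> 0 < tau s' p' r)"
  proof (cases "r \<in> excl s l")
   case True thus ?thesis using ex[OF r] by blast
  next
   case Fa: False
   then obtain p' where "js \<le> p'" "p' < p" "root s d p' = r" "0 < tau s p' r" using o(2) by blast
   thus ?thesis using t[of p' r] r p(1) by (intro disjI2 exI[of _ p']) auto
  qed
  thus ?thesis unfolding row_ok_def root r_def[symmetric] using F o(1) t[OF p(1)] by auto
 qed
qed

lemma alist_stable:
 assumes st: "stable s s' l j" and lo: "lists_ok s j" and u: "0 \<le> u" "u < n"
  and SQ: "\<And>p. js \<le> p ==> p < j' ==> 0 \<le> s rSQ p \<and> s rSQ p < m" and j': "js \<le> j'" "j' \<le> j"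
 shows "alist s' l d u js j' = alist s l d u js j'"
 using j' SQ
proof (induction j' rule: int_ge_induct)
 case (step i)
 have root: "root s' d q = root s d q" for q using st by (simp add: root_def stable_def)
 define R where "R = alist s l d u js i"
 define r where "r = root s d i"
 have r: "0 \<le> r" "r < n" using dst_range step.prems(2)[of i] step.hyps by (auto simp: r_def root_def)
 have IH: "alist s' l d u js i = R" using step R_def by simp
 have t: "tau s' i u = tau s i u" using st u step.prems by (simp add: stable_def)
 have L: "lst s' (l * n + r) = lst s (l * n + r)" "s' rG (l - 1) = s rG (l - 1)" using st r by (auto simp: stable_def algebra_simps)
 have C: "s' rC2 q = s rC2 q" if "q < j" for q using st that by (simp add: stable_def)
 have "okp s' q u r x y = okp s q u r x y" if "q \<in> set (lst s (l * n + r))" for q x y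
  using okp_stable[OF st _ u r] lst_set[OF that lo] by simp
 moreover have "okp s' q r u x y = okp s q r u x y" "s' rC2 q = s rC2 q" if "q \<in> set R" for q x y
  using alist_set[OF that[unfolded R_def]] okp_stable[OF st _ r u, of q] C[of q] step.prems(1) by auto
 ultimately have "cond s' l d u R i = cond s l d u R i"
  unfolding cond_def root r_def[symmetric] t L by simp
 thus ?case using step.hyps by (simp add: alist_step IH R_def[symmetric])
qed simp

definition cw :: "int => bool" where
 "cw t \<longleftrightarrow> 0 < t \<and> (\<exists>d r. (d = 0 \<or> d = 1) \<and> 0 \<le> r \<and> r < n \<and> wk d {} r r t)"

text \<open>Price of one row with a new root: the first summand bounds its search, the second one
  the recording, which treats at most \<open>X + 1\<close> visited vertices.\<close>

definition stage_cost :: "int => nat" where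
 "stage_cost X = (900 * nat K + 200 * b + 1700) * (nat X + 3) + (800 * nat K + 600) * (nat X + 1) + 200"

end

section \<open>The invariant of a stage\<close>

abbreviation (input) "stgr \<equiv> {rCNT, rCTR, rFND, rT, rVIS, rSEG, rTT, rVV, rE, rH, rT2, rOK, rA, rP, rI, rI2, rU, rLI, rLC, rR, rMK, rC2, rBEST, rJ}"

locale prog_stage = prog n m W tlv hdv wt K BIG BC M b
 for n m W tlv hdv wt K BIG BC M b +
 fixes sS :: st and l d X js je :: int
 assumes l1: "1 \<le> l" "l \<le> 3" and d01': "d = 0 \<or> d = 1" and X1': "1 \<le> X" "X \<le> m + 1" and js: "0 \<le> js" "js \<le> je" "je + 2 \<le> M" "3 \<le> M"
  and SQ: "\<And>p. 0 \<le> p ==> p < je ==> 0 \<le> sS rSQ p \<and> sS rSQ p < m"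
  and MK0: "\<And>v. 0 \<le> v ==> v < n ==> 0 \<le> sS rMK v \<and> sS rMK v < l"
  and best0: "0 < sS rBEST 0"
begin

text \<open>The last clause says that a lowered estimate is attained by a row of the stage. It is
  what later identifies \<open>rG 1\<close> with the minimum \<open>gm\<close>.\<close>

definition SI :: "int => st => bool" where
 "SI j s \<longleftrightarrow> js \<le> j \<and> j \<le> je \<and> agree stgr sS s \<and> cst s \<and> s rJ 0 = j \<and> s rST 0 = l \<and> s rD 0 = d \<and> s rX 0 = X \<and> s rJE 0 = je \<and>
   lists_ok s j \<and> seg_tree n (s rSEG) \<and> (\<forall>v. vtx v --> leaf s v = 0) \<and> (\<forall>p v. j \<le> p \<and> vtx v --> tau s p v = 0) \<and>
   stable sS s l js \<and>
   (\<forall>v. vtx v --> s rMK v = sS rMK v \<or> (sS rMK v = 0 \<and> s rMK v = l \<and> (\<exists>p. js \<le> p \<and> p < j \<and> root s d p = v \<and> 0 < tau s p v))) \<and>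
   (\<forall>p. js \<le> p \<and> p < j --> row_ok s l d X js p) \<and>
   (\<forall>u. vtx u --> lst s ((l + 1) * n + u) = alist s l d u js j) \<and> (\<forall>L. (l + 2) * n \<le> L --> lst s L = []) \<and>
   0 < s rBEST 0 \<and> s rBEST 0 \<le> sS rBEST 0 \<and> (s rBEST 0 = sS rBEST 0 \<or> s rBEST 0 = BIG \<or> cw (s rBEST 0)) \<and>
   (\<forall>p. js \<le> p \<and> p < j \<and> 0 < tau s p (root s d p) --> s rMK (root s d p) = l) \<and>
   (s rBEST 0 = sS rBEST 0 \<or> (\<exists>p. js \<le> p \<and> p < j \<and> 0 < tau s p (root s d p) \<and> s rC2 p = min (2 * s rBEST 0) (s rG (l - 1))))"

text \<open>Searches are charged to unmarked roots rather than to rows. So a stage performs at most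
  \<open>n\<close> of them, which makes stage 3 with its \<open>m\<close> rows affordable.\<close>

definition fresh :: "int => st => nat" where
 "fresh j s = card {v. 0 \<le> v \<and> v < n \<and> s rMK v = 0 \<and> (\<exists>p. j \<le> p \<and> p < je \<and> root s d p = v)}"

definition spot :: "int => st => nat" where
 "spot j s = 100 * nat (je - j) + stage_cost X * fresh j s"

lemma fresh_finite: "finite {v. 0 \<le> v \<and> v < n \<and> P v}"
 by (rule finite_subset[of _ "{0..<n}"]) auto

end

lemma wp_Sq_assoc: "wp M (Sq (Sq a b) c) Q s = wp M (Sq a (Sq b c)) Q s"
 by (simp add: add.assoc)

context prog_search begin

lemma rowfacts_done:
 assumes "search_done \<tau> vis cnt fnd"
 shows "rowfacts d r X (excl s0 l) (tst_of s0 l r) \<tau> fnd"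
proof -
 have l: "label_ok \<tau> (m + 1)" and f: "found_ok fnd"
  and v: "vol d {v. 0 < \<tau> v} < nat X --> (\<forall>e. 0 \<le> e \<and> e < m \<and> 0 < \<tau> (src d e) --> relaxed \<tau> fnd e)"
  using assms unfolding search_done_def by - (elim conjE, assumption)+
 show ?thesis unfolding rowfacts_def
 proof (intro conjI)
  show "r \<notin> excl s0 l" by (rule r)
  show "\<tau> r = 1" using l by (simp add: label_ok_def)
  show "\<forall>v. vtx v --> 0 \<le> \<tau> v \<and> (0 < \<tau> v --> wk d (excl s0 l) r v (\<tau> v - 1) \<and> (v \<noteq> r --> v \<notin> excl s0 l \<and> tst_of s0 l r v (\<tau> v - 1)))"
   using l unfolding label_ok_def by blast
  show "0 < fnd" "fnd \<le> BIG" "fnd < BIG --> wk d (excl s0 l) r r fnd" using f by (auto simp: found_ok_def)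
 qed (use v in \<open>simp only: relaxed_def\<close>)
qed

lemma search_cost_le: "search_cost \<le> (900 * nat K + 200 * b + 1700) * (nat X + 3)"
 unfolding search_cost_def cR_def cE_def by (intro mult_le_mono1) simp

end

context prog_stage begin

lemma spot_step:
 assumes j: "js \<le> j" "j < je" and MK: "\<And>v. 0 \<le> v ==> v < n ==> v \<noteq> r ==> s' rMK v = s rMK v" "s' rMK r = (if new then l else s rMK r)"
  and SQ': "s' rSQ = s rSQ" and new: "new ==> s rMK r = 0 \<and> r = root s d j \<and> vtx r"
  and k: "k \<le> 60 + (if new then stage_cost X else 0)"
 shows "spot (j + 1) s' + k + 6 \<le> spot j s"
proof -
 have root: "root s' d p = root s d p" for p using SQ' by (simp add: root_def)
 let ?A = "{v. 0 \<le> v \<and> v < n \<and> s rMK v = 0 \<and> (\<exists>p. j \<le> p \<and> p < je \<and> root s d p = v)}"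
 let ?B = "{v. 0 \<le> v \<and> v < n \<and> s' rMK v = 0 \<and> (\<exists>p. j + 1 \<le> p \<and> p < je \<and> root s' d p = v)}"
 have nj: "nat (je - j) = Suc (nat (je - (j + 1)))" using j by simp
 define NA where "NA = ?A"
 define NB where "NB = ?B"
 have fA: "finite NA" unfolding NA_def by (rule fresh_finite)
 have BA: "v \<in> NA" if "v \<in> NB" for v
 proof -
  have "s rMK v = 0"
  proof (cases "v = r")
   case True
   have z: "s' rMK r = 0" using that True by (simp add: NB_def)
   have "\<not> new" using MK(2) l1 z by auto
   thus ?thesis using MK(2) z True by simp
  next
   case False
   have "s' rMK v = s rMK v" by (rule MK(1)[OF _ _ False]) (use that in \<open>auto simp: NB_def\<close>)
   thus ?thesis using that by (simp add: NB_def)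
  qed
  moreover have "vtx v" and "\<exists>p. j + 1 \<le> p \<and> p < je \<and> root s' d p = v" using that unfolding NB_def by simp_all
  moreover from this(2) obtain p where p: "j + 1 \<le> p" "p < je" "root s' d p = v" by blast
  have "j \<le> p \<and> p < je \<and> root s d p = v" using p root[of p] by simp
  ultimately show ?thesis unfolding NA_def by blast
 qed
 have fr: "fresh j s = card NA" "fresh (j + 1) s' = card NB" unfolding fresh_def NA_def NB_def by (rule refl)+
 show ?thesis
 proof (cases new)
  case True
  have rA: "r \<in> NA" unfolding NA_def using new[OF True] j by (intro CollectI conjI exI[of _ j]) auto
  have rB: "r \<notin> NB" unfolding NB_def using MK(2) True l1 by simp
  have "NB \<subseteq> NA - {r}" using BA rB by blast
  hence "card NB \<le> card (NA - {r})" using fA by (intro card_mono) auto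
  moreover have "card NA = Suc (card (NA - {r}))" using card.remove[OF fA rA] .
  ultimately have "card NB + 1 \<le> card NA" by simp
  hence c: "stage_cost X * (card NB + 1) \<le> stage_cost X * card NA" by (rule mult_le_mono2)
  have k': "k \<le> 60 + stage_cost X" using k True by simp
  show ?thesis unfolding spot_def fr nj mult_Suc_right using c[unfolded add_mult_distrib2 mult_1_right] k' by linarith
 next
  case False
  have "NB \<subseteq> NA" using BA by blast
  hence "card NB \<le> card NA" using fA by (intro card_mono)
  hence c: "stage_cost X * card NB \<le> stage_cost X * card NA" by (rule mult_le_mono2)
  have k': "k \<le> 60" using k False by simp
  show ?thesis unfolding spot_def fr nj mult_Suc_right using c k' by linarith
 qed
qed

lemma wp_row_skip:
 assumes I: "SI j s" "bnd M s" "j < je" and mk: "s rMK (root s d j) \<noteq> 0"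
 shows "wp M row (\<lambda>s' k. SI (j + 1) s' \<and> spot (j + 1) s' + k + 6 \<le> spot j s) s"
proof -
 define r where "r = root s d j"
 have F': "js \<le> j" "j \<le> je" "agree stgr sS s" "cst s" "s rJ 0 = j" "s rST 0 = l" "s rD 0 = d" "s rX 0 = X" "s rJE 0 = je"
   "lists_ok s j" "seg_tree n (s rSEG)" "\<forall>v. vtx v --> leaf s v = 0" "\<forall>p v. j \<le> p \<and> vtx v --> tau s p v = 0"
   "stable sS s l js"
   "\<forall>v. vtx v --> s rMK v = sS rMK v \<or> (sS rMK v = 0 \<and> s rMK v = l \<and> (\<exists>p. js \<le> p \<and> p < j \<and> root s d p = v \<and> 0 < tau s p v))"
   "\<forall>p. js \<le> p \<and> p < j --> row_ok s l d X js p"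
   "\<forall>u. vtx u --> lst s ((l + 1) * n + u) = alist s l d u js j" "\<forall>L. (l + 2) * n \<le> L --> lst s L = []"
   "0 < s rBEST 0" "s rBEST 0 \<le> sS rBEST 0" "s rBEST 0 = sS rBEST 0 \<or> s rBEST 0 = BIG \<or> cw (s rBEST 0)"
   "\<forall>p. js \<le> p \<and> p < j \<and> 0 < tau s p (root s d p) --> s rMK (root s d p) = l"
   "s rBEST 0 = sS rBEST 0 \<or> (\<exists>p. js \<le> p \<and> p < j \<and> 0 < tau s p (root s d p) \<and> s rC2 p = min (2 * s rBEST 0) (s rG (l - 1)))"
  using I(1) unfolding SI_def by - (elim conjE, assumption)+
 note F = F'(1-11) F'(12)[rule_format] F'(13)[rule_format] F'(14) F'(15)[rule_format] F'(16)[rule_format] F'(17)[rule_format] F'(18)[rule_format] F'(19-21) F'(22)[rule_format] F'(23)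
 have sq: "s rSQ = sS rSQ" using F(14) by (simp add: stable_def)
 have SQj: "0 \<le> s rSQ j" "s rSQ j < m" using SQ[of j] F(1) js I(3) sq by auto
 have r: "0 \<le> r" "r < n" using dst_range[OF SQj] by (auto simp: r_def root_def)
 have cs: "s rN 0 = n" "s rM 0 = m" "s rDST (d * m + s rSQ j) = r" "s rK 0 = K" using F(4) d01' SQj by (auto simp: cst_def r_def root_def)
 have rM: "\<bar>r\<bar> \<le> M" "\<bar>j + 1\<bar> \<le> M" using r nM js I(3) F(1) by linarith+
 define s' where "s' = upd (upd s rR 0 r) rJ 0 (j + 1)"
 have same: "tau s' = tau s" "leaf s' = leaf s" "lst s' = lst s" "s' rMK = s rMK" "s' rSQ = s rSQ" "s' rG = s rG" "s' rC2 = s rC2"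
  "s' rBEST = s rBEST" "s' rN = s rN" "s' rK = s rK" "s' rLC = s rLC" "s' rLI = s rLI" "s' rSEG = s rSEG"
  by (auto simp: s'_def tau_def leaf_def lst_def fun_eq_iff)
 have root: "root s' = root s" by (simp add: root_def same fun_eq_iff)
 have st: "stable s s' l j" by (simp add: stable_def same excl_def)
 have SI': "SI (j + 1) s'"
  unfolding SI_def same root
 proof (intro conjI allI impI)
  show "js \<le> j + 1" "j + 1 \<le> je" using F(1) I(3) by auto
  show "agree stgr sS s'" unfolding s'_def using F(3) by (auto intro!: agree_upd simp del: upd_apply)
  show "cst s'" using F(4) by (simp add: cst_def s'_def)
  show "lists_ok s' (j + 1)" using F(10) unfolding lists_ok_def same by fastforce
  show "stable sS s' l js" using F(14) by (simp add: stable_def same excl_def)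
  show "s rMK v = sS rMK v \<or> (sS rMK v = 0 \<and> s rMK v = l \<and> (\<exists>p. js \<le> p \<and> p < j + 1 \<and> root s d p = v \<and> 0 < tau s p v))"
   if "vtx v" for v using F(15)[OF that] by force
  show "tau s p v = 0" if "j + 1 \<le> p \<and> vtx v" for p v using F(13)[of p v] that by simp
  show "row_ok s' l d X js p" if p: "js \<le> p \<and> p < j + 1" for p
  proof (cases "p = j")
   case False
   hence "p < j" using p by simp
   thus ?thesis using row_ok_stable[OF st cs(1,4) F(10) order_refl, of p] F(16)[of p] p SQ[of p] js I(3) sq
    by (simp add: same)
  next
   case True
   have z: "tau s j v = 0" if "vtx v" for v using F(13)[of j v] that by simp
   \<comment> \<open>A mark is either older than the stage, and then excludes the root, or it was
     set by an earlier row of the stage.\<close>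
   have "r \<in> excl s l \<or> (\<exists>p'. js \<le> p' \<and> p' < j \<and> root s d p' = r \<and> 0 < tau s p' r)"
   proof (cases "s rMK r = sS rMK r")
    case True
    hence "r \<in> excl s l" using MK0[OF r] mk by (auto simp: excl_def r_def[symmetric])
    thus ?thesis by simp
   next
    case False
    thus ?thesis using F(15)[of r] r by blast
   qed
   thus ?thesis unfolding row_ok_def True root same r_def[symmetric] using z r by (auto simp: excl_def same)
  qed
  fix u assume u: "vtx u"
  have "alist s' l d u js j = alist s l d u js j"
   by (rule alist_stable[OF st F(10)]) (use u SQ js I(3) F(1) sq in auto)
  moreover have "\<not> cond s' l d u R j" for R using F(13)[of j u] u by (simp add: cond_def same)
  ultimately show "lst s ((l + 1) * n + u) = alist s' l d u js (j + 1)" using F(17)[OF u] F(1) by (simp add: alist_step)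
 next
  show "lst s L = []" if "(l + 2) * n \<le> L" for L using F(18)[OF that] .
  show "s rBEST 0 = sS rBEST 0 \<or> (\<exists>p. js \<le> p \<and> p < j + 1 \<and> 0 < tau s p (root s d p) \<and> s rC2 p = min (2 * s rBEST 0) (s rG (l - 1)))"
  proof (cases "s rBEST 0 = sS rBEST 0")
   case False
   then obtain p where "js \<le> p" "p < j" "0 < tau s p (root s d p)" "s rC2 p = min (2 * s rBEST 0) (s rG (l - 1))" using F(23) by blast
   thus ?thesis by (intro disjI2 exI[of _ p]) simp
  qed simp
  fix p assume p: "js \<le> p \<and> p < j + 1 \<and> 0 < tau s p (root s d p)"
  have "p \<noteq> j" using p F(13)[of j r] r by (auto simp: r_def)
  thus "s rMK (root s d p) = l" using F(22)[of p] p by simp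
 next
 qed (use F(6-9,11,12,19-21) in \<open>simp_all add: s'_def\<close>)
 have sp: "spot (j + 1) s' + 36 + 6 \<le> spot j s"
  by (rule spot_step[where r = r and new = False]) (use F(1) I(3) same in auto)
 have W: "wp M row (\<lambda>s'' k. s'' = s' \<and> k \<le> 36) s"
  unfolding row_def using mk rM F(5,7) cs by (simp add: s'_def r_def[symmetric])
 show ?thesis
 proof (rule wp_mono[OF W])
  fix s'' and k :: nat assume "s'' = s' \<and> k \<le> 36"
  thus "SI (j + 1) s'' \<and> spot (j + 1) s'' + k + 6 \<le> spot j s" using SI' sp by simp
 qed
qed

lemma wp_row_new:
 assumes I: "SI j s" "bnd M s" "j < je" and mk: "s rMK (root s d j) = 0"
 shows "wp M row (\<lambda>s' k. SI (j + 1) s' \<and> spot (j + 1) s' + k + 6 \<le> spot j s) s"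
proof -
 define r where "r = root s d j"
 have F': "js \<le> j" "j \<le> je" "agree stgr sS s" "cst s" "s rJ 0 = j" "s rST 0 = l" "s rD 0 = d" "s rX 0 = X" "s rJE 0 = je"
   "lists_ok s j" "seg_tree n (s rSEG)" "\<forall>v. vtx v --> leaf s v = 0" "\<forall>p v. j \<le> p \<and> vtx v --> tau s p v = 0"
   "stable sS s l js"
   "\<forall>v. vtx v --> s rMK v = sS rMK v \<or> (sS rMK v = 0 \<and> s rMK v = l \<and> (\<exists>p. js \<le> p \<and> p < j \<and> root s d p = v \<and> 0 < tau s p v))"
   "\<forall>p. js \<le> p \<and> p < j --> row_ok s l d X js p"
   "\<forall>u. vtx u --> lst s ((l + 1) * n + u) = alist s l d u js j" "\<forall>L. (l + 2) * n \<le> L --> lst s L = []"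
   "0 < s rBEST 0" "s rBEST 0 \<le> sS rBEST 0" "s rBEST 0 = sS rBEST 0 \<or> s rBEST 0 = BIG \<or> cw (s rBEST 0)"
   "\<forall>p. js \<le> p \<and> p < j \<and> 0 < tau s p (root s d p) --> s rMK (root s d p) = l"
   "s rBEST 0 = sS rBEST 0 \<or> (\<exists>p. js \<le> p \<and> p < j \<and> 0 < tau s p (root s d p) \<and> s rC2 p = min (2 * s rBEST 0) (s rG (l - 1)))"
  using I(1) unfolding SI_def by - (elim conjE, assumption)+
 note F = F'(1-11) F'(12)[rule_format] F'(13)[rule_format] F'(14) F'(15)[rule_format] F'(16)[rule_format] F'(17)[rule_format] F'(18)[rule_format] F'(19-21) F'(22)[rule_format] F'(23)
 have j0: "0 \<le> j" using F(1) js by simp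
 have sq: "s rSQ = sS rSQ" using F(14) by (simp add: stable_def)
 have SQj: "0 \<le> s rSQ j" "s rSQ j < m" using SQ[of j] F(1) js I(3) sq by auto
 have r: "0 \<le> r" "r < n" using dst_range[OF SQj] by (auto simp: r_def root_def)
 have cs: "s rN 0 = n" "s rM 0 = m" "s rK 0 = K" "s rDST (d * m + s rSQ j) = r" using F(4) d01' SQj by (auto simp: cst_def r_def root_def)
 have rM: "\<bar>r\<bar> \<le> M" "\<bar>j + 1\<bar> \<le> M" "\<bar>l\<bar> \<le> M" using r nM js I(3) F(1) l1 by linarith+
 define s1 where "s1 = upd (upd s rR 0 r) rMK r l"
 have same1: "tau s1 = tau s" "leaf s1 = leaf s" "lst s1 = lst s" "s1 rSQ = s rSQ" "s1 rG = s rG" "s1 rC2 = s rC2"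
  "s1 rBEST = s rBEST" "s1 rN = s rN" "s1 rK = s rK" "s1 rLC = s rLC" "s1 rLI = s rLI" "s1 rSEG = s rSEG" "s1 rMK = (s rMK)(r := l)"
  by (auto simp: s1_def tau_def leaf_def lst_def fun_eq_iff)
 \<comment> \<open>The root is marked before its own search starts, but with \<open>l\<close>, and
   \<open>excl\<close> only looks at marks below \<open>l\<close>.\<close>
 have ex1: "excl s1 l = excl s l" using mk by (auto simp: excl_def same1 r_def[symmetric])
 have rZ: "r \<notin> excl s l" using mk by (simp add: excl_def r_def[symmetric])
 have b1: "bnd M s1" unfolding s1_def by (intro bnd_upd I rM)
 have c1: "cst s1" using F(4) by (simp add: cst_def s1_def)
 have ag1: "agree stgr sS s1" unfolding s1_def using F(3) by (auto intro!: agree_upd simp del: upd_apply)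
 interpret S: prog_search n m W tlv hdv wt K BIG BC M b d r X s1 l j
 proof unfold_locales
  show "d = 0 \<or> d = 1" "0 \<le> r" "r < n" "1 \<le> X" "X \<le> m + 1" "0 \<le> j" "1 \<le> l" using d01' r X1' j0 l1 by auto
  show "r \<notin> excl s1 l" unfolding ex1 by (rule rZ)
  show "((m + 2) * W + 2) * n \<le> BC" "(m + 2) * W < BIG" using BCl BIGl by auto
  show "cst s1" "bnd M s1" by (rule c1 b1)+
  show "s1 rJ 0 = j" "s1 rR 0 = r" "s1 rST 0 = l" "s1 rD 0 = d" "s1 rX 0 = X" using F(5-8) by (simp_all add: s1_def)
  show "lists_ok s1 j" using F(10) by (simp add: lists_ok_def same1)
  show "seg_tree n (s1 rSEG)" using F(11) by (simp add: same1)
  show "leaf s1 v = 0" "tau s1 j v = 0" if "0 \<le> v" "v < n" for v using F(12)[of v] F(13)[of j v] that by (simp_all add: same1)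
 qed
 have R1: "wp M (rR ::= A rDST (V rD .* V rM .+ A rSQ (V rJ))) (\<lambda>s' k. s' = upd s rR 0 r \<and> k \<le> 22) s"
  using rM F(5,7) cs by simp
 have R2: "wp M (Put rMK (V rR) (V rST)) (\<lambda>s' k. s' = s1 \<and> k \<le> 9) (upd s rR 0 r)"
  using rM F(6) by (simp add: s1_def)
 define P2 where "P2 s2 \<longleftrightarrow> S.frame s2 \<and> bnd M s2 \<and> (\<forall>v. vtx v --> leaf s2 v = 0) \<and>
   S.search_done (tau s2 j) (s2 rVIS) (s2 rCNT 0) (s2 rFND 0)" for s2
 have R3: "wp M search (\<lambda>s' k. P2 s' \<and> k \<le> S.search_cost) s1"
  by (rule S.wp_search) (auto simp: P2_def)
 define s3f where "s3f s2 = upd s2 rC2 j (min (2 * s2 rFND 0) (s2 rG (l - 1)))" for s2 :: st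
 define s4f where "s4f s2 = (if s2 rFND 0 < s2 rBEST 0 then upd (s3f s2) rBEST 0 (s2 rFND 0) else s3f s2)" for s2 :: st
 have p2: "s2 rST 0 = l" "s2 rJ 0 = j" "s2 rR 0 = r" "\<bar>2 * s2 rFND 0\<bar> \<le> M" "\<bar>s2 rFND 0\<bar> \<le> M" "\<bar>s2 rG i\<bar> \<le> M" if "P2 s2" for s2 i
 proof -
  have fr: "S.frame s2" and b2: "bnd M s2" and fo: "S.found_ok (s2 rFND 0)" using that unfolding P2_def S.search_done_def by blast+
  show "s2 rST 0 = l" "s2 rJ 0 = j" "s2 rR 0 = r" by (rule S.frame_regs[OF fr])+
  show "\<bar>2 * s2 rFND 0\<bar> \<le> M" "\<bar>s2 rFND 0\<bar> \<le> M" using fo BIGM by (auto simp: S.found_ok_def)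
  show "\<bar>s2 rG i\<bar> \<le> M" using b2 by (simp add: bnd_def)
 qed
 have R4: "wp M (store_C2;; clip_C2)
   (\<lambda>s' k. s' = s3f s2 \<and> k \<le> 60) s2" if "P2 s2" for s2
  using p2[OF that] by (auto simp: s3f_def min_def upd_def fun_eq_iff)
 have R5: "wp M (note_best) (\<lambda>s' k. s' = s4f s2 \<and> k \<le> 20) (s3f s2)" if "P2 s2" for s2
  using p2[OF that] by (auto simp: s4f_def s3f_def)
 define P5 where "P5 s5 \<longleftrightarrow> (\<exists>s2. P2 s2 \<and> agree apr (s4f s2) s5 \<and> lists_ok s5 (j + 1) \<and>
   (\<forall>L. lst s5 L = (if \<exists>u. u \<in> s2 rVIS ` {0..<s2 rCNT 0} \<and> L = (l + 1) * n + u \<and> appc (s4f s2) j l r u then lst (s4f s2) L @ [j] else lst (s4f s2) L)))" for s5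
 have f4: "tau (s4f s2) = tau s2" "s4f s2 rVIS = s2 rVIS" "s4f s2 rCNT = s2 rCNT" "lst (s4f s2) = lst s2" "s4f s2 rLC = s2 rLC" "s4f s2 rLI = s2 rLI"
  "s4f s2 rMK = s2 rMK" "s4f s2 rSQ = s2 rSQ" "s4f s2 rG = s2 rG" "s4f s2 rC2 = (s2 rC2)(j := min (2 * s2 rFND 0) (s2 rG (l - 1)))"
  "s4f s2 rBEST 0 = min (s2 rFND 0) (s2 rBEST 0)" "leaf (s4f s2) = leaf s2" "s4f s2 rSEG = s2 rSEG" "agree {rC2, rBEST} s2 (s4f s2)" for s2
  by (auto simp: s4f_def s3f_def tau_def lst_def leaf_def fun_eq_iff agree_def)
 have lst2: "lst s2 = lst s" "s2 rLC = s rLC" "s2 rLI = s rLI" if "P2 s2" for s2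
  using that S.frame_regs[of s2] unfolding P2_def by (auto simp: lst_def same1 fun_eq_iff)
 have R6: "wp M append_row (\<lambda>s' k. P5 s' \<and> k \<le> (800 * nat K + 600) * nat (X + 1) + 20) (s4f s2)" if P: "P2 s2" for s2
 proof (rule wp_append_row[where j = j and r = r and l = l and cnt = "s2 rCNT 0"])
  have fr: "S.frame s2" and b2: "bnd M s2" and sd: "S.search_done (tau s2 j) (s2 rVIS) (s2 rCNT 0) (s2 rFND 0)" using P by (auto simp: P2_def)
  show "bnd M (s4f s2)" unfolding s4f_def s3f_def using b2 p2[OF P] by (auto intro!: bnd_upd simp: min_def simp del: upd_apply)
  show "s4f s2 rJ 0 = j" "s4f s2 rR 0 = r" "s4f s2 rST 0 = l" "s4f s2 rN 0 = n" "s4f s2 rK 0 = K"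
   using S.frame_regs[OF fr] f4(14)[of s2] by (auto simp: agree_def)
  show "s4f s2 rCNT 0 = s2 rCNT 0" by (simp add: f4)
  show "lists_ok (s4f s2) j" using F(10) by (simp add: lists_ok_def f4 lst2[OF P])
  show "0 \<le> s2 rCNT 0" "s2 rCNT 0 \<le> M" using sd X1' mM by (auto simp: S.search_done_def)
  show "0 \<le> s4f s2 rVIS i \<and> s4f s2 rVIS i < n \<and> 0 < tau (s4f s2) j (s4f s2 rVIS i)" if "0 \<le> i" "i < s2 rCNT 0" for i
   using sd that by (auto simp: S.search_done_def S.vis_ok_def f4)
  show "inj_on (s4f s2 rVIS) {0..<s2 rCNT 0}" using sd by (simp add: S.search_done_def S.vis_ok_def f4)
  fix s5 k assume A: "agree apr (s4f s2) s5" "bnd M s5" "lists_ok s5 (j + 1)"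
   "\<And>L. lst s5 L = (if \<exists>u. u \<in> s4f s2 rVIS ` {0..<s2 rCNT 0} \<and> L = (l + 1) * n + u \<and> appc (s4f s2) j l r u then lst (s4f s2) L @ [j] else lst (s4f s2) L)"
   "k \<le> (800 * nat K + 600) * nat (s2 rCNT 0) + 20"
  have "s2 rCNT 0 \<le> X + 1" using sd by (simp add: S.search_done_def)
  hence "(800 * nat K + 600) * nat (s2 rCNT 0) \<le> (800 * nat K + 600) * nat (X + 1)" by (intro mult_le_mono2 nat_mono)
  hence "k \<le> (800 * nat K + 600) * nat (X + 1) + 20" using A(5) by linarith
  thus "P5 s5 \<and> k \<le> (800 * nat K + 600) * nat (X + 1) + 20"
   unfolding P5_def using P A(1,3) A(4)[unfolded f4(2)] by (intro conjI exI[of _ s2]) auto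
 qed (use j0 js I(3) r in auto)
 have R7: "SI (j + 1) (upd s5 rJ 0 (j + 1)) \<and> s5 rJ 0 = j \<and> s5 rMK = (s rMK)(r := l) \<and> s5 rSQ = s rSQ" if P5: "P5 s5" for s5
 proof -
  from P5 obtain s2 where P: "P2 s2" and ag5: "agree apr (s4f s2) s5" and lo5: "lists_ok s5 (j + 1)"
   and l5: "\<And>L. lst s5 L = (if \<exists>u. u \<in> s2 rVIS ` {0..<s2 rCNT 0} \<and> L = (l + 1) * n + u \<and> appc (s4f s2) j l r u then lst (s4f s2) L @ [j] else lst (s4f s2) L)"
   unfolding P5_def by blast
  have fr: "S.frame s2" and sd: "S.search_done (tau s2 j) (s2 rVIS) (s2 rCNT 0) (s2 rFND 0)" and lf: "\<And>v. 0 \<le> v \<and> v < n ==> leaf s2 v = 0"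
   using P by (auto simp: P2_def)
  have fg: "agree srch s1 s2" using fr by (simp add: S.frame_def)
  define s6 where "s6 = upd s5 rJ 0 (j + 1)"
  have g: "tau s6 = tau s2" "s6 rMK = s1 rMK" "s6 rSQ = s rSQ" "s6 rG = s rG" "s6 rC2 = (s rC2)(j := min (2 * s2 rFND 0) (s rG (l - 1)))"
   "s6 rBEST 0 = min (s2 rFND 0) (s rBEST 0)" "leaf s6 = leaf s2" "s6 rSEG = s2 rSEG" "lst s6 = lst s5" "s6 rN = s rN" "s6 rK = s rK" "s6 rLC = s5 rLC" "s6 rLI = s5 rLI"
  proof -
   have a: "s5 x = s4f s2 x" if "x \<notin> apr" for x using ag5 that by (simp add: agree_def)
   have bq: "s2 x = s1 x" if "x \<notin> srch" for x using fg that by (simp add: agree_def)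
   have c: "s4f s2 x = s2 x" if "x \<notin> {rC2, rBEST}" for x using f4(14)[of s2] that by (simp add: agree_def)
   show "tau s6 = tau s2" "leaf s6 = leaf s2" "s6 rSEG = s2 rSEG" by (auto simp: tau_def leaf_def s6_def a c fun_eq_iff)
   show "s6 rMK = s1 rMK" by (simp add: s6_def a c bq)
   show "s6 rSQ = s rSQ" "s6 rG = s rG" "s6 rN = s rN" "s6 rK = s rK" by (simp_all add: s6_def a c bq same1)
   show "s6 rC2 = (s rC2)(j := min (2 * s2 rFND 0) (s rG (l - 1)))" by (rule ext) (simp add: s6_def a f4(10) bq same1)
   show "s6 rBEST 0 = min (s2 rFND 0) (s rBEST 0)" by (simp add: s6_def a f4(11) bq same1)
   show "lst s6 = lst s5" "s6 rLC = s5 rLC" "s6 rLI = s5 rLI" by (auto simp: lst_def s6_def fun_eq_iff)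
  qed
  have tr: "tau s6 p v = tau s p v" if "p \<noteq> j" "0 \<le> v" "v < n" for p v
  proof -
   have "s2 rT (p * n + v) = s1 rT (p * n + v)" using fr row_disjoint[OF that(1)] that unfolding S.frame_def by blast
   thus ?thesis using same1(1) by (simp add: g tau_def fun_eq_iff)
  qed
  have root6: "root s6 = root s" by (simp add: root_def g fun_eq_iff)
  have ex6: "excl s6 l = excl s l" unfolding ex1[symmetric] by (simp add: excl_def g)
  have lL: "lst s6 L = lst s L" if "L < (l + 1) * n" for L
  proof -
   have "\<not> (\<exists>u. u \<in> s2 rVIS ` {0..<s2 rCNT 0} \<and> L = (l + 1) * n + u \<and> appc (s4f s2) j l r u)"
    using sd that by (fastforce simp: S.search_done_def S.vis_ok_def)
   thus ?thesis by (simp add: g l5 f4 lst2[OF P])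
  qed
  have st: "stable s s6 l j" unfolding stable_def using tr lL by (simp add: g ex6)
  have st1: "stable s1 s6 l j" using st by (simp add: stable_def same1 ex1)
  have vis: "u \<in> s2 rVIS ` {0..<s2 rCNT 0} \<longleftrightarrow> 0 < tau s2 j u" if "0 \<le> u" "u < n" for u
   using sd that unfolding S.search_done_def S.vis_ok_def by force
  have visr: "vtx u" if "u \<in> s2 rVIS ` {0..<s2 rCNT 0}" for u
   using sd that unfolding S.search_done_def S.vis_ok_def by force
  have rf: "rowfacts d r X (excl s6 l) (tst_of s6 l r) (tau s6 j) (s2 rFND 0)"
  proof (rule rowfacts_cong[OF S.rowfacts_done[OF sd] r])
   show "v \<in> excl s6 l \<longleftrightarrow> v \<in> excl s1 l" for v by (simp add: ex6 ex1)
   show "tst_of s6 l r v t = tst_of s1 l r v t" if "0 \<le> v" "v < n" for v t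
    by (rule tst_of_stable[OF st1 _ _ S.lists0 order_refl r that]) (use cs same1 in auto)
  qed (simp add: g)
  have fp: "0 < s2 rFND 0" "s2 rFND 0 \<le> BIG" and fw: "s2 rFND 0 < BIG ==> wk d (excl s1 l) r r (s2 rFND 0)" using sd by (auto simp: S.search_done_def S.found_ok_def)
  have t6: "tau s6 j r = 1" using rf by (simp add: rowfacts_def)
  \<comment> \<open>The program tested before it appended. What it wrote since then are lists of
    level \<open>l + 1\<close>, and \<open>cond\<close> receives the old one of these through
    \<open>R\<close>.\<close>
  have cnd: "cond s6 l d u R j \<longleftrightarrow> appc (s4f s2) j l r u" if u: "0 \<le> u" "u < n" and R: "R = lst s ((l + 1) * n + u)" for u R
  proof -
   have q: "okp s6 = okp (s4f s2)" by (simp add: okp_def g f4 fun_eq_iff)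
   have G: "s4f s2 rG = s6 rG" "s4f s2 rC2 = s6 rC2" using f4(9,10)[of s2] fg by (simp_all add: g agree_def same1)
   have L1: "lst s6 (l * n + r) = lst (s4f s2) (l * n + r)" using lL[of "l * n + r"] r by (simp add: f4 lst2[OF P] algebra_simps)
   show ?thesis unfolding cond_def appc_def root6 r_def[symmetric] q G L1 R by (simp add: g f4 lst2[OF P])
  qed
  have "SI (j + 1) s6"
   unfolding SI_def
  proof (intro conjI allI impI)
   show "js \<le> j + 1" "j + 1 \<le> je" using F(1) I(3) by auto
   have "agree stgr sS s2" using ag1 fg by (auto simp: agree_def)
   hence "agree stgr sS (s4f s2)" using f4(14)[of s2] by (auto simp: agree_def)
   hence "agree stgr sS s5" using ag5 by (auto simp: agree_def)
   thus "agree stgr sS s6" unfolding s6_def by (rule agree_upd) simp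
   have cc: "s6 x = s x" if "x \<notin> insert rR (insert rMK (srch \<union> apr \<union> {rC2, rBEST, rJ}))" for x
    using that fg ag5 f4(14)[of s2] by (auto simp: s6_def agree_def s1_def)
   show "cst s6" using F(4) unfolding cst_def by (simp add: cc)
   show "s6 rST 0 = l" "s6 rD 0 = d" "s6 rX 0 = X" "s6 rJE 0 = je" using F(6-9) by (simp_all add: cc)
   show "s6 rJ 0 = j + 1" by (simp add: s6_def)
   show "lists_ok s6 (j + 1)" using lo5 by (simp add: lists_ok_def g)
   show "seg_tree n (s6 rSEG)" using fr by (simp add: g S.frame_def)
   show "leaf s6 v = 0" if "vtx v" for v using lf[OF that] by (simp add: g)
   show "tau s6 p v = 0" if "j + 1 \<le> p \<and> vtx v" for p v using tr[of p v] F(13)[of p v] that by simp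
   show "stable sS s6 l js" using F(14) st F(1) unfolding stable_def by auto
   show "s6 rMK v = sS rMK v \<or> (sS rMK v = 0 \<and> s6 rMK v = l \<and> (\<exists>p. js \<le> p \<and> p < j + 1 \<and> root s6 d p = v \<and> 0 < tau s6 p v))"
    if v: "vtx v" for v
   proof (cases "v = r")
    case True
    have "sS rMK r = 0" using F(15)[of r] r mk l1 by (auto simp: r_def[symmetric])
    thus ?thesis using True t6 F(1) by (intro disjI2) (auto simp: g same1 root6 r_def intro!: exI[of _ j])
   next
    case False
    show ?thesis
    proof (cases "s rMK v = sS rMK v")
     case True thus ?thesis using False by (simp add: g same1)
    next
     case ne: False
     then obtain p where "sS rMK v = 0" "s rMK v = l" "js \<le> p" "p < j" "root s d p = v" "0 < tau s p v" using F(15)[OF v] by blast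
     thus ?thesis using False tr[of p v] v by (intro disjI2 conjI exI[of _ p]) (auto simp: g same1 root6)
    qed
   qed
   show "row_ok s6 l d X js p" if p: "js \<le> p \<and> p < j + 1" for p
   proof (cases "p = j")
    case False
    hence "p < j" using p by simp
    thus ?thesis using row_ok_stable[OF st cs(1,3) F(10) order_refl, of p] F(16)[of p] p SQ[of p] js I(3) sq by (simp add: g)
   next
    case True
    \<comment> \<open>An earlier row with the same root would have left its mark, but the mark was
      0.\<close>
    have ds: "\<not> (root s d p' = r \<and> 0 < tau s6 p' r)" if p': "js \<le> p'" "p' < j" for p'
    proof
     assume "root s d p' = r \<and> 0 < tau s6 p' r"
     hence "s rMK r = l" using F(22)[of p'] p' tr[of p' r] r by auto
     thus False using mk l1 by (simp add: r_def)
    qed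
    show ?thesis unfolding row_ok_def True root6 r_def[symmetric] using rf t6 ds by (auto simp: g intro!: exI[of _ "s2 rFND 0"])
   qed
   show "lst s6 ((l + 1) * n + u) = alist s6 l d u js (j + 1)" if u: "vtx u" for u
   proof -
    have al: "alist s6 l d u js j = lst s ((l + 1) * n + u)"
     unfolding F(17)[OF u] by (rule alist_stable[OF st F(10)]) (use u SQ js I(3) F(1) sq in auto)
    have "(\<exists>u'. u' \<in> s2 rVIS ` {0..<s2 rCNT 0} \<and> (l + 1) * n + u = (l + 1) * n + u' \<and> appc (s4f s2) j l r u') \<longleftrightarrow> appc (s4f s2) j l r u"
     using vis[of u] u by (auto simp: appc_def f4)
    thus ?thesis using F(1) cnd[of u "lst s ((l + 1) * n + u)"] u by (simp add: alist_step al g l5 f4 lst2[OF P])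
   qed
   show "lst s6 L = []" if "(l + 2) * n \<le> L" for L
   proof -
    have "L \<noteq> (l + 1) * n + u" if "u \<in> s2 rVIS ` {0..<s2 rCNT 0}" for u
     using visr[OF that] \<open>(l + 2) * n \<le> L\<close> by (auto simp: algebra_simps)
    thus ?thesis using F(18)[OF that] by (auto simp: g l5 f4 lst2[OF P])
   qed
   show "0 < s6 rBEST 0" "s6 rBEST 0 \<le> sS rBEST 0" using F(19,20) fp by (auto simp: g)
   have cwf: "cw (s2 rFND 0)" if "s2 rFND 0 < BIG" using fw[OF that] fp d01' r wk_mono[of d "excl s1 l" r r _ "{}"] by (auto simp: cw_def)
   have fc: "s2 rFND 0 = BIG \<or> cw (s2 rFND 0)"
   proof (cases "s2 rFND 0 < BIG")
    case False
    thus ?thesis using fp(2) by linarith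
   qed (use cwf in blast)
   show "s6 rBEST 0 = sS rBEST 0 \<or> s6 rBEST 0 = BIG \<or> cw (s6 rBEST 0)"
   proof (cases "s2 rFND 0 < s rBEST 0")
    case True thus ?thesis using fc by (simp add: g)
   next
    case False thus ?thesis using F(21) by (simp add: g)
   qed
   show "s6 rBEST 0 = sS rBEST 0 \<or> (\<exists>p. js \<le> p \<and> p < j + 1 \<and> 0 < tau s6 p (root s6 d p) \<and> s6 rC2 p = min (2 * s6 rBEST 0) (s6 rG (l - 1)))"
   proof (cases "s2 rFND 0 < s rBEST 0")
    case True
    hence "s6 rC2 j = min (2 * s6 rBEST 0) (s6 rG (l - 1))" by (simp add: g)
    thus ?thesis using t6 F(1) by (intro disjI2 exI[of _ j]) (simp add: root6 r_def[symmetric])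
   next
    case False
    hence bb: "s6 rBEST 0 = s rBEST 0" by (simp add: g)
    show ?thesis
    proof (cases "s rBEST 0 = sS rBEST 0")
     case False
     then obtain p where p: "js \<le> p" "p < j" "0 < tau s p (root s d p)" "s rC2 p = min (2 * s rBEST 0) (s rG (l - 1))" using F(23) by blast
     hence "0 \<le> root s d p" "root s d p < n" using SQ[of p] js I(3) dst_range[of "s rSQ p" d] by (auto simp: root_def sq)
     hence "0 < tau s6 p (root s6 d p)" using p tr[of p "root s d p"] by (simp add: root6)
     thus ?thesis using p bb by (intro disjI2 exI[of _ p]) (simp add: g)
    qed (simp add: bb)
   qed
   fix p assume p: "js \<le> p \<and> p < j + 1 \<and> 0 < tau s6 p (root s6 d p)"
   show "s6 rMK (root s6 d p) = l"
   proof (cases "p = j")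
    case False
    hence "0 \<le> root s d p" "root s d p < n" using SQ[of p] p js I(3) dst_range[of "s rSQ p" d] by (auto simp: root_def sq)
    hence "s rMK (root s d p) = l" using F(22)[of p] p tr[OF False] False by (auto simp: root6)
    thus ?thesis by (simp add: g same1 root6)
   qed (simp add: g same1 root6 r_def)
  qed
  moreover have "s5 rJ 0 = j" using ag5 f4(14)[of s2] p2(2)[OF P] by (auto simp: agree_def)
  moreover have "s5 rMK = (s rMK)(r := l)" "s5 rSQ = s rSQ" using g(2,3) same1 by (simp_all add: s6_def)
  ultimately show ?thesis by (simp add: s6_def)
 qed
 have R8: "wp M (rJ ::= V rJ .+ N 1) (\<lambda>s' k. (SI (j + 1) s' \<and> s' rMK = (s rMK)(r := l) \<and> s' rSQ = s rSQ) \<and> k \<le> 6) s5" if "P5 s5" for s5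
  using R7[OF that] rM by (simp add: fun_upd_def)
 let ?c = "22 + (12 + (9 + (S.search_cost + (60 + (20 + ((800 * nat K + 600) * nat (X + 1) + 20)))))) + 6"
 have W: "wp M row (\<lambda>s' k. (SI (j + 1) s' \<and> s' rMK = (s rMK)(r := l) \<and> s' rSQ = s rSQ) \<and> k \<le> ?c) s"
  unfolding row_def
 proof (rule wp_chain[OF R1], rule wp_chainQ[where P = P5 and a = "12 + (9 + (S.search_cost + (60 + (20 + ((800 * nat K + 600) * nat (X + 1) + 20)))))"])
  have z: "ev (upd s rR 0 r) (A rMK (V rR)) = 0" using mk by (simp add: r_def)
  have X: "wp M (Put rMK (V rR) (V rST);; search;; store_C2;;
    clip_C2;;
    note_best;; append_row)
   (\<lambda>s' k. P5 s' \<and> k \<le> 9 + (S.search_cost + (60 + (20 + ((800 * nat K + 600) * nat (X + 1) + 20))))) (upd s rR 0 r)"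
  proof (rule wp_chain[OF R2], rule wp_chainQ[OF R3])
   fix k1 k2 :: nat and s2 assume k1: "k1 \<le> 9" and P: "P2 s2" and k2: "k2 \<le> S.search_cost"
   have Y: "wp M ((store_C2;; clip_C2);;
    note_best;; append_row)
    (\<lambda>s' k. P5 s' \<and> k \<le> 60 + (20 + ((800 * nat K + 600) * nat (X + 1) + 20))) s2"
    by (rule wp_chain[OF R4[OF P]], rule wp_chain[OF R5[OF P]], rule wp_mono[OF R6[OF P]]) auto
   show "wp M (store_C2;; clip_C2;;
    note_best;; append_row)
    (\<lambda>s' k. P5 s' \<and> k1 + (k2 + k) \<le> 9 + (S.search_cost + (60 + (20 + ((800 * nat K + 600) * nat (X + 1) + 20))))) s2"
    by (rule wp_mono[OF Y[unfolded wp_Sq_assoc]]) (use k1 k2 in auto)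
  qed
  show "wp M (Cnd (A rMK (V rR)) Nop (Put rMK (V rR) (V rST);; search;; store_C2;;
    clip_C2;;
    note_best;; append_row))
   (\<lambda>s' k. P5 s' \<and> k \<le> 12 + (9 + (S.search_cost + (60 + (20 + ((800 * nat K + 600) * nat (X + 1) + 20)))))) (upd s rR 0 r)"
   unfolding wp_Cnd z by (simp del: wp_Sq, rule wp_mono[OF X]) auto
 qed (rule wp_mono[OF R8], assumption, auto)
 have cst: "?c \<le> 60 + stage_cost X"
 proof -
  have "nat (X + 1) = nat X + 1" using X1' by simp
  thus ?thesis using S.search_cost_le by (simp add: stage_cost_def)
 qed
 show ?thesis
 proof (rule wp_mono[OF W])
  fix s' k assume A: "(SI (j + 1) s' \<and> s' rMK = (s rMK)(r := l) \<and> s' rSQ = s rSQ) \<and> k \<le> ?c"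
  have "spot (j + 1) s' + k + 6 \<le> spot j s"
   by (rule spot_step[where r = r and new = True]) (use A F(1) I(3) mk r cst in \<open>auto simp: r_def\<close>)
  thus "SI (j + 1) s' \<and> spot (j + 1) s' + k + 6 \<le> spot j s" using A by blast
 qed
qed

lemma wp_stage:
 assumes I: "SI js sS" "bnd M sS"
  and Q: "\<And>s' s k. SI je s' ==> s = upd s' rG l (s' rBEST 0) ==> bnd M s ==> k \<le> spot js sS + 20 ==> Q s k"
 shows "wp M stage Q sS"
 unfolding stage_def
proof (rule wp_seqI)
 show "wp M (Whl (V rJ .< V rJE) row) (\<lambda>s k. SI je s \<and> bnd M s \<and> k \<le> spot js sS + 6) sS"
 proof (rule wp_While[where Inv = "\<lambda>s. SI (s rJ 0) s" and \<Phi> = "\<lambda>s. spot (s rJ 0) s"])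
  have j: "sS rJ 0 = js" using I(1) by (simp add: SI_def)
  show "SI (sS rJ 0) sS" "bnd M sS" using I j by auto
  have cc: "cost (V rJ .< V rJE) + 1 = 6" by simp
  fix s
  {
   assume A: "SI (s rJ 0) s" "bnd M s" "ev s (V rJ .< V rJE) \<noteq> 0"
   have je: "s rJ 0 < je" using A by (auto simp: SI_def split: if_splits)
   have w: "wp M row (\<lambda>s' k. SI (s rJ 0 + 1) s' \<and> spot (s rJ 0 + 1) s' + k + 6 \<le> spot (s rJ 0) s) s"
    by (cases "s rMK (root s d (s rJ 0)) = 0") (use wp_row_new[OF A(1,2) je] wp_row_skip[OF A(1,2) je] in auto)
   show "wp M row (\<lambda>s' k. SI (s' rJ 0) s' \<and> spot (s' rJ 0) s' + k + cost (V rJ .< V rJE) + 1 \<le> spot (s rJ 0) s) s"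
    unfolding add.assoc cc
   proof (rule wp_mono[OF w])
    fix s' k assume B: "SI (s rJ 0 + 1) s' \<and> spot (s rJ 0 + 1) s' + k + 6 \<le> spot (s rJ 0) s"
    hence "s' rJ 0 = s rJ 0 + 1" by (simp add: SI_def)
    thus "SI (s' rJ 0) s' \<and> spot (s' rJ 0) s' + (k + 6) \<le> spot (s rJ 0) s" using B by simp
   qed
  next
   fix k assume A: "SI (s rJ 0) s" "bnd M s" "ev s (V rJ .< V rJE) = 0" "spot (s rJ 0) s + k \<le> spot (sS rJ 0) sS + cost (V rJ .< V rJE) + 1"
   have "s rJ 0 = je" using A by (auto simp: SI_def split: if_splits)
   thus "SI je s \<and> bnd M s \<and> k \<le> spot js sS + 6" using A j by auto
  }
 qed
 fix s k1 assume A: "SI je s \<and> bnd M s \<and> k1 \<le> spot js sS + 6"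
 have b: "\<bar>s rBEST 0\<bar> \<le> M" using A by (simp add: bnd_def)
 have "s rST 0 = l" using A by (simp add: SI_def)
 moreover have "Q (upd s rG l (s rBEST 0)) (k1 + 9)"
  by (rule Q[OF _ refl]) (use A b in \<open>auto intro!: bnd_upd simp del: upd_apply\<close>)
 ultimately show "wp M (Put rG (V rST) (V rBEST)) (\<lambda>s2 k2. Q s2 (k1 + k2)) s" using b by simp
qed

lemma spot_le: "spot js s \<le> 100 * nat (je - js) + stage_cost X * min (nat (je - js)) (nat n)"
proof -
 have a: "fresh js s \<le> nat n"
 proof -
  have "fresh js s \<le> card {0..<n}" unfolding fresh_def by (intro card_mono) auto
  thus ?thesis by simp
 qed
 have "fresh js s \<le> card (root s d ` {js..<je})" unfolding fresh_def by (intro card_mono) auto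
 also have "\<dots> \<le> card {js..<je}" by (rule card_image_le) simp
 finally have "fresh js s \<le> nat (je - js)" by simp
 thus ?thesis unfolding spot_def using a by (intro add_mono mult_le_mono2) auto
qed

end

section \<open>Correctness of the estimate\<close>

text \<open>An element offered before is either on the list and excludes itself, or was rejected for
  a reason that persists. The program skips repeated roots, and this shows that skipping changes no
  list.\<close>

lemma onl_dup:
 assumes "\<And>x. kl x x" "x \<in> set xs"
 shows "\<not> (Ac x \<and> (\<forall>s\<in>set (onl Ac kl K xs). \<not> kl s x) \<and> length (onl Ac kl K xs) < K)"
 using assms(2)
proof (induction xs rule: rev_induct)
 case (snoc y ys)
 define R where "R = onl Ac kl K ys"
 have R': "onl Ac kl K (ys @ [y]) = (if Ac y \<and> (\<forall>s\<in>set R. \<not> kl s y) \<and> length R < K then R @ [y] else R)"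
  by (simp add: onl_snoc R_def Let_def)
 show ?case
 proof (cases "x = y")
  case True
  thus ?thesis unfolding R' using assms(1) by auto
 next
  case False
  hence "x \<in> set ys" using snoc.prems by simp
  hence "\<not> (Ac x \<and> (\<forall>s\<in>set R. \<not> kl s x) \<and> length R < K)" using snoc.IH R_def by blast
  thus ?thesis unfolding R' by auto
 qed
qed simp

context wgraph begin

lemma isd_last:
 assumes "isd d Z r v t"
 shows "(v = r \<and> t = 0) \<or> (\<exists>e. 0 \<le> e \<and> e < m \<and> dst d e = v \<and> v \<notin> Z \<and> isd d Z r (src d e) (t - wt e))"
proof -
 have "wk d Z r v t" by (rule isd_wk[OF assms])
 thus ?thesis
 proof (cases rule: wk.cases)
  case (wk_step v' t' e)
  have "isd d Z r (src d e) t'" unfolding isd_def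
  proof (intro conjI allI impI)
   show "wk d Z r (src d e) t'" using wk_step by simp
   fix t'' assume "wk d Z r (src d e) t''"
   hence "wk d Z r v (t'' + wt e)" using wk.wk_step[of d Z r "src d e" t'' e] wk_step by simp
   thus "t' \<le> t''" using isd_le[OF assms] wk_step by fastforce
  qed
  thus ?thesis using wk_step by (intro disjI2 exI[of _ e]) auto
 qed simp
qed

lemma isd_nonneg: "isd d Z u v t ==> 0 \<le> t"
 using wk_nonneg isd_wk by blast

lemma isd_self: "isd d Z u u 0"
 unfolding isd_def using wk_nonneg wk_refl by blast

end

section \<open>Shortest closed walks and the pruning relations\<close>

context prog begin

text \<open>Length of a shortest closed walk through \<open>x\<close>, capped at \<open>BIG\<close>,
  which also stands for infinity.\<close>

definition cm :: "int => int" where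
 "cm x = (if \<exists>t. 0 < t \<and> wk 0 {} x x t then min BIG (int (LEAST k. 0 < k \<and> wk 0 {} x x (int k))) else BIG)"

lemma BIG0: "0 < BIG"
proof -
 have "1 \<le> W" using wt[of 0] m1 by auto
 hence "1 * 1 \<le> (m + 2) * W" using m1 by (intro mult_mono) auto
 thus ?thesis using BIGl by linarith
qed

lemma cm_props: "0 < cm x" "cm x \<le> BIG" "cm x = BIG \<or> wk 0 {} x x (cm x)"
 and cm_le: "0 < t ==> wk 0 {} x x t ==> cm x \<le> t"
proof -
 let ?P = "\<lambda>k. 0 < k \<and> wk 0 {} x x (int k)"
 have L: "?P (LEAST k. ?P k)" "(LEAST k. ?P k) \<le> nat t" if "0 < t" "wk 0 {} x x t" for t
 proof -
  have p: "?P (nat t)" using that by simp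
  show "?P (LEAST k. ?P k)" by (rule LeastI[of ?P, OF p])
  show "(LEAST k. ?P k) \<le> nat t" by (rule Least_le[of ?P, OF p])
 qed
 show "0 < cm x" "cm x \<le> BIG" "cm x = BIG \<or> wk 0 {} x x (cm x)"
  using L(1) BIG0 by (auto simp: cm_def min_def)
 show "cm x \<le> t" if "0 < t" "wk 0 {} x x t" using L(2)[OF that] that by (auto simp: cm_def)
qed

lemma cm_le_any:
 assumes "d = 0 \<or> d = 1" "0 < t" "wk d Z x x t"
 shows "cm x \<le> t"
proof -
 have w: "wk d {} x x t" using wk_mono[OF assms(3)] by simp
 have "wk 0 {} x x t" using wk_rev[OF w] w assms(1) by auto
 thus ?thesis using cm_le assms(2) by blast
qed

text \<open>From here on the tests are phrased by distances alone. For a fixed owner of the list,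
  admission and exclusion do not depend on the sample in stage 1, and in stage 2 only on the sample
  \<open>ys\<close> of stage 1. This is what makes the sampling bound applicable to each
  stage.\<close>

definition A1 :: "int => int => bool" where "A1 r x \<longleftrightarrow> 0 \<le> x \<and> x < n \<and> (\<exists>b. isd 0 {} x r b)"
definition sv1 :: "int => int => int => bool" where
 "sv1 r s x \<longleftrightarrow> (\<exists>a b c. isd 0 {} s x a \<and> isd 0 {} x r b \<and> isd 0 {} s r c \<and> 4 * (a + b) < 4 * c + 2 * cm s)"
text \<open>The clause \<open>s = x\<close> makes the relation reflexive, as totality demands. It
  loses no visited vertex, since later searches never enter an earlier root.\<close>

definition kl1 :: "int => int => int => bool" where "kl1 r s x \<longleftrightarrow> s = x \<or> \<not> sv1 r s x"
definition L1 :: "int list => int => int list" where "L1 ys r = onl (A1 r) (kl1 r) (nat K) ys"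
definition gm :: "int list => int" where "gm ys = Min (insert BIG (cm ` set ys))"
definition tA :: "int list => int => int => int => bool" where
 "tA ys p x a \<longleftrightarrow> (\<forall>s\<in>set (L1 ys p). \<exists>\<alpha> \<gamma>. isd 0 {} s x \<alpha> \<and> isd 0 {} s p \<gamma> \<and> 4 * (\<alpha> + a) < 4 * \<gamma> + 2 * cm s)"
text \<open>The slack is \<open>gm\<close> where \<open>tA\<close> grants \<open>2 * cm s\<close>,
  which is at least twice as much. The missing half is spent in \<open>four_approx\<close> on a tour
  of the short cycle.\<close>

definition A2 :: "int list => int => int => bool" where
 "A2 ys u x \<longleftrightarrow> 0 \<le> x \<and> x < n \<and> x \<notin> set ys \<and> (\<exists>b. isd 0 (set ys) u x b \<and>
   (\<forall>s\<in>set (L1 ys x). \<exists>a c. isd 0 {} s u a \<and> isd 0 {} s x c \<and> 4 * (a + b) < 4 * c + gm ys))"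
text \<open>\<open>tA\<close> occurs because the distance from \<open>p\<close> is known only where
  the pruned search from \<open>p\<close> gets, and the minimum is the capped length recorded for
  \<open>p\<close>. Both make \<open>sv2\<close> smaller and hence \<open>kl2\<close> larger, so
  totality does not suffer.\<close>

definition sv2 :: "int list => int => int => int => bool" where
 "sv2 ys u p x \<longleftrightarrow> (\<exists>a b c. isd 1 (set ys) p x a \<and> tA ys p x a \<and> isd 0 (set ys) u x b \<and> isd 0 (set ys) u p c \<and>
   4 * (a + b) < 4 * c + min (2 * cm p) (gm ys))"
definition kl2 :: "int list => int => int => int => bool" where "kl2 ys u p x \<longleftrightarrow> p = x \<or> \<not> sv2 ys u p x"
definition L2 :: "int list => int list => int => int list" where "L2 ys zs u = onl (A2 ys u) (kl2 ys u) (nat K) zs"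

text \<open>The survivors have so few edges that the next stage is not truncated. The random choices
  enter the proof of the factor 4 only through \<open>good1\<close> and
  \<open>good2\<close>.\<close>

definition good1 :: "int => int list => bool" where
 "good1 X ys \<longleftrightarrow> (\<forall>r. vtx r --> vol 1 {x. A1 r x \<and> (\<forall>s\<in>set (L1 ys r). \<not> kl1 r s x)} < nat X)"
definition good2 :: "int => int list => int list => bool" where
 "good2 X ys zs \<longleftrightarrow> (\<forall>u. 0 \<le> u \<and> u < n \<and> u \<notin> set ys --> vol 0 {x. A2 ys u x \<and> (\<forall>p\<in>set (L2 ys zs u). \<not> kl2 ys u p x)} < nat X)"

lemma closed_pair:
 assumes "d = 0 \<or> d = 1" "wk d Z x y a" "wk d Z y x a'" "x \<noteq> y"
 shows "cm x \<le> a + a'" "cm y \<le> a + a'"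
proof -
 have p: "0 < a" "0 < a'" using wk_pos[OF assms(2)] wk_pos[OF assms(3)] assms(4) by auto
 show "cm x \<le> a + a'" by (rule cm_le_any[OF assms(1) _ wk_trans[OF assms(3,2)]]) (use p in simp)
 have "wk d Z y y (a' + a)" by (rule wk_trans[OF assms(2,3)])
 thus "cm y \<le> a + a'" using cm_le_any[OF assms(1), of "a' + a" Z y] p by (simp add: add.commute)
qed

text \<open>
 Two vertices that survive each other lie on a closed walk that is shorter than the average of
 their shortest cycles; hence the pruning relation is total.
\<close>

lemma kl1_total: "kl1 r x y \<or> kl1 r y x"
proof (rule ccontr)
 assume "\<not> (kl1 r x y \<or> kl1 r y x)"
 hence ne: "x \<noteq> y" and s: "sv1 r x y" "sv1 r y x" by (auto simp: kl1_def)
 from s(1) obtain a b c where 1: "isd 0 {} x y a" "isd 0 {} y r b" "isd 0 {} x r c" "4 * (a + b) < 4 * c + 2 * cm x" by (auto simp: sv1_def)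
 from s(2) obtain a' b' c' where 2: "isd 0 {} y x a'" "isd 0 {} x r b'" "isd 0 {} y r c'" "4 * (a' + b') < 4 * c' + 2 * cm y" by (auto simp: sv1_def)
 \<comment> \<open>Adding the two inequalities therefore cancels the distances to
   \<open>r\<close>.\<close>
 have "b' = c" "c' = b" using isd_unique 1 2 by blast+
 moreover have "cm x \<le> a + a'" "cm y \<le> a + a'" using closed_pair[OF _ isd_wk[OF 1(1)] isd_wk[OF 2(1)] ne] by auto
 ultimately show False using 1(4) 2(4) by simp
qed

lemma kl2_total: "kl2 ys u x y \<or> kl2 ys u y x"
proof (rule ccontr)
 assume "\<not> (kl2 ys u x y \<or> kl2 ys u y x)"
 hence ne: "x \<noteq> y" and s: "sv2 ys u x y" "sv2 ys u y x" by (auto simp: kl2_def)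
 from s(1) obtain a b c where 1: "isd 1 (set ys) x y a" "isd 0 (set ys) u y b" "isd 0 (set ys) u x c" "4 * (a + b) < 4 * c + min (2 * cm x) (gm ys)" by (auto simp: sv2_def)
 from s(2) obtain a' b' c' where 2: "isd 1 (set ys) y x a'" "isd 0 (set ys) u x b'" "isd 0 (set ys) u y c'" "4 * (a' + b') < 4 * c' + min (2 * cm y) (gm ys)" by (auto simp: sv2_def)
 have "b' = c" "c' = b" using isd_unique 1 2 by blast+
 moreover have "cm x \<le> a + a'" "cm y \<le> a + a'" using closed_pair[OF _ isd_wk[OF 1(1)] isd_wk[OF 2(1)] ne] by auto
 ultimately show False using 1(4) 2(4) by simp
qed

lemma rf_sound:
 assumes "rowfacts d r X Z tst \<tau> fnd" "0 \<le> v" "v < n" "0 < \<tau> v"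
 shows "wk d Z r v (\<tau> v - 1)" "v \<noteq> r ==> v \<notin> Z" "v \<noteq> r ==> tst v (\<tau> v - 1)"
 using assms unfolding rowfacts_def by blast+

lemma rf_relax:
 assumes "rowfacts d r X Z tst \<tau> fnd" "vol d {v. 0 < \<tau> v} < nat X" "0 \<le> e" "e < m" "0 < \<tau> (src d e)"
 shows "dst d e = r ==> fnd \<le> \<tau> (src d e) - 1 + wt e"
  "dst d e \<noteq> r ==> dst d e \<notin> Z ==> tst (dst d e) (\<tau> (src d e) - 1 + wt e) ==> 0 < \<tau> (dst d e) \<and> \<tau> (dst d e) \<le> \<tau> (src d e) + wt e"
 using assms unfolding rowfacts_def by metis+

text \<open>Induction along a shortest walk. By \<open>closed\<close>, the predecessor of
  \<open>v\<close> passes its test as well and so is labelled by its distance at most;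
  \<open>mono\<close> then transfers the test of \<open>v\<close> to the value that the search
  actually tries.\<close>

lemma rf_exact:
 assumes rf: "rowfacts d r X Z tst \<tau> fnd" and un: "vol d {v. 0 < \<tau> v} < nat X" and r: "0 \<le> r" "r < n"
  and mono: "\<And>v t t'. 0 \<le> v ==> v < n ==> tst v t ==> t' \<le> t ==> tst v t'"
  and closed: "\<And>e t. 0 \<le> e ==> e < m ==> tst (dst d e) (t + wt e) ==> tst (src d e) t"
  and v: "0 \<le> v" "v < n" and d: "isd d Z r v t" and ok: "v = r \<or> tst v t"
 shows "\<tau> v = t + 1"
proof -
 have "0 < \<tau> v \<and> \<tau> v \<le> t + 1"
  using v d ok
 proof (induction "nat t" arbitrary: v t rule: less_induct)
  case less
  show ?case
  proof (cases "v = r")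
   case True
   thus ?thesis using rf isd_nonneg[OF less.prems(3)] by (simp add: rowfacts_def)
  next
   case False
   then obtain e where e: "0 \<le> e" "e < m" "dst d e = v" "v \<notin> Z" "isd d Z r (src d e) (t - wt e)"
    using isd_last[OF less.prems(3)] by blast
   have tv: "tst v t" using less.prems False by simp
   have w: "1 \<le> wt e" using wt[OF e(1,2)] by simp
   have "src d e = r \<or> tst (src d e) (t - wt e)" using closed[OF e(1,2), of "t - wt e"] tv e(3) by simp
   moreover have "nat (t - wt e) < nat t" using w isd_nonneg[OF e(5)] by simp
   ultimately have IH: "0 < \<tau> (src d e)" "\<tau> (src d e) \<le> t - wt e + 1"
    using less.hyps[of "t - wt e" "src d e"] src_range[OF e(1,2)] e(5) by auto
   have "tst (dst d e) (\<tau> (src d e) - 1 + wt e)"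
    unfolding e(3) by (rule mono[OF less.prems(1,2) tv]) (use IH in simp)
   from rf_relax(2)[OF rf un e(1,2) IH(1) _ _ this] show ?thesis using e False IH by auto
  qed
 qed
 moreover from this have "t \<le> \<tau> v - 1" using isd_le[OF d rf_sound(1)[OF rf v]] by simp
 ultimately show ?thesis by linarith
qed

lemma rf_found_ge:
 assumes "rowfacts d r X Z tst \<tau> fnd" "d = 0 \<or> d = 1"
 shows "cm r \<le> fnd"
proof (cases "fnd < BIG")
 case True
 hence "0 < fnd" "wk d Z r r fnd" using assms(1) by (auto simp: rowfacts_def)
 thus ?thesis using cm_le_any[OF assms(2)] by blast
next
 case False
 thus ?thesis using cm_props(2)[of r] assms(1) by (simp add: rowfacts_def)
qed

text \<open>Follows the given closed walk itself: each of its vertices passes the test with the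
  length of the way to it, so by \<open>mono\<close> it gets a label that is no larger, and the last
  edge back to \<open>r\<close> reports at most \<open>g\<close>.\<close>

lemma rf_cycle:
 assumes rf: "rowfacts d r X Z tst \<tau> fnd" and un: "vol d {v. 0 < \<tau> v} < nat X" and r: "0 \<le> r" "r < n"
  and mono: "\<And>v t t'. 0 \<le> v ==> v < n ==> tst v t ==> t' \<le> t ==> tst v t'"
  and g: "wk d {} r r g" "0 < g"
  and tst: "\<And>x t t'. 0 \<le> x ==> x < n ==> x \<noteq> r ==> wk d {} r x t ==> wk d {} x r t' ==> t + t' \<le> g ==> x \<notin> Z \<and> tst x t"
 shows "fnd \<le> g"
proof -
 have reach: "wk d {} r v t ==> wk d {} v r t' ==> t + t' \<le> g ==> 0 < \<tau> v \<and> \<tau> v \<le> t + 1" for v t t'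
 proof (induction arbitrary: t' rule: wk.induct)
  case wk_refl
  thus ?case using rf by (simp add: rowfacts_def)
 next
  case (wk_step v t e)
  have b: "wk d {} v r (wt e + t')"
   using wk_trans[OF wk_step.prems(1), of v "wt e"] wk.wk_step[OF wk.wk_refl[of d "{}" v] wk_step.hyps(2,3,4)] by simp
  have IH: "0 < \<tau> v" "\<tau> v \<le> t + 1" using wk_step.IH[OF b] wk_step.prems(2) by auto
  show ?case
  proof (cases "dst d e = r")
   case True
   thus ?thesis using rf wk_nonneg[OF wk_step.hyps(1)] wt[of e] wk_step.hyps by (simp add: rowfacts_def)
  next
   case False
   have x: "0 \<le> dst d e" "dst d e < n" using dst_range wk_step.hyps by auto
   have w: "wk d {} r (dst d e) (t + wt e)" by (rule wk.wk_step[OF wk_step.hyps])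
   have T: "dst d e \<notin> Z" "tst (dst d e) (t + wt e)" using tst[OF x False w wk_step.prems] by auto
   have "tst (dst d e) (\<tau> (src d e) - 1 + wt e)"
    by (rule mono[OF x T(2)]) (use IH wk_step.hyps in simp)
   from rf_relax(2)[OF rf un wk_step.hyps(2,3) _ False T(1) this] IH wk_step.hyps show ?thesis by simp
  qed
 qed
 from g(1) show ?thesis
 proof (cases rule: wk.cases)
  case (wk_step v t e)
  have w: "wk d {} v r (wt e)" using wk.wk_step[OF wk_refl[of d "{}" v] wk_step(4,5,6)] wk_step(1) by simp
  have "0 < \<tau> v" "\<tau> v \<le> t + 1" using reach[OF wk_step(3) w] wk_step(2) by auto
  thus ?thesis using rf_relax(1)[OF rf un wk_step(4,5)] wk_step(1,2,6) by simp
 qed (use g in simp)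
qed

text \<open>Every vertex of a walk splits it into two walks, so the assumption covers all vertices
  on it.\<close>

lemma wk_avoid:
 assumes "wk d {} y x t" "\<And>v a b. wk d {} y v a ==> wk d {} v x b ==> a + b \<le> t ==> v \<notin> Z"
 shows "wk d Z y x t"
proof -
 have "wk d {} y v a ==> wk d {} v x b ==> a + b \<le> t ==> wk d Z y v a" for v a b
 proof (induction arbitrary: b rule: wk.induct)
  case (wk_step v a e)
  have b: "wk d {} v x (wt e + b)"
   using wk_trans[OF wk_step.prems(1), of v "wt e"] wk.wk_step[OF wk.wk_refl[of d "{}" v] wk_step.hyps(2,3,4)] by simp
  have "wk d Z y v a" by (rule wk_step.IH[OF b]) (use wk_step.prems in simp)
  moreover have "dst d e \<notin> Z" by (rule assms(2)[OF wk.wk_step[OF wk_step.hyps] wk_step.prems])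
  ultimately show ?case using wk_step.hyps by (intro wk.wk_step) auto
 qed (rule wk_refl)
 from this[OF assms(1) wk_refl] show ?thesis by simp
qed

end

section \<open>From the final memory to distances\<close>

locale outcome = prog n m W tlv hdv wt K BIG BC M b for n m W tlv hdv wt K BIG BC M b +
 fixes s :: st and N1 NR X2 X3 :: int
 assumes sN: "s rN 0 = n" "s rK 0 = K" and los: "lists_ok s (NR + m)" and N1: "0 \<le> N1" "N1 \<le> NR"
  and SQ: "\<And>p. 0 \<le> p ==> p < NR + m ==> 0 \<le> s rSQ p \<and> s rSQ p < m"
  and SQ3: "\<And>e. 0 \<le> e ==> e < m ==> s rSQ (NR + e) = e"
  and row1: "\<And>p. 0 \<le> p ==> p < N1 ==> row_ok s 1 0 (m + 1) 0 p"
  and row2: "\<And>p. N1 \<le> p ==> p < NR ==> row_ok s 2 1 X2 N1 p"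
  and row3: "\<And>p. NR \<le> p ==> p < NR + m ==> row_ok s 3 0 X3 NR p"
  and lst01: "\<And>u. 0 \<le> u ==> u < n ==> lst s u = [] \<and> lst s (n + u) = []"
  and lst2: "\<And>u. 0 \<le> u ==> u < n ==> lst s (2 * n + u) = alist s 1 0 u 0 N1"
  and lst3: "\<And>u. 0 \<le> u ==> u < n ==> lst s (3 * n + u) = alist s 2 1 u N1 NR"
  and G0: "s rG 0 = 2 * BIG" and G12: "s rBEST 0 \<le> s rG 1" "s rG 1 \<le> BIG"
  and G1le: "\<And>p. 0 \<le> p ==> p < N1 ==> 0 < tau s p (root s 0 p) ==> 2 * s rG 1 \<le> s rC2 p"
  and G1ex: "s rG 1 = BIG \<or> (\<exists>p. 0 \<le> p \<and> p < N1 \<and> 0 < tau s p (root s 0 p) \<and> s rC2 p = 2 * s rG 1)"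
  and ex1: "\<And>v. 0 \<le> v ==> v < n ==> v \<notin> excl s 1"
  and ex2: "\<And>v. 0 \<le> v ==> v < n ==> v \<in> excl s 2 \<longleftrightarrow> (\<exists>p. 0 \<le> p \<and> p < N1 \<and> root s 0 p = v \<and> 0 < tau s p v)"
  and ex3: "\<And>v. 0 \<le> v ==> v < n ==> v \<in> excl s 3 \<longleftrightarrow> v \<in> excl s 2 \<or> (\<exists>p. N1 \<le> p \<and> p < NR \<and> root s 1 p = v \<and> 0 < tau s p v)"
begin

text \<open>\<open>Q1\<close> and \<open>Q2\<close> select the rows in which a search took place;
  rows with a repeated or excluded root stay empty. \<open>ys\<close> and \<open>zs\<close> below
  are the raw samples with repetitions, to which the counting bounds refer.\<close>

definition Q1 where "Q1 p \<longleftrightarrow> 0 \<le> p \<and> p < N1 \<and> 0 < tau s p (root s 0 p)"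
definition Q2 where "Q2 p \<longleftrightarrow> N1 \<le> p \<and> p < NR \<and> 0 < tau s p (root s 1 p)"
definition ys where "ys = map (root s 0) [0..N1 - 1]"
definition zs where "zs = map (root s 1) [N1..NR - 1]"

lemma root_range: "0 \<le> p ==> p < NR + m ==> 0 \<le> root s d p \<and> root s d p < n"
 using SQ[of p] dst_range[of "s rSQ p" d] by (simp add: root_def)

lemma Q1_root: "Q1 p ==> 0 \<le> root s 0 p \<and> root s 0 p < n"
 using root_range[of p 0] N1 m1 by (simp add: Q1_def)

lemma Q2_root: "Q2 p ==> 0 \<le> root s 1 p \<and> root s 1 p < n"
 using root_range[of p 1] N1 m1 by (simp add: Q2_def)

lemma tst_of1:
 assumes r: "0 \<le> r" "r < n" and v: "0 \<le> v" "v < n"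
 shows "tst_of s 1 r v t"
 unfolding tst_of_def passes_lst[where s = s, OF sN] using lst01[OF r] lst01[OF v] by simp

lemma Q1_row:
 assumes "Q1 p"
 obtains fnd where "rowfacts 0 (root s 0 p) (m + 1) {} (\<lambda>_ _. True) (tau s p) fnd" "s rC2 p = 2 * fnd"
  "\<And>p'. 0 \<le> p' ==> p' < p ==> \<not> (root s 0 p' = root s 0 p \<and> Q1 p')"
proof -
 have p: "0 \<le> p" "p < N1" "0 < tau s p (root s 0 p)" using assms by (auto simp: Q1_def)
 from row1[OF p(1,2)] p(3) obtain fnd where f: "rowfacts 0 (root s 0 p) (m + 1) (excl s 1) (tst_of s 1 (root s 0 p)) (tau s p) fnd"
  "s rC2 p = min (2 * fnd) (s rG (1 - 1))" "\<And>p'. 0 \<le> p' ==> p' < p ==> \<not> (root s 0 p' = root s 0 p \<and> 0 < tau s p' (root s 0 p))"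
  unfolding row_ok_def by auto
 have rr: "0 \<le> root s 0 p" "root s 0 p < n" using Q1_root[OF assms] by auto
 have "rowfacts 0 (root s 0 p) (m + 1) {} (\<lambda>_ _. True) (tau s p) fnd"
  by (rule rowfacts_cong[OF f(1) rr]) (use ex1 tst_of1[OF rr] in auto)
 moreover have "s rC2 p = 2 * fnd" using f(1,2) G0 by (simp add: rowfacts_def)
 ultimately show ?thesis using that f(3) by (auto simp: Q1_def)
qed

lemma vol_all: "vol d S < nat (m + 1)"
 using vol_le[of d S] m1 by linarith

text \<open>Stage 1 has empty lists, no excluded vertices and a truncation bound above any volume,
  so its searches are plain Dijkstra.\<close>

lemma Q1_exact:
 assumes "Q1 p" and v: "0 \<le> v" "v < n"
 shows "isd 0 {} (root s 0 p) v t \<longleftrightarrow> 0 < tau s p v \<and> t = tau s p v - 1"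
proof -
 obtain fnd where f: "rowfacts 0 (root s 0 p) (m + 1) {} (\<lambda>_ _. True) (tau s p) fnd" using Q1_row[OF assms(1)] by blast
 have e: "tau s p v = t + 1" if "isd 0 {} (root s 0 p) v t" for t
  by (rule rf_exact[OF f vol_all _ _ _ _ v that]) (use Q1_root[OF assms(1)] in auto)
 show ?thesis
 proof
  assume h: "isd 0 {} (root s 0 p) v t"
  show "0 < tau s p v \<and> t = tau s p v - 1" using e[OF h] isd_nonneg[OF h] by simp
 next
  assume h: "0 < tau s p v \<and> t = tau s p v - 1"
  hence "wk 0 {} (root s 0 p) v t" using rf_sound(1)[OF f v] by simp
  then obtain t' where t': "isd 0 {} (root s 0 p) v t'" using isd_ex by blast
  hence "t' = t" using e[OF t'] h by simp
  thus "isd 0 {} (root s 0 p) v t" using t' by simp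
 qed
qed

lemma Q1_C2:
 assumes "Q1 p" shows "s rC2 p = 2 * cm (root s 0 p)"
proof -
 obtain fnd where f: "rowfacts 0 (root s 0 p) (m + 1) {} (\<lambda>_ _. True) (tau s p) fnd" "s rC2 p = 2 * fnd" using Q1_row[OF assms(1)] by blast
 have "fnd \<le> cm (root s 0 p)"
 proof (cases "cm (root s 0 p) = BIG")
  case True thus ?thesis using f(1) by (simp add: rowfacts_def)
 next
  case False
  show ?thesis
   by (rule rf_cycle[OF f(1) vol_all]) (use False Q1_root[OF assms(1)] cm_props[of "root s 0 p"] in auto)
 qed
 thus ?thesis using rf_found_ge[OF f(1)] f(2) by simp
qed

lemma Q1_distinct: "Q1 p ==> Q1 p' ==> p' < p ==> root s 0 p' \<noteq> root s 0 p"
 by (rule Q1_row[of p]) (auto simp: Q1_def)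

lemma row1_skip:
 assumes "0 \<le> p" "p < N1" "\<not> Q1 p"
 shows "\<And>v. 0 \<le> v ==> v < n ==> tau s p v = 0" "\<exists>p'. p' < p \<and> Q1 p' \<and> root s 0 p' = root s 0 p"
proof -
 have np: "\<not> 0 < tau s p (root s 0 p)" using assms by (simp add: Q1_def)
 have rr: "0 \<le> root s 0 p" "root s 0 p < n" using root_range[of p 0] assms N1 m1 by auto
 have o: "(\<forall>v. vtx v --> tau s p v = 0)"
  "root s 0 p \<in> excl s 1 \<or> (\<exists>p'. 0 \<le> p' \<and> p' < p \<and> root s 0 p' = root s 0 p \<and> 0 < tau s p' (root s 0 p))"
  using row1[OF assms(1,2)] np unfolding row_ok_def by auto
 show "\<And>v. 0 \<le> v ==> v < n ==> tau s p v = 0" using o(1) by blast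
 obtain p' where "0 \<le> p'" "p' < p" "root s 0 p' = root s 0 p" "0 < tau s p' (root s 0 p)" using o(2) ex1[OF rr] by blast
 thus "\<exists>p'. p' < p \<and> Q1 p' \<and> root s 0 p' = root s 0 p" using assms(2) by (intro exI[of _ p']) (auto simp: Q1_def)
qed

lemma set_ys: "v \<in> set ys \<longleftrightarrow> (\<exists>p. Q1 p \<and> root s 0 p = v)"
proof
 assume "v \<in> set ys"
 then obtain p where p: "0 \<le> p" "p < N1" "v = root s 0 p" by (auto simp: ys_def)
 show "\<exists>p. Q1 p \<and> root s 0 p = v"
 proof (cases "Q1 p")
  case False
  thus ?thesis using row1_skip(2)[OF p(1,2)] p(3) by auto
 qed (use p in auto)
qed (auto simp: ys_def Q1_def)

lemma excl2: "0 \<le> v ==> v < n ==> v \<in> excl s 2 \<longleftrightarrow> v \<in> set ys"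
 using ex2[of v] set_ys[of v] by (auto simp: Q1_def)

lemma excl3: "0 \<le> v ==> v < n ==> v \<in> excl s 3 \<longleftrightarrow> v \<in> set ys \<or> (\<exists>p. Q2 p \<and> root s 1 p = v)"
 using ex3[of v] excl2[of v] by (auto simp: Q2_def)

lemma okp1:
 assumes "Q1 q" and x: "0 \<le> x" "x < n" and y: "0 \<le> y" "y < n" and ty: "0 < tau s q y"
 shows "okp s q x y t c \<longleftrightarrow> (\<exists>\<alpha> \<gamma>. isd 0 {} (root s 0 q) x \<alpha> \<and> isd 0 {} (root s 0 q) y \<gamma> \<and> 4 * (\<alpha> + t) < 4 * \<gamma> + c)"
 unfolding okp_def Q1_exact[OF assms(1) x] Q1_exact[OF assms(1) y] using ty by auto

text \<open>The list of the program, read as roots, is the greedy list \<open>onl\<close> for the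
  raw sample. In a row with a search, labels are distances and both conditions coincide; in an empty
  row neither list grows, by \<open>onl_dup\<close>.\<close>

lemma list1:
 assumes u: "0 \<le> u" "u < n" and j: "0 \<le> j" "j \<le> N1"
 shows "map (root s 0) (alist s 1 0 u 0 j) = onl (A1 u) (kl1 u) (nat K) (map (root s 0) [0..j - 1]) \<and>
  (\<forall>p\<in>set (alist s 1 0 u 0 j). Q1 p \<and> 0 < tau s p u)"
 using j
proof (induction j rule: int_ge_induct)
 case (step i)
 define R where "R = alist s 1 0 u 0 i"
 define r where "r = root s 0 i"
 have IH: "map (root s 0) R = onl (A1 u) (kl1 u) (nat K) (map (root s 0) [0..i - 1])" "\<forall>p\<in>set R. Q1 p \<and> 0 < tau s p u"
  using step R_def by auto
 have up: "[0..i + 1 - 1] = [0..i - 1] @ [i]" using step.hyps upto_rec2[of 0 i] by simp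
 have rr: "0 \<le> r" "r < n" using root_range[of i 0] step N1 m1 by (auto simp: r_def)
 have E: "alist s 1 0 u 0 (i + 1) = (if cond s 1 0 u R i then R @ [i] else R)"
  unfolding R_def by (rule alist_step[OF step.hyps])
 have O: "onl (A1 u) (kl1 u) (nat K) (map (root s 0) [0..i + 1 - 1]) =
   (if A1 u r \<and> (\<forall>x\<in>set (map (root s 0) R). \<not> kl1 u x r) \<and> length R < nat K then map (root s 0) R @ [r] else map (root s 0) R)"
  unfolding up map_append list.map onl_snoc IH(1)[symmetric] r_def Let_def by simp
 have c: "cond s 1 0 u R i \<longleftrightarrow> 0 < tau s i u \<and> (\<forall>q\<in>set R. okp s q r u (tau s i u - 1) (s rC2 q)) \<and> length R < nat K"
  unfolding cond_def using lst01[OF rr] by (simp add: r_def)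
 show ?case
 proof (cases "Q1 i")
  case True
  have a: "0 < tau s i u \<longleftrightarrow> A1 u r" unfolding A1_def r_def using Q1_exact[OF True u] rr by (auto simp: r_def)
  have k: "okp s q r u (tau s i u - 1) (s rC2 q) \<longleftrightarrow> \<not> kl1 u (root s 0 q) r" if q: "q \<in> set R" and ti: "0 < tau s i u" for q
  proof -
   have q1: "Q1 q" "0 < tau s q u" "q < i" using IH(2) q alist_set[of q s 1 0 u 0 i] by (auto simp: R_def)
   have "isd 0 {} r u bb \<longleftrightarrow> bb = tau s i u - 1" for bb using Q1_exact[OF True u] ti by (simp add: r_def)
   thus ?thesis unfolding okp1[OF q1(1) rr u q1(2)] kl1_def sv1_def Q1_C2[OF q1(1)]
    using Q1_distinct[OF True q1(1,3)] by (auto simp: r_def)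
  qed
  have "cond s 1 0 u R i \<longleftrightarrow> A1 u r \<and> (\<forall>x\<in>set (map (root s 0) R). \<not> kl1 u x r) \<and> length R < nat K"
   unfolding c a[symmetric] using k by auto
  thus ?thesis unfolding E O using IH(2) True a by (auto simp: r_def)
 next
  case False
  have i: "0 \<le> i" "i < N1" using step by auto
  have "tau s i u = 0" by (rule row1_skip(1)[OF i False u])
  hence "\<not> cond s 1 0 u R i" unfolding c by simp
  moreover have "r \<in> set (map (root s 0) [0..i - 1])"
   using row1_skip(2)[OF i False] unfolding r_def by (auto simp: Q1_def) (metis atLeastAtMost_iff image_eqI zle_diff1_eq)
  hence "\<not> (A1 u r \<and> (\<forall>x\<in>set (map (root s 0) R). \<not> kl1 u x r) \<and> length R < nat K)"
   using onl_dup[of "kl1 u" r "map (root s 0) [0..i - 1]" "A1 u" "nat K"] IH(1) by (metis kl1_def length_map)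
  ultimately show ?thesis unfolding E O using IH(2) by simp
 qed
qed simp

lemma list1_set:
 assumes u: "0 \<le> u" "u < n"
 shows "x \<in> set (L1 ys u) \<longleftrightarrow> (\<exists>q\<in>set (lst s (2 * n + u)). x = root s 0 q)"
  "q \<in> set (lst s (2 * n + u)) ==> Q1 q \<and> 0 < tau s q u"
proof -
 have l: "map (root s 0) (lst s (2 * n + u)) = L1 ys u" "\<forall>p\<in>set (lst s (2 * n + u)). Q1 p \<and> 0 < tau s p u"
  using list1[OF u N1(1) order_refl] unfolding lst2[OF u] L1_def ys_def by auto
 show "x \<in> set (L1 ys u) \<longleftrightarrow> (\<exists>q\<in>set (lst s (2 * n + u)). x = root s 0 q)" unfolding l(1)[symmetric] by auto
 show "q \<in> set (lst s (2 * n + u)) ==> Q1 q \<and> 0 < tau s q u" using l(2) by blast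
qed

lemma list1_ball:
 assumes u: "0 \<le> u" "u < n"
 shows "(\<forall>x\<in>set (L1 ys u). P x) \<longleftrightarrow> (\<forall>q\<in>set (lst s (2 * n + u)). P (root s 0 q))"
 using list1_set(1)[OF u] by auto

lemma gm_le: "x \<in> set ys ==> gm ys \<le> cm x" "gm ys \<le> BIG"
 by (simp_all add: gm_def)

lemma G1: "s rG 1 = gm ys"
proof (rule antisym)
 show "s rG 1 \<le> gm ys"
  unfolding gm_def
 proof (rule Min.boundedI)
  fix a assume "a \<in> insert BIG (cm ` set ys)"
  then consider "a = BIG" | x where "x \<in> set ys" "a = cm x" by blast
  thus "s rG 1 \<le> a"
  proof cases
   case 2
   then obtain p where "Q1 p" "root s 0 p = x" using set_ys by blast
   thus ?thesis using G1le[of p] Q1_C2[of p] 2 by (simp add: Q1_def)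
  qed (use G12 in simp)
 qed simp_all
 from G1ex show "gm ys \<le> s rG 1"
 proof
  assume "\<exists>p. 0 \<le> p \<and> p < N1 \<and> 0 < tau s p (root s 0 p) \<and> s rC2 p = 2 * s rG 1"
  then obtain p where p: "Q1 p" "s rC2 p = 2 * s rG 1" by (auto simp: Q1_def)
  thus ?thesis using gm_le(1)[of "root s 0 p"] Q1_C2[OF p(1)] set_ys by auto
 qed (use gm_le in simp)
qed

lemma gm_pos: "0 < gm ys"
 unfolding gm_def using cm_props(1) BIG0 by simp

lemma L1_props:
 assumes "x \<in> set (L1 ys u)"
 shows "x \<in> set ys" "\<exists>b. isd 0 {} x u b" "gm ys \<le> cm x"
 using assms onl_set[of "A1 u" "kl1 u" "nat K" ys] gm_le(1) unfolding L1_def A1_def by blast+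

lemma tA_mono: "tA ys p x a ==> a' \<le> a ==> tA ys p x a'"
 unfolding tA_def by (meson add_left_mono mult_left_mono order.strict_trans1 zero_le_numeral)

lemma tA_self: "tA ys p p 0"
 unfolding tA_def using L1_props(2) cm_props(1) by fastforce

text \<open>The search runs backwards along \<open>e\<close>, so the walk from a listed root to
  \<open>dst 1 e\<close> continues forwards over \<open>e\<close> to \<open>src 1 e\<close>. The
  weight that the search saves is what that walk pays.\<close>

lemma tA_closed:
 assumes "0 \<le> e" "e < m" "tA ys p (dst 1 e) (t + wt e)"
 shows "tA ys p (src 1 e) t"
 unfolding tA_def
proof
 fix x assume "x \<in> set (L1 ys p)"
 then obtain \<alpha> \<gamma> where h: "isd 0 {} x (dst 1 e) \<alpha>" "isd 0 {} x p \<gamma>" "4 * (\<alpha> + (t + wt e)) < 4 * \<gamma> + 2 * cm x"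
  using assms(3) unfolding tA_def by blast
 have "src 0 e = dst 1 e" "dst 0 e = src 1 e" by (simp_all add: src_def)
 hence "wk 0 {} x (src 1 e) (\<alpha> + wt e)" using wk_step[OF isd_wk[OF h(1)] assms(1,2)] by simp
 then obtain \<alpha>' where "isd 0 {} x (src 1 e) \<alpha>'" "\<alpha>' \<le> \<alpha> + wt e" using isd_ex by blast
 thus "\<exists>\<alpha> \<gamma>. isd 0 {} x (src 1 e) \<alpha> \<and> isd 0 {} x p \<gamma> \<and> 4 * (\<alpha> + t) < 4 * \<gamma> + 2 * cm x" using h(2,3) by (intro exI[of _ \<alpha>'] exI[of _ \<gamma>]) simp
qed

lemma tst_of2:
 assumes r: "0 \<le> r" "r < n" and v: "0 \<le> v" "v < n"
 shows "tst_of s 2 r v t \<longleftrightarrow> tA ys r v t"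
proof -
 have e: "(2 - 1) * n + v = n + v" by simp
 have "okp s q v r t (s rC2 q) \<longleftrightarrow> (\<exists>\<alpha> \<gamma>. isd 0 {} (root s 0 q) v \<alpha> \<and> isd 0 {} (root s 0 q) r \<gamma> \<and> 4 * (\<alpha> + t) < 4 * \<gamma> + 2 * cm (root s 0 q))"
  if "q \<in> set (lst s (2 * n + r))" for q
  using okp1[OF _ v r] list1_set(2)[OF r that] Q1_C2[of q] by simp
 thus ?thesis unfolding tst_of_def passes_lst[where s = s, OF sN] e tA_def list1_ball[OF r] using lst01[OF v] by simp
qed

lemma Q2_row:
 assumes "Q2 p"
 obtains fnd where "rowfacts 1 (root s 1 p) X2 (set ys) (tA ys (root s 1 p)) (tau s p) fnd" "s rC2 p = min (2 * fnd) (gm ys)"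
  "s rBEST 0 \<le> fnd" "\<And>p'. N1 \<le> p' ==> p' < p ==> \<not> (root s 1 p' = root s 1 p \<and> Q2 p')"
proof -
 have p: "N1 \<le> p" "p < NR" "0 < tau s p (root s 1 p)" using assms by (auto simp: Q2_def)
 from row2[OF p(1,2)] p(3) obtain fnd where f: "rowfacts 1 (root s 1 p) X2 (excl s 2) (tst_of s 2 (root s 1 p)) (tau s p) fnd"
  "s rC2 p = min (2 * fnd) (s rG (2 - 1))" "s rBEST 0 \<le> fnd" "\<And>p'. N1 \<le> p' ==> p' < p ==> \<not> (root s 1 p' = root s 1 p \<and> 0 < tau s p' (root s 1 p))"
  unfolding row_ok_def by auto
 have rr: "0 \<le> root s 1 p" "root s 1 p < n" using Q2_root[OF assms] by auto
 have "rowfacts 1 (root s 1 p) X2 (set ys) (tA ys (root s 1 p)) (tau s p) fnd"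
  by (rule rowfacts_cong[OF f(1) rr]) (use excl2 tst_of2[OF rr] in auto)
 moreover have "s rC2 p = min (2 * fnd) (gm ys)" using f(2) G1 by simp
 ultimately show ?thesis using that f(3,4) by (auto simp: Q2_def)
qed

lemma Q2_root_ys: "Q2 p ==> root s 1 p \<notin> set ys"
 by (rule Q2_row[of p]) (auto simp: rowfacts_def)

lemma Q2_distinct: "Q2 p ==> Q2 p' ==> p' < p ==> root s 1 p' \<noteq> root s 1 p"
 by (rule Q2_row[of p]) (auto simp: Q2_def)

lemma row2_skip:
 assumes "N1 \<le> p" "p < NR" "\<not> Q2 p"
 shows "\<And>v. 0 \<le> v ==> v < n ==> tau s p v = 0" "root s 1 p \<in> set ys \<or> (\<exists>p'. p' < p \<and> Q2 p' \<and> root s 1 p' = root s 1 p)"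
proof -
 have np: "\<not> 0 < tau s p (root s 1 p)" using assms by (simp add: Q2_def)
 have rr: "0 \<le> root s 1 p" "root s 1 p < n" using root_range[of p 1] assms N1 m1 by auto
 have o: "(\<forall>v. vtx v --> tau s p v = 0)"
  "root s 1 p \<in> excl s 2 \<or> (\<exists>p'. N1 \<le> p' \<and> p' < p \<and> root s 1 p' = root s 1 p \<and> 0 < tau s p' (root s 1 p))"
  using row2[OF assms(1,2)] np unfolding row_ok_def by auto
 show "\<And>v. 0 \<le> v ==> v < n ==> tau s p v = 0" using o(1) by blast
 show "root s 1 p \<in> set ys \<or> (\<exists>p'. p' < p \<and> Q2 p' \<and> root s 1 p' = root s 1 p)" 
 proof (cases "root s 1 p \<in> excl s 2")
  case False
  then obtain p' where "N1 \<le> p'" "p' < p" "root s 1 p' = root s 1 p" "0 < tau s p' (root s 1 p)" using o(2) by blast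
  thus ?thesis using assms(2) by (intro disjI2 exI[of _ p']) (auto simp: Q2_def)
 qed (use excl2[OF rr] in simp)
qed


text \<open>Every visited vertex survives the list of the root: the search test is the survival
  test, up to labels that may exceed the distance, and the exclusion of \<open>ys\<close> takes care
  of the clause \<open>s = x\<close>. So \<open>good1\<close> bounds the volume.\<close>

lemma Q2_uncapped:
 assumes g: "good1 X2 ys" and p: "Q2 p"
 shows "vol 1 {v. 0 < tau s p v} < nat X2"
proof -
 define r where "r = root s 1 p"
 have r: "0 \<le> r" "r < n" "r \<notin> set ys" using Q2_root[OF p] Q2_root_ys[OF p] by (auto simp: r_def)
 obtain fnd where f: "rowfacts 1 r X2 (set ys) (tA ys r) (tau s p) fnd" using Q2_row[OF p] unfolding r_def by blast
 have "vol 1 {v. 0 < tau s p v} \<le> vol 1 {x. A1 r x \<and> (\<forall>s\<in>set (L1 ys r). \<not> kl1 r s x)}"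
 proof (rule vol_mono)
  fix v assume "v \<in> {v. 0 < tau s p v}" and v: "0 \<le> v" "v < n"
  hence tv: "0 < tau s p v" by simp
  note snd = rf_sound[OF f v tv]
  have vy: "v \<notin> set ys" using snd(2) r by blast
  have "wk 0 (set ys) v r (tau s p v - 1)" using wk_rev[OF snd(1) r(3)] by simp
  hence w: "wk 0 {} v r (tau s p v - 1)" by (rule wk_mono) simp
  then obtain b where b: "isd 0 {} v r b" "b \<le> tau s p v - 1" using isd_ex by blast
  have tA: "tA ys r v b"
  proof (cases "v = r")
   case True
   thus ?thesis using isd_unique[OF b(1)[unfolded True] isd_self] tA_self[of r] by simp
  qed (rule tA_mono[OF snd(3) b(2)])
  have "\<not> kl1 r x v" if x: "x \<in> set (L1 ys r)" for x
  proof -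
   have "x \<noteq> v" using L1_props(1)[OF x] vy by auto
   moreover have "sv1 r x v" using tA x b(1) unfolding tA_def sv1_def by blast
   ultimately show ?thesis by (simp add: kl1_def)
  qed
  thus "v \<in> {x. A1 r x \<and> (\<forall>s\<in>set (L1 ys r). \<not> kl1 r s x)}" using b(1) v by (auto simp: A1_def)
 qed
 also have "\<dots> < nat X2" using g r by (simp add: good1_def)
 finally show ?thesis .
qed

text \<open>A label is the length of some walk and the test is monotone. Hence the distance of a
  labelled vertex passes the test too, and \<open>rf_exact\<close> identifies it with the
  label.\<close>

lemma Q2_exact:
 assumes g: "good1 X2 ys" and p: "Q2 p" and v: "0 \<le> v" "v < n"
 shows "isd 1 (set ys) (root s 1 p) v t \<and> tA ys (root s 1 p) v t \<longleftrightarrow> 0 < tau s p v \<and> t = tau s p v - 1"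
proof -
 define r where "r = root s 1 p"
 have r: "0 \<le> r" "r < n" using Q2_root[OF p] by (auto simp: r_def)
 obtain fnd where f: "rowfacts 1 r X2 (set ys) (tA ys r) (tau s p) fnd" using Q2_row[OF p] unfolding r_def by blast
 have e: "tau s p v = t + 1" if "isd 1 (set ys) r v t" "tA ys r v t" for t
  by (rule rf_exact[OF f Q2_uncapped[OF g p] r _ _ v that(1)]) (use that tA_mono tA_closed in auto)
 show ?thesis unfolding r_def[symmetric]
 proof
  assume h: "isd 1 (set ys) r v t \<and> tA ys r v t"
  show "0 < tau s p v \<and> t = tau s p v - 1" using e[of t] h isd_nonneg[of 1 "set ys" r v t] by simp
 next
  assume h: "0 < tau s p v \<and> t = tau s p v - 1"
  hence tv: "0 < tau s p v" by simp
  note snd = rf_sound[OF f v tv]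
  obtain t' where t': "isd 1 (set ys) r v t'" "t' \<le> tau s p v - 1" using isd_ex[OF snd(1)] by blast
  have tA: "tA ys r v t'"
  proof (cases "v = r")
   case True
   thus ?thesis using isd_unique[OF t'(1)[unfolded True] isd_self] tA_self[of r] by simp
  qed (rule tA_mono[OF snd(3) t'(2)])
  hence "t' = t" using e[OF t'(1)] h by simp
  thus "isd 1 (set ys) r v t \<and> tA ys r v t" using t' tA by simp
 qed
qed

text \<open>If \<open>2 * cm r < gm ys\<close>, no other vertex \<open>x\<close> of a shortest cycle
  through \<open>r\<close> is in \<open>ys\<close>, as that would give
  \<open>gm ys \<le> cm x \<le> cm r\<close>. Going around the cycle yields
  \<open>\<alpha> \<le> \<gamma> + t'\<close>, so the test loses at most
  \<open>4 * cm r < 2 * gm ys \<le> 2 * cm y\<close> and the cycle is found. Otherwise the cap hides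
  what was found.\<close>

lemma Q2_found:
 assumes g: "good1 X2 ys" and p: "Q2 p"
 shows "s rC2 p = min (2 * cm (root s 1 p)) (gm ys)" "2 * cm (root s 1 p) < gm ys ==> s rBEST 0 \<le> cm (root s 1 p)"
proof -
 define r where "r = root s 1 p"
 have r: "0 \<le> r" "r < n" using Q2_root[OF p] by (auto simp: r_def)
 obtain fnd where f: "rowfacts 1 r X2 (set ys) (tA ys r) (tau s p) fnd" "s rC2 p = min (2 * fnd) (gm ys)" "s rBEST 0 \<le> fnd"
  using Q2_row[OF p] unfolding r_def by blast
 have ge: "cm r \<le> fnd" by (rule rf_found_ge[OF f(1)]) simp
 have le: "fnd \<le> cm r" if lt: "2 * cm r < gm ys"
 proof -
  have cB: "cm r \<noteq> BIG" using lt gm_le(2) BIG0 by auto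
  have w: "wk 1 {} r r (cm r)" using wk_rev[of 0 "{}" r r "cm r"] cm_props(3)[of r] cB by simp
  show ?thesis
  proof (rule rf_cycle[OF f(1) Q2_uncapped[OF g p] r])
   fix x t t' assume x: "0 \<le> x" "x < n" "x \<noteq> r" and t: "wk 1 {} r x t" "wk 1 {} x r t'" "t + t' \<le> cm r"
   have xy: "x \<notin> set ys"
   proof
    assume "x \<in> set ys"
    hence "gm ys \<le> cm x" by (rule gm_le)
    thus False using closed_pair(2)[OF _ t(1,2)] x(3) t(3) lt cm_props(1)[of r] by auto
   qed
   have w': "wk 0 {} r x t'" using wk_rev[OF t(2)] by simp
   have "tA ys r x t"
    unfolding tA_def
   proof
    fix y assume y: "y \<in> set (L1 ys r)"
    then obtain \<gamma> where c: "isd 0 {} y r \<gamma>" using L1_props(2) by blast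
    obtain \<alpha> where a: "isd 0 {} y x \<alpha>" "\<alpha> \<le> \<gamma> + t'" using isd_ex[OF wk_trans[OF w' isd_wk[OF c]]] by blast
    thus "\<exists>\<alpha> \<gamma>. isd 0 {} y x \<alpha> \<and> isd 0 {} y r \<gamma> \<and> 4 * (\<alpha> + t) < 4 * \<gamma> + 2 * cm y"
     using c t(3) lt L1_props(3)[OF y] by (intro exI[of _ \<alpha>] exI[of _ \<gamma>]) simp
   qed
   thus "x \<notin> set ys \<and> tA ys r x t" using xy by blast
  qed (use w cm_props(1) tA_mono in auto)
 qed
 show "s rC2 p = min (2 * cm (root s 1 p)) (gm ys)" using f(2) ge le unfolding r_def[symmetric] by (cases "2 * cm r < gm ys") auto
 show "2 * cm (root s 1 p) < gm ys ==> s rBEST 0 \<le> cm (root s 1 p)" using f(3) le unfolding r_def[symmetric] by linarith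
qed

lemma list2:
 assumes g: "good1 X2 ys" and u: "0 \<le> u" "u < n" "u \<notin> set ys" and j: "N1 \<le> j" "j \<le> NR"
 shows "map (root s 1) (alist s 2 1 u N1 j) = onl (A2 ys u) (kl2 ys u) (nat K) (map (root s 1) [N1..j - 1]) \<and>
  (\<forall>p\<in>set (alist s 2 1 u N1 j). Q2 p \<and> 0 < tau s p u)"
 using j
proof (induction j rule: int_ge_induct)
 case (step i)
 define R where "R = alist s 2 1 u N1 i"
 define r where "r = root s 1 i"
 have IH: "map (root s 1) R = onl (A2 ys u) (kl2 ys u) (nat K) (map (root s 1) [N1..i - 1])" "\<forall>p\<in>set R. Q2 p \<and> 0 < tau s p u"
  using step R_def by auto
 have up: "[N1..i + 1 - 1] = [N1..i - 1] @ [i]" using step.hyps upto_rec2[of N1 i] by simp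
 have rr: "0 \<le> r" "r < n" using root_range[of i 1] step N1 m1 by (auto simp: r_def)
 have E: "alist s 2 1 u N1 (i + 1) = (if cond s 2 1 u R i then R @ [i] else R)"
  unfolding R_def by (rule alist_step[OF step.hyps])
 have O: "onl (A2 ys u) (kl2 ys u) (nat K) (map (root s 1) [N1..i + 1 - 1]) =
   (if A2 ys u r \<and> (\<forall>x\<in>set (map (root s 1) R). \<not> kl2 ys u x r) \<and> length R < nat K then map (root s 1) R @ [r] else map (root s 1) R)"
  unfolding up map_append list.map onl_snoc IH(1)[symmetric] r_def Let_def by simp
 have c: "cond s 2 1 u R i \<longleftrightarrow> (0 < tau s i u \<and> (\<forall>q\<in>set (lst s (2 * n + r)). okp s q u r (tau s i u - 1) (gm ys))) \<and>
   (\<forall>q\<in>set R. okp s q r u (tau s i u - 1) (s rC2 q)) \<and> length R < nat K"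
  unfolding cond_def using G1 by (simp add: r_def)
 show ?case
 proof (cases "Q2 i")
  case True
  have ry: "r \<notin> set ys" using Q2_root_ys[OF True] by (simp add: r_def)
  have ex: "isd 1 (set ys) r u t \<and> tA ys r u t \<longleftrightarrow> 0 < tau s i u \<and> t = tau s i u - 1" for t
   using Q2_exact[OF g True u(1,2)] by (simp add: r_def)
  have rev: "isd 1 (set ys) x u t \<longleftrightarrow> isd 0 (set ys) u x t" if "x \<notin> set ys" for x t
   using isd_rev[of 1 "set ys" x u t] isd_rev[of 0 "set ys" u x t] that u(3) by auto
  have o: "(\<forall>q\<in>set (lst s (2 * n + r)). okp s q u r t (gm ys)) \<longleftrightarrow>
   (\<forall>x\<in>set (L1 ys r). \<exists>a c. isd 0 {} x u a \<and> isd 0 {} x r c \<and> 4 * (a + t) < 4 * c + gm ys)" for t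
   unfolding list1_ball[OF rr] by (intro ball_cong refl okp1 u rr) (use list1_set(2)[OF rr] in auto)
  \<comment> \<open>Admission is stricter than the search test, so an admissible \<open>u\<close>
    was certainly reached by the search from \<open>r\<close>.\<close>
  have imp: "tA ys r u t" if h: "\<forall>x\<in>set (L1 ys r). \<exists>a c. isd 0 {} x u a \<and> isd 0 {} x r c \<and> 4 * (a + t) < 4 * c + gm ys" for t
   unfolding tA_def
  proof
   fix x assume x: "x \<in> set (L1 ys r)"
   then obtain a c where "isd 0 {} x u a" "isd 0 {} x r c" "4 * (a + t) < 4 * c + gm ys" using h by blast
   thus "\<exists>\<alpha> \<gamma>. isd 0 {} x u \<alpha> \<and> isd 0 {} x r \<gamma> \<and> 4 * (\<alpha> + t) < 4 * \<gamma> + 2 * cm x"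
    using L1_props(3)[OF x] cm_props(1)[of x] by (intro exI[of _ a] exI[of _ c]) simp
  qed
  have a: "0 < tau s i u \<and> (\<forall>q\<in>set (lst s (2 * n + r)). okp s q u r (tau s i u - 1) (gm ys)) \<longleftrightarrow> A2 ys u r"
  proof
   assume h: "0 < tau s i u \<and> (\<forall>q\<in>set (lst s (2 * n + r)). okp s q u r (tau s i u - 1) (gm ys))"
   hence "isd 0 (set ys) u r (tau s i u - 1)" using ex rev[OF ry] by blast
   thus "A2 ys u r" unfolding A2_def using rr ry h o by blast
  next
   assume "A2 ys u r"
   then obtain b where b: "isd 0 (set ys) u r b" "\<forall>x\<in>set (L1 ys r). \<exists>a c. isd 0 {} x u a \<and> isd 0 {} x r c \<and> 4 * (a + b) < 4 * c + gm ys"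
    unfolding A2_def by blast
   have "0 < tau s i u \<and> b = tau s i u - 1" using ex rev[OF ry] b(1) imp[OF b(2)] by blast
   thus "0 < tau s i u \<and> (\<forall>q\<in>set (lst s (2 * n + r)). okp s q u r (tau s i u - 1) (gm ys))" using o b(2) by blast
  qed
  have k: "okp s q r u (tau s i u - 1) (s rC2 q) \<longleftrightarrow> \<not> kl2 ys u (root s 1 q) r" if q: "q \<in> set R" and ti: "0 < tau s i u" for q
  proof -
   have q1: "Q2 q" "0 < tau s q u" "q < i" using IH(2) q alist_set[of q s 2 1 u N1 i] by (auto simp: R_def)
   have ne: "root s 1 q \<noteq> r" using Q2_distinct[OF True q1(1,3)] by (simp add: r_def)
   have bb: "isd 0 (set ys) u r bb \<longleftrightarrow> bb = tau s i u - 1" for bb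
    using ex[of "tau s i u - 1"] ti rev[OF ry] isd_unique by blast
   have cc: "isd 0 (set ys) u (root s 1 q) c \<longleftrightarrow> c = tau s q u - 1" for c
    using Q2_exact[OF g q1(1) u(1,2), of "tau s q u - 1"] q1(2) rev[OF Q2_root_ys[OF q1(1)]] isd_unique by blast
   have aa: "isd 1 (set ys) (root s 1 q) r a \<and> tA ys (root s 1 q) r a \<longleftrightarrow> 0 < tau s q r \<and> a = tau s q r - 1" for a
    by (rule Q2_exact[OF g q1(1) rr])
   have "sv2 ys u (root s 1 q) r \<longleftrightarrow> (\<exists>a. (isd 1 (set ys) (root s 1 q) r a \<and> tA ys (root s 1 q) r a) \<and>
     4 * (a + (tau s i u - 1)) < 4 * (tau s q u - 1) + min (2 * cm (root s 1 q)) (gm ys))"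
    unfolding sv2_def bb cc by blast
   also have "\<dots> \<longleftrightarrow> okp s q r u (tau s i u - 1) (s rC2 q)"
    unfolding aa okp_def Q2_found(1)[OF g q1(1)] by auto
   finally show ?thesis using ne by (simp add: kl2_def)
  qed
  have "cond s 2 1 u R i \<longleftrightarrow> A2 ys u r \<and> (\<forall>x\<in>set (map (root s 1) R). \<not> kl2 ys u x r) \<and> length R < nat K"
   unfolding c a using a k by auto
  moreover have "A2 ys u r ==> 0 < tau s i u" using a by blast
  ultimately show ?thesis unfolding E O using IH(2) True by (auto simp: r_def)
 next
  case False
  have i: "N1 \<le> i" "i < NR" using step by auto
  have "tau s i u = 0" by (rule row2_skip(1)[OF i False u(1,2)])
  hence "\<not> cond s 2 1 u R i" unfolding c by simp
  moreover have "\<not> (A2 ys u r \<and> (\<forall>x\<in>set (map (root s 1) R). \<not> kl2 ys u x r) \<and> length R < nat K)"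
  proof (cases "r \<in> set ys")
   case False
   hence "r \<in> set (map (root s 1) [N1..i - 1])"
    using row2_skip(2)[OF i \<open>\<not> Q2 i\<close>] unfolding r_def by (auto simp: Q2_def) (metis atLeastAtMost_iff image_eqI zle_diff1_eq)
   thus ?thesis using onl_dup[of "kl2 ys u" r "map (root s 1) [N1..i - 1]" "A2 ys u" "nat K"] IH(1) by (metis kl2_def length_map)
  qed (simp add: A2_def)
  ultimately show ?thesis unfolding E O using IH(2) by simp
 qed
qed simp

lemma list2_set:
 assumes g: "good1 X2 ys" and u: "0 \<le> u" "u < n" "u \<notin> set ys"
 shows "x \<in> set (L2 ys zs u) \<longleftrightarrow> (\<exists>q\<in>set (lst s (3 * n + u)). x = root s 1 q)"
  "q \<in> set (lst s (3 * n + u)) ==> Q2 q \<and> 0 < tau s q u \<and> A2 ys u (root s 1 q)"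
proof -
 have l: "map (root s 1) (lst s (3 * n + u)) = L2 ys zs u" "\<forall>p\<in>set (lst s (3 * n + u)). Q2 p \<and> 0 < tau s p u"
  using list2[OF g u N1(2) order_refl] unfolding lst3[OF u(1,2)] L2_def zs_def by auto
 show 1: "x \<in> set (L2 ys zs u) \<longleftrightarrow> (\<exists>q\<in>set (lst s (3 * n + u)). x = root s 1 q)" for x unfolding l(1)[symmetric] by auto
 show "q \<in> set (lst s (3 * n + u)) ==> Q2 q \<and> 0 < tau s q u \<and> A2 ys u (root s 1 q)"
  using l(2) 1 onl_set[of "A2 ys u" "kl2 ys u" "nat K" zs] unfolding L2_def by blast
qed

lemma tst_of3:
 assumes g: "good1 X2 ys" and r: "0 \<le> r" "r < n" "r \<notin> set ys" and v: "0 \<le> v" "v < n"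
 shows "tst_of s 3 r v t \<longleftrightarrow> (\<forall>p\<in>set (lst s (3 * n + r)). okp s p v r t (s rC2 p)) \<and>
  (\<forall>x\<in>set (L1 ys v). \<exists>a c. isd 0 {} x r a \<and> isd 0 {} x v c \<and> 4 * (a + t) < 4 * c + gm ys)"
proof -
 have e: "(3 - 1) * n + v = 2 * n + v" "s rG (3 - 2) = gm ys" using G1 by simp_all
 have "(\<forall>q\<in>set (lst s (2 * n + v)). okp s q r v t (gm ys)) \<longleftrightarrow>
  (\<forall>x\<in>set (L1 ys v). \<exists>a c. isd 0 {} x r a \<and> isd 0 {} x v c \<and> 4 * (a + t) < 4 * c + gm ys)"
  unfolding list1_ball[OF v] by (intro ball_cong refl okp1 r v) (use list1_set(2)[OF v] in auto)
 thus ?thesis unfolding tst_of_def passes_lst[where s = s, OF sN] e by simp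
qed

lemma tst_of3_mono:
 assumes g: "good1 X2 ys" and r: "0 \<le> r" "r < n" "r \<notin> set ys" and v: "0 \<le> v" "v < n"
  and t: "tst_of s 3 r v t" "t' \<le> t"
 shows "tst_of s 3 r v t'"
proof -
 have "\<exists>a c. isd 0 {} x r a \<and> isd 0 {} x v c \<and> 4 * (a + t') < 4 * c + gm ys" if x: "x \<in> set (L1 ys v)" for x
 proof -
  obtain a c where "isd 0 {} x r a" "isd 0 {} x v c" "4 * (a + t) < 4 * c + gm ys" using t(1) x unfolding tst_of3[OF g r v] by blast
  thus ?thesis using t(2) by (intro exI[of _ a] exI[of _ c]) simp
 qed
 moreover have "okp s p v r t' (s rC2 p)" if p: "p \<in> set (lst s (3 * n + r))" for p
 proof -
  have "okp s p v r t (s rC2 p)" using t(1) p unfolding tst_of3[OF g r v] by blast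
  thus ?thesis using t(2) by (simp add: okp_def)
 qed
 ultimately show ?thesis unfolding tst_of3[OF g r v] by blast
qed

text \<open>Visited vertices survive the list of \<open>r\<close>: the second check in
  \<open>tests\<close> gives admission by \<open>A2\<close>, the first one survival. By
  \<open>Q2_exact\<close> the table entries read there carry the distances and the side condition
  \<open>tA\<close> of \<open>sv2\<close>.\<close>

lemma uncapped3:
 assumes g: "good1 X2 ys" "good2 X3 ys zs" and r: "0 \<le> r" "r < n" "r \<notin> excl s 3"
  and f: "rowfacts 0 r X3 (excl s 3) (tst_of s 3 r) (tau s p) fnd"
 shows "vol 0 {v. 0 < tau s p v} < nat X3"
proof -
 have ry: "r \<notin> set ys" using r excl3 by blast
 have "vol 0 {v. 0 < tau s p v} \<le> vol 0 {x. A2 ys r x \<and> (\<forall>p\<in>set (L2 ys zs r). \<not> kl2 ys r p x)}"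
 proof (rule vol_mono)
  fix v assume "v \<in> {v. 0 < tau s p v}" and v: "0 \<le> v" "v < n"
  hence tv: "0 < tau s p v" by simp
  note snd = rf_sound[OF f v tv]
  have ve: "v \<notin> excl s 3" using snd(2) r(3) by blast
  have vy: "v \<notin> set ys" using ve excl3[OF v] by blast
  have sub: "wk 0 (set ys) r v (tau s p v - 1)"
  proof -
   have "wk 0 (set ys) r v t" if "wk 0 (excl s 3) r v t" for t
    using that
   proof induction
    case (wk_step v t e)
    thus ?case using excl3[of "dst 0 e"] dst_range[of e 0] by (intro wk.wk_step) auto
   qed (rule wk_refl)
   thus ?thesis using snd(1) by blast
  qed
  obtain b where b: "isd 0 (set ys) r v b" "b \<le> tau s p v - 1" using isd_ex[OF sub] by blast
  have tst: "v = r \<or> tst_of s 3 r v b" using tst_of3_mono[OF g(1) r(1,2) ry v snd(3) b(2)] by blast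
  \<comment> \<open>The root is labelled without any test. It needs a separate argument: its
    distance is 0 and all thresholds are positive.\<close>
  have b0: "v = r ==> b = 0" using isd_unique[OF b(1)] isd_self by blast
  have A: "A2 ys r v"
   unfolding A2_def
  proof (intro conjI v vy, rule exI[of _ b], intro conjI b(1) ballI)
   fix x assume x: "x \<in> set (L1 ys v)"
   show "\<exists>a c. isd 0 {} x r a \<and> isd 0 {} x v c \<and> 4 * (a + b) < 4 * c + gm ys"
   proof (cases "v = r")
    case True
    obtain c where "isd 0 {} x r c" using L1_props(2)[OF x] True by blast
    thus ?thesis using True b0 gm_pos by (intro exI[of _ c]) simp
   next
    case False
    thus ?thesis using tst x unfolding tst_of3[OF g(1) r(1,2) ry v] by blast
   qed
  qed
  have "\<not> kl2 ys r x v" if x: "x \<in> set (L2 ys zs r)" for x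
  proof -
   obtain q where q: "q \<in> set (lst s (3 * n + r))" "x = root s 1 q" using list2_set(1)[OF g(1) r(1,2) ry] x by blast
   have q2: "Q2 q" "0 < tau s q r" using list2_set(2)[OF g(1) r(1,2) ry q(1)] by auto
   have xn: "x \<notin> set ys" "0 \<le> x" "x < n" using Q2_root_ys[OF q2(1)] Q2_root[OF q2(1)] q(2) by auto
   have "x \<noteq> v" using ve excl3[OF v] q2(1) q(2) by blast
   moreover have "sv2 ys r x v"
   proof -
    have c: "isd 0 (set ys) r x (tau s q r - 1)"
     using Q2_exact[OF g(1) q2(1) r(1,2), of "tau s q r - 1"] q2(2) q(2) isd_rev[of 1 "set ys" x r] xn ry by auto
    have o: "0 < tau s q v \<and> 4 * (tau s q v - 1 + b) < 4 * (tau s q r - 1) + min (2 * cm x) (gm ys)"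
    proof (cases "v = r")
     case True
     thus ?thesis using b0 q2(2) gm_pos cm_props(1)[of x] by simp
    next
     case False
     hence "okp s q v r b (s rC2 q)" using tst q(1) unfolding tst_of3[OF g(1) r(1,2) ry v] by blast
     thus ?thesis unfolding okp_def Q2_found(1)[OF g(1) q2(1)] q(2) by simp
    qed
    have "isd 1 (set ys) x v (tau s q v - 1) \<and> tA ys x v (tau s q v - 1)"
     using Q2_exact[OF g(1) q2(1) v, of "tau s q v - 1"] o q(2) by simp
    thus ?thesis unfolding sv2_def using b(1) c o by blast
   qed
   ultimately show ?thesis by (simp add: kl2_def)
  qed
  thus "v \<in> {x. A2 ys r x \<and> (\<forall>p\<in>set (L2 ys zs r). \<not> kl2 ys r p x)}" using A by blast
 qed
 also have "\<dots> < nat X3" using g(2) r ry by (simp add: good2_def)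
 finally show ?thesis .
qed

text \<open>Assume an estimate above \<open>4 * t0\<close>. Every vertex of the closed walk has
  \<open>cm \<le> t0\<close>, so it was no root of an earlier stage, whose search would have lowered
  the estimate. Hence nothing on the walk is excluded, the search from \<open>r\<close> is not
  truncated, and every test it applies grants a slack of more than \<open>t0\<close>.\<close>

lemma four_approx:
 assumes g: "good1 X2 ys" "good2 X3 ys zs" and w: "wk 0 {} r r t0" "0 < t0"
 shows "s rBEST 0 \<le> 4 * t0"
proof (rule ccontr)
 assume "\<not> s rBEST 0 \<le> 4 * t0"
 hence lt: "4 * t0 < s rBEST 0" by simp
 have bg: "s rBEST 0 \<le> gm ys" using G12 G1 by simp
 obtain e where e: "0 \<le> e" "e < m" "dst 0 e = r"
  using w by (cases rule: wk.cases) auto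
 have r: "0 \<le> r" "r < n" using dst_range[of e 0] e by auto
 have far: "v \<notin> set ys" "v \<notin> excl s 3" if v: "0 \<le> v" "v < n" and c: "cm v \<le> t0" for v
 proof -
  show y: "v \<notin> set ys" using gm_le(1)[of v] c lt bg w by linarith
  have "root s 1 p \<noteq> v" if p: "Q2 p" for p
  proof
   assume "root s 1 p = v"
   thus False using Q2_found(2)[OF g(1) p] c lt bg w by auto
  qed
  thus "v \<notin> excl s 3" using excl3[OF v] y by blast
 qed
 have cr: "cm r \<le> t0" by (rule cm_le) fact+
 note rn = far[OF r cr]
 have P: "NR \<le> NR + e" "NR + e < NR + m" "root s 0 (NR + e) = r" using e SQ3[of e] by (auto simp: root_def)
 have "\<exists>p. NR \<le> p \<and> p < NR + m \<and> root s 0 p = r \<and> 0 < tau s p r"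
 proof (cases "0 < tau s (NR + e) r")
  case True thus ?thesis using P by blast
 next
  case False
  have "\<exists>p'. NR \<le> p' \<and> p' < NR + e \<and> root s 0 p' = r \<and> 0 < tau s p' r"
   using row3[OF P(1,2)] False rn unfolding row_ok_def P(3) by auto
  thus ?thesis using P(2) by force
 qed
 then obtain p where p: "NR \<le> p" "p < NR + m" "root s 0 p = r" "0 < tau s p r" by blast
 obtain fnd where f: "rowfacts 0 r X3 (excl s 3) (tst_of s 3 r) (tau s p) fnd" "s rBEST 0 \<le> fnd"
  using row3[OF p(1,2)] p(4) unfolding row_ok_def p(3) by auto
 have "fnd \<le> t0"
 proof (rule rf_cycle[OF f(1) uncapped3[OF g r rn(2) f(1)] r])
  fix x t t' assume x: "0 \<le> x" "x < n" "x \<noteq> r" and t: "wk 0 {} r x t" "wk 0 {} x r t'" "t + t' \<le> t0"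
  have cx: "cm x \<le> t0" using closed_pair(2)[OF _ t(1,2)] x(3) t(3) by auto
  note xn = far[OF x(1,2) cx]
  \<comment> \<open>Distances to stage 2 roots refer to walks that avoid \<open>ys\<close>, so the
    rest of the closed walk must be known to avoid \<open>ys\<close> before it is joined to one of
    them.\<close>
  have av: "wk 0 (set ys) x r t'"
  proof (rule wk_avoid[OF t(2)])
   fix v a c assume h: "wk 0 {} x v a" "wk 0 {} v r c" "a + c \<le> t'"
   have v: "0 \<le> v" "v < n" using wk_range[OF h(1)] x by auto
   have "cm v \<le> t0"
   proof (cases "v = r")
    case False
    thus ?thesis using closed_pair(2)[OF _ wk_trans[OF h(1) t(1)] h(2)] t(3) h(3) by auto
   qed (use cr in simp)
   thus "v \<notin> set ys" using far v by blast
  qed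
  have "tst_of s 3 r x t"
   unfolding tst_of3[OF g(1) r rn(1) x(1,2)]
  proof (intro conjI ballI)
   fix q assume q: "q \<in> set (lst s (3 * n + r))"
   have q2: "Q2 q" "0 < tau s q r" "A2 ys r (root s 1 q)" using list2_set(2)[OF g(1) r rn(1) q] by auto
   define z where "z = root s 1 q"
   define c where "c = tau s q r - 1"
   have z: "0 \<le> z" "z < n" "z \<notin> set ys" using Q2_root[OF q2(1)] Q2_root_ys[OF q2(1)] by (auto simp: z_def)
   have c: "isd 0 (set ys) r z c"
    using Q2_exact[OF g(1) q2(1) r, of c] q2(2) isd_rev[of 1 "set ys" z r] z(3) rn(1) by (auto simp: z_def c_def)
   obtain al where al: "isd 0 (set ys) x z al" "al \<le> t' + c" using isd_ex[OF wk_trans[OF isd_wk[OF c] av]] by blast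
   have al1: "isd 1 (set ys) z x al" using isd_rev[OF al(1) xn(1) z(3)] by simp
   \<comment> \<open>The budget: \<open>\<alpha> \<le> a + t\<close>, \<open>al \<le> t' + c\<close>
     and the admission of \<open>z\<close> give
     \<open>4 * (\<alpha> + al) < 4 * \<gamma> + gm ys + 4 * t0\<close>, and
     \<open>gm ys + 4 * t0 < 2 * gm ys \<le> 2 * cm y\<close>. This is where the factor 4 is used
     up.\<close>
   have "tA ys z x al"
    unfolding tA_def
   proof
    fix y assume y: "y \<in> set (L1 ys z)"
    obtain c' a \<gamma> where h: "isd 0 (set ys) r z c'" "isd 0 {} y r a" "isd 0 {} y z \<gamma>" "4 * (a + c') < 4 * \<gamma> + gm ys"
     using q2(3) y unfolding A2_def z_def[symmetric] by blast
    have "c' = c" using isd_unique[OF h(1) c] .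
    moreover obtain \<alpha> where "isd 0 {} y x \<alpha>" "\<alpha> \<le> a + t" using isd_ex[OF wk_trans[OF t(1) isd_wk[OF h(2)]]] by blast
    ultimately show "\<exists>\<alpha> \<gamma>. isd 0 {} y x \<alpha> \<and> isd 0 {} y z \<gamma> \<and> 4 * (\<alpha> + al) < 4 * \<gamma> + 2 * cm y"
     using h(3,4) al(2) t(3) lt bg L1_props(3)[OF y] by (intro exI[of _ \<alpha>] exI[of _ \<gamma>]) simp
   qed
   hence ta: "0 < tau s q x" "al = tau s q x - 1" using Q2_exact[OF g(1) q2(1) x(1,2), of al] al1 by (auto simp: z_def)
   \<comment> \<open>Both arguments of the minimum in \<open>rC2\<close> are at least the final
     estimate: \<open>gm ys\<close> and twice what the row found.\<close>
   have "s rBEST 0 \<le> s rC2 q"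
    by (rule Q2_row[OF q2(1)]) (use bg f lt w in auto)
   thus "okp s q x r t (s rC2 q)" unfolding okp_def using ta al(2) t(3) lt by (simp add: c_def)
  next
   fix y assume y: "y \<in> set (L1 ys x)"
   obtain \<gamma> where c: "isd 0 {} y x \<gamma>" using L1_props(2)[OF y] by blast
   obtain \<alpha> where a: "isd 0 {} y r \<alpha>" "\<alpha> \<le> \<gamma> + t'" using isd_ex[OF wk_trans[OF t(2) isd_wk[OF c]]] by blast
   show "\<exists>a c. isd 0 {} y r a \<and> isd 0 {} y x c \<and> 4 * (a + t) < 4 * c + gm ys"
    by (intro exI[of _ \<alpha>] exI[of _ \<gamma>]) (use a c t(3) lt bg in simp)
  qed
  thus "x \<notin> excl s 3 \<and> tst_of s 3 r x t" using xn by blast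
 qed (use w tst_of3_mono[OF g(1) r rn(1)] in auto)
 thus False using f(2) lt w by linarith
qed

end

section \<open>Chaining the three stages\<close>

context prog begin

definition base :: "int => int => st => bool" where
 "base l js s \<longleftrightarrow> cst s \<and> s rJ 0 = js \<and> lists_ok s js \<and> seg_tree n (s rSEG) \<and> (\<forall>v. vtx v --> leaf s v = 0) \<and>
   (\<forall>p v. js \<le> p \<and> vtx v --> tau s p v = 0) \<and> (\<forall>v. vtx v --> 0 \<le> s rMK v \<and> s rMK v < l) \<and>
   (\<forall>L. (l + 1) * n \<le> L --> lst s L = []) \<and> 0 < s rBEST 0"

lemma stable_refl: "stable s s l j"
 by (simp add: stable_def)

lemma stable_trans: "stable s s' l j ==> stable s' s'' l j' ==> j \<le> j' ==> stable s s'' l j"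
 unfolding stable_def by auto

lemma stable_agree:
 assumes "agree {rST, rD, rX, rJE} s s'" shows "stable s s' l j"
 using assms by (simp add: stable_def agree_def tau_def lst_def excl_def)

lemma base_agree: "agree {rST, rD, rX, rJE} s s' ==> base l js s ==> base l js s'"
 by (simp add: base_def agree_def tau_def lst_def leaf_def cst_def lists_ok_def)

end

context prog_stage begin

text \<open>\<open>stable\<close> is demanded for every \<open>l' \<le> l\<close> because the rows
  and lists of each earlier stage must persist to the end, where all three stages are evaluated in
  one state.\<close>

definition after :: "st => bool" where
 "after s \<longleftrightarrow> base (l + 1) je s \<and> (\<forall>l'\<le>l. stable sS s l' js) \<and> agree (insert rG stgr) sS s \<and>
   (\<forall>p. js \<le> p \<and> p < je --> row_ok s l d X js p) \<and>
   (\<forall>u. vtx u --> lst s ((l + 1) * n + u) = alist s l d u js je) \<and>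
   s rG l = s rBEST 0 \<and> s rBEST 0 \<le> sS rBEST 0 \<and> (s rBEST 0 = sS rBEST 0 \<or> s rBEST 0 = BIG \<or> cw (s rBEST 0)) \<and>
   (\<forall>v. vtx v --> s rMK v = sS rMK v \<or> (s rMK v = l \<and> (\<exists>p. js \<le> p \<and> p < je \<and> root s d p = v \<and> 0 < tau s p v))) \<and>
   (\<forall>p. js \<le> p \<and> p < je \<and> 0 < tau s p (root s d p) --> s rMK (root s d p) = l) \<and>
   (s rBEST 0 = sS rBEST 0 \<or> (\<exists>p. js \<le> p \<and> p < je \<and> 0 < tau s p (root s d p) \<and> s rC2 p = min (2 * s rBEST 0) (s rG (l - 1))))"

lemma afterD:
 assumes "after s"
 shows "base (l + 1) je s" "\<forall>l'\<le>l. stable sS s l' js" "agree (insert rG stgr) sS s"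
  "\<forall>p. js \<le> p \<and> p < je --> row_ok s l d X js p" "\<forall>u. vtx u --> lst s ((l + 1) * n + u) = alist s l d u js je"
  "s rG l = s rBEST 0" "s rBEST 0 \<le> sS rBEST 0" "s rBEST 0 = sS rBEST 0 \<or> s rBEST 0 = BIG \<or> cw (s rBEST 0)"
  "\<forall>v. vtx v --> s rMK v = sS rMK v \<or> (s rMK v = l \<and> (\<exists>p. js \<le> p \<and> p < je \<and> root s d p = v \<and> 0 < tau s p v))"
  "\<forall>p. js \<le> p \<and> p < je \<and> 0 < tau s p (root s d p) --> s rMK (root s d p) = l"
  "s rBEST 0 = sS rBEST 0 \<or> (\<exists>p. js \<le> p \<and> p < je \<and> 0 < tau s p (root s d p) \<and> s rC2 p = min (2 * s rBEST 0) (s rG (l - 1)))"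
 using assms unfolding after_def by - (elim conjE, assumption)+

lemma wp_after:
 assumes base: "base l js sS" and bnd: "bnd M sS" and regs: "sS rST 0 = l" "sS rD 0 = d" "sS rX 0 = X" "sS rJE 0 = je"
 shows "wp M stage (\<lambda>s k. (after s \<and> bnd M s) \<and> k \<le> 100 * nat (je - js) + stage_cost X * min (nat (je - js)) (nat n) + 20) sS"
proof -
 note B = base[unfolded base_def]
 have b: "cst sS" "sS rJ 0 = js" "lists_ok sS js" "seg_tree n (sS rSEG)" "\<forall>v. vtx v --> leaf sS v = 0"
  "\<forall>p v. js \<le> p \<and> vtx v --> tau sS p v = 0" "\<forall>L. (l + 1) * n \<le> L --> lst sS L = []" "0 < sS rBEST 0"
  using B by - (elim conjE, assumption)+
 have ln: "(l + 1) * n \<le> (l + 1) * n + u" "(l + 1) * n \<le> (l + 2) * n" if "0 \<le> u" for u using that n2 by (auto simp: algebra_simps)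
 have I: "SI js sS"
  unfolding SI_def
 proof (intro conjI b regs order_refl agree_refl stable_refl)
  show "\<forall>u. vtx u --> lst sS ((l + 1) * n + u) = alist sS l d u js js" using b(7) ln(1) by simp
  show "\<forall>L. (l + 2) * n \<le> L --> lst sS L = []" using b(7) ln(2)[of 0] by fastforce
 qed (use js in auto)
 show ?thesis
 proof (rule wp_stage[OF I bnd])
  fix s' s k assume S: "SI je s'" and s: "s = upd s' rG l (s' rBEST 0)" and bs: "bnd M s" and k: "k \<le> spot js sS + 20"
  have h: "agree stgr sS s'" "cst s'" "s' rJ 0 = je"
   "lists_ok s' je" "seg_tree n (s' rSEG)" "(\<forall>v. vtx v --> leaf s' v = 0)" "(\<forall>p v. je \<le> p \<and> vtx v --> tau s' p v = 0)"
   "stable sS s' l js"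
   "(\<forall>v. vtx v --> s' rMK v = sS rMK v \<or> (sS rMK v = 0 \<and> s' rMK v = l \<and> (\<exists>p. js \<le> p \<and> p < je \<and> root s' d p = v \<and> 0 < tau s' p v)))"
   "(\<forall>p. js \<le> p \<and> p < je --> row_ok s' l d X js p)"
   "(\<forall>u. vtx u --> lst s' ((l + 1) * n + u) = alist s' l d u js je)" "(\<forall>L. (l + 2) * n \<le> L --> lst s' L = [])"
   "0 < s' rBEST 0" "s' rBEST 0 \<le> sS rBEST 0" "(s' rBEST 0 = sS rBEST 0 \<or> s' rBEST 0 = BIG \<or> cw (s' rBEST 0))"
   "(\<forall>p. js \<le> p \<and> p < je \<and> 0 < tau s' p (root s' d p) --> s' rMK (root s' d p) = l)"
   "(s' rBEST 0 = sS rBEST 0 \<or> (\<exists>p. js \<le> p \<and> p < je \<and> 0 < tau s' p (root s' d p) \<and> s' rC2 p = min (2 * s' rBEST 0) (s' rG (l - 1))))"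
   using S unfolding SI_def by - (elim conjE, assumption)+
  have oth: "x \<noteq> rG ==> s x = s' x" for x unfolding s by (rule upd_other) simp
  have ss: "s rBEST = s' rBEST" "s rMK = s' rMK" "s rC2 = s' rC2" "s rSQ = s' rSQ" "s rT = s' rT" "s rN = s' rN" "s rK = s' rK"
   "s rLC = s' rLC" "s rLI = s' rLI" "s rSEG = s' rSEG" "s rJ = s' rJ"
   using oth by auto
  have G: "i < l ==> s rG i = s' rG i" for i by (simp add: s)
  have der: "tau s = tau s'" "lst s = lst s'" "leaf s = leaf s'" "excl s = excl s'" "root s = root s'" "lists_ok s = lists_ok s'"
   by (simp_all add: fun_eq_iff tau_def lst_def leaf_def excl_def root_def lists_ok_def ss)
  have st: "stable s' s l' je" if "l' \<le> l" for l' unfolding stable_def der ss using G that by auto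
  have c: "s' rN 0 = n" "s' rK 0 = K" using h(2) by (auto simp: cst_def)
  have SQ': "0 \<le> s' rSQ p \<and> s' rSQ p < m" if "js \<le> p" "p < je" for p
   using SQ[of p] js that h(1) by (simp add: agree_def)
  have "after s"
   unfolding after_def
  proof (intro conjI allI impI)
   show "base (l + 1) je s"
    unfolding base_def
   proof (intro conjI allI impI)
    show "cst s" using h(2) s by (simp add: cst_def)
    show "s rJ 0 = je" using h(3) ss by simp
    show "lists_ok s je" using h(4) by (simp add: der)
    show "seg_tree n (s rSEG)" using h(5) ss by simp
    show "leaf s v = 0" if "vtx v" for v using h(6) that by (simp add: der)
    show "tau s p v = 0" if "je \<le> p \<and> vtx v" for p v using h(7) that by (simp add: der)
    show "lst s L = []" if "(l + 1 + 1) * n \<le> L" for L using h(12) that by (simp add: der add.assoc)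
    show "0 < s rBEST 0" using h(13) ss by simp
    fix v assume v: "vtx v"
    have "s' rMK v = sS rMK v \<or> s' rMK v = l" using h(9) v by blast
    thus "0 \<le> s rMK v" "s rMK v < l + 1" using MK0[of v] v l1 by (auto simp: ss)
   qed
   show "agree (insert rG stgr) sS s" unfolding s by (rule agree_upd[OF agree_trans[OF h(1) agree_refl]]) auto
   fix l' assume l': "l' \<le> l"
   have "stable sS s' l' js"
    unfolding stable_def
   proof (intro conjI allI impI)
    have m: "(l' + 1) * n \<le> (l + 1) * n" using l' n2 by (intro mult_right_mono) auto
    show "s' rSQ = sS rSQ" "sS rN = s' rN" "sS rK = s' rK" using h(8) by (auto simp: stable_def)
    show "s' rG i = sS rG i" if "i < l'" for i using h(8) that l' by (simp add: stable_def)
    show "tau s' p v = tau sS p v" if "p < js \<and> vtx v" for p v using h(8) that by (simp add: stable_def)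
    show "s' rC2 p = sS rC2 p" if "p < js" for p using h(8) that by (simp add: stable_def)
    show "lst s' L = lst sS L" if "L < (l' + 1) * n" for L using h(8) that m by (simp add: stable_def)
    fix v assume v: "vtx v"
    have "s' rMK v = sS rMK v \<or> (sS rMK v = 0 \<and> s' rMK v = l)" using h(9) v by blast
    thus "(v \<in> excl s' l') = (v \<in> excl sS l')" using l' by (auto simp: excl_def)
   qed
   from stable_trans[OF this st[OF l'] js(2)] show "stable sS s l' js" .
  next
   fix p assume p: "js \<le> p \<and> p < je"
   show "row_ok s l d X js p"
    by (rule row_ok_stable[OF st[OF order_refl] c h(4) order_refl]) (use p SQ'[of p] h(10) in \<open>auto simp: ss\<close>)
  next
   fix u assume u: "vtx u"
   have "alist s l d u js je = alist s' l d u js je"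
    by (rule alist_stable[OF st[OF order_refl] h(4)]) (use u SQ' js in auto)
   thus "lst s ((l + 1) * n + u) = alist s l d u js je" using h(11) u by (simp add: der)
  next
   show "s rG l = s rBEST 0" by (simp add: s)
   show "s rBEST 0 \<le> sS rBEST 0" "s rBEST 0 = sS rBEST 0 \<or> s rBEST 0 = BIG \<or> cw (s rBEST 0)" using h(14,15) by (auto simp: ss)
   show "s rMK v = sS rMK v \<or> (s rMK v = l \<and> (\<exists>p. js \<le> p \<and> p < je \<and> root s d p = v \<and> 0 < tau s p v))" if "vtx v" for v
    using h(9) that by (simp add: ss der) blast
   show "s rMK (root s d p) = l" if "js \<le> p \<and> p < je \<and> 0 < tau s p (root s d p)" for p using h(16) that by (simp add: ss der)
   show "s rBEST 0 = sS rBEST 0 \<or> (\<exists>p. js \<le> p \<and> p < je \<and> 0 < tau s p (root s d p) \<and> s rC2 p = min (2 * s rBEST 0) (s rG (l - 1)))"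
    using h(17) G[of "l - 1"] by (simp add: ss der)
  qed
  thus "(after s \<and> bnd M s) \<and> k \<le> 100 * nat (je - js) + stage_cost X * min (nat (je - js)) (nat n) + 20"
   using bs k spot_le[of sS] by linarith
 qed
qed

end

context prog begin

definition main_cost :: "int => int => int => nat" where
 "main_cost k N1 NR = 100 * nat (NR + m) + stage_cost (m + 1) * min (nat N1) (nat n) +
   stage_cost (m div k + 1) * min (nat (NR - N1)) (nat n) + stage_cost (m div (k * k) + 1) * min (nat m) (nat n) + 300"

lemma wp_main:
 fixes N1 NR k :: int
 assumes cst0: "cst s0" and bnd0: "bnd M s0" and regs: "s0 rN1 0 = N1" "s0 rNR 0 = NR" "s0 rKK 0 = k"
  and k: "1 \<le> k" and N: "0 \<le> N1" "N1 \<le> NR" "NR + m + 2 \<le> M"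
  and SQ: "\<And>p. 0 \<le> p ==> p < NR + m ==> 0 \<le> s0 rSQ p \<and> s0 rSQ p < m"
  and SQ3: "\<And>e. 0 \<le> e ==> e < m ==> s0 rSQ (NR + e) = e"
  and zero: "\<And>i. 0 \<le> i ==> s0 rT i = 0" "\<And>i. 0 \<le> i ==> s0 rSEG i = 0" "\<And>i. 0 \<le> i ==> s0 rMK i = 0" "s0 rLC = (\<lambda>_. 0)"
  and Q: "\<And>s s' kk. outcome n m W tlv hdv wt K BIG BC M b s N1 NR (m div k + 1) (m div (k * k) + 1) ==>
    s rBEST 0 = BIG \<or> cw (s rBEST 0) ==> s rSQ = s0 rSQ ==>
    s' 63 (- 1) = (if s rBEST 0 < BIG then s rBEST 0 else - 1) ==> kk \<le> main_cost k N1 NR ==> Q s' kk"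
 shows "wp M main Q s0"
proof -
 have M3: "3 \<le> M" using mM m1 by linarith
 define X2 where "X2 = m div k + 1"
 define X3 where "X3 = m div (k * k) + 1"
 have kk: "1 * 1 \<le> k * k" using k by (intro mult_mono) auto
 have X: "1 \<le> X2" "X2 \<le> m + 1" "1 \<le> X3" "X3 \<le> m + 1"
  unfolding X2_def X3_def using k kk m1 div_abs_le[of m k] div_abs_le[of m "k * k"] by (auto simp: pos_imp_zdiv_nonneg_iff)
 define t1 where "t1 = upd (upd (upd (upd (upd (upd (upd s0 rBEST 0 BIG) rG 0 (2 * BIG)) rJ 0 0) rST 0 1) rD 0 0) rX 0 (m + 1)) rJE 0 N1"
 define out where "out = Cnd (V rBEST .< V rBIG) (Put 63 (N (- 1)) (V rBEST)) (Put 63 (N (- 1)) (N (- 1)))"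
 define c3 where "c3 = Sq stage out"
 define i3 where "i3 = rST ::= N 3;; rD ::= N 0;; rX ::= V rM .div (V rKK .* V rKK) .+ N 1;; rJE ::= V rNR .+ V rM;; c3"
 define c2 where "c2 = Sq stage i3"
 define i2 where "i2 = rST ::= N 2;; rD ::= N 1;; rX ::= V rM .div V rKK .+ N 1;; rJE ::= V rNR;; c2"
 define c1 where "c1 = Sq stage i2"
 have N1M: "\<bar>N1\<bar> \<le> M" "\<bar>NR\<bar> \<le> M" "\<bar>NR + m\<bar> \<le> M" "\<bar>m + 1\<bar> \<le> M" "\<bar>X2\<bar> \<le> M" "\<bar>X3\<bar> \<le> M" "\<bar>BIG\<bar> \<le> M" "\<bar>2 * BIG\<bar> \<le> M"
  using N X mM m1 BIGM BIG0 by auto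
 have r0: "s0 rBIG 0 = BIG" "s0 rM 0 = m" using cst0 by (auto simp: cst_def)
 have goal1: "wp M main Q s0" if w: "wp M c1 (\<lambda>s k. Q s (33 + k)) t1"
  using w N1M M3 unfolding main_def out_def[symmetric] c3_def[symmetric] i3_def[symmetric] c2_def[symmetric] i2_def[symmetric] c1_def[symmetric] t1_def
  by (simp add: r0 regs)
 have ag1: "agree {rBEST, rG, rJ, rST, rD, rX, rJE} s0 t1" unfolding t1_def by (intro agree_upd agree_refl) auto
 have b1: "bnd M t1" unfolding t1_def using bnd0 N1M M3 by (intro bnd_upd) auto
 have lst0: "lst t1 L = []" for L using zero(4) ag1 by (simp add: lst_def agree_def)
 have base1: "base 1 0 t1"
  unfolding base_def
 proof (intro conjI allI impI)
  show "cst t1" using cst0 ag1 by (simp add: cst_def agree_def)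
  show "lists_ok t1 0" using zero(4) ag1 K1 by (simp add: lists_ok_def agree_def)
  show "seg_tree n (t1 rSEG)" using zero(2) ag1 by (simp add: seg_tree_def seg_node_def agree_def)
  show "leaf t1 v = 0" if "vtx v" for v using that n2 zero(2) ag1 by (simp add: leaf_def agree_def)
  show "tau t1 p v = 0" if "0 \<le> p \<and> vtx v" for p v using that n2 zero(1) ag1 by (simp add: tau_def agree_def)
  show "0 \<le> t1 rMK v" "t1 rMK v < 1" if "vtx v" for v using that zero(3) ag1 by (auto simp: agree_def)
  show "0 < t1 rBEST 0" using BIG0 by (simp add: t1_def)
 qed (simp_all add: lst0, simp add: t1_def)
 have SQ1: "t1 rSQ = s0 rSQ" using ag1 by (simp add: agree_def)
 interpret S1: prog_stage n m W tlv hdv wt K BIG BC M b t1 1 0 "m + 1" 0 N1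
  by unfold_locales (use m1 N M3 SQ SQ1 base1[unfolded base_def] in auto)
 have w1: "wp M stage (\<lambda>s k. (S1.after s \<and> bnd M s) \<and> k \<le> 100 * nat (N1 - 0) + stage_cost (m + 1) * min (nat (N1 - 0)) (nat n) + 20) t1"
  by (rule S1.wp_after[OF base1 b1]) (simp_all add: t1_def)
 show ?thesis
 proof (rule goal1, unfold c1_def, rule wp_chainQ[OF w1])
  fix s1 and k1 :: nat
  assume A1: "S1.after s1 \<and> bnd M s1" and k1: "k1 \<le> 100 * nat (N1 - 0) + stage_cost (m + 1) * min (nat (N1 - 0)) (nat n) + 20"
  note a1 = S1.afterD[OF conjunct1[OF A1]]
  define t2 where "t2 = upd (upd (upd (upd s1 rST 0 2) rD 0 1) rX 0 X2) rJE 0 NR"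
  have ag2: "agree {rST, rD, rX, rJE} s1 t2" unfolding t2_def by (intro agree_upd agree_refl) auto
  have rs1: "s1 rM 0 = m" "s1 rKK 0 = k" "s1 rNR 0 = NR" "s1 rSQ = s0 rSQ" using a1(3) ag1 regs r0 by (auto simp: agree_def)
  have b2: "bnd M t2" unfolding t2_def using A1 N1M M3 by (intro bnd_upd) auto
  have base2: "base 2 N1 t2" using base_agree[OF ag2 a1(1)] by simp
  have SQ2: "t2 rSQ = s0 rSQ" using ag2 rs1 by (simp add: agree_def)
  interpret S2: prog_stage n m W tlv hdv wt K BIG BC M b t2 2 1 X2 N1 NR
   by unfold_locales (use m1 N M3 SQ SQ2 X base2[unfolded base_def] in auto)
  have w2: "wp M stage (\<lambda>s k. (S2.after s \<and> bnd M s) \<and> k \<le> 100 * nat (NR - N1) + stage_cost X2 * min (nat (NR - N1)) (nat n) + 20) t2"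
   by (rule S2.wp_after[OF base2 b2]) (simp_all add: t2_def)
  have goal2: "wp M i2 (\<lambda>s k. Q s (33 + (k1 + k))) s1" if w: "wp M c2 (\<lambda>s k. Q s (33 + (k1 + (19 + k)))) t2"
   using w N1M(5) N1M(2) M3 unfolding i2_def t2_def by (simp add: rs1 X2_def[symmetric])
  show "wp M i2 (\<lambda>s k. Q s (33 + (k1 + k))) s1"
  proof (rule goal2, unfold c2_def, rule wp_chainQ[OF w2])
   fix s2 and k2 :: nat
   assume A2: "S2.after s2 \<and> bnd M s2" and k2: "k2 \<le> 100 * nat (NR - N1) + stage_cost X2 * min (nat (NR - N1)) (nat n) + 20"
   note a2 = S2.afterD[OF conjunct1[OF A2]]
   define t3 where "t3 = upd (upd (upd (upd s2 rST 0 3) rD 0 0) rX 0 X3) rJE 0 (NR + m)"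
   have ag3: "agree {rST, rD, rX, rJE} s2 t3" unfolding t3_def by (intro agree_upd agree_refl) auto
   have rs2: "s2 rM 0 = m" "s2 rKK 0 = k" "s2 rNR 0 = NR" "s2 rSQ = s0 rSQ" using a2(3) ag2 rs1 by (auto simp: agree_def)
   have b3: "bnd M t3" unfolding t3_def using A2 N1M M3 by (intro bnd_upd) auto
   have base3: "base 3 NR t3" using base_agree[OF ag3 a2(1)] by simp
   have SQ3': "t3 rSQ = s0 rSQ" using ag3 rs2 by (simp add: agree_def)
   interpret S3: prog_stage n m W tlv hdv wt K BIG BC M b t3 3 0 X3 NR "NR + m"
    by unfold_locales (use m1 N M3 SQ SQ3' X base3[unfolded base_def] in auto)
   have w3: "wp M stage (\<lambda>s k. (S3.after s \<and> bnd M s) \<and> k \<le> 100 * nat (NR + m - NR) + stage_cost X3 * min (nat (NR + m - NR)) (nat n) + 20) t3"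
    by (rule S3.wp_after[OF base3 b3]) (simp_all add: t3_def)
   have goal3: "wp M i3 (\<lambda>s k. Q s (33 + (k1 + (19 + (k2 + k))))) s2" if w: "wp M c3 (\<lambda>s k. Q s (33 + (k1 + (19 + (k2 + (25 + k)))))) t3"
    using w N1M(6) N1M(3) M3 unfolding i3_def t3_def by (simp add: rs2 X3_def[symmetric])
   show "wp M i3 (\<lambda>s k. Q s (33 + (k1 + (19 + (k2 + k))))) s2"
   proof (rule goal3, unfold c3_def, rule wp_chainQ[OF w3])
    fix s3 and k3 :: nat
    assume A3: "S3.after s3 \<and> bnd M s3" and k3: "k3 \<le> 100 * nat (NR + m - NR) + stage_cost X3 * min (nat (NR + m - NR)) (nat n) + 20"
    note a3 = S3.afterD[OF conjunct1[OF A3]]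
    have st12: "stable s1 s2 l' N1" if "l' \<le> 2" for l'
     using stable_trans[OF stable_agree[OF ag2]] a2(2) that by blast
    have st23: "stable s2 s3 l' NR" if "l' \<le> 3" for l'
     using stable_trans[OF stable_agree[OF ag3]] a3(2) that by blast
    have st13: "stable s1 s3 l' N1" if "l' \<le> 2" for l'
     using stable_trans[OF st12[OF that] st23 N(2)] that by simp
    have st03: "stable t1 s3 1 0" using stable_trans[OF a1(2)[rule_format] st13 N(1)] by simp
    have c: "s1 rN 0 = n" "s1 rK 0 = K" "s2 rN 0 = n" "s2 rK 0 = K" "s3 rN 0 = n" "s3 rK 0 = K"
     using a1(1) a2(1) a3(1) by (simp_all add: base_def cst_def)
    have lo: "lists_ok s1 N1" "lists_ok s2 NR" "lists_ok s3 (NR + m)" using a1(1) a2(1) a3(1) by (simp_all add: base_def)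
    have sq: "s1 rSQ = s0 rSQ" "s2 rSQ = s0 rSQ" "s3 rSQ = s0 rSQ"
     using rs1 rs2 st23[of 1] by (simp_all add: stable_def)
    have rt: "root s1 = root s0" "root s2 = root s0" "root s3 = root s0" using sq by (simp_all add: root_def fun_eq_iff)
    have rr: "0 \<le> root s0 d p \<and> root s0 d p < n" if "0 \<le> p" "p < NR + m" for d p
     using dst_range SQ[OF that] by (simp add: root_def)
    have ta: "tau s3 p v = tau s1 p v" if "p < N1" "0 \<le> v" "v < n" for p v using st13[of 1] that by (simp add: stable_def)
    have tb: "tau s3 p v = tau s2 p v" if "p < NR" "0 \<le> v" "v < n" for p v using st23[of 1] that by (simp add: stable_def)
    have C2: "s3 rC2 p = s1 rC2 p" if "p < N1" for p using st13[of 1] that by (simp add: stable_def)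
    have be: "t1 rBEST 0 = BIG" "t2 rBEST 0 = s1 rBEST 0" "t3 rBEST 0 = s2 rBEST 0" by (simp_all add: t1_def t2_def t3_def)
    have bl: "s3 rBEST 0 \<le> s2 rBEST 0" "s2 rBEST 0 \<le> s1 rBEST 0" "s1 rBEST 0 \<le> BIG" using a1(7) a2(7) a3(7) be by auto
    have G: "s3 rG 0 = 2 * BIG" "s1 rG 0 = 2 * BIG" "s3 rG 1 = s1 rBEST 0"
    proof -
     have "t1 rG 0 = 2 * BIG" by (simp add: t1_def)
     moreover have "s1 rG 0 = t1 rG 0" using a1(2)[rule_format, of 1] unfolding stable_def by simp
     moreover have "s3 rG 0 = s1 rG 0" "s3 rG 1 = s1 rG 1" using st13[of 2] unfolding stable_def by simp_all
     ultimately show "s3 rG 0 = 2 * BIG" "s1 rG 0 = 2 * BIG" "s3 rG 1 = s1 rBEST 0" using a1(6) by simp_all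
    qed
    have MK0: "t1 rMK v = 0" if "0 \<le> v" for v using that zero(3) ag1 by (simp add: agree_def)
    have MK2: "t2 rMK v = s1 rMK v" for v by (simp add: t2_def)
    \<comment> \<open>\<open>outcome\<close> speaks of the last state only; what stages 1 and 2
      established is carried there by stability.\<close>
    have out: "outcome n m W tlv hdv wt K BIG BC M b s3 N1 NR X2 X3"
    proof unfold_locales
     show "s3 rN 0 = n" "s3 rK 0 = K" "lists_ok s3 (NR + m)" "0 \<le> N1" "N1 \<le> NR" using c lo N by auto
     show "0 \<le> s3 rSQ p \<and> s3 rSQ p < m" if "0 \<le> p" "p < NR + m" for p using SQ[OF that] sq by simp
     show "s3 rSQ (NR + e) = e" if "0 \<le> e" "e < m" for e using SQ3[OF that] sq by simp
     show "row_ok s3 1 0 (m + 1) 0 p" if p: "0 \<le> p" "p < N1" for p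
      by (rule row_ok_stable[OF st13 c(1,2) lo(1) order_refl]) (use p SQ[of p] N m1 sq bl a1(4) in auto)
     show "row_ok s3 2 1 X2 N1 p" if p: "N1 \<le> p" "p < NR" for p
      by (rule row_ok_stable[OF st23 c(3,4) lo(2) order_refl]) (use p SQ[of p] N m1 sq bl a2(4) in auto)
     show "row_ok s3 3 0 X3 NR p" if p: "NR \<le> p" "p < NR + m" for p using a3(4) p by blast
     show "lst s3 u = [] \<and> lst s3 (n + u) = []" if "0 \<le> u" "u < n" for u
      using st03 that lst0 by (simp add: stable_def)
     show "lst s3 (2 * n + u) = alist s3 1 0 u 0 N1" if u: "0 \<le> u" "u < n" for u
     proof -
      have "lst s3 (2 * n + u) = lst s1 (2 * n + u)" using st13[of 2] u by (simp add: stable_def)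
      moreover have "alist s3 1 0 u 0 N1 = alist s1 1 0 u 0 N1"
       by (rule alist_stable[OF st13 lo(1) u]) (use SQ N m1 sq in auto)
      ultimately show ?thesis using a1(5) u by simp
     qed
     show "lst s3 (3 * n + u) = alist s3 2 1 u N1 NR" if u: "0 \<le> u" "u < n" for u
     proof -
      have "lst s3 (3 * n + u) = lst s2 (3 * n + u)" using st23[of 3] u by (simp add: stable_def)
      moreover have "alist s3 2 1 u N1 NR = alist s2 2 1 u N1 NR"
       by (rule alist_stable[OF st23 lo(2) u]) (use SQ N m1 sq in auto)
      ultimately show ?thesis using a2(5) u by simp
     qed
     show "s3 rG 0 = 2 * BIG" "s3 rBEST 0 \<le> s3 rG 1" "s3 rG 1 \<le> BIG" using G bl by auto
     show "2 * s3 rG 1 \<le> s3 rC2 p" if p: "0 \<le> p" "p < N1" "0 < tau s3 p (root s3 0 p)" for p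
     proof -
      have "row_ok s1 1 0 (m + 1) 0 p" using a1(4) p by blast
      moreover have "0 < tau s1 p (root s1 0 p)" using p ta[of p "root s0 0 p"] rr[of p 0] N m1 by (simp add: rt)
      ultimately obtain fnd where "s1 rC2 p = min (2 * fnd) (s1 rG (1 - 1))" "s1 rBEST 0 \<le> fnd" unfolding row_ok_def by auto
      thus ?thesis using G bl C2[OF p(2)] by simp
     qed
     show "s3 rG 1 = BIG \<or> (\<exists>p. 0 \<le> p \<and> p < N1 \<and> 0 < tau s3 p (root s3 0 p) \<and> s3 rC2 p = 2 * s3 rG 1)"
     proof (cases "s1 rBEST 0 = BIG")
      case False
      then obtain p where p: "0 \<le> p" "p < N1" "0 < tau s1 p (root s1 0 p)" "s1 rC2 p = min (2 * s1 rBEST 0) (s1 rG (1 - 1))"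
       using a1(11) be by auto
      have "0 < tau s3 p (root s3 0 p)" using p ta[of p "root s0 0 p"] rr[of p 0] N m1 by (simp add: rt)
      moreover have "s3 rC2 p = 2 * s3 rG 1" using p(4) G bl C2[OF p(2)] by simp
      ultimately show ?thesis using p(1,2) by blast
     qed (simp add: G)
     show "v \<notin> excl s3 1" for v by (simp add: excl_def)
     show "v \<in> excl s3 2 \<longleftrightarrow> (\<exists>p. 0 \<le> p \<and> p < N1 \<and> root s3 0 p = v \<and> 0 < tau s3 p v)" if v: "0 \<le> v" "v < n" for v
     proof -
      have "v \<in> excl s3 2 \<longleftrightarrow> v \<in> excl s1 2" using st13[of 2] v by (simp add: stable_def)
      also have "\<dots> \<longleftrightarrow> s1 rMK v = 1" by (auto simp: excl_def)
      also have "\<dots> \<longleftrightarrow> (\<exists>p. 0 \<le> p \<and> p < N1 \<and> root s1 0 p = v \<and> 0 < tau s1 p v)"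
      proof
       assume "s1 rMK v = 1"
       moreover have "s1 rMK v = t1 rMK v \<or> (s1 rMK v = 1 \<and> (\<exists>p. 0 \<le> p \<and> p < N1 \<and> root s1 0 p = v \<and> 0 < tau s1 p v))"
        using a1(9) v by blast
       ultimately show "\<exists>p. 0 \<le> p \<and> p < N1 \<and> root s1 0 p = v \<and> 0 < tau s1 p v" using MK0 v by auto
      qed (use a1(10) in blast)
      also have "\<dots> \<longleftrightarrow> (\<exists>p. 0 \<le> p \<and> p < N1 \<and> root s3 0 p = v \<and> 0 < tau s3 p v)" using ta v by (auto simp: rt)
      finally show ?thesis .
     qed
     show "v \<in> excl s3 3 \<longleftrightarrow> v \<in> excl s3 2 \<or> (\<exists>p. N1 \<le> p \<and> p < NR \<and> root s3 1 p = v \<and> 0 < tau s3 p v)" if v: "0 \<le> v" "v < n" for v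
     proof -
      have m: "0 \<le> s1 rMK v" "s1 rMK v < 2" using a1(1) v by (simp_all add: base_def)
      have mm: "s2 rMK v = s1 rMK v \<or> (s2 rMK v = 2 \<and> (\<exists>p. N1 \<le> p \<and> p < NR \<and> root s2 1 p = v \<and> 0 < tau s2 p v))"
       using a2(9) v unfolding MK2 by blast
      have "v \<in> excl s3 3 \<longleftrightarrow> v \<in> excl s2 3" using st23[of 3] v by (simp add: stable_def)
      also have "\<dots> \<longleftrightarrow> v \<in> excl s2 2 \<or> s2 rMK v = 2" using mm m by (auto simp: excl_def)
      also have "v \<in> excl s2 2 \<longleftrightarrow> v \<in> excl s3 2" using st23[of 2] v by (simp add: stable_def)
      also have "s2 rMK v = 2 \<longleftrightarrow> (\<exists>p. N1 \<le> p \<and> p < NR \<and> root s2 1 p = v \<and> 0 < tau s2 p v)"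
       using mm m a2(10) by fastforce
      also have "\<dots> \<longleftrightarrow> (\<exists>p. N1 \<le> p \<and> p < NR \<and> root s3 1 p = v \<and> 0 < tau s3 p v)" using tb v by (auto simp: rt)
      finally show ?thesis .
     qed
    qed
    have best: "s3 rBEST 0 = BIG \<or> cw (s3 rBEST 0)"
     using a1(8) a2(8) a3(8) unfolding be by metis
    have kk: "33 + (k1 + (19 + (k2 + (25 + (k3 + x))))) \<le> main_cost k N1 NR" if "x \<le> 20" for x
    proof -
     have "100 * nat (NR + m) = 100 * nat N1 + 100 * nat (NR - N1) + 100 * nat m" using N m1 by (simp add: nat_add_distrib nat_diff_distrib)
     thus ?thesis using k1 k2 k3 that unfolding main_cost_def X2_def X3_def by simp
    qed
    have rb: "s3 rBIG 0 = BIG" using a3(1) by (simp add: base_def cst_def)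
    have rm: "\<bar>s3 rBEST 0\<bar> \<le> M" using A3 unfolding bnd_def by blast
    have fin: "Q (upd s3 63 (- 1) (if s3 rBEST 0 < BIG then s3 rBEST 0 else - 1)) (33 + (k1 + (19 + (k2 + (25 + (k3 + x))))))" if "x \<le> 20" for x
     by (rule Q[OF out[unfolded X2_def X3_def] best sq(3) _ kk[OF that]]) simp
    show "wp M out (\<lambda>s k. Q s (33 + (k1 + (19 + (k2 + (25 + (k3 + k))))))) s3"
    proof (cases "s3 rBEST 0 < BIG")
     case True
     thus ?thesis unfolding out_def using rb rm fin[of 14] by simp
    next
     case False
     thus ?thesis unfolding out_def using rb rm fin[of 13] M3 by simp
    qed
   qed
  qed
 qed
qed

end

section \<open>Preprocessing and random choices\<close>

text \<open>Array cells of nonnegative index have negative addresses, so writing them leaves the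
  input intact.\<close>

lemma enc_upd_nonneg: "r < 64 ==> 0 \<le> i ==> 0 \<le> a ==> enc (upd s r i v) a = enc s a"
proof -
 assume "r < 64" "0 \<le> i" "0 \<le> a"
 hence "a \<noteq> addr r i" by (simp add: addr_def)
 thus ?thesis using enc_upd[OF \<open>r < 64\<close>] by simp
qed

text \<open>Edge \<open>e\<close> has its tail, head and weight at the addresses
  \<open>2 + 3 * e\<close>, \<open>3 + 3 * e\<close> and \<open>4 + 3 * e\<close>. It is put in
  front of a linked list in each direction, which is why links point to smaller edges.\<close>

definition read_edge :: cmd where
 "read_edge =
   Put rDST (V rE) (I (N 3 .+ N 3 .* V rE));; Put rDST (V rM .+ V rE) (I (N 2 .+ N 3 .* V rE));;
   Put rWT (V rE) (I (N 4 .+ N 3 .* V rE));;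
   Put rNXT (V rE) (A rFST (A rDST (V rM .+ V rE)));;
   Put rFST (A rDST (V rM .+ V rE)) (V rE .+ N 1);;
   Put rNXT (V rM .+ V rE) (A rFST (V rN .+ A rDST (V rE)));;
   Put rFST (V rN .+ A rDST (V rE)) (V rE .+ N 1);;
   Cnd (V rWM .< A rWT (V rE)) (rWM ::= A rWT (V rE)) Nop;;
   rE ::= V rE .+ N 1"

text \<open>The input occupies cells of negative index of all arrays; only \<open>rLC\<close> is required to vanish there.\<close>

definition clear_loop :: cmd where
 "clear_loop = Whl (V rI .< V rM .+ N 2) (Put rLC (N 0 .- V rI) (N 0);; rI ::= V rI .+ N 1)"

definition log_loop :: cmd where
 "log_loop = Whl (V rI .< N 2 .* V rN) (rI ::= N 2 .* V rI;; rLG ::= V rLG .+ N 1)"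

definition root_loop :: cmd where
 "root_loop = Whl ((V rKK .* V rKK .* V rKK .< V rN) .* (V rKK .* V rKK .* V rKK .< V rM)) (rKK ::= V rKK .+ N 1)"

text \<open>\<open>rN1\<close> and \<open>rNR - rN1\<close> are the numbers of draws that
  \<open>bad_count\<close> asks for with \<open>\<kappa> = k\<close> and
  \<open>\<kappa> = k * k\<close>. \<open>rBIG\<close> exceeds four times the weight of any cycle,
  so for a good sample an estimate that stays at \<open>BIG\<close> means that there is
  none.\<close>

definition set_sizes :: "int => cmd" where
 "set_sizes c = rK ::= N c .* V rLG;; rBIG ::= N 4 .* ((V rM .+ N 2) .* V rWM) .+ N 1;;
   rBC ::= ((V rM .+ N 2) .* V rWM .+ N 2) .* V rN;;
   rN1 ::= V rKK .* (N 4 .* V rK);; rNR ::= V rN1 .+ V rKK .* V rKK .* (N 4 .* V rK);; rJ ::= N 0"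

definition prepare :: "int => cmd" where
 "prepare c = rE ::= N 0;; Whl (V rE .< V rM) read_edge;;
   rI ::= N 1;; clear_loop;;
   rI ::= N 1;; rLG ::= N 0;; log_loop;;
   rKK ::= N 1;;
   root_loop;; set_sizes c"

definition fill :: cmd where
 "fill = rI ::= N 0;; Whl (V rI .< V rM) (Put rSQ (V rNR .+ V rI) (V rI);; rI ::= V rI .+ N 1)"

abbreviation (input) "rdr \<equiv> {rDST, rWT, rNXT, rFST, rWM, rE}"

context wgraph begin

definition inputs :: "st => bool" where
 "inputs s \<longleftrightarrow> s rN 0 = n \<and> s rM 0 = m \<and>
   (\<forall>e. 0 \<le> e \<and> e < m --> enc s (2 + 3 * e) = tlv e \<and> enc s (3 + 3 * e) = hdv e \<and> enc s (4 + 3 * e) = wt e)"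

definition edges_read :: "int => st => bool" where
 "edges_read b s \<longleftrightarrow>
   (\<forall>d e. (d = 0 \<or> d = 1) \<and> 0 \<le> e \<and> e < b --> s rDST (d * m + e) = dst d e \<and> isnx d (src d e) e (s rNXT (d * m + e))) \<and>
   (\<forall>e. 0 \<le> e \<and> e < b --> s rWT e = wt e \<and> wt e \<le> s rWM 0) \<and>
   (\<forall>d v. (d = 0 \<or> d = 1) \<and> 0 \<le> v \<and> v < n --> isnx d v b (s rFST (d * n + v))) \<and> 0 \<le> s rWM 0 \<and> s rWM 0 \<le> W"

lemma isnx_step: "isnx d v e p ==> 0 \<le> e ==> isnx d v (e + 1) (if src d e = v then e + 1 else p)"
proof -
 assume h: "isnx d v e p" "0 \<le> e"
 have s: "e' < e + 1 \<longleftrightarrow> e' < e \<or> e' = e" for e' by auto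
 show ?thesis
 proof (cases "src d e = v")
  case False
  thus ?thesis using h unfolding isnx_def s by auto
 qed (use h in \<open>simp add: isnx_def\<close>)
qed

lemma wp_read_edge:
 assumes i: "inputs s" and r: "edges_read e s" and e: "s rE 0 = e" "0 \<le> e" "e < m" and M: "n \<le> M" "m + 1 \<le> M" "W \<le> M" and b: "bnd M s"
 shows "wp M read_edge (\<lambda>s' k. (inputs s' \<and> edges_read (e + 1) s' \<and> s' rE 0 = e + 1 \<and> agree rdr s s') \<and> k \<le> 190) s"
proof -
 have g: "s rN 0 = n" "s rM 0 = m" "enc s (2 + 3 * e) = tlv e" "enc s (3 + 3 * e) = hdv e" "enc s (4 + 3 * e) = wt e"
  using i e by (auto simp: inputs_def)
 have v: "0 \<le> tlv e" "tlv e < n" "0 \<le> hdv e" "hdv e < n" "1 \<le> wt e" "wt e \<le> W" using tlv[of e] hdv[of e] wt[of e] e by auto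
 define s' where "s' = upd (upd (upd (upd (upd (upd (upd (upd (upd s rDST e (hdv e)) rDST (m + e) (tlv e)) rWT e (wt e))
   rNXT e (s rFST (tlv e))) rFST (tlv e) (e + 1)) rNXT (m + e) (s rFST (n + hdv e))) rFST (n + hdv e) (e + 1))
   rWM 0 (if s rWM 0 < wt e then wt e else s rWM 0)) rE 0 (e + 1)"
 have ne: "m + e \<noteq> e" "n + hdv e \<noteq> tlv e" using m1 v by auto
 have FM: "\<bar>s rFST x\<bar> \<le> M" for x using b by (simp add: bnd_def)
 have bs: "\<bar>wt e\<bar> \<le> M" "\<bar>tlv e\<bar> \<le> M" "\<bar>hdv e\<bar> \<le> M" "\<bar>e + 1\<bar> \<le> M" using v M e by auto
 have t0: "upd x rWM 0 (x rWM 0) = x" for x by (rule ext)+ (simp add: upd_def)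
 have W: "wp M read_edge (\<lambda>t k. t = s' \<and> k \<le> 190) s"
 proof (cases "s rWM 0 < wt e")
  case True
  thus ?thesis unfolding read_edge_def s'_def using g v ne bs FM e by (simp add: enc_upd_nonneg)
 next
  case False
  hence s'': "s' = upd (upd (upd (upd (upd (upd (upd (upd s rDST e (hdv e)) rDST (m + e) (tlv e)) rWT e (wt e))
   rNXT e (s rFST (tlv e))) rFST (tlv e) (e + 1)) rNXT (m + e) (s rFST (n + hdv e))) rFST (n + hdv e) (e + 1)) rE 0 (e + 1)"
   unfolding s'_def by (intro ext) simp
  show ?thesis unfolding read_edge_def s'' using False g v ne bs FM e by (simp add: enc_upd_nonneg)
 qed
 have ag: "agree rdr s s'" unfolding s'_def by (intro agree_upd agree_refl) auto
 have enc: "enc s' a = enc s a" if "0 \<le> a" for a unfolding s'_def using v e m1 that n2 by (simp add: enc_upd_nonneg)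
 have in': "inputs s'" using i ag enc by (simp add: inputs_def agree_def)
 have D: "s' rDST x = (if x = m + e then tlv e else if x = e then hdv e else s rDST x)"
  "s' rNXT x = (if x = m + e then s rFST (n + hdv e) else if x = e then s rFST (tlv e) else s rNXT x)"
  "s' rFST x = (if x = n + hdv e then e + 1 else if x = tlv e then e + 1 else s rFST x)"
  "s' rWT x = (if x = e then wt e else s rWT x)" "s' rWM 0 = max (s rWM 0) (wt e)" for x
  unfolding s'_def by simp_all
 have F: "isnx d v e (s rFST (d * n + v))" if "d = 0 \<or> d = 1" "0 \<le> v" "v < n" for d v using r that by (simp add: edges_read_def)
 have "edges_read (e + 1) s'"
  unfolding edges_read_def
 proof (intro conjI allI impI)
  fix d x :: int assume h: "(d = 0 \<or> d = 1) \<and> 0 \<le> x \<and> x < e + 1"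
  have "s' rDST (d * m + x) = dst d x \<and> isnx d (src d x) x (s' rNXT (d * m + x))"
  proof (cases "x = e")
   case True
   have sd: "src 0 e = tlv e" "src 1 e = hdv e" "dst 0 e = hdv e" "dst 1 e = tlv e" by (simp_all add: src_def dst_def)
   show ?thesis using h F[of 0 "tlv e"] F[of 1 "hdv e"] v ne by (auto simp: True D sd)
  next
   case False
   hence "d * m + x \<noteq> m + e" "d * m + x \<noteq> e" using h e by auto
   thus ?thesis using r h False by (simp add: D edges_read_def)
  qed
  thus "s' rDST (d * m + x) = dst d x" "isnx d (src d x) x (s' rNXT (d * m + x))" by auto
 next
  fix x assume h: "0 \<le> x \<and> x < e + 1"
  have "s' rWT x = wt x \<and> wt x \<le> s' rWM 0"
  proof (cases "x = e")
   case False
   hence "s rWT x = wt x \<and> wt x \<le> s rWM 0" using r h by (simp add: edges_read_def)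
   thus ?thesis using False by (auto simp: D)
  qed (simp add: D)
  thus "s' rWT x = wt x" "wt x \<le> s' rWM 0" by auto
 next
  fix d x :: int assume h: "(d = 0 \<or> d = 1) \<and> 0 \<le> x \<and> x < n"
  \<comment> \<open>The two directions occupy disjoint halves of \<open>rFST\<close>, so the edge
    changes one list head in each.\<close>
  have "d * n + x = n + hdv e \<longleftrightarrow> d = 1 \<and> x = hdv e" "d * n + x = tlv e \<longleftrightarrow> d = 0 \<and> x = tlv e" using h v by auto
  hence "s' rFST (d * n + x) = (if src d e = x then e + 1 else s rFST (d * n + x))"
   using h by (auto simp: D src_def dst_def)
  thus "isnx d x (e + 1) (s' rFST (d * n + x))" using isnx_step[OF F e(2)] h by simp
 next
  have "0 \<le> s rWM 0" "s rWM 0 \<le> W" using r by (simp_all add: edges_read_def)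
  thus "0 \<le> s' rWM 0" "s' rWM 0 \<le> W" using v by (auto simp: D)
 qed
 moreover have "s' rE 0 = e + 1" by (simp add: s'_def)
 ultimately show ?thesis using in' ag by (intro wp_mono[OF W]) auto
qed

lemma wp_read:
 assumes i: "inputs s" and z: "s rE 0 = 0" "s rWM 0 = 0" "\<And>x. 0 \<le> x ==> s rFST x = 0" and M: "n \<le> M" "m + 1 \<le> M" "W \<le> M" and b: "bnd M s"
 shows "wp M (Whl (V rE .< V rM) read_edge) (\<lambda>s' k. (inputs s' \<and> edges_read m s' \<and> agree rdr s s' \<and> bnd M s') \<and> k \<le> 200 * nat m + 20) s"
proof (rule wp_While[where Inv = "\<lambda>s'. inputs s' \<and> edges_read (s' rE 0) s' \<and> agree rdr s s' \<and> 0 \<le> s' rE 0 \<and> s' rE 0 \<le> m" and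
  \<Phi> = "\<lambda>s'. 200 * nat (m - s' rE 0)", OF _ b])
 have "1 \<le> W" using wt[of 0] m1 by auto
 hence "edges_read 0 s" using z by (auto simp: edges_read_def isnx_def)
 thus "inputs s \<and> edges_read (s rE 0) s \<and> agree rdr s s \<and> 0 \<le> s rE 0 \<and> s rE 0 \<le> m" using i z m1 by simp
next
 fix s' assume I: "inputs s' \<and> edges_read (s' rE 0) s' \<and> agree rdr s s' \<and> 0 \<le> s' rE 0 \<and> s' rE 0 \<le> m" "bnd M s'" "ev s' (V rE .< V rM) \<noteq> 0"
 have e: "s' rE 0 < m" using I by (auto simp: inputs_def split: if_splits)
 have w: "wp M read_edge (\<lambda>t k. (inputs t \<and> edges_read (s' rE 0 + 1) t \<and> t rE 0 = s' rE 0 + 1 \<and> agree rdr s' t) \<and> k \<le> 190) s'"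
  using I by (intro wp_read_edge e M) auto
 show "wp M read_edge (\<lambda>t k. (inputs t \<and> edges_read (t rE 0) t \<and> agree rdr s t \<and> 0 \<le> t rE 0 \<and> t rE 0 \<le> m) \<and>
   200 * nat (m - t rE 0) + k + cost (V rE .< V rM) + 1 \<le> 200 * nat (m - s' rE 0)) s'"
 proof (rule wp_mono[OF w])
  fix t and k :: nat assume A: "(inputs t \<and> edges_read (s' rE 0 + 1) t \<and> t rE 0 = s' rE 0 + 1 \<and> agree rdr s' t) \<and> k \<le> 190"
  have "agree rdr s t" using A I agree_trans[of rdr s s' rdr t rdr] by blast
  moreover have "nat (m - s' rE 0) = nat (m - (s' rE 0 + 1)) + 1" using e by simp
  moreover have "k \<le> 190" using A by blast
  ultimately    show "(inputs t \<and> edges_read (t rE 0) t \<and> agree rdr s t \<and> 0 \<le> t rE 0 \<and> t rE 0 \<le> m) \<and>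
   200 * nat (m - t rE 0) + k + cost (V rE .< V rM) + 1 \<le> 200 * nat (m - s' rE 0)" using A I e by simp
 qed
next
 fix s' k assume I: "inputs s' \<and> edges_read (s' rE 0) s' \<and> agree rdr s s' \<and> 0 \<le> s' rE 0 \<and> s' rE 0 \<le> m" "bnd M s'"
  "ev s' (V rE .< V rM) = 0" "200 * nat (m - s' rE 0) + k \<le> 200 * nat (m - s rE 0) + cost (V rE .< V rM) + 1"
 have "s' rE 0 = m" using I by (auto simp: inputs_def split: if_splits)
 thus "(inputs s' \<and> edges_read m s' \<and> agree rdr s s' \<and> bnd M s') \<and> k \<le> 200 * nat m + 20" using I z by simp
qed

end

text \<open>Clearing \<open>m + 1\<close> cells suffices: from index \<open>- m - 2\<close>
  downwards the addresses of \<open>rLC\<close> are at least \<open>64 * m + 78\<close>, beyond the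
  \<open>3 * m + 2\<close> input cells.\<close>

lemma wp_clear:
 assumes b: "bnd M s" and i: "s rI 0 = 1" "s rM 0 = m" "0 \<le> m" "m + 2 \<le> M" and z: "\<And>i. i < - m - 1 \<or> 0 \<le> i ==> s rLC i = 0"
 shows "wp M clear_loop
  (\<lambda>s' k. (agree {rI, rLC} s s' \<and> s' rLC = (\<lambda>_. 0) \<and> bnd M s') \<and> k \<le> 30 * nat m + 60) s"
unfolding clear_loop_def
proof (rule wp_While[where Inv = "\<lambda>s'. agree {rI, rLC} s s' \<and> 1 \<le> s' rI 0 \<and> s' rI 0 \<le> m + 2 \<and> (\<forall>i. s' rLC i = (if - s' rI 0 < i then 0 else s rLC i))" and
  \<Phi> = "\<lambda>s'. 30 * nat (m + 2 - s' rI 0)", OF _ b])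
 show "agree {rI, rLC} s s \<and> 1 \<le> s rI 0 \<and> s rI 0 \<le> m + 2 \<and> (\<forall>i. s rLC i = (if - s rI 0 < i then 0 else s rLC i))" using i z by auto
next
 fix s' assume I: "agree {rI, rLC} s s' \<and> 1 \<le> s' rI 0 \<and> s' rI 0 \<le> m + 2 \<and> (\<forall>i. s' rLC i = (if - s' rI 0 < i then 0 else s rLC i))"
  "bnd M s'" "ev s' (V rI .< V rM .+ N 2) \<noteq> 0"
 define j where "j = s' rI 0"
 have j: "1 \<le> j" "j < m + 2" using I i by (auto simp: j_def agree_def split: if_splits)
 have L: "s' rLC x = (if - j < x then 0 else s rLC x)" for x using I j_def by blast
 have "agree {rI, rLC} s (upd (upd s' rLC (- j) 0) rI 0 (j + 1))" by (intro agree_upd) (use I in auto)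
 moreover have "upd (upd s' rLC (- j) 0) rI 0 (j + 1) rLC x = (if - (j + 1) < x then 0 else s rLC x)" for x using L[of x] by auto
 ultimately show "wp M (Put rLC (N 0 .- V rI) (N 0);; rI ::= V rI .+ N 1)
   (\<lambda>t k. (agree {rI, rLC} s t \<and> 1 \<le> t rI 0 \<and> t rI 0 \<le> m + 2 \<and> (\<forall>i. t rLC i = (if - t rI 0 < i then 0 else s rLC i))) \<and>
    30 * nat (m + 2 - t rI 0) + k + cost (V rI .< V rM .+ N 2) + 1 \<le> 30 * nat (m + 2 - s' rI 0)) s'"
  using j i by (simp add: j_def[symmetric])
next
 fix s' k assume I: "agree {rI, rLC} s s' \<and> 1 \<le> s' rI 0 \<and> s' rI 0 \<le> m + 2 \<and> (\<forall>i. s' rLC i = (if - s' rI 0 < i then 0 else s rLC i))"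
  "bnd M s'" "ev s' (V rI .< V rM .+ N 2) = 0" "30 * nat (m + 2 - s' rI 0) + k \<le> 30 * nat (m + 2 - s rI 0) + cost (V rI .< V rM .+ N 2) + 1"
 have j: "s' rI 0 = m + 2" using I i by (auto simp: agree_def split: if_splits)
 have L: "s' rLC x = 0" for x
 proof -
  have "s' rLC x = (if - s' rI 0 < x then 0 else s rLC x)" using I by blast
  thus ?thesis using z[of x] j by auto
 qed
 thus "(agree {rI, rLC} s s' \<and> s' rLC = (\<lambda>_. 0) \<and> bnd M s') \<and> k \<le> 30 * nat m + 60" using I i j by auto
qed

lemma least_pow2:
 assumes "1 \<le> n"
 obtains l :: nat where "2 * n \<le> 2 ^ l" "2 ^ l < 4 * n" "1 \<le> l" "\<forall>i<l. 2 ^ i < 2 * (n :: int)"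
proof -
 let ?P = "\<lambda>l :: nat. 2 * n \<le> 2 ^ l"
 have "int (nat (2 * n)) < 2 ^ nat (2 * n)" by (rule of_nat_less_two_power)
 hence p: "?P (nat (2 * n))" using assms by simp
 define l where "l = (LEAST l. ?P l)"
 have l: "?P l" unfolding l_def by (rule LeastI[of ?P, OF p])
 have lt: "2 ^ i < 2 * n" if "i < l" for i using not_less_Least[of i ?P] that unfolding l_def by simp
 have "l \<noteq> 0" using l assms by (cases l) auto
 then obtain i where "l = Suc i" by (cases l) auto
 thus ?thesis using l lt lt[of i] by (intro that[of l]) auto
qed

lemma wp_log:
 assumes b: "bnd M s" and i: "s rI 0 = 1" "s rLG 0 = 0" "s rN 0 = n" "1 \<le> n" "4 * n \<le> M"
 shows "wp M log_loop
  (\<lambda>s' k. \<exists>l. agree {rI, rLG} s s' \<and> s' rLG 0 = int l \<and> 2 * n \<le> 2 ^ l \<and> 2 ^ l < 4 * n \<and> 1 \<le> l \<and> bnd M s' \<and> k \<le> 30 * l + 30) s"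
proof -
 obtain L :: nat where L: "2 * n \<le> 2 ^ L" "2 ^ L < 4 * n" "1 \<le> L" "\<forall>i<L. 2 ^ i < 2 * n" by (rule least_pow2[OF i(4)])
 define Inv where "Inv s' \<longleftrightarrow> agree {rI, rLG} s s' \<and> (\<exists>l\<le>L. s' rLG 0 = int l \<and> s' rI 0 = 2 ^ l)" for s'
 show ?thesis unfolding log_loop_def
 proof (rule wp_While[where Inv = Inv and \<Phi> = "\<lambda>s'. 30 * nat (int L - s' rLG 0)", OF _ b])
  show "Inv s" using i by (auto simp: Inv_def intro!: exI[of _ 0])
 next
  fix s' assume I: "Inv s'" "bnd M s'" "ev s' (V rI .< N 2 .* V rN) \<noteq> 0"
  obtain l where l: "l \<le> L" "s' rLG 0 = int l" "s' rI 0 = 2 ^ l" "agree {rI, rLG} s s'" using I by (auto simp: Inv_def)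
  have rn: "s' rN 0 = n" using l(4) i by (simp add: agree_def)
  have lt: "2 ^ l < 2 * n" using I(3) l rn by (auto split: if_splits)
  hence "l \<noteq> L" using L(1) by auto
  hence lL: "l < L" using l(1) by simp
  have "int l < 2 ^ l" by (rule of_nat_less_two_power)
  hence lM: "\<bar>int l + 1\<bar> \<le> M" using lt i by linarith
  have "0 \<le> (2 :: int) ^ l" by simp
  hence pM: "\<bar>2 * 2 ^ l\<bar> \<le> M" using lt i(5) unfolding abs_le_iff by linarith
  have "agree {rI, rLG} s (upd (upd s' rI 0 (2 * 2 ^ l)) rLG 0 (int l + 1))" by (intro agree_upd) (use l in auto)
  hence "Inv (upd (upd s' rI 0 (2 * 2 ^ l)) rLG 0 (int l + 1))"
   unfolding Inv_def using lL by (intro conjI exI[of _ "Suc l"]) auto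
  thus "wp M (rI ::= N 2 .* V rI;; rLG ::= V rLG .+ N 1) (\<lambda>t k. Inv t \<and>
    30 * nat (int L - t rLG 0) + k + cost (V rI .< N 2 .* V rN) + 1 \<le> 30 * nat (int L - s' rLG 0)) s'"
   using lM pM lL by (simp add: l(2,3))
 next
  fix s' k assume I: "Inv s'" "bnd M s'" "ev s' (V rI .< N 2 .* V rN) = 0"
   "30 * nat (int L - s' rLG 0) + k \<le> 30 * nat (int L - s rLG 0) + cost (V rI .< N 2 .* V rN) + 1"
  obtain l where l: "l \<le> L" "s' rLG 0 = int l" "s' rI 0 = 2 ^ l" "agree {rI, rLG} s s'" using I by (auto simp: Inv_def)
  have "s' rN 0 = n" using l(4) i by (simp add: agree_def)
  hence "\<not> 2 ^ l < 2 * n" using I(3) l by (auto split: if_splits)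
  hence "l = L" using L(4) l(1) by (cases "l = L") auto
  thus "\<exists>l. agree {rI, rLG} s s' \<and> s' rLG 0 = int l \<and> 2 * n \<le> 2 ^ l \<and> 2 ^ l < 4 * n \<and> 1 \<le> l \<and> bnd M s' \<and> k \<le> 30 * l + 30"
   using L l I i by (intro exI[of _ L]) simp
 qed
qed

text \<open>Both sides of the root are used: \<open>(k - 1) ^ 3 < min n m\<close> bounds
  \<open>k\<close> in the running time, and \<open>min n m \<le> k ^ 3\<close> bounds the number of
  searches in stage 3.\<close>

lemma wp_root3:
 assumes b: "bnd M s" and i: "s rKK 0 = 1" "s rN 0 = n" "s rM 0 = m" "1 \<le> n" "1 \<le> m" "n + 1 \<le> M"
 shows "wp M root_loop
  (\<lambda>s' k. \<exists>j. agree {rKK} s s' \<and> s' rKK 0 = j \<and> 1 \<le> j \<and> j \<le> n \<and> min n m \<le> j * j * j \<and> (j - 1) * (j - 1) * (j - 1) < min n m \<and> bnd M s' \<and> k \<le> 60 * nat j + 60) s"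
proof -
 have cube: "i \<le> i * i * i" if "1 \<le> i" for i :: int
 proof -
  have "1 * 1 \<le> i * i" using that by (intro mult_mono) auto
  hence "1 * i \<le> i * i * i" using that by (intro mult_right_mono) auto
  thus ?thesis by simp
 qed
 let ?P = "\<lambda>j :: nat. min n m \<le> int j * int j * int j"
 have "?P (nat n)" using min.coboundedI1[OF cube[OF i(4)], of m] i(4) by (simp only: nat_0_le order_trans[OF zero_le_one])
 define J where "J = (LEAST j. ?P j)"
 have J: "?P J" unfolding J_def by (rule LeastI[of ?P]) fact
 have Jn: "J \<le> nat n" unfolding J_def by (rule Least_le) fact
 have lt: "int j * int j * int j < min n m" if "j < J" for j using not_less_Least[of j ?P] that unfolding J_def not_le .
 have "J \<noteq> 0"
 proof
  assume "J = 0"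
  hence "n \<le> 0 \<or> m \<le> 0" using J by (simp add: min_le_iff_disj)
  thus False using i(4,5) by auto
 qed
 hence J0: "1 \<le> J" by simp
 define e where "e = (V rKK .* V rKK .* V rKK .< V rN) .* (V rKK .* V rKK .* V rKK .< V rM)"
 have ce: "cost e = 23" by (simp add: e_def)
 define Inv where "Inv s' \<longleftrightarrow> agree {rKK} s s' \<and> (\<exists>j. 1 \<le> j \<and> j \<le> J \<and> s' rKK 0 = int j)" for s'
 show ?thesis unfolding root_loop_def e_def[symmetric]
 proof (rule wp_While[where Inv = Inv and \<Phi> = "\<lambda>s'. 40 * nat (int J - s' rKK 0)", OF _ b])
  show "Inv s" unfolding Inv_def using i J0 by (auto intro!: exI[of _ 1])
 next
  fix s' assume I: "Inv s'" "bnd M s'" "ev s' e \<noteq> 0"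
  obtain j where j: "j \<le> J" "s' rKK 0 = int j" "agree {rKK} s s'" "1 \<le> j" using I by (auto simp: Inv_def)
  have rn: "s' rN 0 = n" "s' rM 0 = m" using j(3) i by (simp_all add: agree_def)
  have "int j * int j * int j < min n m" using I(3) j rn by (auto simp: e_def split: if_splits)
  hence "j \<noteq> J" using J by auto
  hence lJ: "j < J" using j(1) by simp
  hence jM: "\<bar>int j + 1\<bar> \<le> M" using Jn i by linarith
  have "agree {rKK} s (upd s' rKK 0 (int j + 1))" by (intro agree_upd) (use j in auto)
  hence "Inv (upd s' rKK 0 (int j + 1))" unfolding Inv_def using lJ by (intro conjI exI[of _ "Suc j"]) auto
  thus "wp M (rKK ::= V rKK .+ N 1) (\<lambda>t k. Inv t \<and> 40 * nat (int J - t rKK 0) + k + cost e + 1 \<le> 40 * nat (int J - s' rKK 0)) s'"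
   using jM lJ by (simp add: j(2) ce)
 next
  fix s' k assume I: "Inv s'" "bnd M s'" "ev s' e = 0" "40 * nat (int J - s' rKK 0) + k \<le> 40 * nat (int J - s rKK 0) + cost e + 1"
  obtain j where j: "j \<le> J" "s' rKK 0 = int j" "agree {rKK} s s'" using I by (auto simp: Inv_def)
  have rn: "s' rN 0 = n" "s' rM 0 = m" using j(3) i by (simp_all add: agree_def)
  have "\<not> int j * int j * int j < min n m" using I(3) j rn by (auto simp: e_def split: if_splits)
  hence "j = J" using lt[of j] j(1) by (cases "j = J") auto
  moreover have "(int J - 1) * (int J - 1) * (int J - 1) < min n m" using lt[of "J - 1"] J0 by (simp add: of_nat_diff)
  ultimately show "\<exists>j. agree {rKK} s s' \<and> s' rKK 0 = j \<and> 1 \<le> j \<and> j \<le> n \<and> min n m \<le> j * j * j \<and> (j - 1) * (j - 1) * (j - 1) < min n m \<and> bnd M s' \<and> k \<le> 60 * nat j + 60"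
   using J J0 Jn j I i ce by (intro exI[of _ "int J"]) auto
 qed
qed

lemma wp_fill:
 assumes b: "bnd M s" and i: "s rM 0 = m" "0 \<le> m" "m + 2 \<le> M" "s rNR 0 = NR"
 shows "wp M fill (\<lambda>s' k. (agree {rI, rSQ} s s' \<and> (\<forall>p. s' rSQ p = (if NR \<le> p \<and> p < NR + m then p - NR else s rSQ p)) \<and> bnd M s') \<and> k \<le> 40 * nat m + 20) s"
 unfolding fill_def
proof (rule wp_chain[where t = "upd s rI 0 0" and a = 3])
 define s1 where "s1 = upd s rI 0 0"
 have b1: "bnd M s1" unfolding s1_def using b i by (intro bnd_upd) auto
 show "wp M (rI ::= N 0) (\<lambda>s' k. s' = upd s rI 0 0 \<and> k \<le> 3) s" using i by simp
 fix k1 :: nat assume k1: "k1 \<le> 3"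
 show "wp M (Whl (V rI .< V rM) (Put rSQ (V rNR .+ V rI) (V rI);; rI ::= V rI .+ N 1))
   (\<lambda>s' k. (agree {rI, rSQ} s s' \<and> (\<forall>p. s' rSQ p = (if NR \<le> p \<and> p < NR + m then p - NR else s rSQ p)) \<and> bnd M s') \<and> k1 + k \<le> 40 * nat m + 20) (upd s rI 0 0)"
  unfolding s1_def[symmetric]
 proof (rule wp_While[where Inv = "\<lambda>s'. agree {rI, rSQ} s s' \<and> 0 \<le> s' rI 0 \<and> s' rI 0 \<le> m \<and> (\<forall>p. s' rSQ p = (if NR \<le> p \<and> p < NR + s' rI 0 then p - NR else s rSQ p))"
   and \<Phi> = "\<lambda>s'. 40 * nat (m - s' rI 0)", OF _ b1])
  show "agree {rI, rSQ} s s1 \<and> 0 \<le> s1 rI 0 \<and> s1 rI 0 \<le> m \<and> (\<forall>p. s1 rSQ p = (if NR \<le> p \<and> p < NR + s1 rI 0 then p - NR else s rSQ p))"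
   unfolding s1_def using i by (simp add: agree_def)
 next
  fix s' assume I: "agree {rI, rSQ} s s' \<and> 0 \<le> s' rI 0 \<and> s' rI 0 \<le> m \<and> (\<forall>p. s' rSQ p = (if NR \<le> p \<and> p < NR + s' rI 0 then p - NR else s rSQ p))"
   "bnd M s'" "ev s' (V rI .< V rM) \<noteq> 0"
  define j where "j = s' rI 0"
  have g: "s' rM 0 = m" "s' rNR 0 = NR" using I i by (simp_all add: agree_def)
  have j: "0 \<le> j" "j < m" using I g by (auto simp: j_def split: if_splits)
  have L: "s' rSQ p = (if NR \<le> p \<and> p < NR + j then p - NR else s rSQ p)" for p using I j_def by blast
  have "agree {rI, rSQ} s (upd (upd s' rSQ (NR + j) j) rI 0 (j + 1))" by (intro agree_upd) (use I in auto)
  moreover have "upd (upd s' rSQ (NR + j) j) rI 0 (j + 1) rSQ p = (if NR \<le> p \<and> p < NR + (j + 1) then p - NR else s rSQ p)" for p using L[of p] j by auto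
  ultimately show "wp M (Put rSQ (V rNR .+ V rI) (V rI);; rI ::= V rI .+ N 1)
    (\<lambda>t k. (agree {rI, rSQ} s t \<and> 0 \<le> t rI 0 \<and> t rI 0 \<le> m \<and> (\<forall>p. t rSQ p = (if NR \<le> p \<and> p < NR + t rI 0 then p - NR else s rSQ p))) \<and>
     40 * nat (m - t rI 0) + k + cost (V rI .< V rM) + 1 \<le> 40 * nat (m - s' rI 0)) s'"
   using j i by (simp add: j_def[symmetric] g)
 next
  fix s' k assume I: "agree {rI, rSQ} s s' \<and> 0 \<le> s' rI 0 \<and> s' rI 0 \<le> m \<and> (\<forall>p. s' rSQ p = (if NR \<le> p \<and> p < NR + s' rI 0 then p - NR else s rSQ p))"
   "bnd M s'" "ev s' (V rI .< V rM) = 0" "40 * nat (m - s' rI 0) + k \<le> 40 * nat (m - s1 rI 0) + cost (V rI .< V rM) + 1"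
  have "s' rM 0 = m" using I i by (simp add: agree_def)
  hence "s' rI 0 = m" using I by (auto split: if_splits)
  thus "(agree {rI, rSQ} s s' \<and> (\<forall>p. s' rSQ p = (if NR \<le> p \<and> p < NR + m then p - NR else s rSQ p)) \<and> bnd M s') \<and> k1 + k \<le> 40 * nat m + 20"
   using I k1 by (simp add: s1_def)
 qed
qed

context wgraph begin

definition prep_cost :: "nat => int => nat" where
 "prep_cost l k = 240 * nat m + 30 * l + 60 * nat k + 400"

lemma wp_prepare:
 fixes c :: int
 assumes i: "inputs s" and b: "bnd M s" and z: "\<And>r x. 4 \<le> r ==> 0 \<le> x ==> s r x = 0" "\<And>x. x < - m - 1 ==> s rLC x = 0"
  and c: "1 \<le> c" and M: "W \<le> M" "m + 2 \<le> M" "4 * n \<le> M" "((m + 2) * W + 2) * n \<le> M"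
   "8 * ((m + 2) * W) + 2 \<le> M"
   "\<And>l. 1 \<le> l ==> 2 ^ l < 4 * n ==> 2 * (n * n) * (4 * (c * int l)) \<le> M"
  and Q: "\<And>l k W' s' kk. 2 * n \<le> 2 ^ l ==> 2 ^ l < 4 * n ==> 1 \<le> l ==> 1 \<le> k ==> k \<le> n ==>
    min n m \<le> k * k * k ==> (k - 1) * (k - 1) * (k - 1) < min n m ==> W' \<le> W ==> (\<forall>e. 0 \<le> e \<and> e < m --> wt e \<le> W') ==>
    s' rN 0 = n ==> s' rM 0 = m ==> s' rKK 0 = k ==> s' rK 0 = c * int l ==> s' rBIG 0 = 4 * ((m + 2) * W') + 1 ==>
    s' rBC 0 = ((m + 2) * W' + 2) * n ==> s' rN1 0 = k * (4 * (c * int l)) ==>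
    s' rNR 0 = k * (4 * (c * int l)) + k * k * (4 * (c * int l)) ==> s' rJ 0 = 0 ==>
    edges_read m s' ==> s' rLC = (\<lambda>_. 0) ==> (\<forall>r x. 44 \<le> r \<and> 0 \<le> x --> s' r x = 0) ==> bnd M s' ==> kk \<le> prep_cost l k ==> Q s' kk"
 shows "wp M (prepare c) Q s"
proof -
 have W1: "1 \<le> W" using wt[of 0] m1 by auto
 have M8: "8 \<le> M" using M(3) n2 by linarith
 define s1 where "s1 = upd s rE 0 0"
 have i1: "inputs s1" using i by (simp add: inputs_def s1_def enc_upd_nonneg)
 have b1: "bnd M s1" unfolding s1_def using b M8 by (intro bnd_upd) auto
 have w1: "wp M (rE ::= N 0) (\<lambda>s' k. s' = s1 \<and> k \<le> 3) s" using M8 by (simp add: s1_def)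
 have w2: "wp M (Whl (V rE .< V rM) read_edge) (\<lambda>s' k. (inputs s' \<and> edges_read m s' \<and> agree rdr s1 s' \<and> bnd M s') \<and> k \<le> 200 * nat m + 20) s1"
  by (rule wp_read[OF i1 _ _ _ _ _ _ b1]) (use z M n2 in \<open>auto simp: s1_def\<close>)
 show ?thesis
  unfolding prepare_def
 proof (rule wp_chain[OF w1], rule wp_chainQ[OF w2])
  fix s2 and k1 k2 :: nat
  assume k1: "k1 \<le> 3" and A2: "inputs s2 \<and> edges_read m s2 \<and> agree rdr s1 s2 \<and> bnd M s2" and k2: "k2 \<le> 200 * nat m + 20"
  define s3 where "s3 = upd s2 rI 0 1"
  have b3: "bnd M s3" unfolding s3_def using A2 M8 by (intro bnd_upd) auto
  have o2: "s2 r = s r" if "r \<notin> rdr" for r using A2 that by (auto simp: agree_def s1_def)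
  have w3: "wp M (rI ::= N 1) (\<lambda>s' k. s' = s3 \<and> k \<le> 3) s2" using M8 by (simp add: s3_def)
  have w4: "wp M clear_loop
    (\<lambda>s' k. (agree {rI, rLC} s3 s' \<and> s' rLC = (\<lambda>_. 0) \<and> bnd M s') \<and> k \<le> 30 * nat m + 60) s3"
   by (rule wp_clear[OF b3]) (use A2 M m1 z o2 in \<open>auto simp: s3_def inputs_def\<close>)
  show "wp M (rI ::= N 1;; clear_loop;;
    rI ::= N 1;; rLG ::= N 0;; log_loop;;
    rKK ::= N 1;;
    root_loop;; (set_sizes c))
    (\<lambda>s' k. Q s' (k1 + (k2 + k))) s2"
  proof (rule wp_chain[OF w3], rule wp_chainQ[OF w4])
   fix s4 and k3 k4 :: nat
   assume k3: "k3 \<le> 3" and A4: "agree {rI, rLC} s3 s4 \<and> s4 rLC = (\<lambda>_. 0) \<and> bnd M s4" and k4: "k4 \<le> 30 * nat m + 60"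
   define s5 where "s5 = upd (upd s4 rI 0 1) rLG 0 0"
   have b5: "bnd M s5" unfolding s5_def using A4 M8 by (intro bnd_upd) auto
   have o4: "s5 r = s2 r" if "r \<notin> {rI, rLC, rLG}" for r using A4 that by (auto simp: agree_def s3_def s5_def)
   have w5: "wp M (rI ::= N 1;; rLG ::= N 0) (\<lambda>s' k. s' = s5 \<and> k \<le> 6) s4" using M8 by (simp add: s5_def)
   have w6: "wp M log_loop
     (\<lambda>s' k. \<exists>l. agree {rI, rLG} s5 s' \<and> s' rLG 0 = int l \<and> 2 * n \<le> 2 ^ l \<and> 2 ^ l < 4 * n \<and> 1 \<le> l \<and> bnd M s' \<and> k \<le> 30 * l + 30) s5"
    by (rule wp_log[OF b5]) (use A2 M n2 o4 in \<open>auto simp: s5_def inputs_def\<close>)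
   have "wp M ((rI ::= N 1;; rLG ::= N 0);; log_loop;;
     rKK ::= N 1;;
     root_loop;; (set_sizes c))
     (\<lambda>s' k. Q s' (k1 + (k2 + (k3 + (k4 + k))))) s4"
   proof (rule wp_chain[OF w5], rule wp_seqI[OF w6])
    fix s6 and k5 k6 :: nat
    assume k5: "k5 \<le> 6" and "\<exists>l. agree {rI, rLG} s5 s6 \<and> s6 rLG 0 = int l \<and> 2 * n \<le> 2 ^ l \<and> 2 ^ l < 4 * n \<and> 1 \<le> l \<and> bnd M s6 \<and> k6 \<le> 30 * l + 30"
    then obtain l where A6: "agree {rI, rLG} s5 s6" "s6 rLG 0 = int l" "2 * n \<le> 2 ^ l" "2 ^ l < 4 * n" "1 \<le> l" "bnd M s6" "k6 \<le> 30 * l + 30" by blast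
    define s7 where "s7 = upd s6 rKK 0 1"
    have b7: "bnd M s7" unfolding s7_def using A6 M8 by (intro bnd_upd) auto
    have o6: "s7 r = s5 r" if "r \<notin> {rI, rLG, rKK}" for r using A6(1) that by (auto simp: agree_def s7_def)
    have w7: "wp M (rKK ::= N 1) (\<lambda>s' k. s' = s7 \<and> k \<le> 3) s6" using M8 by (simp add: s7_def)
    have w8: "wp M root_loop
      (\<lambda>s' k. \<exists>j. agree {rKK} s7 s' \<and> s' rKK 0 = j \<and> 1 \<le> j \<and> j \<le> n \<and> min n m \<le> j * j * j \<and> (j - 1) * (j - 1) * (j - 1) < min n m \<and> bnd M s' \<and> k \<le> 60 * nat j + 60) s7"
     by (rule wp_root3[OF b7]) (use A2 M n2 m1 o6 o4 in \<open>auto simp: s7_def inputs_def\<close>)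
    show "wp M (rKK ::= N 1;;
      root_loop;; (set_sizes c))
      (\<lambda>s' k. Q s' (k1 + (k2 + (k3 + (k4 + (k5 + (k6 + k))))))) s6"
    proof (rule wp_chain[OF w7], rule wp_seqI[OF w8])
     fix s8 and k7 k8 :: nat
     assume k7: "k7 \<le> 3" and "\<exists>j. agree {rKK} s7 s8 \<and> s8 rKK 0 = j \<and> 1 \<le> j \<and> j \<le> n \<and> min n m \<le> j * j * j \<and> (j - 1) * (j - 1) * (j - 1) < min n m \<and> bnd M s8 \<and> k8 \<le> 60 * nat j + 60"
     then obtain k where A8: "agree {rKK} s7 s8" "s8 rKK 0 = k" "1 \<le> k" "k \<le> n" "min n m \<le> k * k * k" "(k - 1) * (k - 1) * (k - 1) < min n m" "bnd M s8" "k8 \<le> 60 * nat k + 60" by blast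
     have o8: "s8 r = s2 r" if "r \<notin> {rI, rLG, rKK, rLC}" for r using A8(1) that o6[of r] o4[of r] by (auto simp: agree_def)
     have LC: "s8 rLC = (\<lambda>_. 0)" using A8(1) o6[of rLC] A4 by (simp add: agree_def s5_def)
     have "s8 rN = s2 rN" "s8 rM = s2 rM" by (rule o8; simp)+
     moreover have "s8 rLG = s6 rLG" using A8(1) by (simp add: agree_def s7_def)
     ultimately have g: "s8 rN 0 = n" "s8 rM 0 = m" "s8 rLG 0 = int l" using A2 A6(2) by (simp_all add: inputs_def)
     define W' where "W' = s8 rWM 0"
     have er: "edges_read m s8" using A2 o8 by (simp add: edges_read_def)
     have W': "0 \<le> W'" "W' \<le> W" "\<forall>e. 0 \<le> e \<and> e < m --> wt e \<le> W'" using er by (auto simp: edges_read_def W'_def)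
     have zr: "s8 r x = 0" if "44 \<le> r" "0 \<le> x" for r x
     proof (cases "r = rLC")
      case False
      thus ?thesis using that o8[of r] o2[of r] z(1)[of r x] by auto
     qed (simp add: LC)
     define K where "K = c * int l"
     have K: "1 * 1 \<le> K" unfolding K_def using c A6(5) by (intro mult_mono) auto
     have p1: "k * k \<le> n * n" using A8(3,4) by (intro mult_mono) auto
     have kk: "k * 1 \<le> k * k" using A8(3) by (intro mult_left_mono) auto
     have q1: "k * (4 * K) \<le> n * n * (4 * K)" by (rule mult_right_mono) (use p1 kk K in auto)
     have q2: "k * k * (4 * K) \<le> n * n * (4 * K)" by (rule mult_right_mono) (use p1 K in auto)
     have q3: "1 * (4 * K) \<le> k * (4 * K)" using A8(3) K by (intro mult_right_mono) auto
     have q0: "0 \<le> k * k * (4 * K)" using A8(3) K by simp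
     have qM: "2 * (n * n) * (4 * K) \<le> M" using M(6)[OF A6(5,4)] by (simp add: K_def)
     have mw: "0 \<le> (m + 2) * W'" "(m + 2) * W' \<le> (m + 2) * W" using W' m1 by (auto intro: mult_left_mono)
     have mw2: "((m + 2) * W' + 2) * 1 \<le> ((m + 2) * W' + 2) * n" "((m + 2) * W' + 2) * n \<le> ((m + 2) * W + 2) * n"
      using mw n2 by (auto intro: mult_left_mono mult_right_mono)
     have bd: "\<bar>K\<bar> \<le> M" "\<bar>4 * ((m + 2) * W') + 1\<bar> \<le> M" "\<bar>((m + 2) * W' + 2) * n\<bar> \<le> M" "\<bar>k * (4 * K)\<bar> \<le> M" "\<bar>k * (4 * K) + k * k * (4 * K)\<bar> \<le> M"
     proof -
      have d: "2 * (n * n) * (4 * K) = n * n * (4 * K) + n * n * (4 * K)" by simp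
      show "\<bar>K\<bar> \<le> M" "\<bar>k * (4 * K)\<bar> \<le> M" "\<bar>k * (4 * K) + k * k * (4 * K)\<bar> \<le> M" using q0 q1 q2 q3 qM K unfolding d by linarith+
      define x where "x = (m + 2) * W'"
      define y where "y = (x + 2) * n"
      have "0 \<le> x" using mw(1) by (simp only: x_def)
      moreover have "x + 2 \<le> y" using mw2(1) by (simp only: x_def y_def mult_1_right)
      moreover have "y \<le> M" using mw2(2) M(4) unfolding x_def y_def by (rule order_trans)
      moreover have "8 * x + 2 \<le> M" using mw M(5) by (simp add: x_def)
      ultimately show "\<bar>4 * ((m + 2) * W') + 1\<bar> \<le> M" "\<bar>((m + 2) * W' + 2) * n\<bar> \<le> M" unfolding x_def[symmetric] y_def[symmetric] by linarith+
     qed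
     define s9 where "s9 = upd (upd (upd (upd (upd (upd s8 rK 0 K) rBIG 0 (4 * ((m + 2) * W') + 1)) rBC 0 (((m + 2) * W' + 2) * n))
       rN1 0 (k * (4 * K))) rNR 0 (k * (4 * K) + k * k * (4 * K))) rJ 0 0"
     have b9: "bnd M s9" unfolding s9_def using A8(7) bd M8 by (intro bnd_upd) auto
     have ag9: "agree {rK, rBIG, rBC, rN1, rNR, rJ} s8 s9" unfolding s9_def by (intro agree_upd agree_refl) auto
     have w9: "wp M (set_sizes c) (\<lambda>s' k. s' = s9 \<and> k \<le> 80) s8"
      unfolding set_sizes_def s9_def using bd M8 by (simp add: g A8(2) W'_def[symmetric] K_def[symmetric])
     show "wp M (set_sizes c) (\<lambda>s' k. Q s' (k1 + (k2 + (k3 + (k4 + (k5 + (k6 + (k7 + (k8 + k))))))))) s8"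
     proof (rule wp_mono[OF w9])
      fix s' and k9 :: nat assume h: "s' = s9 \<and> k9 \<le> 80"
      have "Q s9 (k1 + (k2 + (k3 + (k4 + (k5 + (k6 + (k7 + (k8 + k9))))))))"
      proof (rule Q[OF A6(3,4,5) A8(3,4,5,6) W'(2,3)])
       show "s9 rN 0 = n" "s9 rM 0 = m" "s9 rKK 0 = k" "s9 rK 0 = c * int l" "s9 rBIG 0 = 4 * ((m + 2) * W') + 1"
        "s9 rBC 0 = ((m + 2) * W' + 2) * n" "s9 rN1 0 = k * (4 * (c * int l))" "s9 rNR 0 = k * (4 * (c * int l)) + k * k * (4 * (c * int l))" "s9 rJ 0 = 0"
        using g A8(2) by (simp_all add: s9_def K_def)
       show "edges_read m s9" using er ag9 by (simp add: edges_read_def agree_def)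
       show "s9 rLC = (\<lambda>_. 0)" "\<forall>r x. 44 \<le> r \<and> 0 \<le> x --> s9 r x = 0" using LC ag9 zr by (auto simp: agree_def)
       show "k1 + (k2 + (k3 + (k4 + (k5 + (k6 + (k7 + (k8 + k9))))))) \<le> prep_cost l k"
        using k1 k2 k3 k4 k5 A6(7) k7 A8(8) h unfolding prep_cost_def by linarith
      qed (rule b9)
      thus "Q s' (k1 + (k2 + (k3 + (k4 + (k5 + (k6 + (k7 + (k8 + k9))))))))" using h by simp
     qed
    qed
   qed
   thus "wp M (rI ::= N 1;; rLG ::= N 0;; log_loop;;
     rKK ::= N 1;;
     root_loop;; (set_sizes c))
     (\<lambda>s' k. Q s' (k1 + (k2 + (k3 + (k4 + k))))) s4" unfolding wp_Sq_assoc .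
  qed
 qed
qed

end

section \<open>The random draws\<close>

definition draw :: com where
 "draw = While (comp (V rJ .< V rNR))
   (Seq (Rand (Op Sub (Lit (- 1 - int rSQ)) (Op Mul (Lit 64) (comp (V rJ)))) (comp (V rM))) (co (rJ ::= V rJ .+ N 1)))"

text \<open>\<open>cmd\<close> is deterministic, so the program is assembled in \<open>com\<close>,
  around its one random loop. A graph without edges is answered at once, since drawing from an empty
  range would abort.\<close>

definition program :: "int => com" where
 "program c = Seq (co (rN ::= I (N 0);; rM ::= I (N 1)))
   (If (comp (V rM))
    (Seq (co (prepare c)) (Seq draw (co (fill;; main))))
    (co (Put 63 (N (- 1)) (N (- 1)))))"

lemma ok_program:
 assumes "64 \<le> M" "\<bar>c\<bar> \<le> M"
 shows "ok M (prepare c)" "ok M (fill;; main)" "ok M (rN ::= I (N 0);; rM ::= I (N 1))" "ok M (Put 63 (N (- 1)) (N (- 1)))"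
  "ok M (rJ ::= V rJ .+ N 1)"
 using assms
 by (simp_all add: prepare_def clear_loop_def log_loop_def root_loop_def set_sizes_def read_edge_def fill_def main_def stage_def row_def append_row_def append_tests_def search_def expand_def expand_edge_def
   relax_def tests_def label_def chk_def segu_def ok_ex_def)

text \<open>The effect of the draw loop when its draws are prescribed. It separates chance from
  computation: after the loop everything is a function of the drawn list.\<close>

primrec fl :: "int list => st => st" where
 "fl [] s = s"
| "fl (e # es) s = fl es (upd (upd s rSQ (s rJ 0) e) rJ 0 (s rJ 0 + 1))"

lemma fl_agree: "agree {rSQ, rJ} s (fl es s)"
proof (induction es arbitrary: s)
 case (Cons e es)
 define t where "t = upd (upd s rSQ (s rJ 0) e) rJ 0 (s rJ 0 + 1)"
 have f: "fl (e # es) s = fl es t" by (simp add: t_def del: upd_apply)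
 have "agree {rSQ, rJ} s t" unfolding t_def by (intro agree_upd agree_refl) auto
 thus ?case unfolding f by (rule agree_trans[OF _ Cons[of t]]) auto
qed simp

lemma fl_SQ: "fl es s rSQ i = (if s rJ 0 \<le> i \<and> i < s rJ 0 + int (length es) then es ! nat (i - s rJ 0) else s rSQ i)"
proof (induction es arbitrary: s)
 case (Cons e es)
 define t where "t = upd (upd s rSQ (s rJ 0) e) rJ 0 (s rJ 0 + 1)"
 have f: "fl (e # es) s = fl es t" by (simp add: t_def del: upd_apply)
 have n: "nat (i - s rJ 0) = Suc (nat (i - (s rJ 0 + 1)))" if "s rJ 0 + 1 \<le> i" using that by simp
 have t: "t rJ 0 = s rJ 0 + 1" "t rSQ i = (if i = s rJ 0 then e else s rSQ i)" by (simp_all add: t_def)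
 show ?case unfolding f Cons t using n by auto
qed simp

lemma bnd_fl: "bnd M s ==> 0 \<le> s rJ 0 ==> s rJ 0 + int (length es) \<le> M ==> \<forall>e\<in>set es. \<bar>e\<bar> \<le> M ==> bnd M (fl es s)"
proof (induction es arbitrary: s)
 case (Cons e es)
 define t where "t = upd (upd s rSQ (s rJ 0) e) rJ 0 (s rJ 0 + 1)"
 have f: "fl (e # es) s = fl es t" by (simp add: t_def del: upd_apply)
 have "bnd M t" unfolding t_def using Cons.prems by (intro bnd_upd) auto
 moreover have "t rJ 0 = s rJ 0 + 1" by (simp add: t_def)
 ultimately show ?case unfolding f using Cons.IH[of t] Cons.prems by auto
qed simp

lemma LS_Suc': "LS m (Suc k) = (\<lambda>(e, es). e # es) ` ({0..<m} \<times> LS m k)"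
proof
 show "LS m (Suc k) \<subseteq> (\<lambda>(e, es). e # es) ` ({0..<m} \<times> LS m k)"
 proof
  fix xs assume xs: "xs \<in> LS m (Suc k)"
  then obtain y ys where "xs = y # ys" by (cases xs) (auto simp: LS_def)
  thus "xs \<in> (\<lambda>(e, es). e # es) ` ({0..<m} \<times> LS m k)" using xs by (force simp: LS_def)
 qed
qed (auto simp: LS_def)

lemma spmf_LS_Suc:
 "spmf_of_set (LS m (Suc k)) = bind_spmf (spmf_of_set {0..<m}) (\<lambda>e. map_spmf (\<lambda>es. e # es) (spmf_of_set (LS m k)))"
proof -
 have inj: "inj_on (\<lambda>(e, es). e # es) ({0..<m} \<times> LS m k)" by (auto simp: inj_on_def)
 have "spmf_of_set (LS m (Suc k)) = map_spmf (\<lambda>(e, es). e # es) (spmf_of_set ({0..<m} \<times> LS m k))"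
  unfolding LS_Suc' by (rule map_spmf_of_set_inj_on[symmetric, OF inj])
 also have "spmf_of_set ({0..<m} \<times> LS m k) = pair_spmf (spmf_of_set {0..<m}) (spmf_of_set (LS m k))"
  by (rule spmf_eqI) (auto simp: spmf_pair spmf_of_set indicator_def card_cartesian_product)
 finally show ?thesis unfolding pair_spmf_alt_def by (simp add: map_spmf_bind_spmf o_def map_spmf_conv_bind_spmf)
qed

lemma run_While:
 assumes "eval_expr B s e = Some v"
 shows "run B (While e c) (s, t) =
  (if v \<noteq> 0 then bind_spmf (run B c (s, t + expr_cost e + 1)) (run B (While e c)) else return_spmf (s, t + expr_cost e + 1))"
 unfolding run.simps by (subst loop_spmf.simps) (use assms in auto)

lemma run_Rand:
 assumes "eval_expr B s a = Some i" "eval_expr B s e = Some v"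
 shows "run B (Rand a e) (s, t) = bind_spmf (spmf_of_set {0..<v}) (\<lambda>r. return_spmf (s(i := r), t + expr_cost a + expr_cost e + 1))"
 using assms by simp

lemma run_Seq: "run B (Seq c d) st = bind_spmf (run B c st) (run B d)"
 by simp

text \<open>Successive uniform draws amount to one uniform list. A round takes 21 units of time, the
  final test 6.\<close>

lemma run_draw:
 assumes M: "64 \<le> M" "real_of_int (M ^ 40) \<le> B" and m: "1 \<le> m" "m \<le> M"
 shows "bnd M s ==> 0 \<le> s rJ 0 ==> s rNR 0 = s rJ 0 + int k ==> s rNR 0 \<le> M ==> s rM 0 = m ==>
  run B draw (enc s, t) = map_spmf (\<lambda>es. (enc (fl es s), t + 21 * k + 6)) (spmf_of_set (LS m k))"
proof (induction k arbitrary: s t)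
 case 0
 have "ok_ex M (V rJ .< V rNR)" by (simp add: ok_ex_def)
 note e = ok_ex_eval(1)[OF M(1) 0(1) this M(2)]
 have "run B draw (enc s, t) = return_spmf (enc s, t + 6)"
  unfolding draw_def run_While[OF e] using 0 by simp
 thus ?case by (simp add: spmf_of_set_singleton)
next
 case (Suc k)
 have o: "ok_ex M (V rJ .< V rNR)" "ok_ex M (V rM)" "ok_ex M (V rJ)" by (simp_all add: ok_ex_def)
 note e1 = ok_ex_eval(1)[OF M(1) Suc(2) o(1) M(2)] and e2 = ok_ex_eval(1)[OF M(1) Suc(2) o(2) M(2)]
  and e3 = ok_ex_eval(2)[OF M(1) Suc(2) o(3) M(2), of rSQ]
 define sr where "sr r = upd (upd s rSQ (s rJ 0) r) rJ 0 (s rJ 0 + 1)" for r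
 have inc: "run B (co (rJ ::= V rJ .+ N 1)) (enc (upd s rSQ (s rJ 0) r), t') = return_spmf (enc (sr r), t' + 6)" if "0 \<le> r" "r < m" for r t'
 proof -
  have b: "bnd M (upd s rSQ (s rJ 0) r)" using Suc that m by (intro bnd_upd) auto
  have kk: "bs M (rJ ::= V rJ .+ N 1) (upd s rSQ (s rJ 0) r) (sr r) 6"
  proof -
   have "\<bar>ev (upd s rSQ (s rJ 0) r) (V rJ .+ N 1)\<bar> \<le> M" using Suc by simp
   from bs_Asg[OF this, of rJ] show ?thesis by (simp add: sr_def)
  qed
  show ?thesis using bs_run[OF kk M b ok_program(5)[OF M(1)], of 0] M(1) by simp
 qed
 have IH: "run B draw (enc (sr r), t') = map_spmf (\<lambda>es. (enc (fl (r # es) s), t' + 21 * k + 6)) (spmf_of_set (LS m k))" if "0 \<le> r" "r < m" for r t'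
 proof -
  have "bnd M (sr r)" unfolding sr_def using Suc that m by (intro bnd_upd) auto
  moreover have "sr r rJ 0 = s rJ 0 + 1" "sr r rNR 0 = s rNR 0" "sr r rM 0 = s rM 0" by (simp_all add: sr_def)
  moreover have "fl (r # es) s = fl es (sr r)" for es by (simp add: sr_def del: upd_apply)
  ultimately show ?thesis using Suc.IH[of "sr r" t'] Suc.prems by simp
 qed
 have "run B draw (enc s, t) = bind_spmf (spmf_of_set {0..<m}) (\<lambda>r. run B draw (enc (sr r), t + 21))"
 proof -
  have lt44: "rSQ < 64" by simp
  have v: "ev s (V rJ .< V rNR) = 1" "ev s (V rM) = m" "ev s (V rJ) = s rJ 0" using Suc.prems by simp_all
  have "run B draw (enc s, t) = bind_spmf (run B (Seq (Rand (Op Sub (Lit (- 1 - int rSQ)) (Op Mul (Lit 64) (comp (V rJ)))) (comp (V rM))) (co (rJ ::= V rJ .+ N 1))) (enc s, t + 6)) (run B draw)"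
   unfolding draw_def run_While[OF e1] v expr_cost_comp by (simp add: add.commute del: run.simps comp.simps co.simps)
  also have "\<dots> = bind_spmf (spmf_of_set {0..<m}) (\<lambda>r.
    bind_spmf (run B (co (rJ ::= V rJ .+ N 1)) (enc (upd s rSQ (s rJ 0) r), t + 15)) (run B draw))"
   unfolding run_Seq run_Rand[OF e3 e2, simplified v, OF lt44] bind_spmf_assoc return_bind_spmf
   by (simp add: enc_upd add.commute del: upd_apply run.simps co.simps)
  also have "\<dots> = bind_spmf (spmf_of_set {0..<m}) (\<lambda>r. run B draw (enc (sr r), t + 21))"
   by (rule bind_spmf_cong[OF refl]) (use m in \<open>simp add: inc add.commute del: co.simps\<close>)
  finally show ?thesis .
 qed
 also have "\<dots> = bind_spmf (spmf_of_set {0..<m}) (\<lambda>r. map_spmf (\<lambda>es. (enc (fl (r # es) s), t + 21 + 21 * k + 6)) (spmf_of_set (LS m k)))"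
  by (rule bind_spmf_cong[OF refl]) (use IH in simp)
 also have "\<dots> = map_spmf (\<lambda>es. (enc (fl es s), t + 21 * Suc k + 6)) (spmf_of_set (LS m (Suc k)))"
  unfolding spmf_LS_Suc map_spmf_bind_spmf spmf.map_comp o_def by (simp add: add_ac del: fl.simps)
 finally show ?case .
qed

text \<open>Conditioning on the first \<open>a\<close> draws, as the relation that the second sample
  prunes with depends on the first sample.\<close>

lemma card_LS_add:
 assumes "\<And>xs. xs \<in> LS m a ==> real (card {ys \<in> LS m b. P xs ys}) \<le> c xs"
 shows "real (card {es \<in> LS m (a + b). P (take a es) (drop a es)}) \<le> (\<Sum>xs\<in>LS m a. c xs)"
proof -
 have "{es \<in> LS m (a + b). P (take a es) (drop a es)} \<subseteq> (\<Union>xs\<in>LS m a. (\<lambda>ys. xs @ ys) ` {ys \<in> LS m b. P xs ys})"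
 proof
  fix es assume "es \<in> {es \<in> LS m (a + b). P (take a es) (drop a es)}"
  hence es: "length es = a + b" "set es \<subseteq> {0..<m}" "P (take a es) (drop a es)" by (auto simp: LS_def)
  have "take a es \<in> LS m a" "drop a es \<in> LS m b" using es set_take_subset[of a es] set_drop_subset[of a es] by (auto simp: LS_def)
  thus "es \<in> (\<Union>xs\<in>LS m a. (\<lambda>ys. xs @ ys) ` {ys \<in> LS m b. P xs ys})" using es(3) by (intro UN_I[of "take a es"] image_eqI[of _ _ "drop a es"]) auto
 qed
 hence "card {es \<in> LS m (a + b). P (take a es) (drop a es)} \<le> card (\<Union>xs\<in>LS m a. (\<lambda>ys. xs @ ys) ` {ys \<in> LS m b. P xs ys})"
  by (intro card_mono finite_UN_I finite_LS finite_imageI) (auto simp: finite_LS)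
 also have "\<dots> \<le> (\<Sum>xs\<in>LS m a. card ((\<lambda>ys. xs @ ys) ` {ys \<in> LS m b. P xs ys}))" by (rule card_UN_le[OF finite_LS])
 also have "\<dots> \<le> (\<Sum>xs\<in>LS m a. card {ys \<in> LS m b. P xs ys})" by (intro sum_mono card_image_le) (auto simp: finite_LS)
 finally have "real (card {es \<in> LS m (a + b). P (take a es) (drop a es)}) \<le> (\<Sum>xs\<in>LS m a. real (card {ys \<in> LS m b. P xs ys}))"
  unfolding of_nat_sum[symmetric] of_nat_le_iff .
 also have "\<dots> \<le> (\<Sum>xs\<in>LS m a. c xs)" by (intro sum_mono assms)
 finally show ?thesis .
qed

lemma card_union_range:
 assumes "\<And>r. 0 \<le> r ==> r < n ==> real (card {es \<in> LS m k. Q r es}) \<le> c" "0 \<le> c" "0 \<le> n"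
 shows "real (card {es \<in> LS m k. \<exists>r. 0 \<le> r \<and> r < n \<and> Q r es}) \<le> real_of_int n * c"
proof -
 have "{es \<in> LS m k. \<exists>r. 0 \<le> r \<and> r < n \<and> Q r es} = (\<Union>r\<in>{0..<n}. {es \<in> LS m k. Q r es})" by auto
 hence "card {es \<in> LS m k. \<exists>r. 0 \<le> r \<and> r < n \<and> Q r es} \<le> (\<Sum>r\<in>{0..<n}. card {es \<in> LS m k. Q r es})" using card_UN_le[of "{0..<n}"] by simp
 hence "real (card {es \<in> LS m k. \<exists>r. 0 \<le> r \<and> r < n \<and> Q r es}) \<le> (\<Sum>r\<in>{0..<n}. real (card {es \<in> LS m k. Q r es}))" unfolding of_nat_sum[symmetric] of_nat_le_iff .
 also have "\<dots> \<le> (\<Sum>r\<in>{0..<n}. c)" by (intro sum_mono assms) auto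
 finally show ?thesis using assms(3) by simp
qed

section \<open>Counting the bad samples\<close>

context prog begin

text \<open>Since \<open>src (1 - d) = dst d\<close>, an edge drawn by its end
  \<open>dst d e\<close> hits a vertex as often as a search in direction \<open>1 - d\<close>
  relaxes edges there. So the surviving draws are counted by just the volume that matters to the
  next stage. The factor \<open>n\<close> is a union bound over the owners of lists.\<close>

lemma bad_stage:
 fixes k :: int
 assumes k: "1 \<le> k" and tot: "\<And>r x y. kl r x y \<or> kl r y x"
  and Q: "\<And>es. Q es ==> \<exists>r. 0 \<le> r \<and> r < n \<and> nat (m div k + 1) \<le> vol (1 - d) {x. Ac r x \<and> (\<forall>s\<in>set (onl (Ac r) (kl r) (nat K) (map (dst d) es)). \<not> kl r s x)}"
 shows "real (card {es \<in> LS m (nat k * (4 * nat K)). Q es}) \<le>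
  real_of_int n * ((2 * real (nat k * (4 * nat K)) + 1) / 2 ^ nat K * real_of_int m ^ (nat k * (4 * nat K)))"
proof -
 define X where "X = nat (m div k + 1)"
 have dv: "0 \<le> m div k" "m div k \<le> m" using k m1 div_abs_le[of m k] by (auto simp: pos_imp_zdiv_nonneg_iff)
 let ?P = "\<lambda>r es. X \<le> vol (1 - d) {x. Ac r x \<and> (\<forall>s\<in>set (onl (Ac r) (kl r) (nat K) (map (dst d) es)). \<not> kl r s x)}"
 have "card {es \<in> LS m (nat k * (4 * nat K)). Q es} \<le> card {es \<in> LS m (nat k * (4 * nat K)). \<exists>r. 0 \<le> r \<and> r < n \<and> ?P r es}"
  using Q unfolding X_def by (intro card_mono) (auto simp: finite_LS)
 hence "real (card {es \<in> LS m (nat k * (4 * nat K)). Q es}) \<le> real (card {es \<in> LS m (nat k * (4 * nat K)). \<exists>r. 0 \<le> r \<and> r < n \<and> ?P r es})"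
  by (simp only: of_nat_le_iff)
 also have "\<dots> \<le> real_of_int n * ((2 * real (nat k * (4 * nat K)) + 1) / 2 ^ nat K * real_of_int m ^ (nat k * (4 * nat K)))"
 proof (rule card_union_range)
  fix r assume r: "0 \<le> r" "r < n"
  interpret S: sampling m "dst d" "Ac r" "kl r" "nat K"
   by unfold_locales (use m1 tot K1 in auto)
  have E: "vol (1 - d) {x. Ac r x \<and> (\<forall>s\<in>set (onl (Ac r) (kl r) (nat K) (map (dst d) es)). \<not> kl r s x)} =
   card (S.surv (onl (Ac r) (kl r) (nat K) (map (dst d) es)))" for es
   unfolding vol_def S.surv_def by (simp add: src_flip)
  show "real (card {es \<in> LS m (nat k * (4 * nat K)). ?P r es}) \<le>
   (2 * real (nat k * (4 * nat K)) + 1) / 2 ^ nat K * real_of_int m ^ (nat k * (4 * nat K))"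
   unfolding E
  proof (rule S.bad_count[OF _ _ _ refl])
   show "1 \<le> nat k" using k by simp
   have "m = k * (m div k) + m mod k" by simp
   moreover have "m mod k \<le> k" using k by (simp add: less_imp_le)
   ultimately have "m \<le> k * (m div k + 1)" unfolding distrib_left mult_1_right by linarith
   hence "real_of_int m \<le> real_of_int (k * (m div k + 1))" by (simp only: of_int_le_iff)
   thus "real_of_int m \<le> real (nat k) * real X" using k dv by (simp add: X_def)
   show "int X \<le> 2 * m" using dv m1 by (simp add: X_def)
  qed
 qed (use m1 n2 in auto)
 finally show ?thesis .
qed

definition bad :: "int => int list => bool" where
 "bad k es \<longleftrightarrow> (let ys = map (dst 0) (take (nat k * (4 * nat K)) es) in
   \<not> (good1 (m div k + 1) ys \<and> good2 (m div (k * k) + 1) ys (map (dst 1) (drop (nat k * (4 * nat K)) es))))"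

text \<open>\<open>kl2_total\<close> holds for every \<open>ys\<close>, good or not. So the second
  stage can be bounded conditionally on an arbitrary first sample, and the two failure counts add
  up.\<close>

lemma bad_le:
 fixes k :: int
 assumes k: "1 \<le> k" and uv: "u = nat k * (4 * nat K)" "v = nat (k * k) * (4 * nat K)"
 shows "real (card {es \<in> LS m (u + v). bad k es}) \<le> real_of_int n * (2 * (2 * real (u + v) + 1) / 2 ^ nat K) * real_of_int m ^ (u + v)"
proof -
 define p where "p = (2 * real (u + v) + 1) / 2 ^ nat K"
 have kk: "1 \<le> k * k" using mult_mono[of 1 k 1 k] k by simp
 have pa: "(2 * real u + 1) / 2 ^ nat K \<le> p" "(2 * real v + 1) / 2 ^ nat K \<le> p" unfolding p_def by (intro divide_right_mono; simp)+
 have mp: "0 \<le> real_of_int m ^ x" for x using m1 by simp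
 have n0: "0 \<le> real_of_int n" using n2 by simp
 have "{es \<in> LS m (u + v). bad k es} \<subseteq>
  {es \<in> LS m (u + v). (\<lambda>xs _. \<not> good1 (m div k + 1) (map (dst 0) xs)) (take u es) (drop u es)} \<union>
  {es \<in> LS m (u + v). (\<lambda>xs ys. \<not> good2 (m div (k * k) + 1) (map (dst 0) xs) (map (dst 1) ys)) (take u es) (drop u es)}"
  (is "?B \<subseteq> ?B1 \<union> ?B2") by (auto simp: bad_def Let_def uv(1))
 hence "card ?B \<le> card (?B1 \<union> ?B2)" by (intro card_mono) (auto simp: finite_LS)
 also have "\<dots> \<le> card ?B1 + card ?B2" by (rule card_Un_le)
 finally have 0: "real (card ?B) \<le> real (card ?B1) + real (card ?B2)" by linarith
 have c: "real (card (LS m x)) = real_of_int m ^ x" for x by (rule card_LS) (use m1 in simp)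
 have 1: "real (card ?B1) \<le> (\<Sum>xs\<in>LS m u. if good1 (m div k + 1) (map (dst 0) xs) then 0 else real_of_int m ^ v)"
  by (rule card_LS_add) (auto simp: c)
 have "\<dots> = real (card {xs \<in> LS m u. \<not> good1 (m div k + 1) (map (dst 0) xs)}) * real_of_int m ^ v"
  by (simp add: sum.If_cases finite_LS Int_def conj_commute)
 also have "\<dots> \<le> (real_of_int n * ((2 * real u + 1) / 2 ^ nat K * real_of_int m ^ u)) * real_of_int m ^ v"
  unfolding uv(1)
  by (intro mult_right_mono mp bad_stage[where d = 0 and Ac = A1 and kl = kl1] k kl1_total) (auto simp: good1_def L1_def not_less)
 also have "\<dots> \<le> (real_of_int n * (p * real_of_int m ^ u)) * real_of_int m ^ v"
  by (intro mult_right_mono mult_left_mono pa mp n0)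
 finally have 2: "real (card ?B1) \<le> real_of_int n * p * real_of_int m ^ (u + v)" using 1 by (simp add: power_add mult_ac)
 have "real (card ?B2) \<le> (\<Sum>xs\<in>LS m u. real_of_int n * ((2 * real v + 1) / 2 ^ nat K * real_of_int m ^ v))"
  
  by (rule card_LS_add, unfold uv(2), rule bad_stage[where d = 1, OF kk kl2_total]) (auto simp: good2_def L2_def not_less)
 also have "\<dots> = real_of_int m ^ u * (real_of_int n * ((2 * real v + 1) / 2 ^ nat K * real_of_int m ^ v))" by (simp add: c)
 also have "\<dots> \<le> real_of_int m ^ u * (real_of_int n * (p * real_of_int m ^ v))"
  by (intro mult_right_mono mult_left_mono pa mp n0)
 finally have 3: "real (card ?B2) \<le> real_of_int n * p * real_of_int m ^ (u + v)" by (simp add: power_add mult_ac)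
 have "real_of_int n * (2 * (2 * real (u + v) + 1) / 2 ^ nat K) * real_of_int m ^ (u + v) = 2 * (real_of_int n * p * real_of_int m ^ (u + v))"
  by (simp add: p_def)
 thus ?thesis using 0 2 3 by linarith
qed

end

section \<open>Correctness of the whole run\<close>

context wgraph begin

definition closed_len :: "int => bool" where
 "closed_len t \<longleftrightarrow> 0 < t \<and> (\<exists>r. wk 0 {} r r t)"

text \<open>A negative output asserts only that closed walks have length at least
  \<open>b / 4\<close>. With \<open>b = BIG\<close> this rules out cycles, but that step uses simple
  cycles of the graph and is left to \<open>correct_out_approximates\<close>.\<close>

definition correct_out :: "int => int => bool" where
 "correct_out b x \<longleftrightarrow> (x < 0 \<and> (\<forall>t. closed_len t --> b \<le> 4 * t)) \<or> (closed_len x \<and> (\<forall>t. closed_len t --> x \<le> 4 * t))"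

end

context prog begin

lemma cw_closed_len: "cw t ==> closed_len t"
 unfolding cw_def closed_len_def using wk_rev[of 1 "{}"] by force

text \<open>For a fixed list of draws the rest of the run is deterministic: either the list is bad
  or the output is right, with no probability involved.\<close>

lemma wp_tail:
 fixes k :: int
 defines "N1 \<equiv> k * (4 * K)" and "NR \<equiv> k * (4 * K) + k * k * (4 * K)"
 assumes cst0: "cst s0" and bnd0: "bnd M s0" and regs: "s0 rN1 0 = N1" "s0 rNR 0 = NR" "s0 rKK 0 = k" "s0 rJ 0 = 0"
  and k: "1 \<le> k" and NRM: "NR + m + 2 \<le> M" and es: "es \<in> LS m (nat NR)"
  and zero: "\<And>i. 0 \<le> i ==> s0 rT i = 0" "\<And>i. 0 \<le> i ==> s0 rSEG i = 0" "\<And>i. 0 \<le> i ==> s0 rMK i = 0" "s0 rLC = (\<lambda>_. 0)"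
 shows "wp M (fill;; main) (\<lambda>s' kk. (bad k es \<or> correct_out BIG (s' 63 (- 1))) \<and> kk \<le> 40 * nat m + 20 + main_cost k N1 NR) (fl es s0)"
proof -
 have N: "0 \<le> N1" "N1 \<le> NR" using k K1 by (auto simp: N1_def NR_def)
 have len: "int (length es) = NR" "\<And>e. e \<in> set es ==> 0 \<le> e \<and> e < m" using es N by (auto simp: LS_def)
 define s1 where "s1 = fl es s0"
 have ag1: "agree {rSQ, rJ} s0 s1" unfolding s1_def by (rule fl_agree)
 have SQ1: "s1 rSQ p = es ! nat p" if "0 \<le> p" "p < NR" for p using that fl_SQ[of es s0 p] regs len by (simp add: s1_def)
 have b1: "bnd M s1" unfolding s1_def
 proof (rule bnd_fl[OF bnd0])
  show "\<forall>e\<in>set es. \<bar>e\<bar> \<le> M" using len(2) mM by fastforce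
 qed (use regs len NRM m1 in auto)
 have w1: "wp M fill (\<lambda>s' k. (agree {rI, rSQ} s1 s' \<and> (\<forall>p. s' rSQ p = (if NR \<le> p \<and> p < NR + m then p - NR else s1 rSQ p)) \<and> bnd M s') \<and> k \<le> 40 * nat m + 20) s1"
  by (rule wp_fill[OF b1]) (use ag1 cst0 regs m1 mM in \<open>auto simp: agree_def cst_def\<close>)
 show ?thesis unfolding s1_def[symmetric]
 proof (rule wp_chainQ[OF w1])
  fix s2 and k1 :: nat
  assume A: "agree {rI, rSQ} s1 s2 \<and> (\<forall>p. s2 rSQ p = (if NR \<le> p \<and> p < NR + m then p - NR else s1 rSQ p)) \<and> bnd M s2" and k1: "k1 \<le> 40 * nat m + 20"
  have o: "s2 r = s0 r" if "r \<notin> {rI, rSQ, rJ}" for r using A ag1 that by (auto simp: agree_def)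
  have SQ2: "s2 rSQ p = (if NR \<le> p \<and> p < NR + m then p - NR else s1 rSQ p)" for p using A by blast
  have SQ2': "s2 rSQ p = es ! nat p" if "0 \<le> p" "p < NR" for p using SQ2[of p] SQ1[OF that] that by simp
  have ran: "0 \<le> es ! nat p \<and> es ! nat p < m" if "0 \<le> p" "p < NR" for p
   by (rule len(2)) (use that len(1) in \<open>auto intro!: nth_mem\<close>)
  show "wp M main (\<lambda>s' kk. (bad k es \<or> correct_out BIG (s' 63 (- 1))) \<and> k1 + kk \<le> 40 * nat m + 20 + main_cost k N1 NR) s2"
  proof (rule wp_main[where k = k and ?N1.0 = N1 and NR = NR])
   show "cst s2" using cst0 o by (simp add: cst_def)
   show "bnd M s2" using A by blast
   show "0 \<le> s2 rSQ p \<and> s2 rSQ p < m" if "0 \<le> p" "p < NR + m" for p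
    using SQ2[of p] SQ2'[of p] ran[of p] that by (cases "p < NR") auto
   show "s2 rSQ (NR + e) = e" if "0 \<le> e" "e < m" for e using SQ2 that by simp
   show "s2 rLC = (\<lambda>_. 0)" using zero(4) o by simp
  next
   fix s s' kk
   assume out: "outcome n m W tlv hdv wt K BIG BC M b s N1 NR (m div k + 1) (m div (k * k) + 1)"
    and best: "s rBEST 0 = BIG \<or> cw (s rBEST 0)" and sq: "s rSQ = s2 rSQ"
    and res: "s' 63 (- 1) = (if s rBEST 0 < BIG then s rBEST 0 else - 1)" and kk: "kk \<le> main_cost k N1 NR"
   interpret O: outcome n m W tlv hdv wt K BIG BC M b s N1 NR "m div k + 1" "m div (k * k) + 1" by (rule out)
   have n1: "nat k * (4 * nat K) = nat N1" using k K1 by (simp add: N1_def nat_mult_distrib)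
   have ys: "O.ys = map (dst 0) (take (nat N1) es)"
    unfolding O.ys_def
   proof (rule nth_equalityI)
    show "length (map (root s 0) [0..N1 - 1]) = length (map (dst 0) (take (nat N1) es))" using len(1) N by simp
    fix i assume "i < length (map (root s 0) [0..N1 - 1])"
    hence i: "i < nat N1" by simp
    have "root s 0 (int i) = dst 0 (es ! i)" using SQ2'[of "int i"] i N by (simp add: root_def sq)
    thus "map (root s 0) [0..N1 - 1] ! i = map (dst 0) (take (nat N1) es) ! i" using i len(1) N by (simp add: nth_upto)
   qed
   have zs: "O.zs = map (dst 1) (drop (nat N1) es)"
    unfolding O.zs_def
   proof (rule nth_equalityI)
    show "length (map (root s 1) [N1..NR - 1]) = length (map (dst 1) (drop (nat N1) es))" using len(1) N by simp
    fix i assume "i < length (map (root s 1) [N1..NR - 1])"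
    hence i: "i < nat (NR - N1)" by simp
    have "nat (N1 + int i) = nat N1 + i" using N by simp
    hence "root s 1 (N1 + int i) = dst 1 (es ! (nat N1 + i))" using SQ2'[of "N1 + int i"] i N by (simp add: root_def sq)
    thus "map (root s 1) [N1..NR - 1] ! i = map (dst 1) (drop (nat N1) es) ! i" using i len(1) N by (simp add: nth_upto)
   qed
   have "correct_out BIG (s' 63 (- 1))" if "\<not> bad k es"
   proof -
    have g: "good1 (m div k + 1) O.ys" "good2 (m div (k * k) + 1) O.ys O.zs"
     using that unfolding bad_def Let_def n1 ys zs by auto
    have ap: "s rBEST 0 \<le> 4 * t" if "closed_len t" for t
     using that O.four_approx[OF g] unfolding closed_len_def by blast
    show ?thesis
    proof (cases "s rBEST 0 < BIG")
     case True
     thus ?thesis using best ap cw_closed_len res unfolding correct_out_def by auto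
    next
     case False
     hence "s rBEST 0 = BIG" using O.G12 by linarith
     thus ?thesis using ap res unfolding correct_out_def by simp
    qed
   qed
   thus "(bad k es \<or> correct_out BIG (s' 63 (- 1))) \<and> k1 + kk \<le> 40 * nat m + 20 + main_cost k N1 NR" using k1 kk by auto
  qed (use regs k N NRM zero o in auto)
 qed
qed

lemma run_tail:
 fixes k :: int and t0 :: nat and B :: real and s0 :: st
 defines "N1 \<equiv> k * (4 * K)" and "NR \<equiv> k * (4 * K) + k * k * (4 * K)"
 assumes MB: "64 \<le> M" "real_of_int (M ^ 40) \<le> B"
  and cst0: "cst s0" and bnd0: "bnd M s0" and regs: "s0 rN1 0 = N1" "s0 rNR 0 = NR" "s0 rKK 0 = k" "s0 rJ 0 = 0"
  and k: "1 \<le> k" and NRM: "NR + m + 2 \<le> M"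
  and zero: "\<And>i. 0 \<le> i ==> s0 rT i = 0" "\<And>i. 0 \<le> i ==> s0 rSEG i = 0" "\<And>i. 0 \<le> i ==> s0 rMK i = 0" "s0 rLC = (\<lambda>_. 0)"
 defines "R \<equiv> run B (Seq draw (co (fill;; main))) (enc s0, t0)"
 shows "lossless_spmf R"
  "\<And>s t. (s, t) \<in> set_spmf R ==> t \<le> t0 + 21 * nat NR + 40 * nat m + 26 + main_cost k N1 NR"
  "1 - real_of_int n * (2 * (2 * real (nat NR) + 1) / 2 ^ nat K) \<le> measure (measure_spmf R) {(s, t). correct_out BIG (s 0)}"
proof -
 define S where "S = LS m (nat NR)"
 have N: "0 \<le> NR" using k K1 by (simp add: NR_def)
 have S: "finite S" "real (card S) = real_of_int m ^ nat NR" unfolding S_def using finite_LS card_LS m1 by auto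
 have mp: "0 < real_of_int m ^ nat NR" using m1 by simp
 have cS: "real (card S) \<noteq> 0" using S(2) mp by linarith
 hence ne: "S \<noteq> {}" by auto
 have rm: "s0 rM 0 = m" using cst0 by (simp add: cst_def)
 have mM': "m \<le> M" "NR \<le> M" using mM NRM m1 N by auto
 have d: "run B draw (enc s0, t0) = map_spmf (\<lambda>es. (enc (fl es s0), t0 + 21 * nat NR + 6)) (spmf_of_set S)"
  unfolding S_def by (rule run_draw[OF MB m1 mM'(1) bnd0]) (use regs N rm mM' in auto)
 have "\<forall>es\<in>S. \<exists>s' kk. bs M (fill;; main) (fl es s0) s' kk \<and> (bad k es \<or> correct_out BIG (s' 63 (- 1))) \<and> kk \<le> 40 * nat m + 20 + main_cost k N1 NR"
 proof
  fix es assume "es \<in> S"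
  hence es: "es \<in> LS m (nat (k * (4 * K) + k * k * (4 * K)))" by (simp add: S_def NR_def)
  show "\<exists>s' kk. bs M (fill;; main) (fl es s0) s' kk \<and> (bad k es \<or> correct_out BIG (s' 63 (- 1))) \<and> kk \<le> 40 * nat m + 20 + main_cost k N1 NR"
   using wp_tail[OF cst0 bnd0 regs[unfolded N1_def NR_def] k NRM[unfolded NR_def] es zero] unfolding wp_def N1_def NR_def .
 qed
 \<comment> \<open>Choosing a final state and a time for each sample turns the whole run into the
   image of one uniform distribution, so probabilities are quotients of cardinalities.\<close>
 then obtain f g where fg: "\<And>es. es \<in> S ==> bs M (fill;; main) (fl es s0) (f es) (g es)"
  "\<And>es. es \<in> S ==> bad k es \<or> correct_out BIG (f es 63 (- 1))" "\<And>es. es \<in> S ==> g es \<le> 40 * nat m + 20 + main_cost k N1 NR"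
  by metis
 have R: "R = map_spmf (\<lambda>es. (enc (f es), t0 + 21 * nat NR + 6 + g es)) (spmf_of_set S)"
 proof -
  have "R = bind_spmf (spmf_of_set S) (\<lambda>es. run B (co (fill;; main)) (enc (fl es s0), t0 + 21 * nat NR + 6))"
   unfolding R_def run_Seq d by (simp add: map_spmf_conv_bind_spmf del: co.simps)
  also have "\<dots> = bind_spmf (spmf_of_set S) (\<lambda>es. return_spmf (enc (f es), t0 + 21 * nat NR + 6 + g es))"
  proof (rule bind_spmf_cong[OF refl])
   fix es assume "es \<in> set_spmf (spmf_of_set S)"
   hence es: "es \<in> S" using S(1) by (simp add: set_spmf_of_set)
   have "bnd M (fl es s0)"
   proof (rule bnd_fl[OF bnd0])
    show "\<forall>e\<in>set es. \<bar>e\<bar> \<le> M" using es mM by (fastforce simp: S_def LS_def)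
   qed (use regs es mM' N in \<open>auto simp: S_def LS_def\<close>)
   from bs_run[OF fg(1)[OF es] MB this ok_program(2)[OF MB(1), of 0]] MB(1)
   show "run B (co (fill;; main)) (enc (fl es s0), t0 + 21 * nat NR + 6) = return_spmf (enc (f es), t0 + 21 * nat NR + 6 + g es)" by simp
  qed
  finally show ?thesis by (simp add: map_spmf_conv_bind_spmf)
 qed
 show "lossless_spmf R" unfolding R using S(1) ne by simp
 show "t \<le> t0 + 21 * nat NR + 40 * nat m + 26 + main_cost k N1 NR" if "(s, t) \<in> set_spmf R" for s t
  using that fg(3) S(1) unfolding R by (auto simp: set_spmf_of_set) (fastforce)
 \<comment> \<open>\<open>addr 63 (- 1) = - 1 - 63 + 64 = 0\<close>, the output cell.\<close>
 have e0: "enc s 0 = s 63 (- 1)" for s by (simp add: enc_def reg_of_def idx_of_def)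
 define A where "A = (\<lambda>es. (enc (f es), t0 + 21 * nat NR + 6 + g es)) -` {(s, t). correct_out BIG (s 0)}"
 have "S - {es \<in> S. bad k es} \<subseteq> S \<inter> A" using fg(2) by (auto simp: A_def e0)
 hence "card (S - {es \<in> S. bad k es}) \<le> card (S \<inter> A)" by (intro card_mono) (auto simp: S)
 moreover have "card (S - {es \<in> S. bad k es}) = card S - card {es \<in> S. bad k es}" by (rule card_Diff_subset) (auto simp: S)
 ultimately have c: "real (card S) - real (card {es \<in> S. bad k es}) \<le> real (card (S \<inter> A))" by linarith
 have NRe: "nat NR = nat k * (4 * nat K) + nat (k * k) * (4 * nat K)"
  using k K1 by (simp add: NR_def nat_add_distrib nat_mult_distrib)
 have bl: "real (card {es \<in> S. bad k es}) \<le> real_of_int n * (2 * (2 * real (nat NR) + 1) / 2 ^ nat K) * real (card S)"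
  unfolding S(2) unfolding S_def NRe by (rule bad_le[OF k refl refl])
 have "measure (measure_spmf R) {(s, t). correct_out BIG (s 0)} = real (card (S \<inter> A)) / real (card S)"
  unfolding R measure_map_spmf A_def[symmetric] by (simp add: measure_spmf_of_set)
 also have "\<dots> \<ge> (real (card S) - real_of_int n * (2 * (2 * real (nat NR) + 1) / 2 ^ nat K) * real (card S)) / real (card S)"
  by (intro divide_right_mono) (use c bl in linarith)+
 also have "(real (card S) - real_of_int n * (2 * (2 * real (nat NR) + 1) / 2 ^ nat K) * real (card S)) / real (card S) =
   1 - real_of_int n * (2 * (2 * real (nat NR) + 1) / 2 ^ nat K)" using cS by (simp add: diff_divide_distrib)
 finally show "1 - real_of_int n * (2 * (2 * real (nat NR) + 1) / 2 ^ nat K) \<le> measure (measure_spmf R) {(s, t). correct_out BIG (s 0)}" .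
qed

end

text \<open>\<open>stage_cost\<close> without locale parameters, for the arithmetic at the
  end.\<close>

definition scost :: "nat => nat => int => nat" where
 "scost K b X = (900 * K + 200 * b + 1700) * (nat X + 3) + (800 * K + 600) * (nat X + 1) + 200"

definition total_cost :: "int => int => int => nat => int => nat" where
 "total_cost n m c l k =
  (let K = c * int l; N1 = k * (4 * K); NR = k * (4 * K) + k * k * (4 * K); cs = scost (nat K) l in
   20 + (240 * nat m + 30 * l + 60 * nat k + 400) + 21 * nat NR + 40 * nat m + 26 + 100 * nat (NR + m) +
   cs (m + 1) * min (nat N1) (nat n) + cs (m div k + 1) * min (nat (NR - N1)) (nat n) + cs (m div (k * k) + 1) * min (nat m) (nat n) + 300)"

context wgraph begin

lemma run_program:
 fixes c M :: int and B :: real and mem :: memory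
 assumes MB: "64 \<le> M" "real_of_int (M ^ 40) \<le> B" and c: "1 \<le> c" "c \<le> M"
  and M: "W \<le> M" "m + 2 \<le> M" "4 * n \<le> M" "((m + 2) * W + 2) * n \<le> M" "8 * ((m + 2) * W) + 2 \<le> M"
   "\<And>l. 1 \<le> l ==> 2 ^ l < 4 * n ==> 2 * (n * n) * (4 * (c * int l)) + m + 2 \<le> M"
  and mem: "mem 0 = n" "mem 1 = m" "\<And>e. 0 \<le> e ==> e < m ==> mem (2 + 3 * e) = tlv e \<and> mem (3 + 3 * e) = hdv e \<and> mem (4 + 3 * e) = wt e"
   "\<And>a. a < 0 \<or> 3 * m + 2 \<le> a ==> mem a = 0" "\<And>a. \<bar>mem a\<bar> \<le> M"
 obtains l k W' where "2 * n \<le> 2 ^ l" "2 ^ l < 4 * n" "1 \<le> l" "1 \<le> k" "k \<le> n" "(k - 1) * (k - 1) * (k - 1) < min n m" "min n m \<le> k * k * k"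
  "\<forall>e. 0 \<le> e \<and> e < m --> wt e \<le> W'"
  "lossless_spmf (run B (program c) (mem, 0))"
  "\<forall>s t. (s, t) \<in> set_spmf (run B (program c) (mem, 0)) --> t \<le> total_cost n m c l k"
  "1 - real_of_int n * (2 * (2 * real (nat (k * (4 * (c * int l)) + k * k * (4 * (c * int l)))) + 1) / 2 ^ nat (c * int l))
   \<le> measure (measure_spmf (run B (program c) (mem, 0))) {(s, t). correct_out (4 * ((m + 2) * W') + 1) (s 0)}"
proof -
 define s0 where "s0 = dec mem"
 have e0: "enc s0 a = mem a" for a by (simp add: s0_def)
 have b0: "bnd M s0" using mem(5) by (simp add: bnd_def s0_def dec_def)
 define s1 where "s1 = upd (upd s0 rN 0 n) rM 0 m"
 have nm: "\<bar>n\<bar> \<le> M" "\<bar>m\<bar> \<le> M" using M n2 m1 by auto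
 have b1: "bnd M s1" unfolding s1_def using b0 nm by (intro bnd_upd)
 have "wp M (rN ::= I (N 0);; rM ::= I (N 1)) (\<lambda>s' k. s' = s1 \<and> k = 8) s0"
  using nm by (simp add: enc_upd_nonneg e0 mem s1_def)
 hence bs1: "bs M (rN ::= I (N 0);; rM ::= I (N 1)) s0 s1 8" unfolding wp_def by blast
 have r1: "run B (co (rN ::= I (N 0);; rM ::= I (N 1))) (mem, 0) = return_spmf (enc s1, 8)"
  using bs_run[OF bs1 MB b0 ok_program(3)[OF MB(1), of 0]] MB(1) by (simp add: s0_def del: co.simps)
 have i1: "inputs s1" unfolding inputs_def using mem(3) by (simp add: s1_def enc_upd_nonneg e0)
 have z0: "s1 r x = 0" if "4 \<le> r" "0 \<le> x" for r x
 proof -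
  have "s1 r x = mem (addr r x)" using that by (simp add: s1_def s0_def dec_def)
  also have "\<dots> = 0" using that by (intro mem(4)) (simp add: addr_def)
  finally show ?thesis .
 qed
 have z1: "s1 rLC x = 0" if "x < - m - 1" for x
 proof -
  have "s1 rLC x = mem (addr rLC x)" by (simp add: s1_def s0_def dec_def)
  also have "\<dots> = 0" using that m1 by (intro mem(4)) (simp add: addr_def)
  finally show ?thesis .
 qed
 have M6: "2 * (n * n) * (4 * (c * int l)) \<le> M" if "1 \<le> l" "2 ^ l < 4 * n" for l using M(6)[OF that] m1 by linarith
 have "wp M (prepare c) (\<lambda>s' kk. \<exists>l k W'. (2 * n \<le> 2 ^ l \<and> 2 ^ l < 4 * n \<and> 1 \<le> l \<and> 1 \<le> k \<and> k \<le> n \<and>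
    min n m \<le> k * k * k \<and> (k - 1) * (k - 1) * (k - 1) < min n m \<and> W' \<le> W \<and> (\<forall>e. 0 \<le> e \<and> e < m --> wt e \<le> W') \<and>
    s' rN 0 = n \<and> s' rM 0 = m \<and> s' rKK 0 = k \<and> s' rK 0 = c * int l \<and> s' rBIG 0 = 4 * ((m + 2) * W') + 1 \<and>
    s' rBC 0 = ((m + 2) * W' + 2) * n \<and> s' rN1 0 = k * (4 * (c * int l)) \<and>
    s' rNR 0 = k * (4 * (c * int l)) + k * k * (4 * (c * int l)) \<and> s' rJ 0 = 0 \<and>
    edges_read m s' \<and> s' rLC = (\<lambda>_. 0) \<and> (\<forall>r x. 44 \<le> r \<and> 0 \<le> x --> s' r x = 0) \<and> bnd M s' \<and> kk \<le> prep_cost l k)) s1"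
  by (rule wp_prepare[OF i1 b1 z0 z1 c(1) M(1-5) M6]) (assumption | intro exI conjI | assumption)+
 then obtain s2 kk l k W' where bs2: "bs M (prepare c) s1 s2 kk" and
  p: "2 * n \<le> 2 ^ l" "2 ^ l < 4 * n" "1 \<le> l" "1 \<le> k" "k \<le> n" "min n m \<le> k * k * k" "(k - 1) * (k - 1) * (k - 1) < min n m"
   "W' \<le> W" "\<forall>e. 0 \<le> e \<and> e < m --> wt e \<le> W'"
  and r: "s2 rN 0 = n" "s2 rM 0 = m" "s2 rKK 0 = k" "s2 rK 0 = c * int l" "s2 rBIG 0 = 4 * ((m + 2) * W') + 1"
    "s2 rBC 0 = ((m + 2) * W' + 2) * n" "s2 rN1 0 = k * (4 * (c * int l))"
    "s2 rNR 0 = k * (4 * (c * int l)) + k * k * (4 * (c * int l))" "s2 rJ 0 = 0"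
  and er: "edges_read m s2" and LC: "s2 rLC = (\<lambda>_. 0)" and z2: "\<forall>r x. 44 \<le> r \<and> 0 \<le> x --> s2 r x = 0" and b2: "bnd M s2" and kk: "kk \<le> prep_cost l k"
  unfolding wp_def by (elim exE conjE)
 define K where "K = c * int l"
 have K: "1 * 1 \<le> K" unfolding K_def using c p(3) by (intro mult_mono) auto
 have nn: "2 * 2 \<le> n * n" using n2 by (intro mult_mono) auto
 have M6': "2 * (n * n) * (4 * K) + m + 2 \<le> M" using M(6)[OF p(3,2)] by (simp add: K_def)
 have big: "4 * (4 * K) \<le> n * n * (4 * K)" using nn K by (intro mult_right_mono) auto
 have kkn: "k * k \<le> n * n" "k \<le> k * k" using mult_mono[of k n k n] mult_mono[of 1 k k k] p by auto
 have q: "k * (4 * K) \<le> n * n * (4 * K)" "k * k * (4 * K) \<le> n * n * (4 * K)" using kkn K by (auto intro!: mult_right_mono)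
 have d: "2 * (n * n) * (4 * K) = n * n * (4 * K) + n * n * (4 * K)" by simp
 have NRM: "k * (4 * K) + k * k * (4 * K) + m + 2 \<le> M" using q M6' unfolding d by linarith
 have K2: "K + 1 \<le> M" using big M6' K m1 unfolding d by linarith
 have W': "1 \<le> W'" using wt[of 0] p(9) m1 by force
 have mW: "0 \<le> (m + 2) * W'" "(m + 2) * W' \<le> (m + 2) * W" using W' p(8) m1 by (auto intro: mult_left_mono)
 have BCM: "((m + 2) * W' + 2) * n \<le> M"
 proof -
  have "((m + 2) * W' + 2) * n \<le> ((m + 2) * W + 2) * n" by (rule mult_right_mono) (use mW n2 in auto)
  thus ?thesis using M(4) by (rule order_trans)
 qed
 have BIGM: "2 * (4 * ((m + 2) * W') + 1) \<le> M" "(m + 2) * W' < 4 * ((m + 2) * W') + 1"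
 proof -
  define x where "x = (m + 2) * W'"
  define y where "y = (m + 2) * W"
  have "0 \<le> x" "x \<le> y" "8 * y + 2 \<le> M" using mW M(5) by (simp_all only: x_def y_def)
  hence "2 * (4 * x + 1) \<le> M \<and> x < 4 * x + 1" by simp
  thus "2 * (4 * ((m + 2) * W') + 1) \<le> M" "(m + 2) * W' < 4 * ((m + 2) * W') + 1" by (simp_all only: x_def)
 qed
 interpret P: prog n m W' tlv hdv wt K "4 * ((m + 2) * W') + 1" "((m + 2) * W' + 2) * n" M l
 proof unfold_locales
  show "1 \<le> wt e \<and> wt e \<le> W'" if "0 \<le> e" "e < m" for e using wt[OF that] p(9) that by blast
  show "((m + 2) * W' + 2) * n \<le> ((m + 2) * W' + 2) * n" by simp
  show "2 * n \<le> M" using M(3) n2 by linarith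
  show "1 \<le> K" using K by simp
 qed (fact K2 BCM BIGM p(1) M(2) n2 m1 tlv hdv)+
 have cst: "P.cst s2" unfolding P.cst_def using er r by (simp add: edges_read_def K_def)
 have s263: "s2 x i = 0" if "44 \<le> x" "0 \<le> i" for x i using z2 that by blast
 define R where "R = run B (program c) (mem, 0)"
 have okc: "\<bar>c\<bar> \<le> M" using c by simp
 have vM: "eval_expr B (enc s1) (comp (V rM)) = Some m"
  using ok_ex_eval(1)[OF MB(1) b1 _ MB(2), of "V rM"] by (simp add: ok_ex_def s1_def)
 have r2: "run B (co (prepare c)) (enc s1, t) = return_spmf (enc s2, t + kk)" for t
  using bs_run[OF bs2 MB b1 ok_program(1)[OF MB(1) okc]] by blast
 have R: "R = run B (Seq draw (co (fill;; main))) (enc s2, 11 + kk)"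
  unfolding R_def program_def run_Seq r1 return_bind_spmf
  unfolding run.simps(5) split vM using m1 r2 by (simp add: run_Seq del: co.simps comp.simps run.simps)
 have T: "lossless_spmf R" "\<And>s t. (s, t) \<in> set_spmf R ==> t \<le> 11 + kk + 21 * nat (k * (4 * K) + k * k * (4 * K)) + 40 * nat m + 26 + P.main_cost k (k * (4 * K)) (k * (4 * K) + k * k * (4 * K))"
  "1 - real_of_int n * (2 * (2 * real (nat (k * (4 * K) + k * k * (4 * K))) + 1) / 2 ^ nat K) \<le> measure (measure_spmf R) {(s, t). P.correct_out (4 * ((m + 2) * W') + 1) (s 0)}"
  using P.run_tail[OF MB cst b2 r(7)[folded K_def] r(8)[folded K_def] r(3,9) p(4) NRM s263 s263 s263 LC, where ?t0.0 = "11 + kk"] unfolding R by auto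
 show ?thesis
 proof (rule that[OF p(1-5,7,6,9)])
  show "lossless_spmf (run B (program c) (mem, 0))" using T(1) by (simp add: R_def)
  show "\<forall>s t. (s, t) \<in> set_spmf (run B (program c) (mem, 0)) --> t \<le> total_cost n m c l k"
  proof (intro allI impI)
   fix s t assume "(s, t) \<in> set_spmf (run B (program c) (mem, 0))"
   hence "t \<le> 11 + kk + 21 * nat (k * (4 * K) + k * k * (4 * K)) + 40 * nat m + 26 + P.main_cost k (k * (4 * K)) (k * (4 * K) + k * k * (4 * K))"
    using T(2) by (simp add: R_def)
   thus "t \<le> total_cost n m c l k" using kk
    unfolding total_cost_def Let_def K_def[symmetric] P.main_cost_def P.stage_cost_def scost_def prep_cost_def by simp
  qed
  show "1 - real_of_int n * (2 * (2 * real (nat (k * (4 * (c * int l)) + k * k * (4 * (c * int l)))) + 1) / 2 ^ nat (c * int l))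
   \<le> measure (measure_spmf (run B (program c) (mem, 0))) {(s, t). correct_out (4 * ((m + 2) * W') + 1) (s 0)}"
   using T(3) unfolding R_def K_def .
 qed
qed

end

section \<open>Cycles and closed walks\<close>

text \<open>A repeated vertex cuts out a shorter closed walk, whose weight is no larger because
  weights are nonnegative. This is what allows the algorithm to work with closed walks instead of
  simple cycles.\<close>

lemma (in wf_digraph) closed_walk_cycle:
 fixes f :: "'b => real"
 assumes "awalk u p u" "p \<noteq> []" and f: "\<And>a. 0 \<le> f a"
 shows "\<exists>c. cycle c \<and> sum_list (map f c) \<le> sum_list (map f p)"
 using assms(1,2)
proof (induct "length p" arbitrary: u p rule: less_induct)
 case less
 show ?case
 proof (cases "distinct (tl (awalk_verts u p))")
  case True
  thus ?thesis using less.prems by (auto simp: cycle_def)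
 next
  case False
  obtain e es where p: "p = e # es" using less.prems by (cases p) auto
  with False less.prems have "awalk (head G e) es u" "\<not> distinct (awalk_verts (head G e) es)"
   by (auto simp: awalk_Cons_iff)
  then obtain q r s where es: "es = q @ r @ s" "closed_w r"
   using awalk_not_distinct_decomp by (metis closed_w_def)
  then obtain v where r: "awalk v r v" "r \<noteq> []" by (auto simp: closed_w_def)
  have "length r < length p" using p es by simp
  from less.hyps[OF this r] obtain c where "cycle c" "sum_list (map f c) \<le> sum_list (map f r)" by blast
  moreover have "sum_list (map f r) \<le> sum_list (map f p)"
  proof -
   have "0 \<le> sum_list (map f x)" for x using f by (intro sum_list_nonneg) auto
   from this[of q] this[of s] f[of e] show ?thesis by (simp add: p es)
  qed
  ultimately show ?thesis by force
 qed
qed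

locale graph_input =
 fixes n :: nat and G :: "nat pair_pre_digraph" and w :: "nat \<times> nat => nat" and es :: "(nat \<times> nat) list"
 assumes inp: "weighted_digraph_input n G w es" and ne: "es \<noteq> []"
begin

abbreviation "tlv e \<equiv> int (fst (es ! nat e))"
abbreviation "hdv e \<equiv> int (snd (es ! nat e))"
abbreviation "wt e \<equiv> int (w (es ! nat e))"

lemma parts: "pair_digraph G" "pverts G = {0..<n}" "\<And>a. a \<in> parcs G ==> 0 < w a" "distinct es" "set es = parcs G"
 using inp by (auto simp: weighted_digraph_input_def)

lemma arc: "a \<in> parcs G ==> fst a < n \<and> snd a < n \<and> fst a \<noteq> snd a"
proof -
 assume a: "a \<in> parcs G"
 interpret pair_digraph G by (rule parts)
 show ?thesis using arc_fst_in_verts[OF a] arc_snd_in_verts[OF a] pair_no_loops[OF a] parts(2) by simp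
qed

lemma weight_le: "a \<in> parcs G ==> w a \<le> max_weight G w"
proof -
 assume a: "a \<in> parcs G"
 have "finite (parcs G)" using parts(5) by (metis finite_set)
 thus ?thesis unfolding max_weight_def using a by (intro Max_ge) auto
qed

lemma nth_arc: "0 \<le> e ==> e < int (length es) ==> es ! nat e \<in> parcs G"
 using parts(5) by (metis nat_less_iff nth_mem)

sublocale wg: wgraph "int n" "int (length es)" "int (max_weight G w)" tlv hdv wt
proof
 have "es ! 0 \<in> parcs G" using ne parts(5) by (cases es) auto
 from arc[OF this] show "2 \<le> int n" by linarith
 show "1 \<le> int (length es)" using ne by (cases es) auto
next
 fix e assume e: "0 \<le> e" "e < int (length es)"
 note a = nth_arc[OF e]
 show "0 \<le> tlv e \<and> tlv e < int n" "0 \<le> hdv e \<and> hdv e < int n" "1 \<le> wt e \<and> wt e \<le> int (max_weight G w)"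
  using arc[OF a] weight_le[OF a] parts(3)[OF a] by auto
qed

interpretation pair_digraph G by (rule parts)

lemma cost_eq: "awalk_cost (\<lambda>a. real (w a)) p = sum_list (map (\<lambda>a. real (w a)) p)"
 by (rule awalk_cost_def)

lemma real_sum: "sum_list (map (\<lambda>a. real (w a)) p) = real_of_int (sum_list (map (\<lambda>a. int (w a)) p))"
 by (induction p) auto

lemma wk_awalk: "wg.wk 0 {} u v t ==> 0 \<le> u ==> u < int n ==> \<exists>p. awalk (nat u) p (nat v) \<and> t = sum_list (map (\<lambda>a. int (w a)) p)"
proof (induction rule: wg.wk.induct)
 case wk_refl
 thus ?case using parts(2) by (intro exI[of _ "[]"]) (auto simp: awalk_Nil_iff)
next
 case (wk_step v t e)
 then obtain p where p: "awalk (nat u) p (nat v)" "t = sum_list (map (\<lambda>a. int (w a)) p)" by blast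
 define a where "a = es ! nat e"
 have a: "a \<in> parcs G" "v = int (fst a)" "wg.dst 0 e = int (snd a)"
  using wk_step nth_arc by (auto simp: a_def wg.src_def wg.dst_def)
 have "snd a \<in> pverts G" using arc[OF a(1)] parts(2) by simp
 hence "awalk (nat v) [a] (nat (wg.dst 0 e))" using a by (simp add: awalk_Cons_iff awalk_Nil_iff)
 from awalk_appendI[OF p(1) this] show ?case by (intro exI[of _ "p @ [a]"]) (simp add: p(2) a_def)
qed

lemma awalk_wk: "awalk u p v ==> wg.wk 0 {} (int u) (int v) (sum_list (map (\<lambda>a. int (w a)) p))"
proof (induction p arbitrary: u)
 case Nil
 thus ?case by (simp add: awalk_Nil_iff wg.wk_refl)
next
 case (Cons a p)
 hence a: "a \<in> parcs G" "fst a = u" "awalk (snd a) p v" by (auto simp: awalk_Cons_iff)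
 then obtain i where i: "i < length es" "es ! i = a" using parts(5) by (metis in_set_conv_nth)
 have "wg.wk 0 {} (int u) (wg.dst 0 (int i)) (0 + wt (int i))"
  by (rule wg.wk_step[OF wg.wk_refl]) (use i a in \<open>auto simp: wg.src_def wg.dst_def\<close>)
 hence "wg.wk 0 {} (int u) (int (snd a)) (int (w a))" using i by (simp add: wg.dst_def)
 from wg.wk_trans[OF Cons.IH[OF a(3)] this] show ?case by simp
qed

lemma girth_le: "wg.closed_len t ==> girth G w \<le> ereal (real_of_int t)"
proof -
 assume "wg.closed_len t"
 then obtain r where r: "0 < t" "wg.wk 0 {} r r t" by (auto simp: wg.closed_len_def)
 have rr: "0 \<le> r" "r < int n"
 proof -
  obtain e where "0 \<le> e" "e < int (length es)" "wg.dst 0 e = r" using r(2,1) by (cases rule: wg.wk.cases) auto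
  thus "0 \<le> r" "r < int n" using wg.dst_range by blast+
 qed
 obtain p where p: "awalk (nat r) p (nat r)" "t = sum_list (map (\<lambda>a. int (w a)) p)" using wk_awalk[OF r(2) rr] by blast
 have "p \<noteq> []" using p(2) r(1) by auto
 then obtain c where c: "cycle c" "sum_list (map (\<lambda>a. real (w a)) c) \<le> sum_list (map (\<lambda>a. real (w a)) p)"
  using closed_walk_cycle[OF p(1), of "\<lambda>a. real (w a)"] by auto
 have "girth G w \<le> ereal (awalk_cost (\<lambda>a. real (w a)) c)" unfolding girth_def using c(1) by (intro INF_lower) simp
 also have "\<dots> \<le> ereal (real_of_int t)" using c(2) by (simp add: cost_eq p(2) real_sum[symmetric])
 finally show ?thesis .
qed

text \<open>The bound by the number of edges times \<open>W'\<close> holds because a simple cycle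
  repeats no edge. It is what \<open>BIG\<close> is compared with.\<close>

lemma cycle_closed_len:
 assumes "cycle p"
 obtains t where "wg.closed_len t" "awalk_cost (\<lambda>a. real (w a)) p = real_of_int t"
  "\<And>W'. \<forall>e. 0 \<le> e \<and> e < int (length es) --> wt e \<le> W' ==> t \<le> int (length es) * W'"
proof (rule that[of "sum_list (map (\<lambda>a. int (w a)) p)"])
 obtain u where u: "awalk u p u" "p \<noteq> []" "distinct p" using assms by (auto simp: cycle_conv)
 have sub: "set p \<subseteq> parcs G" using u(1) by (auto simp: awalk_def)
 have "0 < sum_list (map (\<lambda>a. int (w a)) p)"
 proof -
  obtain a q where p: "p = a # q" using u(2) by (cases p) auto
  have "0 < int (w a)" using parts(3) sub p by auto
  moreover have "0 \<le> sum_list (map (\<lambda>a. int (w a)) q)" by (rule sum_list_nonneg) auto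
  ultimately show ?thesis by (simp add: p)
 qed
 thus "wg.closed_len (sum_list (map (\<lambda>a. int (w a)) p))" using awalk_wk[OF u(1)] by (auto simp: wg.closed_len_def)
 show "awalk_cost (\<lambda>a. real (w a)) p = real_of_int (sum_list (map (\<lambda>a. int (w a)) p))" by (simp add: cost_eq real_sum)
 fix W' assume W: "\<forall>e. 0 \<le> e \<and> e < int (length es) --> wt e \<le> W'"
 have wa: "int (w a) \<le> W'" if "a \<in> set p" for a
 proof -
  have "a \<in> set es" using that sub parts(5) by blast
  then obtain i where "i < length es" "es ! i = a" by (metis in_set_conv_nth)
  thus ?thesis using W[rule_format, of "int i"] by simp
 qed
 have "sum_list (map (\<lambda>a. int (w a)) p) \<le> sum_list (map (\<lambda>a. W') p)" by (rule sum_list_mono) (use wa in simp)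
 also have "\<dots> = int (length p) * W'" by (simp add: sum_list_triv)
 also have "\<dots> \<le> int (length es) * W'"
 proof (rule mult_right_mono)
  have "length p = card (set p)" using u(3) by (simp add: distinct_card)
  also have "\<dots> \<le> card (set es)" using sub parts(5) by (intro card_mono) auto
  also have "\<dots> \<le> length es" by (rule card_length)
  finally show "int (length p) \<le> int (length es)" by simp
  show "0 \<le> W'" using wa[of "hd p"] u(2) by force
 qed
 finally show "sum_list (map (\<lambda>a. int (w a)) p) \<le> int (length es) * W'" .
qed

text \<open>With a negative output a cycle would satisfy
  \<open>4 * ((m + 2) * W') + 1 \<le> 4 * t \<le> 4 * (m * W')\<close>, where \<open>m\<close> is
  the number of edges, so there is none. A positive output is itself the length of a closed walk,
  hence at least the girth, and at most 4 times the weight of any cycle.\<close>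

lemma correct_out_approximates:
 fixes \<epsilon> :: real and s :: memory
 assumes W: "\<forall>e. 0 \<le> e \<and> e < int (length es) --> wt e \<le> W'" and out: "wg.correct_out (4 * ((int (length es) + 2) * W') + 1) (s 0)" and eps: "0 < \<epsilon>"
 shows "approximates (4 + \<epsilon>) (girth G w) (result_of s)"
 using out unfolding wg.correct_out_def
proof
 assume h: "s 0 < 0 \<and> (\<forall>t. wg.closed_len t --> 4 * ((int (length es) + 2) * W') + 1 \<le> 4 * t)"
 have "\<not> cycle p" for p
 proof
  assume "cycle p"
  from cycle_closed_len[OF this] obtain t where t: "wg.closed_len t" "t \<le> int (length es) * W'" using W by metis
  have "0 \<le> W'" using W[rule_format, of 0] wg.wt[of 0] wg.m1 by fastforce
  moreover have "4 * ((int (length es) + 2) * W') + 1 \<le> 4 * (int (length es) * W')" using h t by force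
  ultimately show False by (simp add: algebra_simps)
 qed
 hence "girth G w = \<infinity>" by (simp add: girth_def top_ereal_def)
 thus ?thesis using h eps by (simp add: approximates_def result_of_def)
next
 assume h: "wg.closed_len (s 0) \<and> (\<forall>t. wg.closed_len t --> s 0 \<le> 4 * t)"
 hence pos: "0 < s 0" by (simp add: wg.closed_len_def)
 have "ereal (real_of_int (s 0) / 4) \<le> girth G w" unfolding girth_def
 proof (rule INF_greatest)
  fix p assume "p \<in> {p. cycle p}"
  hence "cycle p" by simp
  from cycle_closed_len[OF this] obtain t where t: "wg.closed_len t" "awalk_cost (\<lambda>a. real (w a)) p = real_of_int t" by metis
  have "s 0 \<le> 4 * t" using h t(1) by blast
  hence "real_of_int (s 0) \<le> real_of_int (4 * t)" by (simp only: of_int_le_iff)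
  thus "ereal (real_of_int (s 0) / 4) \<le> ereal (awalk_cost (\<lambda>a. real (w a)) p)" using t(2) by simp
 qed
 hence "ereal (4 + \<epsilon>) * ereal (real_of_int (s 0) / 4) \<le> ereal (4 + \<epsilon>) * girth G w"
  using eps by (intro ereal_mult_left_mono) auto
 moreover have "real_of_int (s 0) \<le> (4 + \<epsilon>) * (real_of_int (s 0) / 4)" using eps pos by (simp add: field_simps)
 ultimately have "ereal (real_of_int (s 0)) \<le> ereal (4 + \<epsilon>) * girth G w" by (metis ereal_less_eq(3) order_trans times_ereal.simps(1))
 thus ?thesis using pos h girth_le by (simp add: approximates_def result_of_def)
qed

end

section \<open>Running time and success probability\<close>

text \<open>By \<open>1 \<le> l \<le> K\<close> every summand is at most a multiple of
  \<open>K * (x + 3)\<close>; 4400 is 2800 + 1400 + 200.\<close>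

lemma scost_le: "1 \<le> l ==> l \<le> K ==> scost K l (int x) \<le> 4400 * K * (x + 3)"
proof -
 assume l: "1 \<le> l" "l \<le> K"
 have "(900 * K + 200 * l + 1700) * (x + 3) \<le> 2800 * K * (x + 3)" "(800 * K + 600) * (x + 1) \<le> 1400 * K * (x + 3)"
  by (rule mult_le_mono; use l in simp)+
 moreover have "200 * 1 * 1 \<le> 200 * K * (x + 3)" using l by (intro mult_mono) auto
 ultimately show ?thesis unfolding scost_def by (simp add: algebra_simps)
qed

text \<open>Each of the three stages contributes at most a multiple of \<open>(C * l) ^ 2 * m * k\<close>.\<close>

lemma total_cost_le:
 fixes n m C l k :: nat
 assumes C: "1 \<le> C" and l: "1 \<le> l" and m: "1 \<le> m" and k: "1 \<le> k" "k \<le> m" and km: "min n m \<le> k * k * k"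
 shows "total_cost (int n) (int m) (int C) l (int k) \<le> 201000 * ((C * l) * (C * l) * m * k)"
proof -
 define K where "K = C * l"
 define S where "S = K * K * m * k"
 have K: "1 \<le> K" "l \<le> K" unfolding K_def using mult_le_mono[OF C l] C by auto
 have cost: "scost K l (int m + 1) \<le> 22000 * (K * m)" "scost K l (int m div int k + 1) \<le> 4400 * (K * (m div k + 4))"
  "scost K l (int m div (int k * int k) + 1) \<le> 4400 * (K * (m div (k * k) + 4))"
 proof -
  have "scost K l (int (m + 1)) \<le> 4400 * K * (m + 1 + 3)" by (rule scost_le[OF l K(2)])
  also have "\<dots> \<le> 4400 * K * (5 * m)" using m by (intro mult_le_mono2) simp
  also have "int (m + 1) = int m + 1" by simp
  finally show "scost K l (int m + 1) \<le> 22000 * (K * m)" by simp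
  show "scost K l (int m div int k + 1) \<le> 4400 * (K * (m div k + 4))"
   using scost_le[OF l K(2), of "m div k + 1"] by (simp add: zdiv_int add.commute mult.assoc)
  show "scost K l (int m div (int k * int k) + 1) \<le> 4400 * (K * (m div (k * k) + 4))"
   using scost_le[OF l K(2), of "m div (k * k) + 1"] by (simp add: zdiv_int add.commute mult.assoc)
 qed
 have kk: "k * k \<le> m * k" using k by simp
 have mk: "m \<le> m * k" using k by simp
 have KK: "K \<le> K * K" using K by simp
 have K1: "x \<le> K * x" for x using K by simp
 have S1: "m * k \<le> S" "K * (m * k) \<le> S"
 proof -
  show "K * (m * k) \<le> S" unfolding S_def mult.assoc using K1 by simp
  thus "m * k \<le> S" using K1[of "m * k"] by (rule order_trans[rotated])
 qed
 have S2: "m \<le> S" "k \<le> S" "1 \<le> S" "l \<le> S"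
 proof -
  show "m \<le> S" using mk S1 by linarith
  show "k \<le> S" using k S1 mk m by (metis le_trans)
  show "1 \<le> S" using m \<open>m \<le> S\<close> by linarith
  have "K * 1 \<le> K * (m * k)" using m k by (intro mult_le_mono2) simp
  thus "l \<le> S" using K S1 by linarith
 qed
 define N1 where "N1 = k * (4 * K)"
 define N2 where "N2 = k * k * (4 * K)"
 have N: "N1 \<le> 4 * S" "N2 \<le> 4 * S"
 proof -
  have e: "m * k * (4 * K) = 4 * (K * (m * k))" by simp
  have "k * (4 * K) \<le> m * k * (4 * K)" using m by simp
  thus "N1 \<le> 4 * S" using S1(2) unfolding N1_def e by linarith
  have "k * k * (4 * K) \<le> m * k * (4 * K)" by (rule mult_le_mono1[OF kk])
  thus "N2 \<le> 4 * S" using S1(2) unfolding N2_def e by linarith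
 qed
 have t1: "scost K l (int m + 1) * min N1 n \<le> 88000 * S"
 proof -
  have "scost K l (int m + 1) * min N1 n \<le> 22000 * (K * m) * N1" by (intro mult_le_mono cost) simp
  also have "\<dots> = 88000 * S" by (simp add: N1_def S_def)
  finally show ?thesis .
 qed
 have t2: "scost K l (int m div int k + 1) * min N2 n \<le> 88000 * S"
 proof -
  have "scost K l (int m div int k + 1) * min N2 n \<le> 4400 * (K * (m div k + 4)) * N2" by (intro mult_le_mono cost) simp
  also have "\<dots> = 17600 * (K * K) * (m div k * k * k + 4 * (k * k))" by (simp add: N2_def algebra_simps)
  also have "\<dots> \<le> 17600 * (K * K) * (m * k + 4 * (m * k))"
  proof (intro mult_le_mono2 add_mono kk)
   show "m div k * k * k \<le> m * k" by (rule mult_le_mono1) simp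
  qed
  also have "\<dots> = 88000 * S" by (simp add: S_def)
  finally show ?thesis .
 qed
 have t3: "scost K l (int m div (int k * int k) + 1) * min m n \<le> 22000 * S"
 proof -
  have "scost K l (int m div (int k * int k) + 1) * min m n \<le> 4400 * (K * (m div (k * k) + 4)) * min m n" by (rule mult_le_mono1[OF cost(3)])
  also have "\<dots> = 4400 * K * (m div (k * k) * min m n + 4 * min m n)" by (simp add: algebra_simps)
  also have "\<dots> \<le> 4400 * K * (m * k + 4 * (m * k))"
  proof (intro mult_le_mono2 add_mono)
   \<comment> \<open>Here \<open>min n m \<le> k ^ 3\<close> enters: the number of searches times
     \<open>m / k ^ 2\<close> becomes \<open>m * k\<close>.\<close>
   have "m div (k * k) * min m n \<le> m div (k * k) * (k * k * k)" using km by (intro mult_le_mono2) (simp add: min.commute)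
   also have "\<dots> = m div (k * k) * (k * k) * k" by (simp add: mult_ac)
   also have "\<dots> \<le> m * k" by (rule mult_le_mono1) simp
   finally show "m div (k * k) * min m n \<le> m * k" .
   show "min m n \<le> m * k" using mk by linarith
  qed
  also have "\<dots> = 22000 * (K * (m * k))" by simp
  also have "\<dots> \<le> 22000 * S" using S1(2) by simp
  finally show ?thesis .
 qed
 have e: "int C * int l = int K" "int k * (4 * int K) = int N1" "int k * int k * (4 * int K) = int N2" by (simp_all add: K_def N1_def N2_def)
 have "total_cost (int n) (int m) (int C) l (int k) = 20 + (240 * m + 30 * l + 60 * k + 400) + 21 * (N1 + N2) + 40 * m + 26 + 100 * (N1 + N2 + m) +
   scost K l (int m + 1) * min N1 n + scost K l (int m div int k + 1) * min N2 n + scost K l (int m div (int k * int k) + 1) * min m n + 300"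
  unfolding total_cost_def Let_def e by (simp add: nat_int_add)
 \<comment> \<open>The three stages contribute 198000, and all lower-order terms together stay below
   3000.\<close>
 also have "\<dots> \<le> 201000 * S"
 proof -
  have "20 + (240 * m + 30 * l + 60 * k + 400) + 21 * (N1 + N2) + 40 * m + 26 + 100 * (N1 + N2 + m) + x + y + z + 300 \<le> 201000 * S"
   if "x \<le> 88000 * S" "y \<le> 88000 * S" "z \<le> 22000 * S" for x y z
   using that N S2 unfolding distrib_left by linarith
  from this[OF t1 t2 t3] show ?thesis .
 qed
 finally show ?thesis unfolding S_def K_def .
qed

text \<open>\<open>l < log 2 (4 * (n + 1)) = 2 + log 2 (n + 1)\<close>, and the last logarithm is at
  least 1. The shift to \<open>n + 1\<close> keeps it so for \<open>n = 1\<close>.\<close>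

lemma log_le:
 fixes n l :: nat
 assumes "1 \<le> n" "2 ^ l < 4 * int n"
 shows "real l \<le> 3 * log 2 (real n + 1)"
proof -
 have "real_of_int (2 ^ l) < real_of_int (4 * int n)" using assms(2) by (simp only: of_int_less_iff)
 hence "2 powr real l < 4 * (real n + 1)" by (simp add: powr_realpow)
 hence "real l < log 2 (4 * (real n + 1))" by (simp add: less_log_iff)
 moreover have "log 2 (4 * (real n + 1)) = log 2 4 + log 2 (real n + 1)" by (rule log_mult_pos) simp_all
 moreover have "log 2 (4 :: real) = 2" using log_pow_cancel[of 2 2] by simp
 moreover have "1 \<le> log 2 (real n + 1)" using assms(1) by (simp add: le_log_iff)
 ultimately show ?thesis by linarith
qed

text \<open>\<open>k - 1\<close> is at most the cube root of \<open>n\<close>, and 1/3 is below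
  \<open>sqrt 2 - 1\<close> because \<open>(4 / 3) ^ 2 = 16 / 9 < 2\<close>. Doubling absorbs the
  1.\<close>

lemma root_le:
 fixes n m :: nat and k :: int
 assumes "1 \<le> n" "1 \<le> k" "(k - 1) * (k - 1) * (k - 1) < min (int n) (int m)"
 shows "real_of_int k \<le> 2 * real n powr (sqrt 2 - 1)"
proof -
 define x where "x = real_of_int (k - 1)"
 have x: "0 \<le> x" using assms by (simp add: x_def)
 have n1: "1 \<le> real n" using assms by simp
 have "real_of_int ((k - 1) * (k - 1) * (k - 1)) \<le> real_of_int (int n)" using assms(3) by (simp only: of_int_le_iff)
 hence "x ^ 3 \<le> real n" by (simp add: x_def power3_eq_cube)
 also have "real n = (real n powr (1 / 3)) ^ 3" using n1 by (simp add: powr_realpow[symmetric] powr_powr)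
 finally have "x ^ Suc 2 \<le> (real n powr (1 / 3)) ^ Suc 2" by (simp add: eval_nat_numeral)
 hence "x \<le> real n powr (1 / 3)" by (rule power_le_imp_le_base) simp
 also have "\<dots> \<le> real n powr (sqrt 2 - 1)"
 proof (rule powr_mono[OF _ n1])
  have "(4 / 3 :: real) \<le> sqrt 2" by (rule real_le_rsqrt) (simp add: power2_eq_square)
  thus "1 / 3 \<le> sqrt 2 - (1 :: real)" by simp
 qed
 finally have "real_of_int k \<le> real n powr (sqrt 2 - 1) + 1" by (simp add: x_def)
 moreover have "1 \<le> real n powr (sqrt 2 - 1)"
  using ge_one_powr_ge_zero[OF n1, of "sqrt 2 - 1"] by simp
 ultimately show ?thesis by simp
qed

text \<open>There are at most \<open>32 * C * n ^ 3\<close> draws, so the numerator is at most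
  \<open>130 * C * n ^ 4\<close>. The denominator \<open>2 ^ (C * l)\<close> is at least
  \<open>(2 * n) ^ C\<close>: its part \<open>2 ^ C\<close> absorbs \<open>130 * C\<close> from
  \<open>C = 11\<close> on, and \<open>n ^ C\<close> absorbs
  \<open>n ^ 4 * n powr c\<close>.\<close>

lemma fail_le:
 fixes n l C :: nat and k :: int and c :: real
 assumes n: "1 \<le> n" and l: "2 * int n \<le> 2 ^ l" "2 ^ l < 4 * int n" "1 \<le> l" and k: "1 \<le> k" "k \<le> int n" and C: "11 \<le> C" "c + 11 \<le> real C"
 shows "real_of_int (int n) * (2 * (2 * real (nat (k * (4 * (int C * int l)) + k * k * (4 * (int C * int l)))) + 1) / 2 ^ nat (int C * int l)) \<le> 1 / real n powr c"
proof -
 define N where "N = k * (4 * (int C * int l)) + k * k * (4 * (int C * int l))"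
 have n1: "1 \<le> real n" using n by simp
 have "int l < 2 ^ l" by (rule of_nat_less_two_power)
 hence l4: "int l \<le> 4 * int n" using l(2) by linarith
 have kk: "k * k \<le> int n * int n" "k \<le> int n * int n" using k n mult_mono[of k "int n" k "int n"] mult_mono[of k "int n" 1 "int n"] by auto
 have K: "4 * (int C * int l) \<le> 16 * (int C * int n)" using l4 C by simp
 have "N \<le> int n * int n * (16 * (int C * int n)) + int n * int n * (16 * (int C * int n))"
  unfolding N_def by (intro add_mono mult_mono kk K) (use k in auto)
 also have "\<dots> = int (32 * C * n ^ 3)" by (simp add: power3_eq_cube mult_ac)
 finally have "nat N \<le> 32 * C * n ^ 3" by (simp only: nat_le_iff)
 hence "real (nat N) \<le> real (32 * C * n ^ 3)" by (simp only: of_nat_le_iff)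
 hence Nn: "real (nat N) \<le> 32 * real C * real n ^ 3" by simp
 have p1: "1 \<le> real C * real n ^ 3" using C n1 mult_mono[of 1 "real C" 1 "real n ^ 3"] by (simp add: one_le_power)
 have num: "real n * (2 * (2 * real (nat N) + 1)) \<le> 130 * real C * real n ^ 4"
 proof -
  have "real (nat N) \<le> 32 * (real C * real n ^ 3)" using Nn by (simp only: mult.assoc)
  hence "2 * (2 * real (nat N) + 1) \<le> 130 * (real C * real n ^ 3)" using p1 unfolding distrib_left by linarith
  hence "real n * (2 * (2 * real (nat N) + 1)) \<le> real n * (130 * (real C * real n ^ 3))" by (intro mult_left_mono) auto
  also have "real n * (130 * (real C * real n ^ 3)) = 130 * real C * real n ^ 4" by (simp add: eval_nat_numeral)
  finally show ?thesis .
 qed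
 have two: "130 * real C \<le> 2 ^ C" using C(1)
 proof (induction C rule: dec_induct)
  case (step i)
  have "130 * real (Suc i) \<le> 2 * (130 * real i)" using step by simp
  also have "\<dots> \<le> 2 * 2 ^ i" using step by simp
  finally show ?case by simp
 qed simp
 have den: "2 ^ C * real n ^ C \<le> 2 ^ nat (int C * int l)"
 proof -
  have "real_of_int (2 * int n) \<le> real_of_int (2 ^ l)" using l(1) by (simp only: of_int_le_iff)
  hence "(2 * real n) ^ C \<le> (2 ^ l) ^ C" by (intro power_mono) auto
  moreover have "nat (int C * int l) = l * C" by (simp add: nat_mult_distrib)
  ultimately show ?thesis by (simp add: power_mult_distrib power_mult)
 qed
 have np: "real n ^ 4 * real n powr c \<le> real n ^ C"
 proof -
  have "real n ^ 4 = real n powr real 4" using n1 by (subst powr_realpow) auto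
  hence "real n ^ 4 * real n powr c = real n powr (real 4 + c)" by (simp only: powr_add)
  also have "\<dots> \<le> real n powr real C" by (rule powr_mono) (use C n1 in auto)
  finally show ?thesis using n1 by (simp add: powr_realpow)
 qed
 have pc: "0 < real n powr c" using n1 by simp
 have "real n * (2 * (2 * real (nat N) + 1)) * real n powr c \<le> 130 * real C * real n ^ 4 * real n powr c" by (rule mult_right_mono[OF num]) simp
 also have "\<dots> = 130 * real C * (real n ^ 4 * real n powr c)" by simp
 also have "\<dots> \<le> 2 ^ C * real n ^ C" by (intro mult_mono two np) auto
 also note den
 finally have "real n * (2 * (2 * real (nat N) + 1)) * real n powr c \<le> 2 ^ nat (int C * int l)" .
 moreover have "a / D \<le> 1 / p" if "a * p \<le> D" "0 < D" "0 < p" for a D p :: real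
  using that by (simp add: divide_simps mult.commute)
 ultimately have "real n * (2 * (2 * real (nat N) + 1)) / 2 ^ nat (int C * int l) \<le> 1 / real n powr c" using pc by simp
 thus ?thesis unfolding N_def[symmetric] by simp
qed

section \<open>Input cells and word size\<close>

lemma concat_nth:
 "i < length es ==> concat (map (\<lambda>(u, v). [u, v, w (u, v)]) es) ! (3 * i) = fst (es ! i) \<and>
  concat (map (\<lambda>(u, v). [u, v, w (u, v)]) es) ! (3 * i + 1) = snd (es ! i) \<and>
  concat (map (\<lambda>(u, v). [u, v, w (u, v)]) es) ! (3 * i + 2) = w (es ! i)"
proof (induction es arbitrary: i)
 case (Cons a es)
 obtain x y where a: "a = (x, y)" by (cases a)
 show ?case using Cons by (cases i) (auto simp: a)
qed simp

lemma length_input: "length (input_words n w es) = 2 + 3 * length es"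
proof -
 have "length (concat (map (\<lambda>(u, v). [u, v, w (u, v)]) es)) = 3 * length es" by (induction es) auto
 thus ?thesis by (simp add: input_words_def)
qed

lemma initial_memory_words:
 fixes es w n
 defines "mem \<equiv> initial_memory (input_words n w es)"
 shows "mem 0 = int n" "mem 1 = int (length es)"
  "0 \<le> e ==> e < int (length es) ==> mem (2 + 3 * e) = int (fst (es ! nat e)) \<and> mem (3 + 3 * e) = int (snd (es ! nat e)) \<and> mem (4 + 3 * e) = int (w (es ! nat e))"
  "a < 0 \<or> 3 * int (length es) + 2 \<le> a ==> mem a = 0"
proof -
 show "mem 0 = int n" "mem 1 = int (length es)" unfolding mem_def initial_memory_def length_input by (simp_all add: input_words_def)
 show "mem a = 0" if "a < 0 \<or> 3 * int (length es) + 2 \<le> a" using that unfolding mem_def initial_memory_def length_input by auto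
 assume e: "0 \<le> e" "e < int (length es)"
 then obtain i where i: "e = int i" "i < length es" by (metis nat_0_le nat_less_iff)
 have n: "nat (2 + 3 * int i) = Suc (Suc (3 * i))" "nat (3 + 3 * int i) = Suc (Suc (3 * i + 1))" "nat (4 + 3 * int i) = Suc (Suc (3 * i + 2))" by auto
 show "mem (2 + 3 * e) = int (fst (es ! nat e)) \<and> mem (3 + 3 * e) = int (snd (es ! nat e)) \<and> mem (4 + 3 * e) = int (w (es ! nat e))"
  unfolding mem_def initial_memory_def length_input i n using i(2) concat_nth[OF i(2), of w] by (simp add: input_words_def)
qed

text \<open>With \<open>n + W\<close> as base, every quantity is below a power with fixed exponent,
  except that \<open>C \<le> 2 ^ C\<close> adds \<open>C\<close> to the exponent. The largest power
  that occurs is \<open>C + 9\<close>.\<close>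

lemma size_bounds:
 fixes n W m C :: nat
 assumes n: "2 \<le> n" and W: "1 \<le> W" and m: "m \<le> n * n"
 defines "M \<equiv> (int n + int W) ^ (C + 20)"
 shows "int C \<le> M" "int W \<le> M" "int m + 2 \<le> M" "4 * int n \<le> M"
  "((int m + 2) * int W + 2) * int n \<le> M" "8 * ((int m + 2) * int W) + 2 \<le> M"
  "2 ^ l < 4 * int n ==> 2 * (int n * int n) * (4 * (int C * int l)) + int m + 2 \<le> M"
proof -
 define X where "X = int n + int W"
 have X: "2 \<le> X" "int n \<le> X" "int W \<le> X" using n W by (auto simp: X_def)
 have le: "X ^ i \<le> M" if "i \<le> C + 20" for i unfolding M_def X_def[symmetric] using X that by (intro power_increasing) auto
 have st: "x + y \<le> X ^ Suc i" if "x \<le> X ^ i" "y \<le> X ^ i" for x y i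
 proof -
  have "x + y \<le> 2 * X ^ i" using that by simp
  also have "\<dots> \<le> X * X ^ i" using X by (intro mult_right_mono) auto
  finally show ?thesis by simp
 qed
 have mu: "x * y \<le> X ^ (i + j)" if "x \<le> X ^ i" "y \<le> X ^ j" "0 \<le> y" for x y i j
  unfolding power_add using that X by (intro mult_mono) auto
 have two: "2 \<le> X ^ 1" "4 \<le> X ^ 2" "8 \<le> X ^ 3" using X power_mono[of 2 X 2] power_mono[of 2 X 3] by auto
 have X1: "int n \<le> X ^ 1" "int W \<le> X ^ 1" using X by auto
 have inc: "X ^ i \<le> X ^ j" if "i \<le> j" for i j using X that by (intro power_increasing) auto
 have C: "int C \<le> X ^ C"
 proof -
  have "int C < 2 ^ C" by (rule of_nat_less_two_power)
  also have "\<dots> \<le> X ^ C" using X by (intro power_mono) auto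
  finally show ?thesis by simp
 qed
 have "int m \<le> int n * int n" using m by (metis of_nat_le_iff of_nat_mult)
 also have "\<dots> \<le> X ^ (1 + 1)" by (rule mu[OF X1(1) X1(1)]) simp
 finally have m2: "int m \<le> X ^ 2" by (simp add: numeral_2_eq_2)
 have m3: "int m + 2 \<le> X ^ 3" using st[OF m2, of 2] order_trans[OF two(1) inc[of 1 2]] by (simp add: eval_nat_numeral)
 have mW: "(int m + 2) * int W \<le> X ^ 4" using mu[OF m3 X1(2)] by simp
 have mW2: "(int m + 2) * int W + 2 \<le> X ^ 5" using st[OF mW, of 2] order_trans[OF two(1) inc[of 1 4]] by (simp add: eval_nat_numeral)
 show "int C \<le> M" using C le[of C] by simp
 show "int W \<le> M" "int m + 2 \<le> M" using X1(2) m3 le[of 1] le[of 3] by auto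
 show "4 * int n \<le> M" using order_trans[OF mu[OF two(2) X1(1)] le[of "2 + 1"]] by simp
 show "((int m + 2) * int W + 2) * int n \<le> M" using order_trans[OF mu[OF mW2 X1(1)] le[of "5 + 1"]] by simp
 have "8 * ((int m + 2) * int W) \<le> X ^ (3 + 4)" by (rule mu[OF two(3) mW]) simp
 from st[OF this, of 2] have "8 * ((int m + 2) * int W) + 2 \<le> X ^ Suc (3 + 4)" using order_trans[OF two(1) inc[of 1 "3 + 4"]] by simp
 thus "8 * ((int m + 2) * int W) + 2 \<le> M" using le[of "Suc (3 + 4)"] by linarith
 assume l: "2 ^ l < 4 * int n"
 have "int l < 2 ^ l" by (rule of_nat_less_two_power)
 hence "int l \<le> 4 * int n" using l by linarith
 also have "\<dots> \<le> X ^ (2 + 1)" by (rule mu[OF two(2) X1(1)]) simp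
 finally have lX: "int l \<le> X ^ (2 + 1)" .
 have nn: "int n * int n \<le> X ^ (1 + 1)" by (rule mu[OF X1(1) X1(1)]) simp
 have a: "4 * (int C * int l) \<le> X ^ (2 + (C + (2 + 1)))" by (intro mu two(2) C lX) simp_all
 have b: "2 * (int n * int n) \<le> X ^ (1 + (1 + 1))" by (intro mu two(1) nn) simp
 have "2 * (int n * int n) * (4 * (int C * int l)) \<le> X ^ (1 + (1 + 1) + (2 + (C + (2 + 1))))" by (rule mu[OF b a]) simp
 from st[OF this, of "int m + 2"] have "2 * (int n * int n) * (4 * (int C * int l)) + (int m + 2) \<le> X ^ Suc (1 + (1 + 1) + (2 + (C + (2 + 1))))"
  using order_trans[OF m3 inc[of 3 "1 + (1 + 1) + (2 + (C + (2 + 1)))"]] by simp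
 also have "\<dots> \<le> M" by (rule le) simp
 finally show "2 * (int n * int n) * (4 * (int C * int l)) + int m + 2 \<le> M" by simp
qed

lemma word_bound:
 fixes n W C :: nat and \<epsilon> :: real
 assumes "0 < \<epsilon>"
 shows "real_of_int (((int n + int W) ^ (C + 20)) ^ 40) \<le> (real n + real W + 1 / \<epsilon>) ^ ((C + 20) * 40)"
proof -
 have "real_of_int (((int n + int W) ^ (C + 20)) ^ 40) = (real n + real W) ^ ((C + 20) * 40)" by (simp only: power_mult of_int_power of_int_add of_int_of_nat_eq)
 also have "\<dots> \<le> (real n + real W + 1 / \<epsilon>) ^ ((C + 20) * 40)" using assms by (intro power_mono) auto
 finally show ?thesis .
qed

lemma memory_bound:
 assumes inp: "weighted_digraph_input n G w es" and M: "int n \<le> M" "int (length es) \<le> M" "int (max_weight G w) \<le> M" "0 \<le> M"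
 shows "\<bar>initial_memory (input_words n w es) a\<bar> \<le> M"
proof -
 have le: "x \<le> nat M" if x: "x \<in> set (input_words n w es)" for x
 proof -
  consider "x = n" | "x = length es" | e where "e \<in> set es" "x = fst e \<or> x = snd e \<or> x = w e"
   using x by (force simp: input_words_def)
  thus ?thesis
  proof cases
   case (3 e)
   interpret graph_input n G w es using inp 3(1) by unfold_locales auto
   have "e \<in> parcs G" using 3(1) parts(5) by simp
   thus ?thesis using arc[of e] weight_le[of e] 3(2) M by auto
  qed (use M in auto)
 qed
 show ?thesis
 proof (cases "0 \<le> a \<and> a < int (length (input_words n w es))")
  case True
  hence "input_words n w es ! nat a \<le> nat M" by (intro le nth_mem) auto
  thus ?thesis using True M(4) by (simp add: initial_memory_def le_nat_iff)
 qed (use M(4) in \<open>auto simp: initial_memory_def\<close>)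
qed

lemma run_empty:
 assumes "initial_memory (input_words n w []) = mem" "64 \<le> M" "real_of_int (M ^ 40) \<le> B" "int n \<le> M" "\<And>a. \<bar>mem a\<bar> \<le> M"
 shows "\<exists>s. run B (program c) (mem, 0) = return_spmf (s, 18) \<and> s 0 = - 1"
proof -
 have m: "mem 0 = int n" "mem 1 = 0" using initial_memory_words(1,2)[of n w "[]"] assms(1) by auto
 define s0 where "s0 = dec mem"
 have e0: "enc s0 a = mem a" for a by (simp add: s0_def)
 have b0: "bnd M s0" using assms(5) by (simp add: bnd_def s0_def dec_def)
 define s1 where "s1 = upd (upd s0 rN 0 (int n)) rM 0 0"
 have b1: "bnd M s1" unfolding s1_def using b0 assms by (intro bnd_upd) auto
 have "wp M (rN ::= I (N 0);; rM ::= I (N 1)) (\<lambda>s' k. s' = s1 \<and> k = 8) s0"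
  using assms by (simp add: enc_upd_nonneg e0 m s1_def)
 hence bs1: "bs M (rN ::= I (N 0);; rM ::= I (N 1)) s0 s1 8" unfolding wp_def by blast
 have r1: "run B (co (rN ::= I (N 0);; rM ::= I (N 1))) (mem, 0) = return_spmf (enc s1, 8)"
  using bs_run[OF bs1 assms(2,3) b0 ok_program(3)[OF assms(2), of 0]] assms(2) by (simp add: s0_def del: co.simps)
 define s2 where "s2 = upd s1 63 (- 1) (- 1)"
 have bs2: "bs M (Put 63 (N (- 1)) (N (- 1))) s1 s2 7"
  using bs_Put[of s1 "N (- 1)" M 63 "N (- 1)"] assms(2) by (simp add: s2_def)
 have r2: "run B (co (Put 63 (N (- 1)) (N (- 1)))) (enc s1, t) = return_spmf (enc s2, t + 7)" for t
  using bs_run[OF bs2 assms(2,3) b1 ok_program(4)[OF assms(2), of 0]] assms(2) by simp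
 have vM: "eval_expr B (enc s1) (comp (V rM)) = Some 0"
  using ok_ex_eval(1)[OF assms(2) b1 _ assms(3), of "V rM"] by (simp add: ok_ex_def s1_def)
 have "run B (program c) (mem, 0) = return_spmf (enc s2, 18)"
  unfolding program_def run_Seq r1 return_bind_spmf
  unfolding run.simps(5) split vM using r2 by (simp del: co.simps comp.simps run.simps)
 moreover have "enc s2 0 = - 1" by (simp add: enc_def reg_of_def idx_of_def s2_def)
 ultimately show ?thesis by blast
qed

lemma program_works:
 fixes n C :: nat and c \<epsilon> \<epsilon>\<^sub>0 :: real
 assumes inp: "weighted_digraph_input n G w es" and C: "11 \<le> C" "c + 11 \<le> real C" and eps: "0 < \<epsilon>" "\<epsilon> \<le> \<epsilon>\<^sub>0"
 shows "approximates_girth_within ((real n + real (max_weight G w) + 1 / \<epsilon>) ^ ((C + 20) * 40)) (program (int C)) n G w es (4 + \<epsilon>)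
  (4000000 * (real C)\<^sup>2 * \<epsilon>\<^sub>0 * (real (card (parcs G) + 1) * real n powr (sqrt 2 - 1) / \<epsilon>) * log 2 (real n + 1) ^ 2) (1 - 1 / real n powr c)"
proof -
 define W where "W = max_weight G w"
 define B where "B = (real n + real W + 1 / \<epsilon>) ^ ((C + 20) * 40)"
 define M where "M = (int n + int W) ^ (C + 20)"
 define mem where "mem = initial_memory (input_words n w es)"
 have p: "pair_digraph G" "pverts G = {0..<n}" "set es = parcs G" "distinct es" "1 \<le> n" using inp by (auto simp: weighted_digraph_input_def)
 interpret pair_digraph G by (rule p)
 have fin: "finite (parcs G)" using p(3) by (metis finite_set)
 have W1: "1 \<le> W" unfolding W_def max_weight_def using fin by (intro Max_ge) auto
 have MB: "real_of_int (M ^ 40) \<le> B" unfolding M_def B_def by (rule word_bound[OF eps(1)])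
 have M64: "64 \<le> M"
 proof -
  have "(2 :: int) ^ 6 \<le> (int n + int W) ^ 6" using W1 p(5) by (intro power_mono) auto
  also have "\<dots> \<le> M" unfolding M_def using W1 p(5) by (intro power_increasing) auto
  finally show ?thesis by simp
 qed
 have X1: "int n + int W \<le> M" unfolding M_def using W1 p(5) power_increasing[of 1 "C + 20" "int n + int W"] by auto
 have m: "length es = card (parcs G)" using distinct_card[OF p(4)] p(3) by simp
 define T where "T = 4000000 * (real C)\<^sup>2 * \<epsilon>\<^sub>0 * (real (card (parcs G) + 1) * real n powr (sqrt 2 - 1) / \<epsilon>) * log 2 (real n + 1) ^ 2"
 have L1: "1 \<le> log 2 (real n + 1)" using p(5) by (simp add: le_log_iff)
 have np1: "1 \<le> real n powr (sqrt 2 - 1)" using ge_one_powr_ge_zero[of "real n" "sqrt 2 - 1"] p(5) by simp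
 \<comment> \<open>The program does not use \<epsilon>. The factor
   \<open>\<epsilon>\<^sub>0 / \<epsilon> \<ge> 1\<close> only brings its time bound into the
   required form.\<close>
 have e1: "1 \<le> \<epsilon>\<^sub>0 / \<epsilon>" using eps by simp
 define U where "U = 4000000 * (real C)\<^sup>2 * (real (length es + 1) * real n powr (sqrt 2 - 1)) * log 2 (real n + 1) ^ 2"
 have U0: "0 \<le> U" unfolding U_def using L1 by simp
 have UT: "U \<le> T"
 proof -
  have "T = \<epsilon>\<^sub>0 / \<epsilon> * U" unfolding T_def U_def m by simp
  thus ?thesis using mult_right_mono[OF e1 U0] by simp
 qed
 have "lossless_spmf (run B (program (int C)) (mem, 0)) \<and> (\<forall>(s, t)\<in>set_spmf (run B (program (int C)) (mem, 0)). real t \<le> U) \<and>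
  measure (measure_spmf (run B (program (int C)) (mem, 0))) {(s, t). approximates (4 + \<epsilon>) (girth G w) (result_of s)} \<ge> 1 - 1 / real n powr c"
 proof (cases "es = []")
  case True
  have memM: "\<bar>mem a\<bar> \<le> M" for a unfolding mem_def by (rule memory_bound[OF inp]) (use X1 M64 True in \<open>auto simp: W_def\<close>)
  obtain s where s: "run B (program (int C)) (mem, 0) = return_spmf (s, 18)" "s 0 = - 1"
   using run_empty[of n w mem M B "int C"] True M64 MB X1 memM by (auto simp: mem_def)
  have "\<not> cycle q" for q
  proof
   assume "cycle q"
   then obtain u where "awalk u q u" "q \<noteq> []" by (auto simp: cycle_def)
   thus False using True p(3) by (cases q) (auto simp: awalk_Cons_iff)
  qed
  hence "girth G w = \<infinity>" by (simp add: girth_def top_ereal_def)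
  hence ap: "approximates (4 + \<epsilon>) (girth G w) (result_of s)" using s(2) eps by (simp add: approximates_def result_of_def)
  have "18 \<le> U"
  proof -
   have "1 * 1 \<le> (real C)\<^sup>2 * (real (length es + 1) * real n powr (sqrt 2 - 1))"
    using C(1) np1 True by (intro mult_mono) (auto simp: one_le_power)
   hence "1 * 1 \<le> (real C)\<^sup>2 * (real (length es + 1) * real n powr (sqrt 2 - 1)) * log 2 (real n + 1) ^ 2"
    using L1 by (intro mult_mono) (auto simp: one_le_power)
   moreover have "U = 4000000 * ((real C)\<^sup>2 * (real (length es + 1) * real n powr (sqrt 2 - 1)) * log 2 (real n + 1) ^ 2)"
    unfolding U_def by (simp only: mult.assoc)
   ultimately show ?thesis by linarith
  qed
  thus ?thesis using ap unfolding s(1) spmf_of_set_singleton[symmetric] measure_spmf_of_set by (simp add: set_spmf_of_set)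
 next
  case False
  interpret g: graph_input n G w es by unfold_locales (fact inp False)+
  have n2: "2 \<le> n" using g.wg.n2 by simp
  have mn: "length es \<le> n * n"
  proof -
   have "parcs G \<subseteq> {0..<n} \<times> {0..<n}" using g.arc by fastforce
   hence "card (parcs G) \<le> card ({0..<n} \<times> {0..<n})" by (intro card_mono) auto
   thus ?thesis using m by simp
  qed
  note sb = size_bounds[OF n2 W1 mn, where C = C, folded M_def]
  have memM: "\<bar>mem a\<bar> \<le> M" for a unfolding mem_def by (rule memory_bound[OF inp]) (use X1 M64 sb(2,3) in \<open>auto simp: W_def\<close>)
  have im: "mem 0 = int n" "mem 1 = int (length es)"
   "\<And>e. 0 \<le> e ==> e < int (length es) ==> mem (2 + 3 * e) = int (fst (es ! nat e)) \<and> mem (3 + 3 * e) = int (snd (es ! nat e)) \<and> mem (4 + 3 * e) = int (w (es ! nat e))"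
   "\<And>a. a < 0 \<or> 3 * int (length es) + 2 \<le> a ==> mem a = 0"
   unfolding mem_def by (rule initial_memory_words; assumption)+
  have C1: "1 \<le> int C" using C by simp
  have lM: "2 * (int n * int n) * (4 * (int C * int l)) + int (length es) + 2 \<le> M" if "1 \<le> l" "2 ^ l < 4 * int n" for l by (rule sb(7)[OF that(2)])
  show ?thesis
  proof (rule g.wg.run_program[OF M64 MB C1 sb(1) sb(2)[unfolded W_def] sb(3,4) sb(5)[unfolded W_def] sb(6)[unfolded W_def] lM im memM])
   fix l :: nat and k W' :: int
   assume l: "2 * int n \<le> 2 ^ l" "2 ^ l < 4 * int n" "1 \<le> l" and k: "1 \<le> k" "k \<le> int n"
    "(k - 1) * (k - 1) * (k - 1) < min (int n) (int (length es))" "min (int n) (int (length es)) \<le> k * k * k"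
    and W': "\<forall>e. 0 \<le> e \<and> e < int (length es) --> int (w (es ! nat e)) \<le> W'"
    and R: "lossless_spmf (run B (program (int C)) (mem, 0))"
     "\<forall>s t. (s, t) \<in> set_spmf (run B (program (int C)) (mem, 0)) --> t \<le> total_cost (int n) (int (length es)) (int C) l k"
     "1 - real_of_int (int n) * (2 * (2 * real (nat (k * (4 * (int C * int l)) + k * k * (4 * (int C * int l)))) + 1) / 2 ^ nat (int C * int l))
      \<le> measure (measure_spmf (run B (program (int C)) (mem, 0))) {(s, t). g.wg.correct_out (4 * ((int (length es) + 2) * W') + 1) (s 0)}"
   have cost: "real (total_cost (int n) (int (length es)) (int C) l k) \<le> U"
   proof -
    obtain j where j: "k = int j" using k(1) by (metis nonneg_int_cases order_trans zero_le_one)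
    have j1: "1 \<le> j" using k(1) j by simp
    \<comment> \<open>For \<open>k > 1\<close> this follows from
      \<open>k - 1 \<le> (k - 1) ^ 3 < m\<close>, with \<open>m\<close> the number of edges.\<close>
    have jm: "j \<le> length es"
    proof (cases "j = 1")
     case True
     thus ?thesis using False by (cases es) auto
    next
     case False
     hence "1 \<le> k - 1" using j j1 by simp
     hence "1 * 1 \<le> (k - 1) * (k - 1)" by (intro mult_mono) auto
     hence "1 * (k - 1) \<le> (k - 1) * (k - 1) * (k - 1)" using \<open>1 \<le> k - 1\<close> by (intro mult_right_mono) auto
     thus ?thesis using k(3) j by simp
    qed
    have "int (min n (length es)) \<le> int (j * j * j)" using k(4) unfolding j by simp
    hence "min n (length es) \<le> j * j * j" by (simp only: of_nat_le_iff)
    hence "total_cost (int n) (int (length es)) (int C) l (int j) \<le> 201000 * ((C * l) * (C * l) * length es * j)"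
     using C False l(3) j1 jm by (intro total_cost_le) (auto simp: Suc_le_eq)
    hence "real (total_cost (int n) (int (length es)) (int C) l k) \<le> real (201000 * ((C * l) * (C * l) * length es * j))" unfolding j of_nat_le_iff .
    also have "\<dots> = 201000 * (real C)\<^sup>2 * (real (length es) * real j) * (real l)\<^sup>2" by (simp add: power2_eq_square)
    also have "\<dots> \<le> 201000 * (real C)\<^sup>2 * (real (length es + 1) * (2 * real n powr (sqrt 2 - 1))) * (3 * log 2 (real n + 1))\<^sup>2"
     using root_le[OF p(5) k(1,3)] j log_le[OF p(5) l(2)] by (intro mult_mono power_mono) auto
    \<comment> \<open>\<open>201000 * 2 * 3 ^ 2 = 3618000\<close>, where 2 comes from
      \<open>root_le\<close> and 3 from \<open>log_le\<close>.\<close>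
    also have "\<dots> = 3618000 / 4000000 * U" unfolding U_def by (simp add: power2_eq_square)
    also have "\<dots> \<le> U" using U0 by simp
    finally show ?thesis .
   qed
   have "1 - 1 / real n powr c \<le> 1 - real_of_int (int n) * (2 * (2 * real (nat (k * (4 * (int C * int l)) + k * k * (4 * (int C * int l)))) + 1) / 2 ^ nat (int C * int l))"
    using fail_le[OF p(5) l k(1,2) C] by linarith
   also note R(3)
   also have "measure (measure_spmf (run B (program (int C)) (mem, 0))) {(s, t). g.wg.correct_out (4 * ((int (length es) + 2) * W') + 1) (s 0)} \<le>
    measure (measure_spmf (run B (program (int C)) (mem, 0))) {(s, t). approximates (4 + \<epsilon>) (girth G w) (result_of s)}"
    by (rule measure_spmf.finite_measure_mono) (use g.correct_out_approximates[OF W' _ eps(1)] in auto)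
   finally have P: "1 - 1 / real n powr c \<le> measure (measure_spmf (run B (program (int C)) (mem, 0))) {(s, t). approximates (4 + \<epsilon>) (girth G w) (result_of s)}" .
   have "real t \<le> U" if "(s, t) \<in> set_spmf (run B (program (int C)) (mem, 0))" for s t
   proof -
    have "t \<le> total_cost (int n) (int (length es)) (int C) l k" using R(2) that by blast
    hence "real t \<le> real (total_cost (int n) (int (length es)) (int C) l k)" by (simp only: of_nat_le_iff)
    thus ?thesis using cost by (rule order_trans)
   qed
   thus ?thesis using R(1) P by blast
  qed
 qed
 hence "lossless_spmf (run B (program (int C)) (mem, 0))" "\<forall>(s, t)\<in>set_spmf (run B (program (int C)) (mem, 0)). real t \<le> T"
  "measure (measure_spmf (run B (program (int C)) (mem, 0))) {(s, t). approximates (4 + \<epsilon>) (girth G w) (result_of s)} \<ge> 1 - 1 / real n powr c"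
  using UT by (auto intro: order_trans)
 thus ?thesis
  unfolding approximates_girth_within_def Let_def T_def[symmetric] W_def[symmetric] B_def[symmetric] mem_def[symmetric] by blast
qed

theorem theorem1p3:
  shows "\<exists>k::nat. \<forall>c::real. c > 0 \<longrightarrow> (\<forall>\<epsilon>\<^sub>0::real. \<epsilon>\<^sub>0 > 0 \<longrightarrow> (\<exists>(C::real) (K::nat).
    \<forall>\<epsilon>::real. 0 < \<epsilon> \<and> \<epsilon> \<le> \<epsilon>\<^sub>0 \<longrightarrow> (\<exists>P::com. \<forall>n G w es. weighted_digraph_input n G w es \<longrightarrow>
      approximates_girth_within
        ((real n + real (max_weight G w) + 1 / \<epsilon>) ^ K) P n G w es
        (4 + \<epsilon>)
        (C * (real (card (parcs G) + 1) * real n powr (sqrt 2 - 1) / \<epsilon>) * log 2 (real n + 1) ^ k)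
        (1 - 1 / real n powr c))))"
\<comment> \<open>Two logarithms: in the first two stages the list capacity enters once through the
  number of draws and once through the cost of a relaxation.\<close>
proof (rule exI[of _ 2], intro allI impI)
 fix c \<epsilon>\<^sub>0 :: real
 assume "c > 0" "\<epsilon>\<^sub>0 > 0"
 define C where "C = nat \<lceil>c\<rceil> + 11"
 have C: "11 \<le> C" "c + 11 \<le> real C" using real_nat_ceiling_ge[of c] by (simp_all add: C_def)
 show "\<exists>(D::real) (K::nat). \<forall>\<epsilon>::real. 0 < \<epsilon> \<and> \<epsilon> \<le> \<epsilon>\<^sub>0 --> (\<exists>P::com. \<forall>n G w es. weighted_digraph_input n G w es -->
   approximates_girth_within ((real n + real (max_weight G w) + 1 / \<epsilon>) ^ K) P n G w es (4 + \<epsilon>)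
    (D * (real (card (parcs G) + 1) * real n powr (sqrt 2 - 1) / \<epsilon>) * log 2 (real n + 1) ^ 2)
    (1 - 1 / real n powr c))"
  by (rule exI[of _ "4000000 * (real C)\<^sup>2 * \<epsilon>\<^sub>0"], rule exI[of _ "(C + 20) * 40"], intro allI impI, rule exI[of _ "program (int C)"], intro allI impI)
   (rule program_works[OF _ C], auto)
qed

end
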